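(* Let $\mathfrak g$ be a finite-dimensional complex Lie algebra, $\mathfrak k\subset\mathfrak g$ a reductive subalgebra such that the adjoint action of $\mathfrak k$ on $\mathfrak g$ is semisimple, with a triangular decomposition $\mathfrak k=\mathfrak n_-+\mathfrak h+\mathfrak n_+$, and let $\mathrm Z(\mathfrak g,\mathfrak k)$ be the associated (localized) reduction algebra. Let $\mathfrak p$ be an $\mathrm{ad}_{\mathfrak k}$-invariant complement of $\mathfrak k$ in $\mathfrak g$, $\{p_K\}$ a linear basis of $\mathfrak p$ consisting of weight vectors, $[h,p_K]=\mu_K(h)p_K$ for $h\in\mathfrak h$, with a total order $\prec$ compatible with the partial order $<$ on $\mathfrak h^*$, and let $\tilde p_K$ be the image of $p_K$ in $\mathrm Z(\mathfrak g,\mathfrak k)$. Then there exist elements $\mathrm B_{IJKL},\mathrm C_{IJL},\mathrm D_{IJ}\in\overline{\mathrm U}(\mathfrak h)$ such that $\mathrm Z(\mathfrak g,\mathfrak k)$ is the unital associative algebra generated by $\overline{\mathrm U}(\mathfrak h)$ and all the elements $\tilde p_L$, with the (defining) weight relations $$[h,\tilde p_K]=\mu_K(h)\,\tilde p_K\qquad (h\in\mathfrak h)$$ and the (defining) ordering relations $$\tilde p_I\diamond\tilde p_J=\sum_{K,L:\ p_K\preceq p_L}\mathrm B_{IJKL}\,\tilde p_K\diamond\tilde p_L+\sum_{L}\mathrm C_{IJL}\,\tilde p_L+\mathrm D_{IJ},\qquad p_I\succ p_J .$$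
   Context: Let $\Delta\subset\mathfrak h^*$ be the root system of $\mathfrak k$, $\Delta_+$ the positive roots (the weights of $\mathfrak n_+$), and $h_\alpha\in\mathfrak h$ the coroot of $\alpha\in\Delta$. Here $\mathfrak h$ is a Cartan subalgebra of $\mathfrak k$ and $\mathfrak n_\pm$ are the nilradicals of two opposite Borel subalgebras of $\mathfrak k$. $\overline{\mathrm U}(\mathfrak h)$ denotes the localization of $\mathrm U(\mathfrak h)$ at the multiplicative set generated by $\{h_\alpha+l\mid\alpha\in\Delta,\ l\in\mathbb Z\}$, and $\bar{\mathrm A}$ denotes the localization of $\mathrm A=\mathrm U(\mathfrak g)$ at the same set of denominators (it satisfies the Ore condition). Reduction algebra: $\mathrm Z(\mathfrak g,\mathfrak k):=\bar{\mathrm A}/(\bar{\mathrm A}\mathfrak n_++\mathfrak n_-\bar{\mathrm A})$, an associative algebra under the product $a\diamond b:=aPb$, where $P$ is the extremal projector of $\mathfrak k$: the unique formal series with constant term $1$ of elements $\xi e_{-\gamma_1}\cdots e_{-\gamma_m}e_{\gamma'_1}\cdots e_{\gamma'_{m'}}$ of zero weight ($\xi\in\overline{\mathrm U}(\mathfrak h)$, $\gamma_i,\gamma'_j\in\Delta_+$, $e_{\pm\gamma}$ root vectors of $\mathfrak k$) satisfying $\mathfrak n_+P=P\mathfrak n_-=0$ and $P^2=P$. The product is well defined on the double coset space. $\overline{\mathrm U}(\mathfrak h)$ embeds in $\mathrm Z(\mathfrak g,\mathfrak k)$, and $\mathrm Z(\mathfrak g,\mathfrak k)$ is an $\overline{\mathrm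 U}(\mathfrak h)$-bimodule. Order: for $\lambda,\mu\in\mathfrak h^*$, $\lambda>\mu$ means $\lambda-\mu\in\mathrm Q_+=\{\sum_{\alpha\in\Delta_+}n_\alpha\alpha\mid n_\alpha\in\mathbb Z_{\ge0}\}$. Compatibility of $\prec$ with $<$ means: $\mu_K<\mu_L$ and $\mu_K\ne\mu_L$ imply $p_K\prec p_L$. *)

theory Defs
  imports Complex_Main
    "HOL-Algebra.QuotRing"
    "HOL-Algebra.Generated_Groups"
    "HOL-Library.Poly_Mapping"
    "HOL-Library.Function_Algebras"
begin

section \<open>Finite-dimensional complex Lie algebras\<close>

class fin_dim_complex_lie_algebra = ab_group_add +
  fixes cscale :: "complex \<Rightarrow> 'a \<Rightarrow> 'a"  (infixr "*\<^sub>C" 75)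
    and lie :: "'a \<Rightarrow> 'a \<Rightarrow> 'a"
  assumes cscale_add_right: "a *\<^sub>C (x + y) = a *\<^sub>C x + a *\<^sub>C y"
    and cscale_add_left: "(a + b) *\<^sub>C x = a *\<^sub>C x + b *\<^sub>C x"
    and cscale_cscale: "a *\<^sub>C b *\<^sub>C x = (a * b) *\<^sub>C x"
    and cscale_one: "1 *\<^sub>C x = x"
    and finite_dimensional: "\<exists>B. finite B \<and> (\<forall>x. \<exists>c. x = (\<Sum>b\<in>B. c b *\<^sub>C b))"
    and lie_add_left: "lie (x + y) z = lie x z + lie y z"
    and lie_add_right: "lie x (y + z) = lie x y + lie x z"
    and lie_cscale_left: "lie (a *\<^sub>C x) y = a *\<^sub>C lie x y"
    and lie_cscale_right: "lie x (a *\<^sub>C y) = a *\<^sub>C lie x y"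
    and lie_self: "lie x x = 0"
    and jacobi: "lie x (lie y z) + lie y (lie z x) + lie z (lie x y) = 0"

global_interpretation clin: vector_space "cscale :: complex \<Rightarrow> 'g \<Rightarrow> 'g::fin_dim_complex_lie_algebra"
  by unfold_locales (simp_all add: cscale_add_right cscale_add_left cscale_cscale cscale_one)

definition subalgebra :: "'g::fin_dim_complex_lie_algebra set \<Rightarrow> bool" where
  "subalgebra L \<longleftrightarrow> clin.subspace L \<and> (\<forall>x\<in>L. \<forall>y\<in>L. lie x y \<in> L)"

definition brackets :: "'g::fin_dim_complex_lie_algebra set \<Rightarrow> 'g set \<Rightarrow> 'g set" where
  "brackets X Y = clin.span {lie x y | x y. x \<in> X \<and> y \<in> Y}"

definition ad_stable :: "'g::fin_dim_complex_lie_algebra set \<Rightarrow> 'g set \<Rightarrow> bool" where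
  "ad_stable L V \<longleftrightarrow> (\<forall>x\<in>L. \<forall>v\<in>V. lie x v \<in> V)"

definition complementary :: "'g::fin_dim_complex_lie_algebra set \<Rightarrow> 'g set \<Rightarrow> 'g set \<Rightarrow> bool" where
  "complementary W W' V \<longleftrightarrow> W \<inter> W' = {0} \<and> {w + w' | w w'. w \<in> W \<and> w' \<in> W'} = V"

definition ad_semisimple :: "'g::fin_dim_complex_lie_algebra set \<Rightarrow> 'g set \<Rightarrow> bool" where
  "ad_semisimple L V \<longleftrightarrow>
     (\<forall>W. clin.subspace W \<and> W \<subseteq> V \<and> ad_stable L W \<longrightarrow>
       (\<exists>W'. clin.subspace W' \<and> ad_stable L W' \<and> complementary W W' V))"

text \<open>A Lie algebra is reductive when its adjoint representation is semisimple.\<close>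

definition reductive_subalgebra :: "'g::fin_dim_complex_lie_algebra set \<Rightarrow> bool" where
  "reductive_subalgebra k \<longleftrightarrow> subalgebra k \<and> ad_semisimple k k"

primrec lower_central :: "'g::fin_dim_complex_lie_algebra set \<Rightarrow> nat \<Rightarrow> 'g set" where
  "lower_central L 0 = L"
| "lower_central L (Suc n) = brackets L (lower_central L n)"

primrec derived_series :: "'g::fin_dim_complex_lie_algebra set \<Rightarrow> nat \<Rightarrow> 'g set" where
  "derived_series L 0 = L"
| "derived_series L (Suc n) = brackets (derived_series L n) (derived_series L n)"

definition cartan_subalgebra ::
    "'g::fin_dim_complex_lie_algebra set \<Rightarrow> 'g set \<Rightarrow> bool" where
  "cartan_subalgebra k h \<longleftrightarrow> subalgebra h \<and> h \<subseteq> k \<and> (\<exists>n. lower_central h n = {0}) \<and>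
     (\<forall>x\<in>k. (\<forall>y\<in>h. lie x y \<in> h) \<longrightarrow> x \<in> h)"

definition solvable_subalgebra :: "'g::fin_dim_complex_lie_algebra set \<Rightarrow> bool" where
  "solvable_subalgebra b \<longleftrightarrow> subalgebra b \<and> (\<exists>n. derived_series b n = {0})"

definition borel_subalgebra ::
    "'g::fin_dim_complex_lie_algebra set \<Rightarrow> 'g set \<Rightarrow> bool" where
  "borel_subalgebra k b \<longleftrightarrow> b \<subseteq> k \<and> solvable_subalgebra b \<and>
     (\<forall>b'. b \<subseteq> b' \<and> b' \<subseteq> k \<and> solvable_subalgebra b' \<longrightarrow> b' = b)"

text \<open>The nilradical of a Borel subalgebra \<open>b\<close> is taken in the sense of the nilpotent radical
  \<open>[b, b]\<close> (the sum of the root spaces in \<open>b\<close>). The largest nilpotent ideal of \<open>b\<close> would also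
  contain the centre of \<open>k\<close>, which is part of \<open>h\<close>. Two Borel subalgebras are opposite when
  they meet in a Cartan subalgebra.\<close>

definition triangular_decomposition ::
    "'g::fin_dim_complex_lie_algebra set \<Rightarrow> 'g set \<Rightarrow> 'g set \<Rightarrow> 'g set \<Rightarrow> bool" where
  "triangular_decomposition k nm h np \<longleftrightarrow>
     (\<exists>bm bp. borel_subalgebra k bm \<and> borel_subalgebra k bp \<and>
        cartan_subalgebra k h \<and> bm \<inter> bp = h \<and>
        nm = brackets bm bm \<and> np = brackets bp bp) \<and>
     bij_betw (\<lambda>(x, y, z). x + y + z) (nm \<times> h \<times> np) k"

section \<open>Weights, roots and coroots\<close>

text \<open>A linear functional on the subspace \<open>h\<close> is represented by its extension by \<open>0\<close> outside
  \<open>h\<close>, so that equality and the pointwise operations are those of the dual space.\<close>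

definition dual_space :: "'g::fin_dim_complex_lie_algebra set \<Rightarrow> ('g \<Rightarrow> complex) set" where
  "dual_space h = {\<nu>. (\<forall>x. x \<notin> h \<longrightarrow> \<nu> x = 0) \<and>
     (\<forall>x\<in>h. \<forall>y\<in>h. \<nu> (x + y) = \<nu> x + \<nu> y) \<and> (\<forall>c. \<forall>x\<in>h. \<nu> (c *\<^sub>C x) = c * \<nu> x)}"

definition weight_space ::
    "'g::fin_dim_complex_lie_algebra set \<Rightarrow> 'g set \<Rightarrow> ('g \<Rightarrow> complex) \<Rightarrow> 'g set" where
  "weight_space h V \<nu> = {v \<in> V. \<forall>x\<in>h. lie x v = \<nu> x *\<^sub>C v}"

definition weights ::
    "'g::fin_dim_complex_lie_algebra set \<Rightarrow> 'g set \<Rightarrow> ('g \<Rightarrow> complex) set" where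
  "weights h V = {\<nu> \<in> dual_space h. \<exists>v\<in>weight_space h V \<nu>. v \<noteq> 0}"

definition roots ::
    "'g::fin_dim_complex_lie_algebra set \<Rightarrow> 'g set \<Rightarrow> ('g \<Rightarrow> complex) set" where
  "roots k h = weights h k - {0}"

definition coroot ::
    "'g::fin_dim_complex_lie_algebra set \<Rightarrow> 'g set \<Rightarrow> ('g \<Rightarrow> complex) \<Rightarrow> 'g" where
  "coroot k h \<alpha> =
     (THE t. t \<in> brackets (weight_space h k \<alpha>) (weight_space h k (- \<alpha>)) \<and> \<alpha> t = 2)"

definition Q_plus ::
    "'g::fin_dim_complex_lie_algebra set \<Rightarrow> 'g set \<Rightarrow> ('g \<Rightarrow> complex) set" where
  "Q_plus h np = {(\<Sum>\<alpha>\<in>weights h np. (\<lambda>x. of_nat (n \<alpha>) * \<alpha> x)) | n :: ('g \<Rightarrow> complex) \<Rightarrow> nat. True}"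

definition weight_less ::
    "'g::fin_dim_complex_lie_algebra set \<Rightarrow> 'g set \<Rightarrow> ('g \<Rightarrow> complex) \<Rightarrow> ('g \<Rightarrow> complex) \<Rightarrow> bool" where
  "weight_less h np \<mu> \<nu> \<longleftrightarrow> \<nu> - \<mu> \<in> Q_plus h np"

section \<open>Algebras given by generators and relations\<close>

text \<open>The free monoid, written additively, so that \<open>'x word \<Rightarrow>\<^sub>0 complex\<close> with its convolution
  product is the free unital associative complex algebra on \<open>'x\<close>.\<close>

datatype 'x word = Word (letters: "'x list")

instantiation word :: (type) monoid_add
begin
definition zero_word :: "'a word" where "0 = Word []"
definition plus_word :: "'a word \<Rightarrow> 'a word \<Rightarrow> 'a word" where
  "v + w = Word (letters v @ letters w)"
instance by standard (simp_all add: zero_word_def plus_word_def)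
end

type_synonym 'x falg = "'x word \<Rightarrow>\<^sub>0 complex"

definition fgen :: "'x \<Rightarrow> 'x falg" where
  "fgen x = Poly_Mapping.single (Word [x]) 1"

definition fconst :: "complex \<Rightarrow> 'x falg" where
  "fconst c = Poly_Mapping.single 0 c"

definition frename :: "('x \<Rightarrow> 'y) \<Rightarrow> 'x falg \<Rightarrow> 'y falg" where
  "frename f p = (\<Sum>w\<in>Poly_Mapping.keys p.
     Poly_Mapping.single (Word (map f (letters w))) (Poly_Mapping.lookup p w))"

definition free_algebra :: "'x set \<Rightarrow> 'x falg ring" where
  "free_algebra X = \<lparr>carrier = {p. \<forall>w\<in>Poly_Mapping.keys p. set (letters w) \<subseteq> X},
     mult = (*), one = 1, zero = 0, add = (+)\<rparr>"

text \<open>\<open>presented X R\<close> is the unital complex algebra with generators \<open>X\<close> and relators \<open>R\<close>.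
  Two-sided ideals of a unital algebra are closed under scalars, so the ring-theoretic ideal
  is the right one.\<close>

definition presented :: "'x set \<Rightarrow> 'x falg set \<Rightarrow> 'x falg set ring" where
  "presented X R = free_algebra X Quot (genideal (free_algebra X) R)"

definition pclass :: "'x set \<Rightarrow> 'x falg set \<Rightarrow> 'x falg \<Rightarrow> 'x falg set" where
  "pclass X R a = genideal (free_algebra X) R +>\<^bsub>free_algebra X\<^esub> a"

definition presented_by ::
    "('a, 'm) ring_scheme \<Rightarrow> 'x set \<Rightarrow> ('x \<Rightarrow> 'a) \<Rightarrow> 'x falg set \<Rightarrow> bool" where
  "presented_by A X f R \<longleftrightarrow>
     (\<exists>\<phi>\<in>ring_iso (presented X R) A. \<forall>x\<in>X. \<phi> (pclass X R (fgen x)) = f x)"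

text \<open>Relators of the universal enveloping algebra \<open>U(L)\<close> on the generating set \<open>L\<close>; the first
  two families reduce the free algebra on the set \<open>L\<close> to the tensor algebra of the space \<open>L\<close>.\<close>

definition env_rels :: "'g::fin_dim_complex_lie_algebra set \<Rightarrow> 'g falg set" where
  "env_rels L =
     {fgen (x + y) - fgen x - fgen y | x y. x \<in> L \<and> y \<in> L} \<union>
     {fgen (c *\<^sub>C x) - fconst c * fgen x | c x. x \<in> L} \<union>
     {fgen x * fgen y - fgen y * fgen x - fgen (lie x y) | x y. x \<in> L \<and> y \<in> L}"

text \<open>Localization: to an algebra presented by \<open>X\<close> and \<open>R\<close> adjoin, universally, a two-sided
  inverse \<open>Inr d\<close> of (the class of) each \<open>d \<in> D\<close>. This is the localization at the multiplicative
  set generated by \<open>D\<close>, which is the ring of fractions when the Ore condition holds.\<close>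

definition loc_gens :: "'x set \<Rightarrow> 'x falg set \<Rightarrow> ('x + 'x falg) set" where
  "loc_gens X D = Inl ` X \<union> Inr ` D"

definition loc_rels :: "'x falg set \<Rightarrow> 'x falg set \<Rightarrow> ('x + 'x falg) falg set" where
  "loc_rels R D = frename Inl ` R \<union>
     {frename Inl d * fgen (Inr d) - 1 | d. d \<in> D} \<union>
     {fgen (Inr d) * frename Inl d - 1 | d. d \<in> D}"

section \<open>Localized enveloping algebras\<close>

definition denominators ::
    "'g::fin_dim_complex_lie_algebra set \<Rightarrow> 'g set \<Rightarrow> 'g falg set" where
  "denominators k h =
     {fgen (coroot k h \<alpha>) + fconst (of_int l) | \<alpha> l. \<alpha> \<in> roots k h}"

text \<open>\<open>loc_env k h L\<close> is the localization of \<open>U(L)\<close> at the elements \<open>h\<^sub>\<alpha> + l\<close>, for a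
  subalgebra \<open>L\<close> containing \<open>h\<close>.\<close>

type_synonym 'g loc_elem = "('g + 'g falg) falg set"

definition loc_env ::
    "'g::fin_dim_complex_lie_algebra set \<Rightarrow> 'g set \<Rightarrow> 'g set \<Rightarrow> 'g loc_elem ring" where
  "loc_env k h L =
     presented (loc_gens L (denominators k h)) (loc_rels (env_rels L) (denominators k h))"

definition loc_class ::
    "'g::fin_dim_complex_lie_algebra set \<Rightarrow> 'g set \<Rightarrow> 'g set \<Rightarrow> ('g + 'g falg) falg \<Rightarrow> 'g loc_elem" where
  "loc_class k h L =
     pclass (loc_gens L (denominators k h)) (loc_rels (env_rels L) (denominators k h))"

abbreviation Uh_bar :: "'g::fin_dim_complex_lie_algebra set \<Rightarrow> 'g set \<Rightarrow> 'g loc_elem ring" where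
  "Uh_bar k h \<equiv> loc_env k h h"

abbreviation A_bar :: "'g::fin_dim_complex_lie_algebra set \<Rightarrow> 'g set \<Rightarrow> 'g loc_elem ring" where
  "A_bar k h \<equiv> loc_env k h UNIV"

definition A_of ::
    "'g::fin_dim_complex_lie_algebra set \<Rightarrow> 'g set \<Rightarrow> 'g \<Rightarrow> 'g loc_elem" where
  "A_of k h x = loc_class k h UNIV (fgen (Inl x))"

text \<open>The canonical map from \<^term>\<open>Uh_bar k h\<close> to \<^term>\<open>A_bar k h\<close>: the generators and relators
  of the former are among those of the latter, so all members of a class \<open>u\<close> have the same image.\<close>

definition A_of_Uh ::
    "'g::fin_dim_complex_lie_algebra set \<Rightarrow> 'g set \<Rightarrow> 'g loc_elem \<Rightarrow> 'g loc_elem" where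
  "A_of_Uh k h u = (\<Union>a\<in>u. loc_class k h UNIV a)"

section \<open>The extremal projector and the reduction algebra\<close>

definition mprod :: "('a, 'm) ring_scheme \<Rightarrow> 'a list \<Rightarrow> 'a" where
  "mprod A xs = foldr (mult A) xs \<one>\<^bsub>A\<^esub>"

text \<open>\<open>A S\<^sup>N\<close> and \<open>S\<^sup>N A\<close>.\<close>

definition left_pow :: "('a, 'm) ring_scheme \<Rightarrow> 'a set \<Rightarrow> nat \<Rightarrow> 'a set" where
  "left_pow A S N = generate (add_monoid A)
     {a \<otimes>\<^bsub>A\<^esub> mprod A xs | a xs. a \<in> carrier A \<and> set xs \<subseteq> S \<and> length xs = N}"

definition right_pow :: "('a, 'm) ring_scheme \<Rightarrow> 'a set \<Rightarrow> nat \<Rightarrow> 'a set" where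
  "right_pow A S N = generate (add_monoid A)
     {mprod A xs \<otimes>\<^bsub>A\<^esub> a | a xs. a \<in> carrier A \<and> set xs \<subseteq> S \<and> length xs = N}"

text \<open>Combinations of the terms \<open>\<xi> e\<^sub>-\<^sub>\<gamma>\<^sub>1 \<dots> e\<^sub>-\<^sub>\<gamma>\<^sub>m e\<^sub>\<gamma>\<^sub>'\<^sub>1 \<dots> e\<^sub>\<gamma>\<^sub>'\<^sub>m\<^sub>'\<close> with
  \<open>\<gamma>\<^sub>1 + \<dots> + \<gamma>\<^sub>m = \<kappa> = \<gamma>'\<^sub>1 + \<dots> + \<gamma>'\<^sub>m\<^sub>'\<close>. Every term of zero weight belongs to exactly one
  \<open>\<kappa> \<in> Q\<^sub>+\<close>, and only finitely many sequences of positive roots have the sum \<open>\<kappa>\<close>. So a formal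
  series of such terms is a family \<open>P\<close> whose value at each \<open>\<kappa> \<in> Q\<^sub>+\<close> lies in
  \<open>proj_terms \<dots> \<kappa>\<close>, and the only terms with \<open>\<kappa> = 0\<close> are the constant ones.\<close>

definition proj_terms ::
    "'g::fin_dim_complex_lie_algebra set \<Rightarrow> 'g set \<Rightarrow> 'g set \<Rightarrow> ('g \<Rightarrow> complex) \<Rightarrow> 'g loc_elem set" where
  "proj_terms k h np \<kappa> = generate (add_monoid (A_bar k h))
     {A_of_Uh k h \<xi> \<otimes>\<^bsub>A_bar k h\<^esub>
        (mprod (A_bar k h) (map (A_of k h) fs) \<otimes>\<^bsub>A_bar k h\<^esub>
         mprod (A_bar k h) (map (A_of k h) es)) | \<xi> fs es.
      \<xi> \<in> carrier (Uh_bar k h) \<and>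
      (\<exists>\<gamma>s \<gamma>s'. set \<gamma>s \<subseteq> weights h np \<and> set \<gamma>s' \<subseteq> weights h np \<and>
         list_all2 (\<lambda>\<gamma> f. f \<in> weight_space h k (- \<gamma>)) \<gamma>s fs \<and>
         list_all2 (\<lambda>\<gamma> e. e \<in> weight_space h k \<gamma>) \<gamma>s' es \<and>
         sum_list \<gamma>s = \<kappa> \<and> sum_list \<gamma>s' = \<kappa>)}"

text \<open>Identities between formal series are understood in the topologies in which the left ideals
  \<open>A n\<^sub>+\<^sup>N\<close>, respectively the right ideals \<open>n\<^sub>-\<^sup>N A\<close>, are neighbourhoods of \<open>0\<close>. By the PBW
  decomposition this is the vanishing of all coefficients after normal ordering.\<close>

definition extremal_projector ::
    "'g::fin_dim_complex_lie_algebra set \<Rightarrow> 'g set \<Rightarrow> 'g set \<Rightarrow> 'g set \<Rightarrow>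
     (('g \<Rightarrow> complex) \<Rightarrow> 'g loc_elem) \<Rightarrow> bool" where
  "extremal_projector k nm h np P \<longleftrightarrow>
    (let A = A_bar k h; psum = (\<lambda>T. \<Oplus>\<^bsub>A\<^esub>\<kappa>\<in>T. P \<kappa>);
         F = finite_subsets_at_top (Q_plus h np) in
      (\<forall>\<kappa>\<in>Q_plus h np. P \<kappa> \<in> proj_terms k h np \<kappa>) \<and>
      P 0 = \<one>\<^bsub>A\<^esub> \<and>
      (\<forall>e\<in>np. \<forall>N. \<forall>\<^sub>F T in F. A_of k h e \<otimes>\<^bsub>A\<^esub> psum T \<in> left_pow A (A_of k h ` np) N) \<and>
      (\<forall>f\<in>nm. \<forall>N. \<forall>\<^sub>F T in F. psum T \<otimes>\<^bsub>A\<^esub> A_of k h f \<in> right_pow A (A_of k h ` nm) N) \<and>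
      (\<forall>N. \<forall>\<^sub>F T in F. psum T \<otimes>\<^bsub>A\<^esub> psum T \<ominus>\<^bsub>A\<^esub> psum T \<in> left_pow A (A_of k h ` np) N))"

text \<open>The subspace \<open>A n\<^sub>+ + n\<^sub>- A\<close>.\<close>

definition double_ideal ::
    "'g::fin_dim_complex_lie_algebra set \<Rightarrow> 'g set \<Rightarrow> 'g set \<Rightarrow> 'g set \<Rightarrow> 'g loc_elem set" where
  "double_ideal k nm h np =
     left_pow (A_bar k h) (A_of k h ` np) 1 <+>\<^bsub>A_bar k h\<^esub> right_pow (A_bar k h) (A_of k h ` nm) 1"

text \<open>A representative of \<open>a P b\<close>. For given \<open>a\<close> and \<open>b\<close> all but finitely many terms
  \<open>a P\<^sub>\<kappa> b\<close> lie in \<open>A n\<^sub>+ + n\<^sub>- A\<close>; these are omitted, as they vanish in the quotient.\<close>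

definition proj_mult ::
    "'g::fin_dim_complex_lie_algebra set \<Rightarrow> 'g set \<Rightarrow> 'g set \<Rightarrow> 'g set \<Rightarrow>
     (('g \<Rightarrow> complex) \<Rightarrow> 'g loc_elem) \<Rightarrow> 'g loc_elem \<Rightarrow> 'g loc_elem \<Rightarrow> 'g loc_elem" where
  "proj_mult k nm h np P a b =
    (let A = A_bar k h in
      \<Oplus>\<^bsub>A\<^esub>\<kappa>\<in>{\<kappa> \<in> Q_plus h np. a \<otimes>\<^bsub>A\<^esub> P \<kappa> \<otimes>\<^bsub>A\<^esub> b \<notin> double_ideal k nm h np}.
        a \<otimes>\<^bsub>A\<^esub> P \<kappa> \<otimes>\<^bsub>A\<^esub> b)"

text \<open>The carrier is the additive quotient; as in \<^const>\<open>FactRing\<close>, the product of two classes is the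
  union of the classes of all products of representatives.\<close>

definition reduction_algebra ::
    "'g::fin_dim_complex_lie_algebra set \<Rightarrow> 'g set \<Rightarrow> 'g set \<Rightarrow> 'g set \<Rightarrow>
     (('g \<Rightarrow> complex) \<Rightarrow> 'g loc_elem) \<Rightarrow> 'g loc_elem set ring" where
  "reduction_algebra k nm h np P =
    (let A = A_bar k h; I = double_ideal k nm h np in
      \<lparr>carrier = a_rcosets\<^bsub>A\<^esub> I,
       mult = (\<lambda>X Y. \<Union>a\<in>X. \<Union>b\<in>Y. I +>\<^bsub>A\<^esub> proj_mult k nm h np P a b),
       one = I +>\<^bsub>A\<^esub> \<one>\<^bsub>A\<^esub>, zero = I, add = set_add A\<rparr>)"

definition Z_of_A ::
    "'g::fin_dim_complex_lie_algebra set \<Rightarrow> 'g set \<Rightarrow> 'g set \<Rightarrow> 'g set \<Rightarrow>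
     'g loc_elem \<Rightarrow> 'g loc_elem set" where
  "Z_of_A k nm h np a = double_ideal k nm h np +>\<^bsub>A_bar k h\<^esub> a"

section \<open>The relations\<close>

text \<open>The generators are \<open>Inl u\<close> for \<open>u\<close> in \<^term>\<open>Uh_bar k h\<close>, and \<open>Inr K\<close> for \<open>p\<^sub>K\<close>.
  The coefficient relators make \<open>Inl\<close> a homomorphism of unital complex algebras.\<close>

type_synonym ('g, 'i) red_falg = "('g loc_elem + 'i) falg"

definition coeff_rels ::
    "'g::fin_dim_complex_lie_algebra set \<Rightarrow> 'g set \<Rightarrow> ('g, 'i) red_falg set" where
  "coeff_rels k h =
    (let U = Uh_bar k h in
     {fgen (Inl (u \<oplus>\<^bsub>U\<^esub> v)) - fgen (Inl u) - fgen (Inl v) | u v. u \<in> carrier U \<and> v \<in> carrier U} \<union>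
     {fgen (Inl (u \<otimes>\<^bsub>U\<^esub> v)) - fgen (Inl u) * fgen (Inl v) | u v. u \<in> carrier U \<and> v \<in> carrier U} \<union>
     {fgen (Inl (loc_class k h h (fconst c))) - fconst c | c. True})"

definition weight_rels ::
    "'g::fin_dim_complex_lie_algebra set \<Rightarrow> 'g set \<Rightarrow> 'i set \<Rightarrow> ('i \<Rightarrow> 'g \<Rightarrow> complex) \<Rightarrow>
     ('g, 'i) red_falg set" where
  "weight_rels k h N \<mu> =
     {fgen (Inl (loc_class k h h (fgen (Inl x)))) * fgen (Inr K)
        - fgen (Inr K) * fgen (Inl (loc_class k h h (fgen (Inl x))))
        - fconst (\<mu> K x) * fgen (Inr K) | x K. x \<in> h \<and> K \<in> N}"

definition ordering_rels ::
    "'i::linorder set \<Rightarrow> ('i \<Rightarrow> 'i \<Rightarrow> 'i \<Rightarrow> 'i \<Rightarrow> 'g loc_elem) \<Rightarrow>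
     ('i \<Rightarrow> 'i \<Rightarrow> 'i \<Rightarrow> 'g loc_elem) \<Rightarrow> ('i \<Rightarrow> 'i \<Rightarrow> 'g loc_elem) \<Rightarrow> ('g, 'i) red_falg set" where
  "ordering_rels N B C D =
     {fgen (Inr I) * fgen (Inr J)
        - ((\<Sum>(K, L)\<in>{(K, L). K \<in> N \<and> L \<in> N \<and> K \<le> L}.
               fgen (Inl (B I J K L)) * fgen (Inr K) * fgen (Inr L))
           + (\<Sum>L\<in>N. fgen (Inl (C I J L)) * fgen (Inr L))
           + fgen (Inl (D I J))) | I J. I \<in> N \<and> J \<in> N \<and> J < I}"

end

theory Submission
 imports Defs
  "HOL-Computational_Algebra.Fundamental_Theorem_Algebra"
  "HOL-Analysis.Continuum_Not_Denumerable"
begin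

text \<open>The extremal projector, inserted between \<open>p\<^sub>I\<close> and \<open>p\<^sub>J\<close>, contributes besides \<open>p\<^sub>I p\<^sub>J\<close> only
 products whose first letter is smaller than \<open>I\<close> and whose second letter is larger than \<open>J\<close>. Descending
 induction on \<open>J\<close> yields the ordering relations with \<open>L > J\<close> in all quadratic terms. Hence rewriting
 by them terminates, and the presented algebra is spanned over the localized \<open>U(h)\<close> by the
 sorted monomials.

 The images of the sorted monomials in the reduction algebra are independent: they span the
 sorted ordinary products of the \<open>p\<^sub>K\<close>, equally many, whose coordinates in a module induced from
 a character of \<open>h\<close> (a Poincare-Birkhoff-Witt argument relative to \<open>h\<close>) form the identity matrix. Only
 generic characters, at which no \<open>h\<^sub>\<alpha> + l\<close> vanishes, extend to the localization; they suffice since a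
 polynomial vanishing off countably many hyperplanes is zero.\<close>

section \<open>Linear operators on a finite-dimensional Lie algebra\<close>

text \<open>Two facts about roots carry the construction. They are derived from bare definitions, in
  which \<open>h\<close> is merely nilpotent and self-normalizing and the Borel subalgebras are
  merely maximal solvable. First, \<open>h\<close> acts diagonalizably on \<open>k\<close>, by Lie's
  theorem and Cartan's criterion. Second, coroots have integral eigenvalues on all of g. Hence a
  denominator h_alpha + l moved past a weight vector becomes another denominator, so localized
  coefficients can be collected on either side, and a generic character stays generic when shifted
  by a weight. In a term of p_I P p_J the raising factors are moved to the right past p_J, modulo A
  n_+, and the lowering factors to the left past p_I, modulo n_- A. What remains changes the weight
  of the first letter by -kappa and of the second by +kappa, with kappa in Q_+; compatibility of the
  order turns this into inequalities between letters. The double coset space is not a module over A,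
  so the calculations are made with representatives in the free algebra, modulo the preimage of A
  n_+ + n_- A.\<close>

abbreviation clinear :: "('g::fin_dim_complex_lie_algebra => 'g) => bool" where
 "clinear \<equiv> Vector_Spaces.linear cscale cscale"

lemma clinear_iff:
 "clinear T \<longleftrightarrow> (ALL x y. T (x + y) = T x + T y) & (ALL c x. T (c *\<^sub>C x) = c *\<^sub>C T x)"
 by(simp add: Vector_Spaces.linear_iff clin.vector_space_axioms)

lemma clinear_add: "clinear T ==> T (x + y) = T x + T y"
 and clinear_scale: "clinear T ==> T (c *\<^sub>C x) = c *\<^sub>C T x"
 by(auto simp: clinear_iff)

lemma clinear_additive: "clinear T ==> Modules.additive T"
 by(simp add: Modules.additive_def clinear_add)

lemmas clinear_zero = clinear_additive[THEN additive.zero]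
 and clinear_minus = clinear_additive[THEN additive.minus]
 and clinear_diff = clinear_additive[THEN additive.diff]
 and clinear_sum = clinear_additive[THEN additive.sum]

lemma clinear_lie: "clinear (lie x)"
 by(simp add: clinear_iff lie_add_right lie_cscale_right)

lemma clinear_lie_left: "clinear (%x. lie x y)"
 by(simp add: clinear_iff lie_add_left lie_cscale_left)

lemmas lie_simps = lie_add_left lie_add_right lie_cscale_left lie_cscale_right
lemmas lie_zero_right [simp] = clinear_zero[OF clinear_lie]
lemmas lie_zero_left [simp] = clinear_zero[OF clinear_lie_left]
lemmas lie_minus_right = clinear_minus[OF clinear_lie]
lemmas lie_diff_right = clinear_diff[OF clinear_lie]
lemmas lie_diff_left = clinear_diff[OF clinear_lie_left]
lemmas lie_sum_right = clinear_sum[OF clinear_lie]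
lemmas lie_sum_left = clinear_sum[OF clinear_lie_left]

lemma lie_anti: "lie x y = - lie y x"
proof -
 have "0 = lie (x + y) (x + y)" by(rule lie_self[symmetric])
 also have "... = lie x x + lie x y + (lie y x + lie y y)"
  by(simp only: lie_add_left lie_add_right ac_simps)
 finally have "lie x y + lie y x = 0" by(simp add: lie_self)
 thus ?thesis by(simp add: eq_neg_iff_add_eq_0)
qed

lemma lie_lie: "lie (lie x y) z = lie x (lie y z) - lie y (lie x z)"
proof -
 have "lie x (lie y z) + lie y (lie z x) + lie z (lie x y) = 0" by(rule jacobi)
 moreover have "lie y (lie z x) = - lie y (lie x z)"
  by(metis lie_anti lie_minus_right)
 moreover have "lie z (lie x y) = - lie (lie x y) z" by(rule lie_anti)
 ultimately show ?thesis by(simp add: algebra_simps)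
qed

lemma lie_deriv: "lie x (lie y z) = lie (lie x y) z + lie y (lie x z)"
 by(simp add: lie_lie)

lemma clinear_compose: "clinear S ==> clinear T ==> clinear (%v. S (T v))"
 by(simp add: clinear_iff)

lemma clinear_funpow: "clinear T ==> clinear (T ^^ n)"
 by(induction n) (simp_all add: clinear_iff)

lemma clinear_minus_op: "clinear S ==> clinear T ==> clinear (%v. S v - T v)"
 by(simp add: clinear_iff clin.scale_right_diff_distrib)

lemma clinear_id: "clinear (%v. v)"
 by(simp add: clinear_iff)

lemma clinear_span_subset:
 assumes "clinear T" "!!b. b : B ==> T b : W" "clin.subspace W" "v : clin.span B"
 shows "T v : W"
 using assms(4)
proof (induction rule: clin.span_induct_alt)
 case base
 thus ?case using assms by(simp add: clinear_zero clin.subspace_0)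
next
 case (step c x y)
 thus ?case
  using assms by(simp add: clinear_add clinear_scale clin.subspace_add clin.subspace_scale)
qed

lemma clinear_eq_on_span:
 assumes "clinear S" "clinear T" "!!b. b : B ==> S b = T b" "v : clin.span B"
 shows "S v = T v"
 using clinear_span_subset[OF clinear_minus_op[OF assms(1,2)], of B "{0}" v] assms by simp

lemma exists_finite_basis:
 "EX B :: 'g::fin_dim_complex_lie_algebra set. finite B & clin.independent B & clin.span B = UNIV"
proof -
 obtain S :: "'g set" where S: "finite S" "ALL x. EX c. x = (\<Sum>b\<in>S. c b *\<^sub>C b)"
  using finite_dimensional by blast
 have "x : clin.span S" for x
 proof -
  obtain c where "x = (\<Sum>b\<in>S. c b *\<^sub>C b)" using S(2) by blast
  moreover have "(\<Sum>b\<in>S. c b *\<^sub>C b) : clin.span S"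
   by(intro clin.span_sum clin.span_scale clin.span_base)
  ultimately show ?thesis by simp
 qed
 hence "clin.span S = UNIV" by auto
 moreover obtain B where B: "B <= S" "clin.independent B" "S <= clin.span B"
  using clin.maximal_independent_subset by blast
 ultimately have "clin.span B = UNIV"
  using clin.span_minimal[OF B(3)] by auto
 moreover have "finite B" using B(1) S(1) by(rule finite_subset)
 ultimately show ?thesis using B(2) by(intro exI[of _ B] conjI)
qed

definition cbasis :: "'g::fin_dim_complex_lie_algebra set" where
 "cbasis = (SOME B. finite B & clin.independent B & clin.span B = UNIV)"

lemma cbasis: "finite (cbasis :: 'g::fin_dim_complex_lie_algebra set)"
  "clin.independent (cbasis :: 'g set)" "clin.span (cbasis :: 'g set) = UNIV"
proof -
 have "finite (cbasis :: 'g set) & clin.independent (cbasis :: 'g set) & clin.span (cbasis :: 'g set) = UNIV"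
  unfolding cbasis_def by(rule someI_ex[OF exists_finite_basis])
 thus "finite (cbasis :: 'g set)" "clin.independent (cbasis :: 'g set)"
  "clin.span (cbasis :: 'g set) = UNIV" by blast+
qed

global_interpretation cfin: finite_dimensional_vector_space
  "cscale :: complex => 'g => 'g::fin_dim_complex_lie_algebra" cbasis
 by unfold_locales (auto simp: cbasis)

subsection \<open>Traces\<close>

text \<open>Taken relative to \<open>B\<close> alone, so that the definition also serves on
  subspaces: it is the trace of \<open>T\<close> on the span of \<open>B\<close> whenever that span
  is stable under \<open>T\<close>.\<close>

definition trace :: "'g::fin_dim_complex_lie_algebra set => ('g => 'g) => complex" where
 "trace B T = (\<Sum>b\<in>B. clin.representation B (T b) b)"

lemma representation_clinear:
 assumes "finite B" "clin.independent B" "clinear T" "!!b. b : B ==> T b : clin.span B"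
  "v : clin.span B"
 shows "clin.representation B (T v) b =
   (\<Sum>b'\<in>B. clin.representation B v b' * clin.representation B (T b') b)"
proof -
 have v: "v = (\<Sum>b'\<in>B. clin.representation B v b' *\<^sub>C b')"
  using clin.sum_representation_eq[OF assms(2,5,1)] by simp
 have "T v = (\<Sum>b'\<in>B. clin.representation B v b' *\<^sub>C T b')"
  by(subst v) (simp add: clinear_sum[OF assms(3)] clinear_scale[OF assms(3)])
 thus ?thesis
  using assms
  by(simp add: clin.representation_sum clin.representation_scale clin.span_scale)
qed

lemma trace_comm:
 assumes "finite B" "clin.independent B" "clinear S" "clinear T"
  "!!b. b : B ==> S b : clin.span B" "!!b. b : B ==> T b : clin.span B"
 shows "trace B (%v. S (T v)) = trace B (%v. T (S v))"
proof -
 have "trace B (%v. S (T v)) =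
   (\<Sum>b\<in>B. \<Sum>b'\<in>B. clin.representation B (T b) b' * clin.representation B (S b') b)"
  unfolding trace_def by(intro sum.cong refl representation_clinear assms)
 also have "... = (\<Sum>b'\<in>B. \<Sum>b\<in>B. clin.representation B (S b') b * clin.representation B (T b) b')"
  by(subst sum.swap) (simp add: mult.commute)
 also have "... = trace B (%v. T (S v))"
  unfolding trace_def by(intro sum.cong refl representation_clinear[symmetric] assms)
 finally show ?thesis .
qed

lemma trace_cong: "(!!b. b : B ==> S b = T b) ==> trace B S = trace B T"
 by(simp add: trace_def)

lemma trace_add:
 assumes "clin.independent B" "!!b. b : B ==> S b : clin.span B" "!!b. b : B ==> T b : clin.span B"
 shows "trace B (%v. S v + T v) = trace B S + trace B T"
 using assms by(simp add: trace_def clin.representation_add sum.distrib)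

lemma trace_diff:
 assumes "clin.independent B" "!!b. b : B ==> S b : clin.span B" "!!b. b : B ==> T b : clin.span B"
 shows "trace B (%v. S v - T v) = trace B S - trace B T"
 using assms by(simp add: trace_def clin.representation_diff sum_subtractf)

lemma trace_scale:
 assumes "clin.independent B" "!!b. b : B ==> T b : clin.span B"
 shows "trace B (%v. c *\<^sub>C T v) = c * trace B T"
 using assms by(simp add: trace_def clin.representation_scale sum_distrib_left)

lemma representation_zero_outside:
 assumes "clin.independent B" "v : clin.span B'" "B' <= B" "b \<notin> B'"
 shows "clin.representation B v b = 0"
proof -
 have "clin.representation B v = clin.representation B' v"
  using assms by(intro clin.representation_extend)
 thus ?thesis using assms(4) clin.representation_ne_zero by metis
qed

text \<open>\<open>f\<close> ranks the basis. What \<open>T\<close> adds to \<open>c b\<close> times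
  b lies in the span of vectors of smaller rank and has no coordinate at b.\<close>

lemma trace_triangular:
 fixes f :: "'g::fin_dim_complex_lie_algebra => nat"
 assumes "finite B" "clin.independent B"
  "!!b. b : B ==> T b - c b *\<^sub>C b : clin.span {b' : B. f b' < f b}"
 shows "trace B T = sum c B"
 unfolding trace_def
proof (rule sum.cong[OF refl])
 fix b assume b: "b : B"
 have *: "clin.representation B (T b - c b *\<^sub>C b) b = 0"
  using b by(intro representation_zero_outside[OF assms(2) assms(3)]) auto
 have sp: "T b - c b *\<^sub>C b : clin.span B"
  using assms(3)[OF b] clin.span_mono[of "{b' : B. f b' < f b}" B] by auto
 have "T b = (T b - c b *\<^sub>C b) + c b *\<^sub>C b" by simp
 hence "clin.representation B (T b) b
   = clin.representation B (T b - c b *\<^sub>C b) b + clin.representation B (c b *\<^sub>C b) b"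
  using clin.representation_add[OF assms(2) _ sp, of "c b *\<^sub>C b"] b
  by(metis add.commute clin.span_base clin.span_scale)
 thus "clin.representation B (T b) b = c b"
  using * b assms(2) by(simp add: clin.representation_scale clin.representation_basis clin.span_base)
qed

lemma trace_basis_eq:
 assumes "finite B" "clin.independent B" "finite B'" "clin.independent B'"
  "clin.span B = UNIV" "clin.span B' = UNIV" "clinear T"
 shows "trace B T = trace B' T"
proof -
 have "trace B T = (\<Sum>b\<in>B. clin.representation B (T (\<Sum>b'\<in>B'. clin.representation B' b b' *\<^sub>C b')) b)"
  unfolding trace_def using assms by(simp add: clin.sum_representation_eq)
 also have "... = (\<Sum>b\<in>B. \<Sum>b'\<in>B'. clin.representation B' b b' * clin.representation B (T b') b)"
  using assms by(simp add: clinear_sum[OF assms(7)] clinear_scale[OF assms(7)]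
    clin.representation_sum clin.representation_scale)
 also have "... = (\<Sum>b'\<in>B'. \<Sum>b\<in>B. clin.representation B (T b') b * clin.representation B' b b')"
  by(subst sum.swap) (simp add: mult.commute)
 also have "... = (\<Sum>b'\<in>B'. clin.representation B' (\<Sum>b\<in>B. clin.representation B (T b') b *\<^sub>C b) b')"
  using assms by(simp add: clin.representation_sum clin.representation_scale)
 also have "... = trace B' T"
  unfolding trace_def using assms by(simp add: clin.sum_representation_eq)
 finally show ?thesis .
qed

abbreviation tr :: "('g::fin_dim_complex_lie_algebra => 'g) => complex" where
 "tr \<equiv> trace cbasis"

lemma tr_comm: "clinear S ==> clinear T ==> tr (%v. S (T v)) = tr (%v. T (S v))"
 by(rule trace_comm) (auto simp: cbasis)

lemma tr_add: "tr (%v. S v + T v) = tr S + tr T"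
 and tr_diff: "tr (%v. S v - T v) = tr S - tr T"
 and tr_scale: "tr (%v. c *\<^sub>C T v) = c * tr T"
 by(auto intro: trace_add trace_diff trace_scale simp: cbasis)

subsection \<open>Generalized eigenspaces\<close>

definition shift :: "('g::fin_dim_complex_lie_algebra => 'g) => complex => 'g => 'g" where
 "shift T c v = T v - c *\<^sub>C v"

definition geig :: "('g::fin_dim_complex_lie_algebra => 'g) => complex => 'g set" where
 "geig T c = {v. EX n. (shift T c ^^ n) v = 0}"

lemma clinear_shift: "clinear T ==> clinear (shift T c)"
 by(simp add: clinear_iff shift_def clin.scale_right_distrib clin.scale_right_diff_distrib mult.commute)

lemma funpow_shift_zero_mono:
 assumes "clinear T" "(shift T c ^^ n) v = 0" "n <= m"
 shows "(shift T c ^^ m) v = 0"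
proof -
 obtain k where "m = k + n" using assms(3) le_Suc_ex by(metis add.commute)
 thus ?thesis
  using assms by(simp add: funpow_add clinear_zero clinear_funpow clinear_shift)
qed

lemma geig_subspace: assumes "clinear T" shows "clin.subspace (geig T c)"
proof (rule clin.subspaceI)
 note lin = clinear_funpow[OF clinear_shift[OF assms]]
 show "0 : geig T c" by(auto simp: geig_def clinear_zero[OF lin])
 show "x + y : geig T c" if xy: "x : geig T c" "y : geig T c" for x y
 proof -
  obtain n m where "(shift T c ^^ n) x = 0" "(shift T c ^^ m) y = 0"
   using xy by(auto simp: geig_def)
  hence "(shift T c ^^ (max n m)) (x + y) = 0"
   by(simp add: clinear_add[OF lin] funpow_shift_zero_mono[OF assms])
  thus ?thesis by(auto simp: geig_def)
 qed
 show "a *\<^sub>C x : geig T c" if "x : geig T c" for a x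
  using that by(auto simp: geig_def clinear_scale[OF lin])
qed

lemma geig_shift_mem:
 assumes "clinear T" "v : geig T d" shows "shift T c v : geig T d"
proof -
 have comm: "shift T d (shift T c w) = shift T c (shift T d w)" for w
  using assms(1) by(simp add: shift_def clinear_diff clinear_scale clin.scale_right_diff_distrib
    clin.scale_left_commute[of c d] algebra_simps)
 have "(shift T d ^^ n) (shift T c w) = shift T c ((shift T d ^^ n) w)" for n w
  by(induction n arbitrary: w) (simp_all add: comm)
 moreover obtain n where "(shift T d ^^ n) v = 0" using assms(2) by(auto simp: geig_def)
 ultimately have "(shift T d ^^ n) (shift T c v) = 0"
  using clinear_zero[OF clinear_shift[OF assms(1)]] by simp
 thus ?thesis by(auto simp: geig_def)
qed

lemma geig_mem: "clinear T ==> v : geig T d ==> T v : geig T d"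
 using geig_shift_mem[of T v d 0] by(simp add: shift_def)

lemma geig_shift_eq_0:
 assumes "clinear T" "v : geig T d" "c ~= d" "shift T c v = 0"
 shows "v = 0"
proof -
 have "shift T d v = (c - d) *\<^sub>C v"
  using assms(4) by(simp add: shift_def clin.scale_left_diff_distrib)
 hence "(shift T d ^^ n) v = (c - d) ^ n *\<^sub>C v" for n
  using clinear_scale[OF clinear_shift[OF assms(1)]]
  by(induction n) (simp_all add: mult.commute)
 thus ?thesis using assms(2,3) by(auto simp: geig_def)
qed

lemma geig_shift_pow_eq_0:
 assumes "clinear T" "v : geig T d" "c ~= d" "(shift T c ^^ n) v = 0"
 shows "v = 0"
 using assms(4)
proof (induction n)
 case (Suc n)
 have "(shift T c ^^ n) v : geig T d" for n
  by(induction n) (auto simp: assms geig_shift_mem)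
 thus ?case using Suc geig_shift_eq_0[OF assms(1) _ assms(3)] by auto
qed simp

text \<open>A power of T - a kills the summand at a and is injective on the generalized eigenspaces
  of the other values, so the induction can discard a.\<close>

lemma geig_independent:
 assumes "clinear T" "finite C" "!!c. c : C ==> f c : geig T c" "(\<Sum>c\<in>C. f c) = 0" "c : C"
 shows "f c = 0"
 using assms(2-5)
proof (induction C arbitrary: f c rule: finite_induct)
 case (insert a C)
 obtain n where n: "(shift T a ^^ n) (f a) = 0" using insert.prems(1)[of a] by(auto simp: geig_def)
 note lin = clinear_funpow[OF clinear_shift[OF assms(1)], of n a]
 have mem: "(shift T a ^^ n) v : geig T d" if "v : geig T d" for v d n
  using that by(induction n) (auto simp: geig_shift_mem assms(1))
 have "(shift T a ^^ n) (\<Sum>c\<in>insert a C. f c) = 0"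
  using insert.prems(2) by(simp add: clinear_zero[OF lin])
 hence "(\<Sum>c\<in>C. (shift T a ^^ n) (f c)) = 0"
  using insert.hyps n by(simp add: clinear_sum[OF lin] clinear_add[OF lin])
 hence "(shift T a ^^ n) (f c) = 0" if "c : C" for c
  using insert.IH[of "%c. (shift T a ^^ n) (f c)" c] that insert.prems(1) mem by auto
 hence 0: "f c = 0" if "c : C" for c
  using geig_shift_pow_eq_0[OF assms(1) insert.prems(1)[of c], of a n] that insert.hyps by auto
 moreover have "f a = 0" using 0 insert.prems(2) insert.hyps by simp
 ultimately show ?case using insert.prems(3) by auto
qed simp

text \<open>On the generalized eigenspace of d the operator T - c is invertible, and the preimage
  can be kept inside a stable subspace. The induction is on the nilpotency order of T - d at
  w.\<close>

lemma geig_shift_surj: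
 assumes "clinear T" "clin.subspace W" "!!v. v : W ==> T v : W" "c ~= d"
  "w : W" "(shift T d ^^ n) w = 0"
 shows "EX u:W. u : geig T d & shift T c u = w"
 using assms(5,6)
proof (induction n arbitrary: w)
 case 0
 thus ?case
  using assms(2) geig_subspace[OF assms(1)]
  by(auto intro!: bexI[of _ 0] simp: clin.subspace_0 clinear_zero[OF clinear_shift[OF assms(1)]])
next
 case (Suc n)
 have "shift T d w : W"
  using Suc.prems assms by(simp add: shift_def clin.subspace_diff clin.subspace_scale)
 moreover have "(shift T d ^^ n) (shift T d w) = 0" using Suc.prems(2) by(simp add: funpow_swap1)
 ultimately obtain u where u: "u : W" "u : geig T d" "shift T c u = shift T d w"
  using Suc.IH by blast
 have w: "w : geig T d" using Suc.prems(2) by(auto simp: geig_def intro: exI[of _ "Suc n"])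
 \<comment> \<open>If (T - c) u = (T - d) w, then (T - c) (w - u) = (d - c) w, which dictates the
   scaling.\<close>
 let ?u = "(1 / (d - c)) *\<^sub>C (w - u)"
 have "shift T c (w - u) = shift T c w - shift T d w"
  using u by(simp add: clinear_diff[OF clinear_shift[OF assms(1)]])
 also have "... = (d - c) *\<^sub>C w" by(simp add: shift_def clin.scale_left_diff_distrib)
 finally have "shift T c ?u = w"
  using assms(4) by(simp add: clinear_scale[OF clinear_shift[OF assms(1)]])
 moreover have "?u : W" "?u : geig T d"
  using u w Suc.prems assms(2) geig_subspace[OF assms(1), of d]
  by(auto intro!: clin.subspace_scale clin.subspace_diff)
 ultimately show ?case by blast
qed

definition poly_op :: "complex poly => ('g::fin_dim_complex_lie_algebra => 'g) => 'g => 'g" where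
 "poly_op p T v = (\<Sum>i\<le>degree p. coeff p i *\<^sub>C (T ^^ i) v)"

lemma poly_op_bound: "degree p <= n ==> poly_op p T v = (\<Sum>i\<le>n. coeff p i *\<^sub>C (T ^^ i) v)"
 unfolding poly_op_def by(intro sum.mono_neutral_left) (auto simp: coeff_eq_0)

lemma poly_op_linear_factor:
 assumes "clinear T"
 shows "poly_op ([:-c, 1:] * p) T v = poly_op p T (shift T c v)"
proof -
 let ?n = "Suc (degree p)"
 have deg: "degree ([:-c, 1:] * p) <= ?n"
  using degree_mult_le[of "[:-c, 1:]" p] by simp
 have co: "coeff ([:-c, 1:] * p) i = (case i of 0 => 0 | Suc j => coeff p j) - c * coeff p i" for i
  by(simp add: mult_pCons_left coeff_pCons split: nat.split)
 have "poly_op ([:-c, 1:] * p) T v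
   = (\<Sum>i\<le>?n. (case i of 0 => 0 | Suc j => coeff p j) *\<^sub>C (T ^^ i) v)
    - (\<Sum>i\<le>?n. (c * coeff p i) *\<^sub>C (T ^^ i) v)"
  unfolding poly_op_bound[OF deg] co by(simp only: clin.scale_left_diff_distrib sum_subtractf)
 also have "(\<Sum>i\<le>?n. (case i of 0 => 0 | Suc j => coeff p j) *\<^sub>C (T ^^ i) v)
   = poly_op p T (T v)"
  by(subst sum.atMost_Suc_shift) (simp add: poly_op_def funpow_swap1)
 also have "(\<Sum>i\<le>?n. (c * coeff p i) *\<^sub>C (T ^^ i) v) = poly_op p T (c *\<^sub>C v)"
  using poly_op_bound[of p ?n T "c *\<^sub>C v"]
  by(simp add: clinear_scale[OF clinear_funpow[OF assms]] clinear_scale[OF assms] mult.commute)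
 also have "poly_op p T (T v) - poly_op p T (c *\<^sub>C v) = poly_op p T (shift T c v)"
  by(simp add: poly_op_def shift_def clinear_diff[OF clinear_funpow[OF assms]]
    clin.scale_right_diff_distrib sum_subtractf)
 finally show ?thesis .
qed

lemma exists_annihilating_poly:
 fixes T :: "'g::fin_dim_complex_lie_algebra => 'g"
 shows "EX p. p ~= 0 & poly_op p T v = 0"
proof -
 let ?n = "card (cbasis :: 'g set)" and ?w = "%i. (T ^^ i) v"
 have "EX c. (EX i<=?n. c i ~= 0) & (\<Sum>i\<le>?n. c i *\<^sub>C ?w i) = 0"
 proof (cases "inj_on ?w {..?n}")
  case True
  have "clin.dependent (?w ` {..?n})"
   by(rule cfin.dependent_biggerset_general)
    (use cfin.dim_subset_UNIV[of "?w ` {..?n}"] in \<open>auto simp: card_image[OF True] cfin.dimension_def\<close>)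
  then obtain u where u: "EX x:?w ` {..?n}. u x ~= 0" "(\<Sum>x\<in>?w ` {..?n}. u x *\<^sub>C x) = 0"
   by(auto simp: clin.dependent_finite)
  thus ?thesis
   by(intro exI[of _ "u \<circ> ?w"]) (auto simp: sum.reindex[OF True])
 next
  \<comment> \<open>A coincidence T^i v = T^j v is a relation too, but linear dependence of the set
    of iterates does not see it.\<close>
  case False
  then obtain i j where ij: "i <= ?n" "j <= ?n" "i ~= j" "?w i = ?w j"
   by(auto simp: inj_on_def)
  let ?c = "%k. if k = i then 1 else if k = j then - 1 else (0::complex)"
  have "(\<Sum>k\<le>?n. ?c k *\<^sub>C ?w k) = (\<Sum>k\<in>{i,j}. ?c k *\<^sub>C ?w k)"
   using ij by(intro sum.mono_neutral_right) auto
  also have "... = 0" using ij by simp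
  finally show ?thesis using ij by(intro exI[of _ ?c]) auto
 qed
 then obtain c where c: "EX i<=?n. c i ~= 0" "(\<Sum>i\<le>?n. c i *\<^sub>C ?w i) = 0" by blast
 define p where "p = (\<Sum>i\<le>?n. monom (c i) i)"
 have co: "coeff p i = (if i <= ?n then c i else 0)" for i
  by(simp add: p_def coeff_sum)
 have "degree p <= ?n" by(rule degree_le) (simp add: co)
 hence "poly_op p T v = 0" using c(2) by(simp add: poly_op_bound co)
 moreover have "p ~= 0" using c(1) co by(metis coeff_0)
 ultimately show ?thesis by blast
qed

text \<open>Induction on the degree of a polynomial annihilating v. Once a root c is split off, (T -
  c) v decomposes by induction. Its components at values other than c are lifted through T - c, and
  subtracting the lifts from v leaves a vector in the generalized eigenspace of c.\<close>

lemma geig_decomposition: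
 assumes "clinear T" "clin.subspace W" "!!v. v : W ==> T v : W" "v : W"
 shows "EX C f. finite C & (ALL c:C. f c : geig T c \<inter> W) & v = (\<Sum>c\<in>C. f c)"
proof -
 have "EX C f. finite C & (ALL c:C. f c : geig T c \<inter> W) & v = (\<Sum>c\<in>C. f c)"
  if "p ~= 0" "poly_op p T v = 0" "v : W" for p v
  using that
 proof (induction "degree p" arbitrary: p v)
  case 0
  then obtain a where "p = [:a:]" by(metis degree_eq_zeroE)
  hence "v = 0" using 0 by(simp add: poly_op_def)
  thus ?case by(intro exI[of _ "{}"]) simp
 next
  case (Suc n)
  then obtain c where "poly p c = 0"
   by(metis Zero_neq_Suc constant_degree fundamental_theorem_of_algebra)
  then obtain q where q: "p = [:-c, 1:] * q" by(metis dvdE poly_eq_0_iff_dvd)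
  hence "q ~= 0" using Suc.prems by auto
  moreover have "degree p = Suc (degree q)"
   unfolding q using \<open>q ~= 0\<close> by(subst degree_mult_eq) auto
  hence "n = degree q" using Suc.hyps(2) by simp
  moreover have "poly_op q T (shift T c v) = 0"
   using Suc.prems q poly_op_linear_factor[OF assms(1)] by metis
  moreover have "shift T c v : W"
   using Suc.prems assms by(simp add: shift_def clin.subspace_diff clin.subspace_scale)
  ultimately obtain C f where Cf: "finite C" "ALL c:C. f c : geig T c \<inter> W"
    "shift T c v = (\<Sum>c\<in>C. f c)"
   using Suc.hyps(1) by blast
  have "ALL d:C - {c}. EX u. u : W & u : geig T d & shift T c u = f d"
  proof
   fix d assume d: "d : C - {c}"
   then obtain n where "(shift T d ^^ n) (f d) = 0" using Cf(2) by(auto simp: geig_def)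
   thus "EX u. u : W & u : geig T d & shift T c u = f d"
    using geig_shift_surj[OF assms(1,2,3), of c d "f d" n] d Cf(2) by blast
  qed
  then obtain u where u: "!!d. d : C - {c} ==> u d : W & u d : geig T d & shift T c (u d) = f d"
   by metis
  define v' where "v' = v - (\<Sum>d\<in>C - {c}. u d)"
  have v'W: "v' : W" unfolding v'_def
   using u Suc.prems assms(2) by(auto intro!: clin.subspace_diff clin.subspace_sum)
  have "shift T c v' = (\<Sum>c\<in>C. f c) - (\<Sum>d\<in>C - {c}. f d)"
   unfolding v'_def using u
   by(simp add: clinear_diff[OF clinear_shift[OF assms(1)]] clinear_sum[OF clinear_shift[OF assms(1)]] Cf(3))
  also have "... : geig T c"
  proof (cases "c : C")
   case True
   thus ?thesis using Cf by(simp add: sum.remove)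
  next
   case False
   thus ?thesis by(simp add: clin.subspace_0[OF geig_subspace[OF assms(1)]])
  qed
  finally obtain n where "(shift T c ^^ n) (shift T c v') = 0" by(auto simp: geig_def)
  hence "(shift T c ^^ Suc n) v' = 0" by(simp add: funpow_swap1)
  hence v'G: "v' : geig T c" unfolding geig_def by blast
  define g where "g = (%d. if d = c then v' else u d)"
  have "sum g (insert c C) = v' + (\<Sum>d\<in>C - {c}. g d)"
   using Cf(1) by(simp add: sum.insert_remove g_def)
  also have "(\<Sum>d\<in>C - {c}. g d) = (\<Sum>d\<in>C - {c}. u d)"
   by(intro sum.cong) (auto simp: g_def)
  finally have "v = sum g (insert c C)" by(simp add: v'_def)
  moreover have "ALL d:insert c C. g d : geig T d \<inter> W"
   using u v'G v'W by(auto simp: g_def)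
  ultimately show ?case using Cf(1) by blast
 qed
 thus ?thesis using exists_annihilating_poly[of T v] assms(4) by blast
qed

lemma exists_eigenvector:
 assumes "clinear T" "clin.subspace W" "!!v. v : W ==> T v : W" "W ~= {0}"
 shows "EX v:W. v ~= 0 & (EX c. T v = c *\<^sub>C v)"
proof -
 obtain v where v: "v : W" "v ~= 0" using assms(2,4) clin.subspace_0 by blast
 obtain C f where Cf: "finite C" "ALL c:C. f c : geig T c \<inter> W" "v = (\<Sum>c\<in>C. f c)"
  using geig_decomposition[OF assms(1-3) v(1)] by blast
 then obtain c where c: "c : C" "f c ~= 0" using v(2) by(metis sum.neutral)
 hence "EX n. (shift T c ^^ n) (f c) = 0" using Cf(2) by(auto simp: geig_def)
 define n where "n = (LEAST n. (shift T c ^^ n) (f c) = 0)"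
 have n: "(shift T c ^^ n) (f c) = 0"
  unfolding n_def using \<open>EX n. (shift T c ^^ n) (f c) = 0\<close> by(rule LeastI_ex)
 hence "n ~= 0" using c(2) by(intro notI) simp
 then obtain m where m: "n = Suc m" using not0_implies_Suc by blast
 let ?u = "(shift T c ^^ m) (f c)"
 have "?u ~= 0" using not_less_Least[of m "%n. (shift T c ^^ n) (f c) = 0"] m n_def by simp
 moreover have "T ?u = c *\<^sub>C ?u" using n m by(simp add: shift_def)
 moreover have "(shift T c ^^ k) (f c) : W" for k
  using Cf(2) c(1) assms(2,3) by(induction k) (auto simp: shift_def clin.subspace_diff clin.subspace_scale)
 ultimately show ?thesis by blast
qed

text \<open>The independent set grows by one vector at a time. Some generalized eigenvector, say for
  d, lies outside the current span; its last iterate under T - d outside the span is added, so T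
  acts on it by d modulo the older vectors. \<open>f\<close> records the time of insertion.\<close>

lemma triangular_basis:
 fixes T :: "'g::fin_dim_complex_lie_algebra => 'g"
 assumes "clinear T"
 shows "EX B c f. finite B & clin.independent B & clin.span B = UNIV &
  (ALL b:B. b : geig T (c b) & T b - c b *\<^sub>C b : clin.span {b':B. f b' < (f b :: nat)})"
proof -
 let ?ok = "%n B c f. finite B & clin.independent B & card B = n &
  (ALL b:B. f b < n & b : geig T (c b) & T b - c b *\<^sub>C b : clin.span {b':B. f b' < (f b :: nat)})"
 have "EX B c f. ?ok n B c f" if "n <= card (cbasis :: 'g set)" for n
  using that
 proof (induction n)
  case 0
  thus ?case by(intro exI[of _ "{}"]) (simp add: clin.independent_empty)
 next
  case (Suc n)
  hence "EX B c f. ?ok n B c f" by simp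
  then obtain B c f where B0: "?ok n B c f" by(elim exE)
  hence B: "finite B" "clin.independent B" "card B = n" by simp_all
  have B4: "f b < n & b : geig T (c b) & T b - c b *\<^sub>C b : clin.span {b':B. f b' < f b}"
   if "b : B" for b using B0 that by blast
  have "clin.span B ~= UNIV"
   using clin.dim_eq_card_independent[OF B(2)] B(3) Suc.prems cfin.dim_UNIV
   by(metis clin.dim_span not_less_eq_eq order_refl)
  then obtain x where x: "x \<notin> clin.span B" by auto
  obtain C g where Cg: "finite C" "ALL c:C. g c : geig T c" "x = (\<Sum>c\<in>C. g c)"
   using geig_decomposition[OF assms clin.subspace_UNIV, of x] by auto
  then obtain d where d: "d : C" "g d \<notin> clin.span B" using x clin.span_sum by metis
  obtain k where "(shift T d ^^ k) (g d) = 0" using Cg(2) d(1) by(auto simp: geig_def)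
  hence ex: "EX k. (shift T d ^^ k) (g d) : clin.span B" by(metis clin.span_zero)
  define k where "k = (LEAST k. (shift T d ^^ k) (g d) : clin.span B)"
  have k: "(shift T d ^^ k) (g d) : clin.span B" unfolding k_def using ex by(rule LeastI_ex)
  hence "k ~= 0" using d(2) by(intro notI) simp
  then obtain m where m: "k = Suc m" using not0_implies_Suc by blast
  define v where "v = (shift T d ^^ m) (g d)"
  have v: "v \<notin> clin.span B"
   using not_less_Least[of m "%k. (shift T d ^^ k) (g d) : clin.span B"] m k_def v_def by simp
  have vB: "v \<notin> B" using v clin.span_base by blast
  have vT: "T v - d *\<^sub>C v : clin.span B" using k m by(simp add: v_def shift_def)
  have "(shift T d ^^ j) (g d) : geig T d" for j
   using Cg(2) d(1) by(induction j) (auto simp: geig_shift_mem assms)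
  hence vG: "v : geig T d" by(simp add: v_def)
  let ?f = "f(v := n)" and ?c = "c(v := d)"
  have "?ok (Suc n) (insert v B) ?c ?f"
  proof (intro conjI ballI)
   show "clin.independent (insert v B)" using v B by(simp add: clin.independent_insertI)
   show "card (insert v B) = Suc n" using B vB by simp
   fix b assume b: "b : insert v B"
   show "?f b < Suc n" using b B4 by(auto simp: less_Suc_eq)
   show "b : geig T (?c b)" using b B4 vG by auto
   show "T b - ?c b *\<^sub>C b : clin.span {b':insert v B. ?f b' < ?f b}"
   proof (cases "b = v")
    case True
    have "B <= {b':insert v B. ?f b' < n}" using vB B4 by auto
    from clin.span_mono[OF this] have "T v - d *\<^sub>C v : clin.span {b':insert v B. ?f b' < n}"
     using vT by(rule subsetD)
    thus ?thesis using True by simp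
   next
    case False
    hence "{b':B. f b' < f b} <= {b':insert v B. ?f b' < ?f b}" using vB by auto
    from clin.span_mono[OF this] have "T b - c b *\<^sub>C b : clin.span {b':insert v B. ?f b' < ?f b}"
     by(rule subsetD) (use B4[of b] False b in simp)
    thus ?thesis using False by simp
   qed
  qed (use B in auto)
  thus ?case by blast
 qed
 then obtain B c f where B: "?ok (card (cbasis :: 'g set)) B c f" by blast
 hence "clin.span B = UNIV"
  using cfin.card_ge_dim_independent[of B UNIV] by(auto simp: cfin.dim_UNIV)
 with B show ?thesis by blast
qed

text \<open>For \<open>\<phi> = id\<close> this is the semisimple part of \<open>T\<close>.\<close>

lemma exists_spectral_operator:
 fixes T :: "'g::fin_dim_complex_lie_algebra => 'g"
 assumes "clinear T"
 shows "EX B c y. finite B & 0 \<notin> B & clin.span B = UNIV & (ALL b:B. b : geig T (c b)) & clinear y &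
   (ALL d. ALL v:geig T d. y v = \<phi> d *\<^sub>C v) & tr (%v. T (y v)) = (\<Sum>b\<in>B. c b * \<phi> (c b)) &
   tr T = sum c B"
proof -
 from triangular_basis[OF assms] obtain B c f where B0: "finite B & clin.independent B & clin.span B = UNIV &
  (ALL b:B. b : geig T (c b) & T b - c b *\<^sub>C b : clin.span {b':B. f b' < (f b :: nat)})"
  by(elim exE)
 hence B: "finite B" "clin.independent B" "clin.span B = UNIV"
   "!!b. b : B ==> b : geig T (c b)"
   "!!b. b : B ==> T b - c b *\<^sub>C b : clin.span {b':B. f b' < f b}"
  by blast+
 let ?r = "clin.representation B"
 define y where "y v = (\<Sum>b\<in>B. (?r v b * \<phi> (c b)) *\<^sub>C b)" for v
 have y: "clinear y"
  unfolding clinear_iff y_def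
  by(auto simp: clin.representation_add[OF B(2)] clin.representation_scale[OF B(2)]
    B(3) sum.distrib clin.scale_left_distrib distrib_right clin.scale_sum_right mult.assoc)
 have yG: "y v = \<phi> d *\<^sub>C v" if v: "v : geig T d" for v d
 proof -
  let ?C = "insert d (c ` B)"
  define g where "g e = (\<Sum>b\<in>{b:B. c b = e}. ?r v b *\<^sub>C b) - (if e = d then v else 0)" for e
  have gG: "g e : geig T e" for e
   unfolding g_def using geig_subspace[OF assms] v B(4)
   by(intro clin.subspace_diff clin.subspace_sum) (auto intro: clin.subspace_scale clin.subspace_0)
  have "(\<Sum>e\<in>?C. \<Sum>b\<in>{b:B. c b = e}. ?r v b *\<^sub>C b) = (\<Sum>b\<in>B. ?r v b *\<^sub>C b)"
   using B(1) by(intro sum.group) auto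
  also have "... = v" using B by(simp add: clin.sum_representation_eq)
  finally have "sum g ?C = 0"
   using B(1) by(simp add: g_def sum_subtractf sum.delta del: sum.insert)
  hence ge: "g e = 0" if "e : ?C" for e
   using geig_independent[OF assms _ gG \<open>sum g ?C = 0\<close> that] B(1) by simp
  have g0: "(\<Sum>b\<in>{b:B. c b = e}. ?r v b *\<^sub>C b) = (if e = d then v else 0)" if "e : ?C" for e
   using ge[OF that] unfolding g_def by(simp only: right_minus_eq)
  have "(\<Sum>e\<in>?C. \<Sum>b\<in>{b:B. c b = e}. (?r v b * \<phi> (c b)) *\<^sub>C b)
    = (\<Sum>b\<in>B. (?r v b * \<phi> (c b)) *\<^sub>C b)"
   using B(1) by(intro sum.group) auto
  hence "y v = (\<Sum>e\<in>?C. \<Sum>b\<in>{b:B. c b = e}. (?r v b * \<phi> (c b)) *\<^sub>C b)"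
   by(simp only: y_def)
  also have "... = (\<Sum>e\<in>?C. \<phi> e *\<^sub>C (\<Sum>b\<in>{b:B. c b = e}. ?r v b *\<^sub>C b))"
   by(intro sum.cong refl) (auto simp: clin.scale_sum_right mult.commute intro!: sum.cong)
  also have "... = (\<Sum>e\<in>?C. if e = d then \<phi> d *\<^sub>C v else 0)"
   using g0 by(intro sum.cong refl) auto
  also have "... = \<phi> d *\<^sub>C v" using B(1) by(simp add: sum.delta del: sum.insert)
  finally show ?thesis .
 qed
 have "T (y b) - (c b * \<phi> (c b)) *\<^sub>C b : clin.span {b':B. f b' < f b}" if "b : B" for b
 proof -
  have "T (y b) - (c b * \<phi> (c b)) *\<^sub>C b = \<phi> (c b) *\<^sub>C (T b - c b *\<^sub>C b)"
   using yG[OF B(4)[OF that]]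
   by(simp add: clinear_scale[OF assms] clin.scale_right_diff_distrib mult.commute)
  thus ?thesis using B(5)[OF that] by(simp add: clin.span_scale)
 qed
 hence "trace B (%v. T (y v)) = (\<Sum>b\<in>B. c b * \<phi> (c b))"
  by(intro trace_triangular[OF B(1,2)])
 hence "tr (%v. T (y v)) = (\<Sum>b\<in>B. c b * \<phi> (c b))"
  using trace_basis_eq[OF B(1,2) cbasis(1,2) B(3) cbasis(3) clinear_compose[OF assms y]] by simp
 moreover have "tr T = sum c B"
  using trace_triangular[OF B(1,2,5)] trace_basis_eq[OF B(1,2) cbasis(1,2) B(3) cbasis(3) assms]
  by simp
 moreover have "0 \<notin> B" using B(2) clin.dependent_zero by blast
 ultimately show ?thesis
  using B(1,3,4) y yG by(intro exI[of _ B] exI[of _ c] exI[of _ y] conjI ballI allI)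
qed

lemma tr_nilpotent:
 assumes "clinear T" "!!v. (T ^^ n) v = 0"
 shows "tr T = 0"
proof -
 obtain B c where B: "finite B" "0 \<notin> B" "ALL b:B. b : geig T (c b)" "tr T = sum c B"
  using exists_spectral_operator[OF assms(1), of "%_. 0"] by(elim exE conjE) (rule that)
 have "shift T 0 = T" by(auto simp: shift_def)
 hence "c b = 0" if "b : B" for b
  using geig_shift_pow_eq_0[OF assms(1), of b "c b" 0 n] B that assms(2) by metis
 thus ?thesis using B by simp
qed

subsection \<open>Lie's theorem\<close>

global_interpretation clinp: vector_space_pair
  "cscale :: complex => 'g => 'g::fin_dim_complex_lie_algebra"
  "cscale :: complex => 'h => 'h::fin_dim_complex_lie_algebra"
 by unfold_locales

text \<open>\<open>E\<close> is a complement of \<open>W\<close> in \<open>V\<close> and stands for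
  the quotient V/W, with \<open>\<pi>\<close> as the quotient map. Everything remains in the one
  type on which \<open>lie\<close> acts.\<close>

lemma exists_projection:
 fixes W V :: "'g::fin_dim_complex_lie_algebra set"
 assumes "clin.subspace W" "clin.subspace V" "W <= V"
 obtains \<pi> E where "clinear \<pi>" "clin.subspace E" "E <= V" "!!v. v : V ==> \<pi> v : E"
  "!!v. v : V ==> v - \<pi> v : W" "!!w. w : W ==> \<pi> w = 0" "!!e. e : E ==> \<pi> e = e"
proof -
 obtain B0 where B0: "B0 <= W" "clin.independent B0" "W <= clin.span B0"
  using clin.maximal_independent_subset by metis
 have "B0 <= V" using B0(1) assms(3) by(rule subset_trans)
 then obtain B where B: "B0 <= B" "B <= V" "clin.independent B" "V <= clin.span B"
  by(rule clin.maximal_independent_subset_extend[OF _ B0(2)])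
 obtain \<pi> where \<pi>: "clinear \<pi>" "!!b. b : B ==> \<pi> b = (if b : B0 then 0 else b)"
  using clinp.linear_independent_extend[OF B(3), of "%b. if b : B0 then 0 else b"] by blast
 let ?E = "clin.span (B - B0)"
 show thesis
 proof (rule that[OF \<pi>(1)])
  show "clin.subspace ?E" by(rule clin.subspace_span)
  show "?E <= V" by(rule clin.span_minimal) (use B(2) assms(2) in blast)+
  show "\<pi> v : ?E" if "v : V" for v
  proof (rule clinear_span_subset[OF \<pi>(1) _ clin.subspace_span])
   show "v : clin.span B" using that B(4) by(rule subsetD[rotated])
   show "\<pi> b : ?E" if "b : B" for b
    using that \<pi>(2) clin.span_base[of b "B - B0"] by(simp add: clin.span_zero)
  qed
  show "v - \<pi> v : W" if "v : V" for v
  proof (rule clinear_span_subset[OF clinear_minus_op[OF clinear_id \<pi>(1)] _ assms(1)])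
   show "v : clin.span B" using that B(4) by(rule subsetD[rotated])
   show "b - \<pi> b : W" if "b : B" for b
    using that \<pi>(2) B0(1) clin.subspace_0[OF assms(1)] by auto
  qed
  show "\<pi> w = 0" if "w : W" for w
  proof (rule clinear_eq_on_span[OF \<pi>(1)])
   show "clinear (%_. 0 :: 'g)" by(simp add: clinear_iff)
   show "w : clin.span B0" using that B0(3) by(rule subsetD[rotated])
   show "\<pi> b = 0" if "b : B0" for b using that \<pi>(2) B(1) by auto
  qed
  show "\<pi> e = e" if "e : ?E" for e
   by(rule clinear_eq_on_span[OF \<pi>(1) clinear_id _ that]) (simp add: \<pi>(2))
 qed
qed

lemma brackets_subset:
 assumes "clin.subspace W" "!!x y. x : X ==> y : Y ==> lie x y : W"
 shows "brackets X Y <= W"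
 unfolding brackets_def by(rule clin.span_minimal[OF _ assms(1)]) (use assms(2) in blast)

lemma bracket_mem: "x : X ==> y : Y ==> lie x y : brackets X Y"
 unfolding brackets_def by(rule clin.span_base) blast

lemma brackets_subspace: "clin.subspace (brackets X Y)"
 unfolding brackets_def by(rule clin.subspace_span)

lemma brackets_mono: "X <= X' ==> Y <= Y' ==> brackets X Y <= brackets X' Y'"
 by(intro brackets_subset brackets_subspace bracket_mem) auto

lemma derived_series_mono: "L <= L' ==> derived_series L n <= derived_series L' n"
 by(induction n) (simp_all add: brackets_mono)

lemma subalgebra_subspace: "subalgebra L ==> clin.subspace L"
 and subalgebra_lie: "subalgebra L ==> x : L ==> y : L ==> lie x y : L"
 by(auto simp: subalgebra_def)

text \<open>The eigenvalue \<open>\<theta>\<close> vanishes on commutators since the trace of \<open>\<rho> [x, z]\<close> on the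
 span of the vectors \<open>(\<rho> z)\<^sup>i w\<close> is both zero and a positive multiple of \<open>\<theta> [x, z]\<close>.\<close>

lemma lie_invariance:
 fixes \<rho> :: "'g::fin_dim_complex_lie_algebra => 'g => 'g"
 assumes "!!y. y : insert z K ==> clinear (\<rho> y)" "!!y v. y : insert z K ==> v : E ==> \<rho> y v : E"
  and comm: "!!y v. y : K ==> v : E ==> \<rho> (lie y z) v = \<rho> y (\<rho> z v) - \<rho> z (\<rho> y v)"
  and K: "!!y. y : K ==> lie y z : K"
  and w: "w : E" "w ~= 0" "!!y. y : K ==> \<rho> y w = \<theta> y *\<^sub>C w" and x: "x : K"
 shows "\<theta> (lie x z) = 0"
proof -
 define u where "u i = (\<rho> z ^^ i) w" for i
 have uE: "u i : E" for i using assms(2) w(1) by(induction i) (auto simp: u_def)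
 have uS: "u (Suc i) = \<rho> z (u i)" for i by(simp add: u_def)
 have indep: "clin.independent (u ` {..<j}) & inj_on u {..<j}"
  if "!!i. i < j ==> u i \<notin> clin.span (u ` {..<i})" for j
  using that
 proof (induction j)
  case (Suc j)
  have "u j \<notin> clin.span (u ` {..<j})" using Suc.prems by simp
  moreover from this have "u j \<notin> u ` {..<j}" using clin.span_base by metis
  moreover have "clin.independent (u ` {..<j}) & inj_on u {..<j}" using Suc by simp
  ultimately show ?case by(simp add: lessThan_Suc clin.independent_insertI inj_on_insert)
 qed (simp add: clin.independent_empty)
 have ex: "EX m. u m : clin.span (u ` {..<m})"
 proof (rule ccontr)
  assume no: "\<not> ?thesis"
  let ?n = "Suc (clin.dim (UNIV :: 'g set))"
  have "clin.independent (u ` {..<?n})" "inj_on u {..<?n}" using indep[of ?n] no by simp_all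
  hence "card (u ` {..<?n}) <= clin.dim (UNIV :: 'g set)"
   by(intro cfin.independent_card_le_dim) simp_all
  thus False using \<open>inj_on u {..<?n}\<close> by(simp add: card_image)
 qed
 define m where "m = (LEAST m. u m : clin.span (u ` {..<m}))"
 have m: "u m : clin.span (u ` {..<m})" unfolding m_def using ex by(rule LeastI_ex)
 have less: "u i \<notin> clin.span (u ` {..<i})" if "i < m" for i
  using that not_less_Least unfolding m_def by blast
 have m0: "m > 0"
 proof (rule ccontr)
  assume "\<not> m > 0"
  thus False using m w(2) by(simp add: u_def)
 qed
 define B where "B = u ` {..<m}"
 have B: "finite B" "clin.independent B" and inj: "inj_on u {..<m}"
  using indep[of m] less by(auto simp: B_def)
 have uB: "u i : clin.span B" if "i <= m" for i
  using that m unfolding B_def by(cases "i = m") (auto intro: clin.span_base)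
 have tri: "\<rho> y (u i) - \<theta> y *\<^sub>C u i : clin.span (u ` {..<i})" if "y : K" for y i
  using that
 proof (induction i arbitrary: y)
  case 0
  thus ?case using w(3) by(simp add: u_def)
 next
  case (Suc i)
  let ?S = "clin.span (u ` {..<Suc i})"
  have mono: "clin.span (u ` {..<i}) <= ?S" by(intro clin.span_mono) auto
  let ?s = "\<rho> y (u i) - \<theta> y *\<^sub>C u i"
  have "\<rho> z ?s : ?S"
  proof (rule clinear_span_subset[OF _ _ clin.subspace_span Suc.IH[OF Suc.prems]])
   show "clinear (\<rho> z)" using assms(1) by simp
   show "\<rho> z b : ?S" if "b : u ` {..<i}" for b
    using that by(auto simp: uS[symmetric] intro!: clin.span_base)
  qed
  moreover have "\<rho> (lie y z) (u i) : ?S"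
  proof -
   have "\<rho> (lie y z) (u i) - \<theta> (lie y z) *\<^sub>C u i : ?S"
    using Suc.IH[OF K[OF Suc.prems]] mono by(rule subsetD[rotated])
   moreover have "\<theta> (lie y z) *\<^sub>C u i : ?S" by(intro clin.span_scale clin.span_base) simp
   ultimately show ?thesis using clin.span_add by fastforce
  qed
  moreover have "\<rho> y (u (Suc i)) - \<theta> y *\<^sub>C u (Suc i) = \<rho> z ?s + \<rho> (lie y z) (u i)"
   using comm[OF Suc.prems uE, of i] assms(1)[of z]
   by(simp add: uS clinear_diff clinear_scale)
  ultimately show ?case by(simp add: clin.span_add)
 qed
 define f where "f = inv_into {..<m} u"
 have fu: "f (u i) = i" if "i < m" for i using that inj by(simp add: f_def inv_into_f_f)
 have low: "{b':B. f b' < i} = u ` {..<i}" if "i < m" for i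
  using that fu by(auto simp: B_def)
 have xz: "lie x z : K" using K x by simp
 have "trace B (\<rho> (lie x z)) = sum (%_. \<theta> (lie x z)) B"
 proof (rule trace_triangular[OF B, of _ _ f])
  fix b assume "b : B"
  then obtain i where i: "i < m" "b = u i" by(auto simp: B_def)
  show "\<rho> (lie x z) b - \<theta> (lie x z) *\<^sub>C b : clin.span {b':B. f b' < f b}"
   using tri[OF xz, of i] by(simp add: i fu low)
 qed
 hence 1: "trace B (\<rho> (lie x z)) = of_nat m * \<theta> (lie x z)"
  using inj by(simp add: B_def card_image)
 have zB: "\<rho> z b : clin.span B" if "b : B" for b
  using that uB by(auto simp: B_def uS[symmetric] simp del: uS)
 have xB: "\<rho> x b : clin.span B" if b: "b : B" for b
 proof -
  obtain i where i: "i < m" "b = u i" using b by(auto simp: B_def)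
  have "clin.span (u ` {..<i}) <= clin.span B" unfolding B_def using i by(intro clin.span_mono) auto
  hence "\<rho> x b - \<theta> x *\<^sub>C b : clin.span B" using tri[OF x, of i] i(2) by(metis subsetD)
  moreover have "\<theta> x *\<^sub>C b : clin.span B" using b by(intro clin.span_scale clin.span_base)
  ultimately show ?thesis using clin.span_add by fastforce
 qed
 have lin: "clinear (\<rho> x)" "clinear (\<rho> z)" using assms(1) x by auto
 have BE: "b : E" if "b : B" for b using that uE by(auto simp: B_def)
 have stab: "\<rho> x v : clin.span B & \<rho> z v : clin.span B" if "v : clin.span B" for v
  using clinear_span_subset[OF lin(1) xB clin.subspace_span that]
   clinear_span_subset[OF lin(2) zB clin.subspace_span that] by simp
 have "trace B (\<rho> (lie x z)) = trace B (%v. \<rho> x (\<rho> z v) - \<rho> z (\<rho> x v))"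
  by(rule trace_cong) (simp add: comm x BE)
 also have "... = trace B (%v. \<rho> x (\<rho> z v)) - trace B (%v. \<rho> z (\<rho> x v))"
  by(rule trace_diff[OF B(2)]) (use stab clin.span_base in blast)+
 also have "... = 0" using trace_comm[OF B lin xB zB] by simp
 finally show ?thesis using 1 m0 by simp
qed

text \<open>Stated for a representation \<open>\<rho>\<close> on \<open>E\<close> and not just for
  \<open>lie\<close>, because it is applied to the action induced on a complement that models a
  quotient.\<close>

lemma lie_theorem:
 fixes \<rho> :: "'g::fin_dim_complex_lie_algebra => 'g => 'g"
 assumes "subalgebra L" "derived_series L n = {0}" "clin.subspace E" "E ~= {0}"
  "!!x. x : L ==> clinear (\<rho> x)" "!!x v. x : L ==> v : E ==> \<rho> x v : E"
  "!!x y v. x : L ==> y : L ==> v : E ==> \<rho> (x + y) v = \<rho> x v + \<rho> y v"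
  "!!c x v. x : L ==> v : E ==> \<rho> (c *\<^sub>C x) v = c *\<^sub>C \<rho> x v"
  "!!x y v. x : L ==> y : L ==> v : E ==> \<rho> (lie x y) v = \<rho> x (\<rho> y v) - \<rho> y (\<rho> x v)"
 shows "EX v:E. v ~= 0 & (ALL x:L. EX c. \<rho> x v = c *\<^sub>C v)"
 using assms(1,2,5-9)
proof (induction "clin.dim L" arbitrary: L rule: less_induct)
 case less
 note L = less.prems
 have Lsub: "clin.subspace L" using L(1) by(rule subalgebra_subspace)
 show ?case
 proof (cases "L = {0}")
  case True
  obtain v where "v : E" "v ~= 0" using assms(3,4) clin.subspace_0 by blast
  moreover have "\<rho> 0 v = 0 *\<^sub>C v" using L(6)[of 0 v 0] True \<open>v : E\<close> by simp
  ultimately show ?thesis using True by blast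
 next
  case False
  let ?D = "brackets L L"
  have DL: "?D <= L" using L(1) by(intro brackets_subset Lsub subalgebra_lie)
  have "?D ~= L"
  proof
   assume "?D = L"
   hence "derived_series L j = L" for j by(induction j) auto
   thus False using False L(2) by simp
  qed
  obtain B0 where B0: "B0 <= ?D" "clin.independent B0" "?D <= clin.span B0"
   using clin.maximal_independent_subset by metis
  have "B0 <= L" using B0(1) DL by(rule subset_trans)
  then obtain B where B: "B0 <= B" "B <= L" "clin.independent B" "L <= clin.span B"
   by(rule clin.maximal_independent_subset_extend[OF _ B0(2)])
  have spB: "clin.span B = L" using B(2,4) Lsub by(rule clin.span_subspace)
  have spB0: "clin.span B0 = ?D" using B0(1,3) brackets_subspace by(rule clin.span_subspace)
  have "B ~= B0" using spB spB0 \<open>?D ~= L\<close> by auto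
  then obtain z where z: "z : B" "z \<notin> B0" using B(1) by blast
  \<comment> \<open>A hyperplane of \<open>L\<close> that contains [L, L], hence an ideal of
    codimension one.\<close>
  define K where "K = clin.span (B - {z})"
  have zK: "z \<notin> K" using B(3) z(1) unfolding K_def clin.dependent_def by blast
  have KL: "K <= L" unfolding K_def spB[symmetric] by(rule clin.span_mono) blast
  have DK: "?D <= K" unfolding K_def spB0[symmetric] by(rule clin.span_mono) (use B(1) z in blast)
  have zL: "z : L" using z(1) B(2) by blast
  have Ksub: "clin.subspace K" unfolding K_def by(rule clin.subspace_span)
  have Kalg: "subalgebra K"
   unfolding subalgebra_def using Ksub DK KL bracket_mem[of _ L _ L] by blast
  have "clin.span K \<subset> clin.span L"
   using KL zK zL Ksub Lsub by(metis clin.span_eq_iff psubsetI)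
  hence dim: "clin.dim K < clin.dim L" by(rule cfin.dim_psubset)
  have "0 : derived_series K n"
   by(cases n) (simp_all add: clin.subspace_0[OF Ksub] clin.subspace_0[OF brackets_subspace])
  moreover have "derived_series K n <= {0}" using derived_series_mono[OF KL, of n] L(2) by simp
  ultimately have der: "derived_series K n = {0}" by blast
  have "EX v:E. v ~= 0 & (ALL x:K. EX c. \<rho> x v = c *\<^sub>C v)"
   by(rule less.hyps[OF dim Kalg der]) (use L(3-7) subsetD[OF KL] in simp_all)
  then obtain v \<theta> where v: "v : E" "v ~= 0" "!!x. x : K ==> \<rho> x v = \<theta> x *\<^sub>C v" by metis
  \<comment> \<open>The joint eigenspace of \<open>K\<close> for \<theta>. It is stable under
    \<open>z\<close> because \<theta> vanishes on [K, z], so an eigenvector of \<open>z\<close> in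
    it is a common eigenvector of \<open>L\<close>.\<close>
  define W where "W = {w:E. ALL x:K. \<rho> x w = \<theta> x *\<^sub>C w}"
  have Wsub: "clin.subspace W"
   unfolding W_def using assms(3) L(3) KL
   by(intro clin.subspaceI)
    (auto simp: clin.subspace_0 clin.subspace_add clin.subspace_scale clinear_zero clinear_add
     clinear_scale subset_iff clin.scale_right_distrib mult.commute)
  have KD: "lie y z : K" if "y : K" for y
   using that DK KL zL bracket_mem[of y L z L] by blast
  have W0: "\<theta> (lie x z) = 0" if "x : K" for x
   by(rule lie_invariance[of z K \<rho> E v \<theta>]) (use L zL KL KD v that in \<open>auto simp: subset_iff\<close>)
  have "\<rho> z w : W" if w: "w : W" for w
  proof -
   have "\<rho> x (\<rho> z w) = \<theta> x *\<^sub>C \<rho> z w" if x: "x : K" for x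
   proof -
    have "\<rho> (lie x z) w = 0" using w KD[OF x] W0[OF x] by(simp add: W_def)
    moreover have "\<rho> (lie x z) w = \<rho> x (\<rho> z w) - \<rho> z (\<rho> x w)"
     using L(7)[of x z w] w x KL zL by(auto simp: W_def)
    moreover have "\<rho> z (\<rho> x w) = \<theta> x *\<^sub>C \<rho> z w"
     using w x L(3)[OF zL] by(simp add: W_def clinear_scale)
    ultimately show ?thesis by simp
   qed
   thus ?thesis using w L(4)[OF zL] by(simp add: W_def)
  qed
  moreover have "W ~= {0}" using v by(auto simp: W_def)
  ultimately obtain w c where w: "w : W" "w ~= 0" "\<rho> z w = c *\<^sub>C w"
   using exists_eigenvector[OF L(3)[OF zL] Wsub] by blast
  have "EX c. \<rho> x w = c *\<^sub>C w" if x: "x : L" for x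
  proof -
   have "x : clin.span (insert z (B - {z}))" using x spB z(1) by(simp add: insert_absorb)
   then obtain a where a: "x - a *\<^sub>C z : K"
    unfolding clin.span_breakdown_eq K_def by blast
   have E: "w : E" using w(1) by(simp add: W_def)
   have "\<rho> x w = \<rho> ((x - a *\<^sub>C z) + a *\<^sub>C z) w" by simp
   also have "... = \<rho> (x - a *\<^sub>C z) w + \<rho> (a *\<^sub>C z) w"
    using a KL zL E Lsub by(intro L(5)) (auto simp: clin.subspace_scale)
   also have "... = (\<theta> (x - a *\<^sub>C z) + a * c) *\<^sub>C w"
    using a w zL E L(6) by(simp add: W_def clin.scale_left_distrib)
   finally show ?thesis by blast
  qed
  thus ?thesis using w by(auto simp: W_def)
 qed
qed

text \<open>Lie's theorem in V/W. As \<open>W\<close> is stable, projecting to the complement after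
  each bracket agrees with projecting once at the end (\<open>key\<close>), so the projected
  brackets form a representation on the complement.\<close>

lemma lie_theorem_mod:
 fixes L :: "'g::fin_dim_complex_lie_algebra set"
 assumes "solvable_subalgebra L" "clin.subspace W" "clin.subspace V" "W \<subset> V"
  "ad_stable L W" "ad_stable L V"
 shows "EX v:V - W. ALL x:L. EX c. lie x v - c *\<^sub>C v : W"
proof -
 obtain \<pi> E where \<pi>: "clinear \<pi>" "clin.subspace E" "E <= V" "!!v. v : V ==> \<pi> v : E"
  "!!v. v : V ==> v - \<pi> v : W" "!!w. w : W ==> \<pi> w = 0" "!!e. e : E ==> \<pi> e = e"
  using exists_projection[OF assms(2,3)] assms(4) by blast
 obtain v0 where v0: "v0 : V" "v0 \<notin> W" using assms(4) by blast
 have "\<pi> v0 ~= 0" using \<pi>(5)[OF v0(1)] v0(2) by auto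
 hence E0: "E ~= {0}" using \<pi>(4)[OF v0(1)] by blast
 obtain n where n: "derived_series L n = {0}" "subalgebra L"
  using assms(1) by(auto simp: solvable_subalgebra_def)
 have stW: "lie x w : W" if "x : L" "w : W" for x w
  using that assms(5) by(simp add: ad_stable_def)
 have stV: "lie x w : V" if "x : L" "w : V" for x w
  using that assms(6) by(simp add: ad_stable_def)
 have key: "\<pi> (lie x (\<pi> (lie y v))) = \<pi> (lie x (lie y v))" if "x : L" "y : L" "v : E" for x y v
 proof -
  have "lie y v : V" using that \<pi>(3) stV by blast
  hence "lie x (lie y v - \<pi> (lie y v)) : W" using \<pi>(5) stW that(1) by blast
  hence "\<pi> (lie x (lie y v) - lie x (\<pi> (lie y v))) = 0"
   using \<pi>(6) by(simp add: lie_diff_right)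
  thus ?thesis by(simp add: clinear_diff[OF \<pi>(1)])
 qed
 have "EX v:E. v ~= 0 & (ALL x:L. EX c. \<pi> (lie x v) = c *\<^sub>C v)"
 proof (rule lie_theorem[OF n(2,1) \<pi>(2) E0])
  show "clinear (%v. \<pi> (lie x v))" for x using \<pi>(1) clinear_lie by(rule clinear_compose)
  show "\<pi> (lie x v) : E" if "x : L" "v : E" for x v using that \<pi>(3,4) stV by blast
  show "\<pi> (lie (lie x y) v) = \<pi> (lie x (\<pi> (lie y v))) - \<pi> (lie y (\<pi> (lie x v)))"
   if "x : L" "y : L" "v : E" for x y v
   using that key by(simp add: lie_lie clinear_diff[OF \<pi>(1)])
 qed (simp_all add: lie_simps clinear_add[OF \<pi>(1)] clinear_scale[OF \<pi>(1)])
 then obtain v where v: "v : E" "v ~= 0" "ALL x:L. EX c. \<pi> (lie x v) = c *\<^sub>C v" by blast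
 have "v \<notin> W" using v(1,2) \<pi>(6,7) by metis
 moreover have "EX c. lie x v - c *\<^sub>C v : W" if "x : L" for x
  using \<pi>(5)[of "lie x v"] v that \<pi>(3) stV by fastforce
 ultimately show ?thesis using v(1) \<pi>(3) by blast
qed

text \<open>A stable subspace W on which [b, b] acts nilpotently is enlarged by a common eigenvector
  of b in the quotient by W. Commutators act on it by 0, so [b, b] maps the new vector into W, and
  the bound on the length of products grows by one.\<close>

lemma nilradical_acts_nilpotently:
 fixes b :: "'g::fin_dim_complex_lie_algebra set"
 assumes "solvable_subalgebra b"
 shows "EX M. ALL xs v. set xs <= brackets b b --> M <= length xs --> foldr lie xs v = 0"
proof -
 let ?n = "brackets b b"
 let ?P = "%W. clin.subspace W & ad_stable b W &
  (EX M. ALL v:W. ALL xs. set xs <= ?n --> length xs = M --> foldr lie xs v = 0)"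
 have "EX W. ?P W & d <= clin.dim W" if "d <= clin.dim (UNIV :: 'g set)" for d
  using that
 proof (induction d)
  case 0
  have "foldr lie xs 0 = (0::'g)" for xs by(induction xs) auto
  hence "?P {0}" by(auto simp: ad_stable_def)
  thus ?case by blast
 next
  case (Suc d)
  then obtain W where W: "?P W" "d <= clin.dim W" by(meson Suc_leD)
  show ?case
  proof (cases "W = UNIV")
   case True
   thus ?thesis using W(1) Suc.prems by blast
  next
   case False
   hence "W \<subset> UNIV" by blast
   then obtain v where v: "v \<notin> W" "!!x. x : b ==> EX c. lie x v - c *\<^sub>C v : W"
    using lie_theorem_mod[OF assms, of W UNIV] W(1) by(auto simp: ad_stable_def)
   let ?W' = "clin.span (insert v W)"
   have Wsub: "clin.subspace W" and Wst: "!!x w. x : b ==> w : W ==> lie x w : W"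
    using W(1) by(auto simp: ad_stable_def)
   have W': "EX a. u - a *\<^sub>C v : W" if "u : ?W'" for u
    using that Wsub unfolding clin.span_breakdown_eq by(simp only: clin.span_eq_iff[THEN iffD2])
   have WW': "W <= ?W'" by(rule order_trans[OF _ clin.span_superset]) blast
   have nv: "lie x v : W" if "x : ?n" for x
    unfolding brackets_def
   proof (rule clinear_span_subset[OF clinear_lie_left _ Wsub that[unfolded brackets_def]])
    fix t assume "t : {lie x y |x y. x : b & y : b}"
    then obtain x y where xy: "t = lie x y" "x : b" "y : b" by blast
    obtain c where c: "lie x v - c *\<^sub>C v : W" using v(2) xy by blast
    obtain d where d: "lie y v - d *\<^sub>C v : W" using v(2) xy by blast
    have "lie t v = lie x (lie y v - d *\<^sub>C v) - lie y (lie x v - c *\<^sub>C v)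
      + (d *\<^sub>C (lie x v - c *\<^sub>C v) - c *\<^sub>C (lie y v - d *\<^sub>C v))"
     by(simp add: xy lie_lie lie_diff_right lie_simps clin.scale_right_diff_distrib mult.commute)
    thus "lie t v : W"
     using c d xy Wst Wsub by(simp add: clin.subspace_add clin.subspace_diff clin.subspace_scale)
   qed
   have nb: "?n <= b"
    using assms by(intro brackets_subset) (auto simp: solvable_subalgebra_def subalgebra_def)
   have nW': "lie x u : W" if x: "x : ?n" and u: "u : ?W'" for x u
   proof -
    obtain a where a: "u - a *\<^sub>C v : W" using W'[OF u] by blast
    have "lie x u = lie x (u - a *\<^sub>C v) + a *\<^sub>C lie x v" by(simp add: lie_diff_right lie_simps)
    thus ?thesis
     using a nv[OF x] Wst x nb Wsub by(auto simp: clin.subspace_add clin.subspace_scale)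
   qed
   obtain M where M: "ALL v:W. ALL xs. set xs <= ?n --> length xs = M --> foldr lie xs v = 0"
    using W(1) by blast
   have "foldr lie xs u = 0" if u: "u : ?W'" "set xs <= ?n" "length xs = Suc M" for xs u
   proof -
    obtain ys x where xs: "xs = ys @ [x]" using u(3) by(metis length_Suc_conv_rev)
    thus ?thesis using nW'[of x u] u M by simp
   qed
   moreover have "ad_stable b ?W'"
    unfolding ad_stable_def
   proof (intro ballI)
    fix x u assume x: "x : b" and u: "u : ?W'"
    obtain a where a: "u - a *\<^sub>C v : W" using W'[OF u] by blast
    obtain c where c: "lie x v - c *\<^sub>C v : W" using v(2)[OF x] by blast
    have "lie x u - (a * c) *\<^sub>C v = lie x (u - a *\<^sub>C v) + a *\<^sub>C (lie x v - c *\<^sub>C v)"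
     by(simp add: lie_diff_right lie_simps clin.scale_right_diff_distrib)
    hence "lie x u - (a * c) *\<^sub>C v : W"
     using a c Wst[OF x] Wsub by(simp add: clin.subspace_add clin.subspace_scale)
    thus "lie x u : ?W'"
     unfolding clin.span_breakdown_eq using clin.span_base by blast
   qed
   moreover have "Suc d <= clin.dim ?W'"
    using W(2) v(1) Wsub by(simp add: cfin.dim_insert clin.dim_span clin.span_eq_iff[THEN iffD2])
   ultimately show ?thesis by(intro exI[of _ ?W'] conjI) (blast intro: clin.subspace_span)+
  qed
 qed
 from this[OF order_refl] obtain W where W: "?P W" "clin.dim (UNIV :: 'g set) <= clin.dim W" by blast
 hence "clin.span W = UNIV"
  using cfin.dim_eq_full cfin.dim_subset_UNIV by(metis cfin.dim_UNIV cfin.dimension_def le_antisym)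
 hence "W = UNIV" using W(1) by(metis clin.span_eq_iff)
 then obtain M where M: "!!v xs. set xs <= ?n ==> length xs = M ==> foldr lie xs v = 0"
  using W(1) by blast
 have "foldr lie xs v = 0" if "set xs <= ?n" "M <= length xs" for xs v
 proof -
  let ?k = "length xs - M"
  have "foldr lie (drop ?k xs) v = 0"
   using that set_drop_subset[of ?k xs] by(intro M) auto
  moreover have "foldr lie ys 0 = (0::'g)" for ys by(induction ys) auto
  ultimately show ?thesis by(metis append_take_drop_id foldr_append comp_apply)
 qed
 thus ?thesis by blast
qed

subsection \<open>Derivations attached to the spectrum of an inner derivation\<close>

text \<open>By the Leibniz rule, ad z - (c + d) applied to [v, w] is a sum of two brackets, in each
  of which one of the two nilpotency orders has dropped. The induction is on their sum.\<close>

lemma geig_lie: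
 assumes "v : geig (lie z) c" "w : geig (lie z) d"
 shows "lie v w : geig (lie z) (c + d)"
proof -
 have "(shift (lie z) (c + d) ^^ (n + m)) (lie v w) = 0"
  if "(shift (lie z) c ^^ n) v = 0" "(shift (lie z) d ^^ m) w = 0" for n m v w
  using that
 proof (induction "n + m" arbitrary: n m v w rule: less_induct)
  case less
  note lin = clinear_funpow[OF clinear_shift[OF clinear_lie]]
  show ?case
  proof (cases "n = 0 \<or> m = 0")
   case True
   hence "lie v w = 0" using less.prems by auto
   thus ?thesis using clinear_zero[OF lin] by simp
  next
   case False
   then obtain n' m' where nm: "n = Suc n'" "m = Suc m'" by(meson not0_implies_Suc)
   have "shift (lie z) (c + d) (lie v w)
     = lie (shift (lie z) c v) w + lie v (shift (lie z) d w)"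
    by(simp add: shift_def lie_deriv[of z] lie_diff_left lie_diff_right lie_simps clin.scale_left_distrib)
   moreover have "(shift (lie z) (c + d) ^^ (n' + m)) (lie (shift (lie z) c v) w) = 0"
    using less.prems nm by(intro less.hyps) (simp_all add: funpow_swap1)
   moreover have "(shift (lie z) (c + d) ^^ (n + m')) (lie v (shift (lie z) d w)) = 0"
    using less.prems nm by(intro less.hyps) (simp_all add: funpow_swap1)
   moreover have "n + m = Suc (n' + m)" "n' + m = n + m'" using nm by simp_all
   ultimately show ?thesis
    by(simp add: funpow_Suc_right clinear_add[OF lin] del: funpow.simps)
  qed
 qed
 thus ?thesis using assms unfolding geig_def by blast
qed

lemma spectral_operator_stable:
 assumes "clinear T" "clinear y" "ALL d. ALL v:geig T d. y v = \<phi> d *\<^sub>C v"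
  "clin.subspace W" "!!v. v : W ==> T v : W" "v : W"
 shows "y v : W"
proof -
 obtain C f where Cf: "finite C" "ALL c:C. f c : geig T c \<inter> W" "v = (\<Sum>c\<in>C. f c)"
  using geig_decomposition[OF assms(1,4,5,6)] by blast
 have "y (f c) = \<phi> c *\<^sub>C f c" if "c : C" for c using Cf(2) assms(3) that by blast
 hence "y v = (\<Sum>c\<in>C. \<phi> c *\<^sub>C f c)"
  by(simp add: clinear_sum[OF assms(2)] Cf(3))
 also have "... : W"
  by(rule clin.subspace_sum[OF assms(4)]) (use Cf assms(4) in \<open>auto intro: clin.subspace_scale\<close>)
 finally show ?thesis .
qed

text \<open>Brackets add eigenvalues, so acting by an additive function of the eigenvalue is a
  derivation. Only additivity is asked of \<open>\<phi>\<close>, which admits complex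
  conjugation.\<close>

lemma spectral_operator_derivation:
 assumes "clinear y" "ALL d. ALL v:geig (lie z) d. y v = \<phi> d *\<^sub>C v"
  and \<phi>: "!!c d. \<phi> (c + d) = \<phi> c + \<phi> d"
 shows "y (lie v w) = lie (y v) w + lie v (y w)"
proof -
 obtain C f where C: "finite C" "ALL c:C. f c : geig (lie z) c" "v = (\<Sum>c\<in>C. f c)"
  using geig_decomposition[OF clinear_lie clin.subspace_UNIV] by(metis Int_UNIV_right UNIV_I)
 obtain D g where D: "finite D" "ALL d:D. g d : geig (lie z) d" "w = (\<Sum>d\<in>D. g d)"
  using geig_decomposition[OF clinear_lie clin.subspace_UNIV] by(metis Int_UNIV_right UNIV_I)
 have "y (lie (f c) (g d)) = lie (y (f c)) (g d) + lie (f c) (y (g d))" if "c : C" "d : D" for c d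
 proof -
  have "y (lie (f c) (g d)) = \<phi> (c + d) *\<^sub>C lie (f c) (g d)"
   using geig_lie[of "f c" z c "g d" d] assms(2) C(2) D(2) that by blast
  moreover have "y (f c) = \<phi> c *\<^sub>C f c" "y (g d) = \<phi> d *\<^sub>C g d"
   using assms(2) C(2) D(2) that by blast+
  ultimately show ?thesis by(simp add: \<phi> lie_simps clin.scale_left_distrib)
 qed
 thus ?thesis
  by(simp add: C(3) D(3) lie_sum_left lie_sum_right clinear_sum[OF assms(1)] sum.distrib)
qed

subsection \<open>The trace form\<close>

text \<open>The Killing form of the whole algebra g; on \<open>k\<close> it is the trace form of the
  representation of \<open>k\<close> on g.\<close>

definition trform :: "'g::fin_dim_complex_lie_algebra => 'g => complex" where
 "trform u v = tr (%w. lie u (lie v w))"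

lemma trform_comm: "trform u v = trform v u"
 unfolding trform_def by(rule tr_comm[OF clinear_lie clinear_lie])

lemma trform_lie: "trform (lie u z) w = trform z (lie w u)"
proof -
 have "trform (lie u z) w = tr (%v. lie u (lie z (lie w v))) - tr (%v. lie z (lie u (lie w v)))"
  unfolding trform_def by(simp add: lie_lie tr_diff)
 also have "tr (%v. lie u (lie z (lie w v))) = tr (%v. lie z (lie w (lie u v)))"
  by(rule tr_comm[OF clinear_lie clinear_compose[OF clinear_lie clinear_lie]])
 finally show ?thesis unfolding trform_def by(simp add: lie_lie lie_diff_right tr_diff)
qed

lemma trform_simps:
 "trform (u + u') v = trform u v + trform u' v" "trform u (v + v') = trform u v + trform u v'"
 "trform (c *\<^sub>C u) v = c * trform u v" "trform u (c *\<^sub>C v) = c * trform u v"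
 "trform 0 v = 0" "trform u 0 = 0"
proof -
 have *: "trform (u + u') v = trform u v + trform u' v" "trform (c *\<^sub>C u) v = c * trform u v"
  "trform 0 v = 0" for u u' v c
  using tr_scale[of 0 "%w. w"] by(simp_all add: trform_def lie_simps tr_add tr_scale)
 thus "trform (u + u') v = trform u v + trform u' v" "trform u (v + v') = trform u v + trform u v'"
  "trform (c *\<^sub>C u) v = c * trform u v" "trform u (c *\<^sub>C v) = c * trform u v"
  "trform 0 v = 0" "trform u 0 = 0"
  by(simp_all add: * trform_comm[of u])
qed

lemma uniformly_nilpotent:
 fixes T :: "'g::fin_dim_complex_lie_algebra => 'g"
 assumes "clinear T" "!!v. EX n. (T ^^ n) v = 0"
 shows "EX n. ALL v. (T ^^ n) v = 0"
proof -
 obtain N where N: "!!v. (T ^^ N v) v = 0" using assms(2) by metis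
 define n where "n = (\<Sum>b\<in>(cbasis :: 'g set). N b)"
 have "(T ^^ n) b = 0" if "b : (cbasis :: 'g set)" for b
 proof -
  have "N b <= n" unfolding n_def using that by(intro member_le_sum) (auto simp: cbasis)
  then obtain m where "n = m + N b" by(metis le_Suc_ex add.commute)
  thus ?thesis using N by(simp add: funpow_add clinear_zero clinear_funpow assms(1))
 qed
 hence "(T ^^ n) v = 0" for v
  using clinear_span_subset[OF clinear_funpow[OF assms(1), of n], of cbasis "{0}" v]
  by(simp add: cbasis)
 thus ?thesis by blast
qed

text \<open>A derivation of a subalgebra \<open>n\<close> acting nilpotently preserves the filtration by the
 vectors annihilated by \<open>m\<close>-fold products from \<open>n\<close>, and \<open>lie c\<close> lowers it.\<close>

lemma tr_derivation_nilradical: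
 fixes D :: "'g::fin_dim_complex_lie_algebra => 'g"
 assumes "clinear D" "!!v w. D (lie v w) = lie (D v) w + lie v (D w)" "!!c. c : n ==> D c : n"
  and M: "!!xs v. set xs <= n ==> M <= length xs ==> foldr lie xs v = (0::'g)" and c: "c : n"
 shows "tr (%v. D (lie c v)) = 0"
proof -
 define U where "U m = {w. ALL xs. set xs <= n --> length xs = m --> foldr lie xs w = (0::'g)}" for m
 have lin: "clinear (foldr lie xs)" for xs :: "'g list"
  by(induction xs) (auto simp: clinear_iff lie_simps)
 have USuc: "w : U (Suc m) \<longleftrightarrow> (ALL c:n. lie c w : U m)" for w m
 proof
  assume w: "w : U (Suc m)"
  show "ALL c:n. lie c w : U m"
  proof
   fix c assume "c : n"
   hence "foldr lie (xs @ [c]) w = 0" if "set xs <= n" "length xs = m" for xs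
    by(intro w[unfolded U_def mem_Collect_eq, rule_format]) (use that in simp_all)
   thus "lie c w : U m" by(simp add: U_def)
  qed
 next
  assume *: "ALL c:n. lie c w : U m"
  have "foldr lie xs w = 0" if xs: "set xs <= n" "length xs = Suc m" for xs
  proof -
   obtain ys x where "xs = ys @ [x]" using xs(2) by(metis length_Suc_conv_rev)
   thus ?thesis using * xs by(simp add: U_def)
  qed
  thus "w : U (Suc m)" by(simp add: U_def)
 qed
 have DU: "D w : U m" if "w : U m" for w m
  using that
 proof (induction m arbitrary: w)
  case 0
  thus ?case by(simp add: U_def clinear_zero[OF assms(1)])
 next
  case (Suc m)
  have "lie c (D w) : U m" if c: "c : n" for c
  proof -
   have eq: "lie c (D w) = D (lie c w) - lie (D c) w" by(simp add: assms(2))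
   have "D (lie c w) : U m" "lie (D c) w : U m" using Suc USuc c assms(3) by blast+
   thus ?thesis unfolding eq by(simp add: U_def clinear_diff[OF lin])
  qed
  thus ?case using USuc by blast
 qed
 let ?T = "%v. D (lie c v)"
 have T: "clinear ?T" using assms(1) clinear_lie by(rule clinear_compose)
 have "(?T ^^ j) v : U (M - j)" if "j <= M" for j v
  using that
 proof (induction j)
  case 0
  thus ?case using M by(simp add: U_def)
 next
  case (Suc j)
  hence "(?T ^^ j) v : U (Suc (M - Suc j))" by(simp add: Suc_diff_Suc)
  thus ?case using USuc DU c by simp
 qed
 from this[of M] have "(?T ^^ M) v = 0" for v by(simp add: U_def)
 thus ?thesis by(rule tr_nilpotent[OF T])
qed

section \<open>Structure of the reductive pair\<close>

locale reductive_pair =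
 fixes k nm h np :: "'g::fin_dim_complex_lie_algebra set"
 assumes reductive: "reductive_subalgebra k"
  and semisimple: "ad_semisimple k UNIV"
  and triangular: "triangular_decomposition k nm h np"
begin

lemma k_subspace: "clin.subspace k"
 and k_lie: "x : k ==> y : k ==> lie x y : k"
 using reductive by(auto simp: reductive_subalgebra_def subalgebra_def)

lemma triangular_parts:
 obtains bm bp where "solvable_subalgebra bm" "solvable_subalgebra bp" "bm <= k" "bp <= k"
  "bm \<inter> bp = h" "nm = brackets bm bm" "np = brackets bp bp"
 using triangular unfolding triangular_decomposition_def borel_subalgebra_def by metis

lemma h_cartan: "cartan_subalgebra k h"
 using triangular unfolding triangular_decomposition_def by blast

lemma h_subspace: "clin.subspace h" and h_subset_k: "h <= k"
 and h_self_normalizing: "x : k ==> (!!y. y : h ==> lie x y : h) ==> x : h"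
 using h_cartan by(auto simp: cartan_subalgebra_def subalgebra_def)

lemma solvable_lie: "solvable_subalgebra b ==> x : b ==> y : b ==> lie x y : b"
 by(simp add: solvable_subalgebra_def subalgebra_def)

lemma solvable_brackets: "solvable_subalgebra b ==> brackets b b <= b"
 by(intro brackets_subset solvable_lie) (auto simp: solvable_subalgebra_def subalgebra_def)

lemma n_facts:
 shows nm_subspace: "clin.subspace nm" and np_subspace: "clin.subspace np"
  and nm_subset_k: "nm <= k" and np_subset_k: "np <= k"
  and h_nm: "x : h ==> f : nm ==> lie x f : nm" and h_np: "x : h ==> e : np ==> lie x e : np"
  and nm_lie: "f : nm ==> f' : nm ==> lie f f' : nm"
  and np_lie: "e : np ==> e' : np ==> lie e e' : np"
  and hh_nm: "x : h ==> x' : h ==> lie x x' : nm" and hh_np: "x : h ==> x' : h ==> lie x x' : np"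
  and nm_nilpotent: "EX M. ALL xs v. set xs <= nm --> M <= length xs --> foldr lie xs v = 0"
  and np_nilpotent: "EX M. ALL xs v. set xs <= np --> M <= length xs --> foldr lie xs v = 0"
proof -
 obtain bm bp where b: "solvable_subalgebra bm" "solvable_subalgebra bp" "bm <= k" "bp <= k"
  "bm \<inter> bp = h" "nm = brackets bm bm" "np = brackets bp bp"
  by(rule triangular_parts)
 have hb: "h <= bm" "h <= bp" using b(5) by auto
 have nb: "nm <= bm" "np <= bp" using b solvable_brackets by auto
 show "clin.subspace nm" "clin.subspace np" by(simp_all add: b brackets_subspace)
 show "nm <= k" "np <= k" using nb b(3,4) by auto
 show "x : h ==> f : nm ==> lie x f : nm" "f : nm ==> f' : nm ==> lie f f' : nm"
  "x : h ==> x' : h ==> lie x x' : nm" for x x' f f'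
  unfolding b(6) using bracket_mem[of _ bm _ bm] hb(1) nb(1)[unfolded b(6)] by blast+
 show "x : h ==> f : np ==> lie x f : np" "f : np ==> f' : np ==> lie f f' : np"
  "x : h ==> x' : h ==> lie x x' : np" for x x' f f'
  unfolding b(7) using bracket_mem[of _ bp _ bp] hb(2) nb(2)[unfolded b(7)] by blast+
 show "EX M. ALL xs v. set xs <= nm --> M <= length xs --> foldr lie xs v = 0"
  unfolding b(6) by(rule nilradical_acts_nilpotently[OF b(1)])
 show "EX M. ALL xs v. set xs <= np --> M <= length xs --> foldr lie xs v = 0"
  unfolding b(7) by(rule nilradical_acts_nilpotently[OF b(2)])
qed

lemma triangular_bij: "bij_betw (%(x, y, z). x + y + z) (nm \<times> h \<times> np) k"
 using triangular by(simp add: triangular_decomposition_def)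

lemma triangular_decompose:
 assumes "x : k" obtains a b c where "a : nm" "b : h" "c : np" "x = a + b + c"
 using triangular_bij assms unfolding bij_betw_def by force

lemma triangular_unique:
 assumes "a : nm" "b : h" "c : np" "a' : nm" "b' : h" "c' : np" "a + b + c = a' + b' + c'"
 shows "a = a' & b = b' & c = c'"
 using inj_onD[OF bij_betw_imp_inj_on[OF triangular_bij], of "(a, b, c)" "(a', b', c')"] assms by simp

lemma nm_np_disjoint: "x : nm ==> x : np ==> x = 0"
 using triangular_unique[of x 0 0 0 0 x] nm_subspace np_subspace h_subspace
 by(simp add: clin.subspace_0)

lemma h_np_disjoint: "x : h ==> x : np ==> x = 0"
 using triangular_unique[of 0 x 0 0 0 x] nm_subspace np_subspace h_subspace
 by(simp add: clin.subspace_0)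

lemma h_nm_disjoint: "x : h ==> x : nm ==> x = 0"
 using triangular_unique[of 0 x 0 x 0 0] nm_subspace np_subspace h_subspace
 by(simp add: clin.subspace_0)

text \<open>\<open>h\<close> lies in both Borel subalgebras, so its brackets lie in both of their
  derived subalgebras, which meet in 0.\<close>

lemma h_abelian: "x : h ==> y : h ==> lie x y = 0"
 by(intro nm_np_disjoint hh_nm hh_np)

section \<open>Ideals of k, Cartan's criterion and diagonalizability of h\<close>

lemma ideal_complement:
 assumes "clin.subspace I" "I <= k" "ad_stable k I"
 obtains I' where "clin.subspace I'" "I' <= k" "!!u v. u : k ==> v : I' ==> lie u v : I'"
  "I \<inter> I' = {0}" "!!u. u : k ==> EX i:I. EX i':I'. u = i + i'"
  "!!i i'. i : I ==> i' : I' ==> lie i i' = 0"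
proof -
 obtain I' where I': "clin.subspace I'" "ad_stable k I'" "I \<inter> I' = {0}"
   "{w + w' | w w'. w : I & w' : I'} = k"
  using reductive assms unfolding reductive_subalgebra_def ad_semisimple_def complementary_def
  by meson
 have sub: "I' <= k"
 proof
  fix w assume "w : I'"
  hence "0 + w : {w + w' | w w'. w : I & w' : I'}" using clin.subspace_0[OF assms(1)] by blast
  thus "w : k" using I'(4) by simp
 qed
 show thesis
 proof (rule that[OF I'(1) sub])
  show st: "lie u v : I'" if "u : k" "v : I'" for u v using I'(2) that by(simp add: ad_stable_def)
  show "I \<inter> I' = {0}" by(rule I')
  show "EX i:I. EX i':I'. u = i + i'" if "u : k" for u using I'(4) that by blast
  show "lie i i' = 0" if "i : I" "i' : I'" for i i'
  proof -
   have "lie i' i : I" using assms(3) that sub by(auto simp: ad_stable_def)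
   hence "lie i i' : I" using lie_anti[of i i'] clin.subspace_neg[OF assms(1)] by simp
   moreover have "lie i i' : I'" using st that assms(2) by blast
   ultimately show ?thesis using I'(3) by blast
  qed
 qed
qed

text \<open>k = I + I' with a complementary ideal I'. The ideal I commutes with itself, and with I'
  because [I, I'] lies in the intersection.\<close>

lemma abelian_ideal_central:
 assumes "clin.subspace I" "I <= k" "ad_stable k I" "!!x y. x : I ==> y : I ==> lie x y = 0"
  "u : k" "z : I"
 shows "lie u z = 0"
proof -
 obtain I' where I': "!!u. u : k ==> EX i:I. EX i':I'. u = i + i'"
  "!!i i'. i : I ==> i' : I' ==> lie i i' = 0"
  by(rule ideal_complement[OF assms(1-3)]) blast
 obtain i i' where "i : I" "i' : I'" "u = i + i'" using I'(1)[OF assms(5)] by blast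
 thus ?thesis using assms(4,6) I'(2) lie_anti[of i' z] by(simp add: lie_simps)
qed

text \<open>An ideal complementary to the centre contains all brackets, since central components
  contribute nothing to them, and it meets the centre in 0.\<close>

lemma central_derived_zero:
 assumes "z : k" "!!u. u : k ==> lie u z = 0" "z : brackets k k"
 shows "z = 0"
proof -
 define Z where "Z = {z:k. ALL u:k. lie u z = 0}"
 have "clin.subspace Z" unfolding Z_def
  using k_subspace by(intro clin.subspaceI)
   (auto simp: clin.subspace_0 clin.subspace_add clin.subspace_scale lie_simps)
 moreover have "Z <= k" by(auto simp: Z_def)
 moreover have "ad_stable k Z"
  by(auto simp: Z_def ad_stable_def clin.subspace_0[OF k_subspace])
 ultimately obtain Z' where Z': "clin.subspace Z'" "!!u v. u : k ==> v : Z' ==> lie u v : Z'"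
  "Z \<inter> Z' = {0}" "!!u. u : k ==> EX i:Z. EX i':Z'. u = i + i'"
  by(rule ideal_complement) blast
 have "brackets k k <= Z'"
 proof (rule brackets_subset[OF Z'(1)])
  fix u v assume u: "u : k" and v: "v : k"
  obtain i i' where "i : Z" "i' : Z'" "v = i + i'" using Z'(4)[OF v] by blast
  thus "lie u v : Z'" using u Z'(2) by(simp add: lie_simps Z_def)
 qed
 moreover have "z : Z" using assms by(simp add: Z_def)
 ultimately show ?thesis using assms(3) Z'(3) by blast
qed

definition trform_radical :: "'g set" where
 "trform_radical = {z:k. ALL w:k. trform z w = 0}"

lemma trform_radical_subspace: "clin.subspace trform_radical"
 unfolding trform_radical_def using k_subspace
 by(intro clin.subspaceI) (auto simp: clin.subspace_0 clin.subspace_add clin.subspace_scale trform_simps)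

lemma trform_radical_stable: "ad_stable k trform_radical"
 by(auto simp: ad_stable_def trform_radical_def k_lie trform_lie)

text \<open>Cartan's criterion. Let y act on the generalized eigenspaces of ad z by the conjugate
  eigenvalues. Then tr (ad z y) is a sum of squared absolute values of eigenvalues. For a bracket
  [u, w] the derivation property of y turns the trace into minus \<open>trform u (y w)\<close>,
  which is 0 because y preserves \<open>k\<close>. So all eigenvalues of ad z vanish.\<close>

lemma derived_radical_nilpotent:
 assumes z: "z : brackets trform_radical trform_radical"
 shows "EX n. (lie z ^^ n) v = 0"
proof -
 let ?J = trform_radical
 have Jk: "?J <= k" by(auto simp: trform_radical_def)
 have "brackets ?J ?J <= k" using Jk k_lie by(intro brackets_subset k_subspace) blast
 hence zk: "z : k" using z by blast
 from exists_spectral_operator[OF clinear_lie[of z], of cnj]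
 obtain B c y where B: "finite B" "clin.span B = UNIV" "ALL b:B. b : geig (lie z) (c b)"
  and y: "clinear y" "ALL d. ALL v:geig (lie z) d. y v = cnj d *\<^sub>C v"
  and trB: "tr (%v. lie z (y v)) = (\<Sum>b\<in>B. c b * cnj (c b))"
  by(elim exE conjE)
 have der: "y (lie v w) = lie (y v) w + lie v (y w)" for v w
  by(rule spectral_operator_derivation[OF y]) simp
 have yk: "y v : k" if "v : k" for v
  by(rule spectral_operator_stable[OF clinear_lie y k_subspace _ that]) (rule k_lie[OF zk])
 have "tr (%v. lie z (y v)) = 0"
  using z unfolding brackets_def
 proof (induction rule: clin.span_induct_alt)
  case base
  thus ?case using tr_scale[of 0 "%w. w"] by simp
 next
  case (step a s t)
  then obtain u w where uw: "s = lie u w" "u : ?J" "w : ?J" by blast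
  have "tr (%v. lie s (y v)) = tr (%v. lie u (lie w (y v))) - tr (%v. lie w (lie u (y v)))"
   by(simp add: uw lie_lie tr_diff)
  also have "tr (%v. lie w (lie u (y v))) = tr (%v. lie u (y (lie w v)))"
   by(rule tr_comm[OF clinear_lie clinear_compose[OF clinear_lie y(1)]])
  also have "... = tr (%v. lie u (lie (y w) v)) + tr (%v. lie u (lie w (y v)))"
   by(simp add: der lie_simps tr_add)
  finally have "tr (%v. lie s (y v)) = - trform u (y w)" by(simp add: trform_def)
  also have "... = 0" using uw yk Jk by(auto simp: trform_radical_def)
  finally show ?case using step by(simp add: lie_simps tr_add tr_scale)
 qed
 hence "(\<Sum>b\<in>B. complex_of_real ((cmod (c b))\<^sup>2)) = 0"
  using trB by(simp only: complex_norm_square)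
 hence "(\<Sum>b\<in>B. (cmod (c b))\<^sup>2) = 0" by(metis of_real_eq_0_iff of_real_sum)
 hence "c b = 0" if "b : B" for b
  using that B(1) by(simp add: sum_nonneg_eq_0_iff)
 hence "B <= geig (lie z) 0" using B(3) by fastforce
 from clin.span_minimal[OF this geig_subspace[OF clinear_lie]] have "v : geig (lie z) 0"
  using B(2) by blast
 moreover have "shift (lie z) 0 = lie z" by(auto simp: shift_def)
 ultimately show ?thesis by(auto simp: geig_def)
qed

lemma h_solvable: "solvable_subalgebra h"
proof -
 have "brackets h h <= {0}" by(rule brackets_subset) (auto simp: h_abelian)
 hence "derived_series h 1 = {0}" using clin.subspace_0[OF brackets_subspace, of h h] by auto
 moreover have "subalgebra h"
  using h_subspace h_abelian clin.subspace_0[OF h_subspace] by(simp add: subalgebra_def)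
 ultimately show ?thesis unfolding solvable_subalgebra_def by blast
qed

text \<open>If the ideal S = [J, J] were not inside \<open>h\<close>, Lie's theorem for
  \<open>h\<close> on S modulo its part in \<open>h\<close> would give a vector outside
  \<open>h\<close> which \<open>h\<close> maps to its own multiples modulo \<open>h\<close>. These
  multiples are 0 by nilpotency, contradicting self-normalization. Inside \<open>h\<close> the ideal
  is abelian, hence central; its elements lie in [k, k], hence they are 0.\<close>

lemma derived_radical_zero: "brackets trform_radical trform_radical = {0}"
proof -
 let ?J = trform_radical and ?S = "brackets trform_radical trform_radical"
 have Jk: "?J <= k" by(auto simp: trform_radical_def)
 have Sk: "?S <= k" using Jk k_lie by(intro brackets_subset k_subspace) blast
 have Sst: "lie u s : ?S" if "u : k" "s : ?S" for u s
  using that(2) unfolding brackets_def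
 proof (rule clinear_span_subset[OF clinear_lie _ clin.subspace_span, rotated])
  fix t assume "t : {lie x y |x y. x : ?J & y : ?J}"
  then obtain x y where xy: "t = lie x y" "x : ?J" "y : ?J" by blast
  have "lie u x : ?J" "lie u y : ?J" using xy that(1) trform_radical_stable by(auto simp: ad_stable_def)
  hence "lie (lie u x) y + lie x (lie u y) : ?S"
   using xy by(intro clin.subspace_add brackets_subspace bracket_mem)
  thus "lie u t : clin.span {lie x y |x y. x : ?J & y : ?J}"
   by(simp add: xy(1) lie_deriv[of u] brackets_def)
 qed
 have stS: "ad_stable k ?S" using Sst by(simp add: ad_stable_def)
 obtain S' where S': "clin.subspace S'" "S' <= k" "!!u v. u : k ==> v : S' ==> lie u v : S'"
  "?S \<inter> S' = {0}" "!!u. u : k ==> EX i:?S. EX i':S'. u = i + i'"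
  "!!i i'. i : ?S ==> i' : S' ==> lie i i' = 0"
  by(rule ideal_complement[OF brackets_subspace Sk stS]) blast
 \<comment> \<open>x need not lie in S, but it splits along S and a complementary ideal, and the
   second part commutes with S.\<close>
 have nil: "EX n. (lie x ^^ n) v = 0" if x: "x : h" and v: "v : ?S" for x v
 proof -
  obtain s s' where s: "s : ?S" "s' : S'" "x = s + s'" using S'(5) x h_subset_k by blast
  have eq: "(lie x ^^ n) v = (lie s ^^ n) v & (lie s ^^ n) v : ?S" for n
  proof (induction n)
   case (Suc n)
   have "lie s' ((lie s ^^ n) v) = 0"
    using Suc S'(6)[OF _ s(2)] lie_anti[of s'] by simp
   thus ?case using Suc s(1,3) Sst Sk by(auto simp: lie_simps)
  qed (simp add: v)
  thus ?thesis using derived_radical_nilpotent[OF s(1), of v] by simp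
 qed
 have "?S <= h"
 proof (rule ccontr)
  assume "\<not> ?thesis"
  hence "?S \<inter> h \<subset> ?S" by blast
  moreover have "clin.subspace (?S \<inter> h)" using brackets_subspace h_subspace by(rule clin.subspace_inter)
  moreover have "ad_stable h (?S \<inter> h)"
   using h_abelian clin.subspace_0[OF h_subspace] clin.subspace_0[OF brackets_subspace]
   by(auto simp: ad_stable_def)
  moreover have "ad_stable h ?S" using Sst h_subset_k by(auto simp: ad_stable_def)
  ultimately obtain v where v: "v : ?S" "v \<notin> h" "!!x. x : h ==> EX c. lie x v - c *\<^sub>C v : ?S \<inter> h"
   using lie_theorem_mod[OF h_solvable, of "?S \<inter> h" ?S] brackets_subspace by blast
  have "lie v x : h" if x: "x : h" for x
  proof -
   obtain c where c: "lie x v - c *\<^sub>C v : h" using v(3)[OF x] by blast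
   have pow: "(lie x ^^ n) v - c ^ n *\<^sub>C v : h" for n
   proof (induction n)
    case (Suc n)
    have "(lie x ^^ Suc n) v - c ^ Suc n *\<^sub>C v
      = lie x ((lie x ^^ n) v - c ^ n *\<^sub>C v) + c ^ n *\<^sub>C (lie x v - c *\<^sub>C v)"
     by(simp add: lie_diff_right lie_simps clin.scale_right_diff_distrib mult.commute)
    also have "lie x ((lie x ^^ n) v - c ^ n *\<^sub>C v) = 0" using x Suc by(rule h_abelian)
    finally show ?case using c clin.subspace_scale[OF h_subspace] by simp
   qed (simp add: clin.subspace_0[OF h_subspace])
   obtain n where "(lie x ^^ n) v = 0" using nil[OF x v(1)] by blast
   hence "c ^ n *\<^sub>C v : h" using pow[of n] clin.subspace_neg[OF h_subspace] by fastforce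
   hence "c = 0" using v(2) clin.subspace_scale[OF h_subspace, of "c ^ n *\<^sub>C v" "1 / c ^ n"]
    by(cases "c = 0") simp_all
   thus ?thesis
    using c lie_anti[of v x] clin.subspace_neg[OF h_subspace] by simp
  qed
  hence "v : h" using h_self_normalizing v(1) Sk by blast
  thus False using v(2) by simp
 qed
 hence "lie u z = 0" if "u : k" "z : ?S" for u z
  using abelian_ideal_central[OF brackets_subspace Sk stS _ that] h_abelian by blast
 moreover have "?S <= brackets k k" using Jk by(rule brackets_mono[OF _ Jk])
 ultimately have "z = 0" if "z : ?S" for z
  using central_derived_zero[of z] that Sk by blast
 thus ?thesis using clin.subspace_0[OF brackets_subspace] by blast
qed

lemma trform_radical_central:
 assumes "z : trform_radical" "u : k" shows "lie u z = 0"
proof (rule abelian_ideal_central[OF trform_radical_subspace _ trform_radical_stable _ assms(2,1)])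
 show "trform_radical <= k" by(auto simp: trform_radical_def)
 show "lie x y = 0" if "x : trform_radical" "y : trform_radical" for x y
  using bracket_mem[OF that] derived_radical_zero by blast
qed

lemma trform_nondegenerate:
 assumes "z : brackets k k" "z ~= 0"
 shows "EX w:k. trform z w ~= 0"
proof (rule ccontr)
 assume "\<not> ?thesis"
 moreover have zk: "z : k" using assms(1) brackets_subset[OF k_subspace k_lie] by blast
 ultimately have "z : trform_radical" by(auto simp: trform_radical_def)
 thus False using central_derived_zero[OF zk _ assms(1)] trform_radical_central assms(2) by blast
qed

text \<open>The nilpotent part D of ad x is a derivation, and tr (D ad u) = 0 for u in
  \<open>nm\<close>, in \<open>h\<close> and in \<open>np\<close>, hence on \<open>k\<close>. Since
  \<open>trform (D v) w\<close> is the trace of D ad [v, w], D maps \<open>k\<close> into the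
  radical of the trace form, that is, to central elements. This forces D to vanish on
  \<open>k\<close>.\<close>

lemma h_toral:
 assumes x: "x : h" and W: "clin.subspace W" "W <= k" "!!w. w : W ==> lie x w : W" and v: "v : W"
 shows "v : clin.span {w:W. EX c. lie x w = c *\<^sub>C w}"
proof -
 note xk = subsetD[OF h_subset_k x]
 from exists_spectral_operator[OF clinear_lie[of x], of "%c. c"]
 obtain B c s where s: "clinear s" "ALL d. ALL v:geig (lie x) d. s v = d *\<^sub>C v"
  by(elim exE conjE)
 define D where "D v = lie x v - s v" for v
 have D: "clinear D" unfolding D_def using clinear_lie s(1) by(rule clinear_minus_op)
 have der: "D (lie v w) = lie (D v) w + lie v (D w)" for v w
  using spectral_operator_derivation[OF s, of v w]
  by(simp add: D_def lie_deriv[of x] lie_diff_left lie_diff_right)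
 have sst: "s v : V" if "clin.subspace V" "!!v. v : V ==> lie x v : V" "v : V" for v V
  using spectral_operator_stable[OF clinear_lie s] that by blast
 have Dst: "D v : V" if "clin.subspace V" "!!v. v : V ==> lie x v : V" "v : V" for v V
  unfolding D_def using sst[OF that] that by(intro clin.subspace_diff)
 have Dgeig: "D v = shift (lie x) c v" if "v : geig (lie x) c" for v c
  using s(2) that by(simp add: D_def shift_def)
 have Dnil: "EX n. (D ^^ n) v = 0" for v
 proof -
  obtain C f where C: "finite C" "ALL c:C. f c : geig (lie x) c" "v = (\<Sum>c\<in>C. f c)"
   using geig_decomposition[OF clinear_lie clin.subspace_UNIV] by(metis Int_UNIV_right UNIV_I)
  have pow: "(D ^^ n) w = (shift (lie x) c ^^ n) w & (D ^^ n) w : geig (lie x) c"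
   if "w : geig (lie x) c" for c n w
   using that by(induction n) (auto simp: Dgeig geig_shift_mem[OF clinear_lie])
  have "ALL c:C. EX n. (D ^^ n) (f c) = 0"
  proof
   fix c assume c: "c : C"
   then obtain n where "(shift (lie x) c ^^ n) (f c) = 0" using C(2) by(auto simp: geig_def)
   thus "EX n. (D ^^ n) (f c) = 0" using pow[of "f c" c n] C(2) c by auto
  qed
  then obtain n where n: "!!c. c : C ==> (D ^^ n c) (f c) = 0" by metis
  have "(D ^^ sum n C) (f c) = 0" if c: "c : C" for c
  proof -
   have "n c <= sum n C" using c C(1) by(intro member_le_sum) auto
   then obtain m where "sum n C = m + n c" by(metis le_Suc_ex add.commute)
   thus ?thesis using n[OF c] by(simp add: funpow_add clinear_zero[OF clinear_funpow[OF D]])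
  qed
  hence "(D ^^ sum n C) v = 0" by(simp add: C(3) clinear_sum[OF clinear_funpow[OF D]])
  thus ?thesis by blast
 qed
 obtain n where n: "!!v. (D ^^ n) v = 0" using uniformly_nilpotent[OF D Dnil] by blast
 \<comment> \<open>D b = 0, so D commutes with ad b, and the product is nilpotent along with
   D.\<close>
 have trh: "tr (%v. D (lie b v)) = 0" if b: "b : h" for b
 proof -
  have xb: "lie x b = 0" using x b by(rule h_abelian)
  hence "b : geig (lie x) 0" unfolding geig_def by(auto simp: shift_def intro!: exI[of _ 1])
  hence "D b = 0" using Dgeig[of b 0] xb by(simp add: shift_def)
  hence comm: "D (lie b w) = lie b (D w)" for w using der[of b w] by simp
  let ?T = "%v. D (lie b v)"
  have pow: "(D ^^ i) (lie b w) = lie b ((D ^^ i) w)" for i w by(induction i) (auto simp: comm)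
  have "(?T ^^ i) w = (lie b ^^ i) ((D ^^ i) w)" for i w
  proof (induction i arbitrary: w)
   case (Suc i)
   have "(?T ^^ Suc i) w = (?T ^^ i) (D (lie b w))" by(simp only: funpow_Suc_right comp_apply)
   also have "... = (lie b ^^ i) ((D ^^ Suc i) (lie b w))"
    unfolding Suc by(simp only: funpow_Suc_right comp_apply)
   also have "... = (lie b ^^ Suc i) ((D ^^ Suc i) w)"
    unfolding pow by(simp only: funpow_Suc_right comp_apply)
   finally show ?case .
  qed simp
  hence "(?T ^^ n) w = 0" for w
   using n clinear_zero[OF clinear_funpow[OF clinear_lie]] by simp
  thus ?thesis by(intro tr_nilpotent[OF clinear_compose[OF D clinear_lie]])
 qed
 obtain Mp where Mp: "!!xs v. set xs <= np ==> Mp <= length xs ==> foldr lie xs v = 0"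
  using np_nilpotent by blast
 have trp: "tr (%v. D (lie b v)) = 0" if "b : np" for b
  by(rule tr_derivation_nilradical[OF D der _ Mp that]) (use Dst np_subspace h_np x in blast)+
 obtain Mm where Mm: "!!xs v. set xs <= nm ==> Mm <= length xs ==> foldr lie xs v = 0"
  using nm_nilpotent by blast
 have trm: "tr (%v. D (lie b v)) = 0" if "b : nm" for b
  by(rule tr_derivation_nilradical[OF D der _ Mm that]) (use Dst nm_subspace h_nm x in blast)+
 have trk: "tr (%v. D (lie u v)) = 0" if u: "u : k" for u
 proof -
  obtain a b c where "a : nm" "b : h" "c : np" "u = a + b + c" by(rule triangular_decompose[OF u])
  thus ?thesis using trp trh trm by(simp add: lie_simps clinear_add[OF D] tr_add)
 qed
 have Drad: "D v : trform_radical" if v: "v : k" for v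
 proof -
  have "trform (D v) w = 0" if w: "w : k" for w
  proof -
   have "trform (D v) w = tr (%u. D (lie v (lie w u))) - tr (%u. lie v (D (lie w u)))"
    unfolding trform_def by(simp add: der flip: tr_diff)
   also have "tr (%u. lie v (D (lie w u))) = tr (%u. D (lie w (lie v u)))"
    by(rule tr_comm[OF clinear_lie clinear_compose[OF D clinear_lie]])
   finally have "trform (D v) w = tr (%u. D (lie (lie v w) u))"
    by(simp add: lie_lie clinear_diff[OF D] tr_diff)
   thus ?thesis using trk k_lie v w by simp
  qed
  moreover have "D v : k" using Dst[OF k_subspace k_lie[OF xk] v] .
  ultimately show ?thesis by(simp add: trform_radical_def)
 qed
 \<comment> \<open>For c = 0 the vector D w = [x, w] is both central and a bracket. For other c it
   is killed by ad x although it lies in the generalized eigenspace of c.\<close>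
 have D0: "D w = 0" if w: "w : k" "w : geig (lie x) c" for w c
 proof (cases "c = 0")
  case True
  hence eq: "D w = lie x w" using Dgeig w by(simp add: shift_def)
  hence "D w : brackets k k" using bracket_mem[OF xk w(1)] by simp
  thus ?thesis
   using central_derived_zero[of "D w"] Drad[OF w(1)] trform_radical_central eq k_lie[OF xk w(1)] by simp
 next
  case False
  have "lie x (D w) = 0" using Drad[OF w(1)] xk by(rule trform_radical_central)
  moreover have "D w : geig (lie x) c" using Dgeig[OF w(2)] geig_shift_mem[OF clinear_lie w(2)] by simp
  ultimately show ?thesis
   using geig_shift_eq_0[OF clinear_lie, of "D w" x c 0] False by(simp add: shift_def)
 qed
 obtain C f where C: "finite C" "ALL c:C. f c : geig (lie x) c \<inter> W" "v = (\<Sum>c\<in>C. f c)"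
  using geig_decomposition[OF clinear_lie W(1,3) v] by blast
 have "f c : clin.span {w:W. EX c. lie x w = c *\<^sub>C w}" if c: "c : C" for c
 proof (rule clin.span_base)
  have "D (f c) = 0" using D0[of "f c" c] C(2) c W(2) by blast
  hence "lie x (f c) = c *\<^sub>C f c" using s(2) C(2) c by(simp add: D_def)
  thus "f c : {w:W. EX c. lie x w = c *\<^sub>C w}" using C(2) c by blast
 qed
 thus ?thesis unfolding C(3) by(rule clin.span_sum)
qed

end

subsection \<open>Weight vectors\<close>

lemma dual_space_zero: "0 : dual_space h"
 and dual_space_add: "\<mu> : dual_space h ==> \<nu> : dual_space h ==> \<mu> + \<nu> : dual_space h"
 and dual_space_minus: "\<mu> : dual_space h ==> - \<mu> : dual_space h"
 by(auto simp: dual_space_def algebra_simps)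

lemma dual_space_eqI:
 assumes "\<mu> : dual_space h" "\<nu> : dual_space h" "!!x. x : h ==> \<mu> x = \<nu> x"
 shows "\<mu> = \<nu>"
proof
 fix x show "\<mu> x = \<nu> x" using assms by(cases "x : h") (auto simp: dual_space_def)
qed

definition weight_vector ::
  "'g::fin_dim_complex_lie_algebra set => ('g => complex) => 'g => bool" where
 "weight_vector h \<nu> v \<longleftrightarrow> (ALL x:h. lie x v = \<nu> x *\<^sub>C v)"

lemma weight_space_iff: "v : weight_space h V \<nu> \<longleftrightarrow> v : V & weight_vector h \<nu> v"
 by(simp add: weight_space_def weight_vector_def)

lemma weight_vector_lie:
 assumes "weight_vector h \<mu> v" "weight_vector h \<nu> w"
 shows "weight_vector h (\<mu> + \<nu>) (lie v w)"
 using assms by(simp add: weight_vector_def lie_deriv lie_simps clin.scale_left_distrib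
   lie_deriv[of _ v w])

lemma weight_vector_subspace: "clin.subspace {v. weight_vector h \<nu> v}"
 by(intro clin.subspaceI)
  (auto simp: weight_vector_def lie_simps clin.scale_right_distrib mult.commute)

lemma weight_functional:
 assumes "clin.subspace h" "!!x. x : h ==> EX c. lie x w = c *\<^sub>C w"
 shows "EX \<nu>:dual_space h. weight_vector h \<nu> w"
proof (cases "w = 0")
 case True
 thus ?thesis by(intro bexI[of _ 0]) (auto simp: dual_space_zero weight_vector_def)
next
 case False
 obtain c where c: "!!x. x : h ==> lie x w = c x *\<^sub>C w" using assms(2) by metis
 define \<nu> where "\<nu> x = (if x : h then c x else 0)" for x
 have "\<nu> (x + y) = \<nu> x + \<nu> y" if "x : h" "y : h" for x y
 proof -
  have "c (x + y) *\<^sub>C w = (c x + c y) *\<^sub>C w"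
   using that c[of "x + y"] clin.subspace_add[OF assms(1) that] c
   by(simp add: lie_simps clin.scale_left_distrib)
  hence "c (x + y) = c x + c y" using False by(simp del: clin.scale_left_distrib)
  thus ?thesis using that clin.subspace_add[OF assms(1) that] by(simp add: \<nu>_def)
 qed
 moreover have "\<nu> (a *\<^sub>C x) = a * \<nu> x" if "x : h" for a x
 proof -
  have "c (a *\<^sub>C x) *\<^sub>C w = (a * c x) *\<^sub>C w"
   using c[OF clin.subspace_scale[OF assms(1) that, of a]] c[OF that]
   by(simp del: clin.scale_cancel_right add: lie_simps)
  hence "c (a *\<^sub>C x) = a * c x" using False by simp
  thus ?thesis using that clin.subspace_scale[OF assms(1) that] by(simp add: \<nu>_def)
 qed
 ultimately have "\<nu> : dual_space h" by(simp add: dual_space_def \<nu>_def)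
 moreover have "weight_vector h \<nu> w" using c by(simp add: weight_vector_def \<nu>_def)
 ultimately show ?thesis by blast
qed

text \<open>Apply y in \<open>h\<close> to the expansion of \<open>v\<close> in weight vectors and
  compare coefficients.\<close>

lemma representation_weight:
 assumes "finite X" "clin.independent X" "!!x. x : X ==> weight_vector h (wt x) x"
  "!!x. x : X ==> wt x : dual_space h" "\<nu> : dual_space h" "v : clin.span X" "weight_vector h \<nu> v"
  "x : X" "clin.representation X v x ~= 0"
 shows "wt x = \<nu>"
proof (rule dual_space_eqI[OF assms(4)[OF assms(8)] assms(5)])
 fix y assume y: "y : h"
 have "(\<Sum>x\<in>X. (clin.representation X v x * wt x y) *\<^sub>C x)
   = (\<Sum>x\<in>X. clin.representation X v x *\<^sub>C lie y x)"
  using assms(3) y by(intro sum.cong refl) (simp add: weight_vector_def)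
 also have "... = lie y (\<Sum>x\<in>X. clin.representation X v x *\<^sub>C x)"
  by(simp add: lie_sum_right lie_simps)
 also have "... = \<nu> y *\<^sub>C v"
  using assms(7) y clin.sum_representation_eq[OF assms(2,6,1)] by(simp add: weight_vector_def)
 also have "... = \<nu> y *\<^sub>C (\<Sum>x\<in>X. clin.representation X v x *\<^sub>C x)"
  using clin.sum_representation_eq[OF assms(2,6,1)] by simp
 finally have "(\<Sum>x\<in>X. (clin.representation X v x * (wt x y - \<nu> y)) *\<^sub>C x) = 0"
  by(simp add: clin.scale_sum_right right_diff_distrib clin.scale_left_diff_distrib sum_subtractf mult.commute)
 hence "clin.representation X v x * (wt x y - \<nu> y) = 0"
  by(rule clin.independentD[OF assms(2,1) subset_refl _ assms(8)])
 thus "wt x y = \<nu> y" using assms(9) by simp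
qed

text \<open>The spectral operator that is 0 at the values attached to a triangular basis and 1
  elsewhere kills that basis, hence everything, so no further eigenvalue is possible.\<close>

lemma finite_eigenvalues:
 fixes T :: "'g::fin_dim_complex_lie_algebra => 'g"
 assumes "clinear T" shows "finite {c. EX v. v ~= 0 & T v = c *\<^sub>C v}"
proof -
 from triangular_basis[OF assms] obtain B and c :: "'g => complex"
  where B: "finite B" "clin.span B = UNIV" "ALL b:B. b : geig T (c b)"
  by(elim exE conjE) blast
 have "d : c ` B" if v: "v ~= 0" "T v = d *\<^sub>C v" for v d
 proof (rule ccontr)
  assume d: "d \<notin> c ` B"
  from exists_spectral_operator[OF assms, of "%e. if e : c ` B then 0 else 1"]
  obtain y where y: "clinear y" "ALL d. ALL v:geig T d. y v = (if d : c ` B then 0 else 1) *\<^sub>C v"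
   by(elim exE conjE)
  have "y b = 0" if "b : B" for b using B(3) y(2) that by fastforce
  hence "y v = 0" using clinear_span_subset[OF y(1), of B "{0}" v] B(2) by simp
  moreover have "v : geig T d" using v(2) by(auto simp: geig_def shift_def intro!: exI[of _ 1])
  hence "y v = v" using y(2) d by simp
  ultimately show False using v(1) by simp
 qed
 hence "{c. EX v. v ~= 0 & T v = c *\<^sub>C v} <= c ` B" by blast
 thus ?thesis using B(1) finite_subset by blast
qed

lemma nilpotent_if_eigenvalues_zero:
 assumes "clinear T" "!!c v. T v = c *\<^sub>C v ==> v ~= 0 ==> c = 0"
 shows "EX n. ALL v. (T ^^ n) v = 0"
proof (rule uniformly_nilpotent[OF assms(1)])
 fix v
 obtain C f where C: "finite C" "ALL c:C. f c : geig T c" "v = (\<Sum>c\<in>C. f c)"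
  using geig_decomposition[OF assms(1) clin.subspace_UNIV] by(metis Int_UNIV_right UNIV_I)
 have "geig T c = {0}" if "c ~= 0" for c
 proof (rule ccontr)
  assume "geig T c ~= {0}"
  then obtain v d where v: "v : geig T c" "v ~= 0" "T v = d *\<^sub>C v"
   using exists_eigenvector[OF assms(1) geig_subspace[OF assms(1)] geig_mem[OF assms(1)], of c] by blast
  hence "shift T 0 v = 0" using assms(2)[OF v(3,2)] by(simp add: shift_def)
  thus False using geig_shift_eq_0[OF assms(1) v(1), of 0] that v(2) by simp
 qed
 hence "f c : geig T 0" if "c : C" for c
  using that C(2) clin.subspace_0[OF geig_subspace[OF assms(1)]] by(cases "c = 0") auto
 hence "v : geig T 0" unfolding C(3) by(rule clin.subspace_sum[OF geig_subspace[OF assms(1)]])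
 moreover have "shift T 0 = T" by(auto simp: shift_def)
 ultimately show "EX n. (T ^^ n) v = 0" by(simp add: geig_def)
qed

lemma tr_commuting_nilpotent:
 assumes "clinear S" "clinear T" "!!v. S (T v) = T (S v)" "!!v. (T ^^ n) v = 0"
 shows "tr (%v. S (T v)) = 0"
proof -
 have T1: "(T ^^ i) (S v) = S ((T ^^ i) v)" for i v
  by(induction i) (simp_all add: assms(3))
 have "((%v. S (T v)) ^^ i) v = (S ^^ i) ((T ^^ i) v)" for i v
 proof (induction i arbitrary: v)
  case (Suc i)
  have "((%v. S (T v)) ^^ Suc i) v = (S ^^ i) ((T ^^ i) (S (T v)))"
   using Suc by(simp only: funpow_Suc_right comp_apply)
  thus ?case unfolding T1 by(simp only: funpow_Suc_right comp_apply)
 qed simp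
 thus ?thesis
  using assms(4) clinear_zero[OF clinear_funpow[OF assms(1)]]
  by(intro tr_nilpotent[OF clinear_compose[OF assms(1,2)], of n]) simp
qed

subsection \<open>Triples \<open>e, f, t\<close>\<close>

text \<open>e and f commute with t and so preserve its eigenspace for c. There t = [e, f] has trace
  0, but the trace is also c times the dimension.\<close>

lemma heisenberg_nilpotent:
 assumes "t = lie e f" "lie t e = 0" "lie t f = 0"
 shows "EX n. ALL v. (lie t ^^ n) v = 0"
proof (rule nilpotent_if_eigenvalues_zero[OF clinear_lie], rule ccontr)
 fix c v assume v: "lie t v = c *\<^sub>C v" "v ~= 0" and c: "c ~= 0"
 define E where "E = {v. lie t v = c *\<^sub>C v}"
 have E: "clin.subspace E" unfolding E_def
  by(intro clin.subspaceI) (auto simp: lie_simps clin.scale_right_distrib mult.commute)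
 obtain B where B: "B <= E" "clin.independent B" "E <= clin.span B"
  by(rule clin.maximal_independent_subset)
 have fin: "finite B" using B(2) by(rule cfin.finiteI_independent)
 have spB: "clin.span B = E" using B(1,3) E by(rule clin.span_subspace)
 have eE: "lie e w : E" "lie f w : E" if "w : E" for w
  using that assms(2,3) by(simp_all add: E_def lie_deriv[of t] lie_simps)
 have "trace B (lie t) = trace B (%v. lie e (lie f v) - lie f (lie e v))"
  by(rule trace_cong) (simp add: assms(1) lie_lie)
 also have "... = trace B (%v. lie e (lie f v)) - trace B (%v. lie f (lie e v))"
  using B(1) by(intro trace_diff[OF B(2)]) (auto simp: spB eE)
 also have "... = 0"
  using trace_comm[OF fin B(2) clinear_lie[of e] clinear_lie[of f]] B(1) spB eE by auto
 finally have "trace B (lie t) = 0" .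
 moreover have "trace B (lie t) = sum (%_. c) B"
  using B(1) by(intro trace_triangular[OF fin B(2), of _ _ "%_. 0"]) (auto simp: E_def)
 ultimately have "card B = 0" using c by simp
 hence "E = {0}" using fin spB by simp
 thus False using v by(auto simp: E_def)
qed

locale sl2_triple =
 fixes e f t :: "'g::fin_dim_complex_lie_algebra"
 assumes ef: "lie e f = t" and te: "lie t e = 2 *\<^sub>C e" and tf: "lie t f = (- 2) *\<^sub>C f"
begin

lemma eigenvalue_chain:
 assumes "lie t x = a *\<^sub>C x" "lie t v = c *\<^sub>C v"
 shows "lie t ((lie x ^^ n) v) = (c + of_nat n * a) *\<^sub>C (lie x ^^ n) v"
 using assms by(induction n) (simp_all add: lie_deriv[of t] lie_simps clin.scale_left_distrib algebra_simps)

lemma chain_terminates: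
 assumes "lie t x = a *\<^sub>C x" "a ~= 0" "lie t v = c *\<^sub>C v" "v ~= 0"
 obtains m where "(lie x ^^ m) v ~= 0" "lie x ((lie x ^^ m) v) = 0"
proof -
 have ex: "EX n. (lie x ^^ n) v = 0"
 proof (rule ccontr)
  assume "\<not> ?thesis"
  hence "range (%n. c + of_nat n * a) <= {c. EX v. v ~= 0 & lie t v = c *\<^sub>C v}"
   using eigenvalue_chain[OF assms(1,3)] by blast
  hence "finite (range (%n. c + of_nat n * a))"
   using finite_eigenvalues[OF clinear_lie[of t]] finite_subset by blast
  moreover have "inj (%n. c + of_nat n * a)" using assms(2) by(auto simp: inj_def)
  ultimately show False using finite_imageD by blast
 qed
 define n where "n = (LEAST n. (lie x ^^ n) v = 0)"
 have n: "(lie x ^^ n) v = 0" unfolding n_def using ex by(rule LeastI_ex)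
 hence "n ~= 0" using assms(4) by(intro notI) simp
 then obtain m where m: "n = Suc m" using not0_implies_Suc by blast
 have "(lie x ^^ m) v ~= 0" using not_less_Least[of m "%n. (lie x ^^ n) v = 0"] m n_def by simp
 thus thesis using that n m by simp
qed

text \<open>Along the chain v, e v, e^2 v, ... one has f e^(n+1) v = -(n + 1) (c + n) e^n v. The
  last nonzero member e^m v forces c = -m.\<close>

lemma lowest_weight:
 assumes "lie f v = 0" "lie t v = c *\<^sub>C v" "v ~= 0"
 shows "EX m::nat. c = - of_nat m"
proof -
 obtain m where m: "(lie e ^^ m) v ~= 0" "lie e ((lie e ^^ m) v) = 0"
  by(rule chain_terminates[OF te _ assms(2,3)]) simp
 have "lie f ((lie e ^^ Suc n) v) = (- of_nat (Suc n) * (c + of_nat n)) *\<^sub>C (lie e ^^ n) v" for n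
 proof (induction n)
  case 0
  have "lie f (lie e v) = lie e (lie f v) - lie t v" by(simp add: ef[symmetric] lie_lie)
  thus ?case using assms by simp
 next
  case (Suc n)
  have "lie f ((lie e ^^ Suc (Suc n)) v)
    = lie e (lie f ((lie e ^^ Suc n) v)) - lie t ((lie e ^^ Suc n) v)"
   by(simp add: ef[symmetric] lie_lie)
  also have "... = (- of_nat (Suc n) * (c + of_nat n)) *\<^sub>C (lie e ^^ Suc n) v
    - (c + of_nat (Suc n) * 2) *\<^sub>C (lie e ^^ Suc n) v"
   unfolding Suc eigenvalue_chain[OF te assms(2)] by(simp add: lie_simps)
  also have "... = (- of_nat (Suc (Suc n)) * (c + of_nat (Suc n))) *\<^sub>C (lie e ^^ Suc n) v"
  proof -
   have "- of_nat (Suc n) * (c + of_nat n) - (c + of_nat (Suc n) * 2)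
     = - of_nat (Suc (Suc n)) * (c + of_nat (Suc n))" by(simp add: algebra_simps)
   thus ?thesis by(simp only: clin.scale_left_diff_distrib[symmetric])
  qed
  finally show ?case .
 qed
 from this[of m] have "(- of_nat (Suc m) * (c + of_nat m)) *\<^sub>C (lie e ^^ m) v = 0" using m(2) by simp
 hence "- of_nat (Suc m) * (c + of_nat m) = 0" using m(1) by simp
 hence "c + of_nat m = 0"
  unfolding mult_eq_0_iff neg_equal_0_iff_equal using of_nat_neq_0[of m, where 'a = complex] by simp
 thus ?thesis by(auto simp: eq_neg_iff_add_eq_0)
qed

text \<open>Descend with f to the last nonzero vector, which is a lowest weight vector of eigenvalue
  c - 2m.\<close>

lemma eigenvalue_integral:
 assumes "lie t v = c *\<^sub>C v" "v ~= 0" shows "c : \<int>"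
proof -
 obtain m where m: "(lie f ^^ m) v ~= 0" "lie f ((lie f ^^ m) v) = 0"
  by(rule chain_terminates[OF tf _ assms]) simp
 obtain m' :: nat where "c + of_nat m * (- 2) = - of_nat m'"
  using lowest_weight[OF m(2) eigenvalue_chain[OF tf assms(1)] m(1)] by blast
 hence "c = of_int (2 * int m - int m')" by(simp add: algebra_simps)
 thus ?thesis by simp
qed

end

subsection \<open>Roots and coroots\<close>

context reductive_pair begin

text \<open>Simultaneous diagonalization over a basis of \<open>h\<close>: the eigenspace of one
  element is stable under the others because \<open>h\<close> is abelian, so \<open>h_toral\<close>
  applies to it again.\<close>

lemma weight_span:
 assumes "clin.subspace W" "W <= k" "!!x w. x : h ==> w : W ==> lie x w : W" "v : W"
 shows "v : clin.span {w:W. EX \<nu>:dual_space h. weight_vector h \<nu> w}"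
proof -
 obtain B where B: "B <= h" "clin.independent B" "h <= clin.span B"
  by(rule clin.maximal_independent_subset)
 obtain xs where xs: "set xs = B" using cfin.finiteI_independent[OF B(2)] finite_list by blast
 have "v : clin.span {w:W. ALL x:set xs. EX c. lie x w = c *\<^sub>C w}"
  if "set xs <= h" "clin.subspace W" "W <= k" "!!x w. x : h ==> w : W ==> lie x w : W" "v : W"
  for xs v W
  using that
 proof (induction xs arbitrary: v W)
  case Nil
  thus ?case by(simp add: clin.span_base)
 next
  case (Cons x xs)
  note x = Cons.prems(1)[simplified, THEN conjunct1]
  let ?S = "{w:W. ALL x:set (x # xs). EX c. lie x w = c *\<^sub>C w}"
  have "w : clin.span ?S" if w: "w : W" "lie x w = c *\<^sub>C w" for w c
  proof -
   let ?W = "{w:W. lie x w = c *\<^sub>C w}"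
   have "w : clin.span {w:?W. ALL x:set xs. EX c. lie x w = c *\<^sub>C w}"
   proof (rule Cons.IH)
    show "clin.subspace ?W" using Cons.prems(2)
     by(intro clin.subspaceI) (auto simp: clin.subspace_0 clin.subspace_add clin.subspace_scale
      lie_simps clin.scale_right_distrib mult.commute)
    show "lie y w : ?W" if "y : h" "w : ?W" for y w
     using that Cons.prems(4) x h_abelian[OF x that(1)] by(simp add: lie_deriv[of x] lie_simps)
   qed (use Cons.prems w in auto)
   moreover have "{w:?W. ALL x:set xs. EX c. lie x w = c *\<^sub>C w} <= ?S" by auto
   ultimately show ?thesis by(rule subsetD[OF clin.span_mono, rotated])
  qed
  hence "{w:W. EX c. lie x w = c *\<^sub>C w} <= clin.span ?S" by blast
  from clin.span_minimal[OF this clin.subspace_span]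
  show ?case by(rule subsetD) (rule h_toral[OF x Cons.prems(2,3) Cons.prems(4)[OF x] Cons.prems(5)])
 qed
 hence "v : clin.span {w:W. ALL x:B. EX c. lie x w = c *\<^sub>C w}"
  using assms xs B(1) by blast
 moreover have "{w:W. ALL x:B. EX c. lie x w = c *\<^sub>C w} <= {w:W. EX \<nu>:dual_space h. weight_vector h \<nu> w}"
 proof (clarsimp)
  fix w assume w: "ALL x:B. EX c. lie x w = c *\<^sub>C w"
  have "EX c. lie x w = c *\<^sub>C w" if "x : h" for x
   using subsetD[OF B(3) that]
  proof (induction rule: clin.span_induct_alt)
   case base
   show ?case by(intro exI[of _ 0]) simp
  next
   case (step a x y)
   then obtain c d where "lie x w = c *\<^sub>C w" "lie y w = d *\<^sub>C w" using w by blast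
   thus ?case by(intro exI[of _ "a * c + d"]) (simp add: lie_simps clin.scale_left_distrib)
  qed
  thus "EX \<nu>:dual_space h. weight_vector h \<nu> w" by(rule weight_functional[OF h_subspace])
 qed
 ultimately show ?thesis by(rule subsetD[OF clin.span_mono, rotated])
qed

lemma weight_basis:
 assumes "clin.subspace W" "W <= k" "!!x w. x : h ==> w : W ==> lie x w : W"
 obtains X wt where "finite X" "clin.independent X" "X <= W" "clin.span X = W"
  "ALL x:X. wt x : dual_space h" "ALL x:X. weight_vector h (wt x) x"
proof -
 let ?S = "{w:W. EX \<nu>:dual_space h. weight_vector h \<nu> w}"
 obtain X where X: "X <= ?S" "clin.independent X" "?S <= clin.span X"
  by(rule clin.maximal_independent_subset)
 have "W <= clin.span ?S" using weight_span[OF assms] by blast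
 also have "... <= clin.span X" using X(3) clin.subspace_span by(rule clin.span_minimal)
 finally have "clin.span X = W" using X(1) assms(1) by(intro clin.span_subspace) auto
 moreover have "ALL x:X. EX \<nu>. \<nu> : dual_space h & weight_vector h \<nu> x" using X(1) by blast
 then obtain wt where "!!x. x : X ==> wt x : dual_space h & weight_vector h (wt x) x" by metis
 ultimately show thesis using that[of X wt] X cfin.finiteI_independent[OF X(2)] by blast
qed

lemma zero_weight: "x : k ==> weight_vector h 0 x ==> x : h"
proof (rule h_self_normalizing)
 fix y assume "weight_vector h 0 x" "y : h"
 hence "lie x y = 0" using lie_anti[of x y] by(simp add: weight_vector_def)
 thus "lie x y : h" using clin.subspace_0[OF h_subspace] by simp
qed

lemma nonzero_functional:
 assumes "\<alpha> : dual_space h" "\<alpha> ~= 0" obtains x where "x : h" "\<alpha> x ~= 0"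
 using dual_space_eqI[OF assms(1) dual_space_zero] assms(2) by auto

lemma nonzero_weight_derived:
 assumes "\<alpha> : dual_space h" "\<alpha> ~= 0" "e : k" "weight_vector h \<alpha> e"
 shows "e : brackets k k"
proof -
 obtain x where x: "x : h" "\<alpha> x ~= 0" by(rule nonzero_functional[OF assms(1,2)])
 hence "lie ((1 / \<alpha> x) *\<^sub>C x) e = e" using assms(4) by(simp add: weight_vector_def lie_simps)
 moreover have "(1 / \<alpha> x) *\<^sub>C x : k" using x(1) h_subset_k clin.subspace_scale[OF k_subspace] by blast
 ultimately show ?thesis using bracket_mem[of "(1 / \<alpha> x) *\<^sub>C x" k e k] assms(3) by simp
qed

text \<open>Weight spaces whose weights do not add up to 0 are orthogonal for the trace form, so its
  nondegeneracy at e must be witnessed in the weight opposite to \<alpha>.\<close>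

lemma exists_opposite:
 assumes "\<alpha> : dual_space h" "\<alpha> ~= 0" "e : k" "weight_vector h \<alpha> e" "e ~= 0"
 shows "EX f:k. weight_vector h (- \<alpha>) f & trform e f ~= 0"
proof (rule ccontr)
 assume no: "\<not> ?thesis"
 have "trform e w = 0" if w: "w : k" "weight_vector h \<nu> w" "\<nu> : dual_space h" for w \<nu>
 proof (cases "\<nu> = - \<alpha>")
  case True
  thus ?thesis using no w by blast
 next
  case False
  then obtain x where x: "x : h" "\<nu> x ~= (- \<alpha>) x"
   using dual_space_eqI[OF w(3) dual_space_minus[OF assms(1)]] by blast
  have "trform (lie x e) w = - trform e (lie x w)"
   using lie_anti[of w x] trform_simps(4)[of e "- 1" "lie x w"] by(simp add: trform_lie)
  hence "(\<alpha> x + \<nu> x) * trform e w = 0"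
   using assms(4) w(2) x(1) by(simp add: weight_vector_def trform_simps distrib_right)
  moreover have "\<alpha> x + \<nu> x ~= 0" using x(2) by(metis add.commute eq_neg_iff_add_eq_0 fun_Compl_def)
  ultimately show ?thesis by simp
 qed
 hence 0: "trform e w = 0" if "w : {w:k. EX \<nu>:dual_space h. weight_vector h \<nu> w}" for w
  using that by blast
 have "trform e w = 0" if "w : k" for w
  using weight_span[OF k_subspace subset_refl k_lie[OF subsetD[OF h_subset_k]] that]
  by(induction rule: clin.span_induct_alt) (simp_all add: trform_simps 0)
 thus False
  using trform_nondegenerate[OF nonzero_weight_derived[OF assms(1-4)] assms(5)] by blast
qed

lemma weight_bracket_h:
 assumes "e : k" "weight_vector h \<alpha> e" "f : k" "weight_vector h (- \<alpha>) f"
 shows "lie e f : h"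
 using weight_vector_lie[OF assms(2,4)] by(intro zero_weight k_lie assms) simp

text \<open>For t = [e, f] the value \<alpha> t is nonzero. Otherwise e, f, t is a Heisenberg triple
  and ad t is nilpotent; it commutes with ad x for x in \<open>h\<close>, so
  \<open>trform x t\<close> is 0, whereas it equals \<alpha> x times \<open>trform e f\<close>.
  Rescaling f then achieves \<alpha> t = 2.\<close>

lemma exists_sl2:
 assumes "\<alpha> : dual_space h" "\<alpha> ~= 0" "e : k" "weight_vector h \<alpha> e" "e ~= 0"
 obtains f t where "f : k" "weight_vector h (- \<alpha>) f" "t : h" "\<alpha> t = 2" "sl2_triple e f t"
proof -
 obtain f where f: "f : k" "weight_vector h (- \<alpha>) f" "trform e f ~= 0"
  using exists_opposite[OF assms] by blast
 define t where "t = lie e f"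
 have t: "t : h" unfolding t_def by(rule weight_bracket_h[OF assms(3,4) f(1,2)])
 have tt: "lie t e = \<alpha> t *\<^sub>C e" "lie t f = (- \<alpha> t) *\<^sub>C f"
  using assms(4) f(2) t by(simp_all add: weight_vector_def)
 have "\<alpha> t ~= 0"
 proof
  assume "\<alpha> t = 0"
  then obtain n where n: "!!v. (lie t ^^ n) v = 0"
   using heisenberg_nilpotent[OF t_def] tt by auto
  obtain x where x: "x : h" "\<alpha> x ~= 0" by(rule nonzero_functional[OF assms(1,2)])
  have "lie x (lie t v) = lie t (lie x v)" for v
   using h_abelian[OF x(1) t] by(simp add: lie_deriv[of x])
  hence "trform x t = 0"
   unfolding trform_def by(rule tr_commuting_nilpotent[OF clinear_lie clinear_lie _ n])
  moreover have "trform x t = \<alpha> x * trform e f"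
  proof -
   have "trform x t = trform f (lie x e)" unfolding t_def trform_comm[of x] by(rule trform_lie)
   also have "... = \<alpha> x * trform f e" using assms(4) x(1) by(simp add: weight_vector_def trform_simps)
   finally show ?thesis by(simp add: trform_comm)
  qed
  ultimately show False using x(2) f(3) by simp
 qed
 let ?c = "2 / \<alpha> t"
 have ct: "\<alpha> (?c *\<^sub>C t) = 2" using assms(1) t \<open>\<alpha> t ~= 0\<close> by(simp add: dual_space_def)
 have ch: "?c *\<^sub>C t : h" using t h_subspace by(simp add: clin.subspace_scale)
 show thesis
 proof (rule that[of "?c *\<^sub>C f" "?c *\<^sub>C t"])
  show "?c *\<^sub>C f : k" using f(1) k_subspace by(simp add: clin.subspace_scale)
  show wf: "weight_vector h (- \<alpha>) (?c *\<^sub>C f)"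
   using clin.subspace_scale[OF weight_vector_subspace] f(2) by blast
  show "sl2_triple e (?c *\<^sub>C f) (?c *\<^sub>C t)"
  proof
   show "lie e (?c *\<^sub>C f) = ?c *\<^sub>C t" by(simp add: lie_simps t_def)
   show "lie (?c *\<^sub>C t) e = 2 *\<^sub>C e" "lie (?c *\<^sub>C t) (?c *\<^sub>C f) = (- 2) *\<^sub>C (?c *\<^sub>C f)"
    using assms(4) wf ch ct by(simp_all only: weight_vector_def fun_Compl_def)
  qed
 qed (use ct ch in auto)
qed

lemma nilpotent_h_zero:
 assumes "s : h" "s : brackets k k" "!!v. (lie s ^^ n) v = 0"
 shows "s = 0"
proof (rule central_derived_zero[OF _ _ assms(2)])
 show "s : k" using assms(1) h_subset_k by blast
 show "lie u s = 0" if u: "u : k" for u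
 proof -
  have "lie s w = 0" if w: "w : {w:k. EX \<nu>:dual_space h. weight_vector h \<nu> w}" for w
  proof -
   obtain \<nu> where \<nu>: "weight_vector h \<nu> w" using w by blast
   hence "(lie s ^^ i) w = \<nu> s ^ i *\<^sub>C w" for i
    using assms(1) by(induction i) (simp_all add: weight_vector_def lie_simps mult.commute)
   hence "\<nu> s = 0 \<or> w = 0" using assms(3)[of w] by(metis clin.scale_eq_0_iff power_eq_0_iff)
   thus ?thesis using \<nu> assms(1) by(auto simp: weight_vector_def)
  qed
  hence "lie s u : {0}"
   by(intro clinear_span_subset[OF clinear_lie _ _
      weight_span[OF k_subspace subset_refl k_lie[OF subsetD[OF h_subset_k]] u]]) auto
  hence "lie s u = 0" by simp
  thus ?thesis using lie_anti[of u s] by simp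
 qed
qed

text \<open>A second root vector, corrected by a multiple of e, is killed by f. If nonzero, it would
  be a lowest weight vector with the positive eigenvalue 2.\<close>

lemma root_space_one_dim:
 assumes "\<alpha> : dual_space h" "\<alpha> ~= 0" "e : k" "weight_vector h \<alpha> e" "e ~= 0"
  "y : k" "weight_vector h \<alpha> y"
 shows "EX c. y = c *\<^sub>C e"
proof -
 obtain f t where f: "f : k" "weight_vector h (- \<alpha>) f" and t: "t : h" "\<alpha> t = 2"
  and sl2: "sl2_triple e f t" by(rule exists_sl2[OF assms(1-5)])
 interpret sl2_triple e f t by(rule sl2)
 \<comment> \<open>Chosen, in view of \<alpha> t = 2, so that \<alpha> vanishes on [z, f]. The
   Heisenberg argument then makes [z, f] nilpotent, hence 0.\<close>
 let ?c = "\<alpha> (lie y f) / 2"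
 define z where "z = y - ?c *\<^sub>C e"
 have zk: "z : k" unfolding z_def
  using assms(3,6) k_subspace by(simp add: clin.subspace_diff clin.subspace_scale)
 have zw: "weight_vector h \<alpha> z"
  using assms(4,7) by(simp add: z_def weight_vector_def lie_simps lie_diff_right
    clin.scale_right_diff_distrib mult.commute)
 define s where "s = lie z f"
 have s: "s : h" unfolding s_def by(rule weight_bracket_h[OF zk zw f])
 have yf: "lie y f : h" by(rule weight_bracket_h[OF assms(6,7) f])
 have "\<alpha> s = \<alpha> (lie y f + (- ?c) *\<^sub>C t)" by(simp add: s_def z_def lie_diff_left lie_simps ef)
 also have "... = \<alpha> (lie y f) + \<alpha> ((- ?c) *\<^sub>C t)"
  using assms(1) yf t(1) clin.subspace_scale[OF h_subspace] unfolding dual_space_def by blast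
 also have "\<alpha> ((- ?c) *\<^sub>C t) = - ?c * \<alpha> t" using assms(1) t(1) unfolding dual_space_def by blast
 finally have "\<alpha> s = 0" using t(2) by simp
 hence "lie s z = 0" "lie s f = 0" using zw f(2) s by(simp_all add: weight_vector_def)
 then obtain n where n: "!!v. (lie s ^^ n) v = 0" using heisenberg_nilpotent[OF s_def] by blast
 have "s : brackets k k" unfolding s_def by(rule bracket_mem[OF zk f(1)])
 hence "s = 0" using nilpotent_h_zero[OF s _ n] by blast
 hence fz: "lie f z = 0" using lie_anti[of f z] by(simp add: s_def)
 have tz: "lie t z = 2 *\<^sub>C z" using zw t by(simp add: weight_vector_def)
 have "z = 0"
 proof (rule ccontr)
  assume "z ~= 0"
  then obtain m :: nat where "2 = - (of_nat m :: complex)" using lowest_weight[OF fz tz] by blast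
  hence "Re 2 = Re (- (of_nat m :: complex))" by(rule arg_cong)
  thus False by simp
 qed
 thus ?thesis unfolding z_def by auto
qed

lemma roots_iff:
 "\<alpha> : roots k h \<longleftrightarrow> \<alpha> : dual_space h & \<alpha> ~= 0 & (EX e:k. weight_vector h \<alpha> e & e ~= 0)"
 by(auto simp: roots_def weights_def weight_space_iff)

text \<open>Root spaces are lines, so the brackets of opposite root vectors fill the line through
  the t of a single sl2-triple, and the normalization at 2 makes the description in
  \<open>coroot\<close> pick t. The triple acts on all of g, which gives integrality there.\<close>

lemma coroot_facts:
 assumes "\<alpha> : roots k h"
 shows coroot_mem: "coroot k h \<alpha> : h" and coroot_pair: "\<alpha> (coroot k h \<alpha>) = 2"
  and coroot_integral: "lie (coroot k h \<alpha>) v = c *\<^sub>C v ==> v ~= 0 ==> c : \<int>"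
proof -
 obtain e where e: "\<alpha> : dual_space h" "\<alpha> ~= 0" "e : k" "weight_vector h \<alpha> e" "e ~= 0"
  using assms by(auto simp: roots_iff)
 obtain f t where f: "f : k" "weight_vector h (- \<alpha>) f" and t: "t : h" "\<alpha> t = 2"
  and sl2: "sl2_triple e f t" by(rule exists_sl2[OF e])
 interpret sl2_triple e f t by(rule sl2)
 have f0: "f ~= 0"
 proof
  assume "f = 0"
  hence "t = 0 *\<^sub>C t" using ef by simp
  moreover have "\<alpha> (0 *\<^sub>C t) = 0 * \<alpha> t" using e(1) t(1) unfolding dual_space_def by blast
  ultimately show False using t(2) by simp
 qed
 have sub: "brackets (weight_space h k \<alpha>) (weight_space h k (- \<alpha>)) <= clin.span {t}"
 proof (rule brackets_subset[OF clin.subspace_span])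
  fix e' f' assume "e' : weight_space h k \<alpha>" "f' : weight_space h k (- \<alpha>)"
  then obtain a b where "e' = a *\<^sub>C e" "f' = b *\<^sub>C f"
   using root_space_one_dim[OF e, of e'] e(2) root_space_one_dim[OF dual_space_minus[OF e(1)] _ f f0, of f']
   by(auto simp: weight_space_iff)
  hence "lie e' f' = (b * a) *\<^sub>C t" by(simp add: lie_simps ef mult.commute)
  thus "lie e' f' : clin.span {t}" by(simp add: clin.span_base clin.span_scale)
 qed
 have tmem: "t : brackets (weight_space h k \<alpha>) (weight_space h k (- \<alpha>))"
  using bracket_mem[of e "weight_space h k \<alpha>" f "weight_space h k (- \<alpha>)"] e f
  by(simp add: weight_space_iff ef)
 have co: "coroot k h \<alpha> = t"
  unfolding coroot_def
 proof (rule the_equality)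
  fix s assume s: "s : brackets (weight_space h k \<alpha>) (weight_space h k (- \<alpha>)) & \<alpha> s = 2"
  then obtain a where a: "s = a *\<^sub>C t" using sub by(auto simp: clin.span_singleton)
  hence "a * \<alpha> t = 2" using s e(1) t(1) by(simp add: dual_space_def)
  thus "s = t" using a t(2) by simp
 qed (use tmem t in blast)
 show "coroot k h \<alpha> : h" "\<alpha> (coroot k h \<alpha>) = 2" using co t by simp_all
 show "lie (coroot k h \<alpha>) v = c *\<^sub>C v ==> v ~= 0 ==> c : \<int>" unfolding co by(rule eigenvalue_integral)
qed

lemma weights_finite:
 assumes "clin.subspace W" "W <= k" "!!x w. x : h ==> w : W ==> lie x w : W"
 shows "finite (weights h W)"
proof -
 obtain X wt where X: "finite X" "clin.independent X" "X <= W" "clin.span X = W"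
  "ALL x:X. wt x : dual_space h" "ALL x:X. weight_vector h (wt x) x"
  by(rule weight_basis[OF assms])
 have "\<nu> : wt ` X" if \<nu>: "\<nu> : weights h W" for \<nu>
 proof -
  obtain v where v: "\<nu> : dual_space h" "v : W" "weight_vector h \<nu> v" "v ~= 0"
   using \<nu> by(auto simp: weights_def weight_space_iff)
  have vX: "v : clin.span X" using v(2) X(4) by simp
  have "v = (\<Sum>x\<in>X. clin.representation X v x *\<^sub>C x)"
   using clin.sum_representation_eq[OF X(2) vX X(1)] by simp
  then obtain x where "x : X" "clin.representation X v x ~= 0"
   using v(4) by(metis (no_types, lifting) clin.scale_eq_0_iff sum.neutral)
  hence "wt x = \<nu>" using representation_weight[OF X(1,2) _ _ v(1) vX v(3)] X(5,6) by blast
  thus ?thesis using \<open>x : X\<close> by blast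
 qed
 thus ?thesis using X(1) by(meson finite_imageI finite_subset subsetI)
qed

lemma roots_finite: "finite (roots k h)"
 unfolding roots_def
 using weights_finite[OF k_subspace subset_refl k_lie[OF subsetD[OF h_subset_k]]] by simp

text \<open>A root space is a line, so it lies in \<open>np\<close> once it meets \<open>np\<close>.
  For the opposite root the component in \<open>h\<close> is 0 by weight. A nonzero component in
  \<open>np\<close> would put f and hence t = [e, f] into \<open>np\<close>, which acts nilpotently
  although [t, e] = 2 e.\<close>

lemma positive_root:
 assumes "\<gamma> : weights h np"
 shows positive_root_dual: "\<gamma> : dual_space h" and positive_root_nonzero: "\<gamma> ~= 0"
  and positive_root_space: "e' : k ==> weight_vector h \<gamma> e' ==> e' : np"
  and negative_root_space: "f' : k ==> weight_vector h (- \<gamma>) f' ==> f' : nm"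
proof -
 obtain e where e: "\<gamma> : dual_space h" "e : np" "weight_vector h \<gamma> e" "e ~= 0"
  using assms by(auto simp: weights_def weight_space_iff)
 have ek: "e : k" using e(2) np_subset_k by blast
 show "\<gamma> : dual_space h" by(rule e)
 show \<gamma>0: "\<gamma> ~= 0"
 proof
  assume "\<gamma> = 0"
  hence "e : h" using zero_weight ek e(3) by blast
  thus False using h_np_disjoint e(2,4) by blast
 qed
 show "e' : np" if "e' : k" "weight_vector h \<gamma> e'" for e'
  using root_space_one_dim[OF e(1) \<gamma>0 ek e(3,4) that] e(2) clin.subspace_scale[OF np_subspace] by blast
 show "f' : nm" if f': "f' : k" "weight_vector h (- \<gamma>) f'" for f'
 proof -
  obtain f t where f: "f : k" "weight_vector h (- \<gamma>) f" and t: "t : h" "\<gamma> t = 2"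
   and sl2: "sl2_triple e f t" by(rule exists_sl2[OF e(1) \<gamma>0 ek e(3,4)])
  interpret sl2_triple e f t by(rule sl2)
  obtain a b c where abc: "a : nm" "b : h" "c : np" "f' = a + b + c"
   by(rule triangular_decompose[OF f'(1)])
  have w: "lie x a = (- \<gamma>) x *\<^sub>C a & lie x b = (- \<gamma>) x *\<^sub>C b & lie x c = (- \<gamma>) x *\<^sub>C c" if x: "x : h" for x
  proof (rule triangular_unique)
   show "lie x a : nm" "lie x c : np" using h_nm h_np x abc by auto
   show "lie x b : h" using h_abelian[OF x abc(2)] clin.subspace_0[OF h_subspace] by simp
   show "(- \<gamma>) x *\<^sub>C a : nm" "(- \<gamma>) x *\<^sub>C b : h" "(- \<gamma>) x *\<^sub>C c : np"
    using abc clin.subspace_scale nm_subspace h_subspace np_subspace by blast+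
   have "lie x f' = (- \<gamma>) x *\<^sub>C f'" using f'(2) x by(simp add: weight_vector_def)
   thus "lie x a + lie x b + lie x c = (- \<gamma>) x *\<^sub>C a + (- \<gamma>) x *\<^sub>C b + (- \<gamma>) x *\<^sub>C c"
    by(simp only: abc(4) lie_simps clin.scale_right_distrib)
  qed
  have "b = 0"
  proof -
   obtain x where x: "x : h" "\<gamma> x ~= 0" by(rule nonzero_functional[OF e(1) \<gamma>0])
   have "(- \<gamma>) x *\<^sub>C b = 0" using w[OF x(1)] h_abelian[OF x(1) abc(2)] by simp
   thus ?thesis using x(2) by simp
  qed
  moreover have "c = 0"
  proof (rule ccontr)
   assume c0: "c ~= 0"
   have ck: "c : k" using abc(3) np_subset_k by blast
   have cw: "weight_vector h (- \<gamma>) c" using w by(simp add: weight_vector_def)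
   obtain z where "f = z *\<^sub>C c"
    using root_space_one_dim[OF dual_space_minus[OF e(1)] _ ck cw c0 f] \<gamma>0 by auto
   hence "f : np" using abc(3) clin.subspace_scale[OF np_subspace] by blast
   hence tn: "t : np" using np_lie[OF e(2)] ef by blast
   obtain M where M: "!!xs v. set xs <= np ==> M <= length xs ==> foldr lie xs v = 0"
    using np_nilpotent by blast
   have "foldr lie (replicate n t) e = 2 ^ n *\<^sub>C e" for n
    by(induction n) (simp_all add: te lie_simps mult.commute)
   moreover have "foldr lie (replicate M t) e = 0" by(rule M) (use tn in \<open>simp_all add: set_replicate_conv_if\<close>)
   ultimately show False using e(4) by simp
  qed
  ultimately show ?thesis using abc by simp
 qed
qed

end

section \<open>Free algebras and presentations\<close>

abbreviation fword :: "'x list => 'x falg" where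
 "fword w \<equiv> prod_list (map fgen w)"

abbreviation "FA X \<equiv> carrier (free_algebra X)"

lemma fword_eq_single: "fword w = Poly_Mapping.single (Word w) 1"
proof (induction w)
 case Nil
 have "Word [] = (0 :: 'a word)" by(simp add: zero_word_def)
 thus ?case by simp
next
 case (Cons x w)
 thus ?case by(simp add: fgen_def mult_single plus_word_def)
qed

lemma fconst_simps [simp]: "fconst 0 = 0" "fconst 1 = 1"
 by(simp_all add: fconst_def)

lemma fconst_add: "fconst (a + b) = fconst a + fconst b"
 and fconst_mult: "fconst (a * b) = fconst a * fconst b"
 by(simp_all add: fconst_def single_add mult_single)

lemma fconst_minus: "fconst (- a) = - fconst a"
 by(metis add_eq_0_iff fconst_add fconst_simps(1) ab_left_minus)

lemma fconst_fword: "fconst c * fword w = Poly_Mapping.single (Word w) c"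
 by(simp add: fword_eq_single fconst_def mult_single zero_word_def plus_word_def)

lemma falg_expand:
 "p = (\<Sum>w\<in>Poly_Mapping.keys p. fconst (Poly_Mapping.lookup p w) * fword (letters w))"
 by(rule poly_mapping_eqI) (simp add: fconst_fword lookup_sum lookup_single when_def sum.delta' in_keys_iff)

lemma falg_induct [case_names monomial add]:
 assumes "!!c w. P (fconst c * fword w)" "!!p q. P p ==> P q ==> P (p + q)"
 shows "P p"
proof -
 have "P (\<Sum>w\<in>K. fconst (Poly_Mapping.lookup p w) * fword (letters w))" if "finite K" for K
  using that
 proof induction
  case empty
  show ?case using assms(1)[of 0 "[]"] by simp
 qed (simp add: assms)
 thus ?thesis using falg_expand[of p] by(metis finite_keys)
qed

lemma fconst_central: "fconst c * p = p * fconst c"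
proof (induction p rule: falg_induct)
 case (monomial d w)
 have "fword w * fconst c = fconst c * fword w"
  by(simp add: fword_eq_single fconst_def mult_single zero_word_def plus_word_def)
 thus ?case
  by(simp only: mult.assoc) (simp only: mult.assoc[symmetric] fconst_mult[symmetric] mult.commute[of c])
qed (simp add: algebra_simps)

text \<open>Scalars acting through a central ring homomorphism; the instances are the scalars of a
 free algebra and the complex numbers themselves.\<close>

locale central_scalars =
 fixes s :: "complex => 'r::ring_1"
 assumes s_add: "s (a + b) = s a + s b" and s_mult: "s (a * b) = s a * s b"
  and s_one: "s 1 = 1" and s_central: "s a * r = r * s a"
begin

lemma s_zero: "s 0 = 0"
 using s_add[of 0 0] by simp

text \<open>Linear extension of a function on words, the common source of homomorphisms
  (\<open>fhom\<close>) and of actions (\<open>flact\<close>).\<close>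

definition flin :: "('x list => 'r) => 'x falg => 'r" where
 "flin f p = (\<Sum>w\<in>Poly_Mapping.keys p. s (Poly_Mapping.lookup p w) * f (letters w))"

lemma flin_superset:
 assumes "finite K" "Poly_Mapping.keys p <= K"
 shows "flin f p = (\<Sum>w\<in>K. s (Poly_Mapping.lookup p w) * f (letters w))"
 unfolding flin_def using assms by(intro sum.mono_neutral_left) (auto simp: in_keys_iff s_zero)

lemma flin_add: "flin f (p + q) = flin f p + flin f q"
proof -
 let ?K = "Poly_Mapping.keys p \<union> Poly_Mapping.keys q"
 have "flin f (p + q) = (\<Sum>w\<in>?K. s (Poly_Mapping.lookup (p + q) w) * f (letters w))"
  by(rule flin_superset) (simp_all add: keys_add)
 also have "... = flin f p + flin f q"
  by(simp add: flin_superset[of ?K p] flin_superset[of ?K q] lookup_add s_add distrib_right sum.distrib)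
 finally show ?thesis .
qed

lemma flin_term: "flin f (fconst c * fword w) = s c * f w"
 by(simp add: fconst_fword flin_superset[of "{Word w}"])

lemma flin_fword: "flin f (fword w) = f w"
 using flin_term[of f 1 w] by(simp add: s_one)

lemma flin_fgen: "flin f (fgen x) = f [x]"
 using flin_fword[of f "[x]"] by simp

lemma flin_fconst: "flin f (fconst c) = s c * f []"
 using flin_term[of f c "[]"] by simp

lemma flin_scale: "flin f (fconst c * p) = s c * flin f p"
proof (induction p rule: falg_induct)
 case (monomial d w)
 have "fconst c * (fconst d * fword w) = fconst (c * d) * fword w" by(simp add: fconst_mult mult.assoc)
 thus ?case by(simp add: flin_term s_mult mult.assoc)
qed (simp add: flin_add distrib_left)

lemma flin_zero [simp]: "flin f 0 = 0"
 by(simp add: flin_def)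

lemma flin_minus: "flin f (- p) = - flin f p"
 by(metis add_eq_0_iff flin_add flin_zero ab_left_minus)

lemma flin_diff: "flin f (p - q) = flin f p - flin f q"
 using flin_add[of f p "- q"] by(simp add: flin_minus)

lemma flin_sum: "flin f (sum g A) = (\<Sum>x\<in>A. flin f (g x))"
 by(induction A rule: infinite_finite_induct) (simp_all add: flin_add)

definition fhom :: "('x => 'r) => 'x falg => 'r" where
 "fhom g = flin (%w. prod_list (map g w))"

lemma fhom_simps: "fhom g (fgen x) = g x" "fhom g (fconst c) = s c" "fhom g 0 = 0" "fhom g 1 = 1"
 "fhom g (p + q) = fhom g p + fhom g q" "fhom g (p - q) = fhom g p - fhom g q"
 "fhom g (- p) = - fhom g p"
 using flin_fconst[of "%w. prod_list (map g w)" 1]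
 by(simp_all add: fhom_def flin_fgen flin_fconst flin_add flin_diff flin_minus s_one)

lemma fhom_mult: "fhom g (p * q) = fhom g p * fhom g q"
proof (induction p rule: falg_induct)
 case (monomial c u)
 show ?case
 proof (induction q rule: falg_induct)
  case (monomial d v)
  have "fconst c * fword u * (fconst d * fword v) = fconst (c * d) * fword (u @ v)"
   unfolding fconst_fword mult_single plus_word_def by simp
  moreover have "s c * a * (s d * b) = s (c * d) * (a * b)" for a b
  proof -
   have "s c * a * (s d * b) = s c * (a * s d) * b" by(simp only: mult.assoc)
   also have "... = s c * (s d * a) * b" by(simp only: s_central[of d a])
   finally show ?thesis by(simp only: s_mult mult.assoc)
  qed
  ultimately show ?case
   using flin_term[of "%w. prod_list (map g w)" "c * d" "u @ v"] by(simp add: fhom_def flin_term)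
 qed (simp add: fhom_simps distrib_left)
qed (simp add: fhom_simps distrib_right)

definition flact :: "('x => 'r => 'r) => 'x falg => 'r => 'r" where
 "flact L p m = flin (%w. foldr L w m) p"

end

interpretation fs: central_scalars "fconst :: complex => 'y falg"
 by unfold_locales (rule fconst_add fconst_mult fconst_simps fconst_central)+

interpretation cs: central_scalars "%c::complex. c"
 by unfold_locales (simp_all add: mult.commute)

lemma falg_hom_ext:
 assumes "!!p q. F (p + q) = F p + (F q :: 'r::ring_1)" "!!p q. F (p * q) = F p * F q"
  "!!p q. G (p + q) = G p + G q" "!!p q. G (p * q) = G p * G q" "F 1 = 1" "G 1 = 1"
  "!!c. F (fconst c) = G (fconst c)" "!!x. F (fgen x) = G (fgen x)"
 shows "F p = G p"
proof (induction p rule: falg_induct)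
 case (monomial c w)
 have "F (fword w) = G (fword w)" by(induction w) (simp_all add: assms)
 thus ?case by(simp add: assms)
qed (simp add: assms)

lemma frename_eq: "frename f p = fs.fhom (%x. fgen (f x)) p"
 unfolding frename_def fs.fhom_def fs.flin_def
 by(intro sum.cong refl) (simp add: fconst_fword[symmetric] comp_def)

lemmas frename_simps = fs.fhom_simps[where g = "%x. fgen (f x)" for f, folded frename_eq]
 fs.fhom_mult[where g = "%x. fgen (f x)" for f, folded frename_eq]

lemma free_algebra_simps:
 "\<zero>\<^bsub>free_algebra X\<^esub> = 0" "\<one>\<^bsub>free_algebra X\<^esub> = 1" "p \<oplus>\<^bsub>free_algebra X\<^esub> q = p + q"
 "p \<otimes>\<^bsub>free_algebra X\<^esub> q = p * q"
 by(simp_all add: free_algebra_def)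

lemma free_algebra_mem:
 "p : FA X \<longleftrightarrow> (ALL w:Poly_Mapping.keys p. set (letters w) <= X)"
 by(simp add: free_algebra_def)

lemma free_algebra_closed [simp, intro]:
 "0 : FA X" "fconst c : FA X" "1 : FA X"
 "p : FA X ==> - p : FA X"
 "p : FA X ==> q : FA X ==> p + q : FA X"
 "p : FA X ==> q : FA X ==> p - q : FA X"
 "p : FA X ==> q : FA X ==> p * q : FA X"
proof -
 let ?C = "FA X"
 show "0 : ?C" "fconst c : ?C" "1 : ?C" "p : ?C ==> - p : ?C"
  unfolding free_algebra_mem by(simp_all add: fconst_def keys_one zero_word_def del: single_one)
 show "p : ?C ==> q : ?C ==> p + q : ?C" "p : ?C ==> q : ?C ==> p - q : ?C"
  unfolding free_algebra_mem using keys_add[of p q] keys_diff[of p q] by blast+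
 assume p: "p : ?C" and q: "q : ?C"
 have "set (letters w) <= X" if w: "w : Poly_Mapping.keys (p * q)" for w
 proof -
  obtain a b where "a : Poly_Mapping.keys p" "b : Poly_Mapping.keys q" "w = a + b"
   using keys_mult[of p q] w by blast
  thus ?thesis using p q unfolding free_algebra_mem by(simp add: plus_word_def)
 qed
 thus "p * q : ?C" unfolding free_algebra_mem by blast
qed

lemma free_algebra_fgen [simp]: "x : X ==> fgen x : FA X"
 unfolding free_algebra_mem by(simp add: fgen_def)

lemma free_algebra_fword: "set w <= X ==> fword w : FA X"
 by(induction w) auto

lemma free_algebra_sum: "(!!x. x : A ==> f x : FA X) ==> sum f A : FA X"
 by(induction A rule: infinite_finite_induct) auto

lemma free_algebra_induct [consumes 1, case_names const gen add mult]:
 assumes "p : FA X" "!!c. P (fconst c)" "!!x. x : X ==> P (fgen x)"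
  "!!p q. P p ==> P q ==> P (p + q)" "!!p q. P p ==> P q ==> P (p * q)"
 shows "P p"
proof -
 have 0: "P 0" and 1: "P 1" using assms(2)[of 0] assms(2)[of 1] by simp_all
 have "P (fword w)" if "set w <= X" for w
  using that by(induction w) (simp_all add: 1 assms)
 hence "P (fconst (Poly_Mapping.lookup p w) * fword (letters w))" if "w : Poly_Mapping.keys p" for w
  using that assms by(simp add: free_algebra_mem)
 hence "P (\<Sum>w\<in>K. fconst (Poly_Mapping.lookup p w) * fword (letters w))"
  if "K <= Poly_Mapping.keys p" for K
  using that
 proof (induction K rule: infinite_finite_induct)
  case (insert w K)
  thus ?case using assms(4) by simp
 qed (simp_all add: 0)
 from this[OF subset_refl] show ?thesis using falg_expand[of p] by simp
qed

lemma free_algebra_ring: "ring (free_algebra X)"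
proof (rule ringI)
 show "abelian_group (free_algebra X)"
 proof (rule abelian_groupI)
  fix x assume "x : FA X"
  thus "EX y:FA X. y \<oplus>\<^bsub>free_algebra X\<^esub> x = \<zero>\<^bsub>free_algebra X\<^esub>"
   by(intro bexI[of _ "- x"]) (auto simp: free_algebra_simps)
 qed (auto simp: free_algebra_simps add_ac)
 show "Group.monoid (free_algebra X)"
  by(rule monoidI) (auto simp: free_algebra_simps mult.assoc)
qed (auto simp: free_algebra_simps algebra_simps)

lemma free_algebra_minus:
 assumes "x : FA X" shows "\<ominus>\<^bsub>free_algebra X\<^esub> x = - x"
proof -
 interpret ring "free_algebra X" by(rule free_algebra_ring)
 have "- x \<oplus>\<^bsub>free_algebra X\<^esub> x = \<zero>\<^bsub>free_algebra X\<^esub>" by(simp add: free_algebra_simps)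
 thus ?thesis using assms minus_equality by blast
qed

definition frestrict :: "'x set => 'x falg => 'x falg" where
 "frestrict X = fs.fhom (%x. if x : X then fgen x else 0)"

lemma frestrict_mem: "frestrict X p : FA X"
proof (induction p rule: falg_induct)
 case (monomial c w)
 have "frestrict X (fword w) : FA X"
  by(induction w) (auto simp: frestrict_def fs.fhom_simps fs.fhom_mult)
 thus ?case by(auto simp: frestrict_def fs.fhom_simps fs.fhom_mult)
qed (auto simp: frestrict_def fs.fhom_simps)

lemma frestrict_id: "p : FA X ==> frestrict X p = p"
 by(induction p rule: free_algebra_induct) (simp_all add: frestrict_def fs.fhom_simps fs.fhom_mult)

definition two_sided_ideal :: "'r::ring_1 set => bool" where
 "two_sided_ideal K \<longleftrightarrow> 0 : K & (ALL a:K. ALL b:K. a + b : K) & (ALL a:K. ALL r. r * a : K & a * r : K)"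

lemma two_sided_idealD:
 assumes "two_sided_ideal K"
 shows "0 : K" "a : K ==> b : K ==> a + b : K" "a : K ==> r * a : K" "a : K ==> a * r : K"
  "a : K ==> - a : K" "a : K ==> b : K ==> a - b : K"
proof -
 show *: "0 : K" "a : K ==> b : K ==> a + b : K" "a : K ==> r * a : K" "a : K ==> a * r : K" for a b r
  using assms by(auto simp: two_sided_ideal_def)
 show m: "a : K ==> - a : K" for a using *(3)[of a "- 1"] by simp
 show "a : K ==> b : K ==> a - b : K" using *(2)[of a "- b"] m by simp
qed

text \<open>The quotient map is extended to all of \<open>'x falg\<close> by killing the letters outside \<open>X\<close>, so
 that computations in a presented algebra take place in a type.\<close>

definition pmap :: "'x set => 'x falg set => 'x falg => 'x falg set" where
 "pmap X R p = pclass X R (frestrict X p)"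

definition pker :: "'x set => 'x falg set => 'x falg set" where
 "pker X R = {p. frestrict X p : genideal (free_algebra X) R}"

locale presentation =
 fixes X :: "'x set" and R :: "'x falg set"
 assumes relators: "R <= FA X"
begin

sublocale F: ring "free_algebra X" by(rule free_algebra_ring)

sublocale gi: ideal "genideal (free_algebra X) R" "free_algebra X"
 by(rule F.genideal_ideal[OF relators])

lemma presented_ring: "ring (presented X R)"
 unfolding presented_def by(rule gi.quotient_is_ring)

lemma pker_ideal: "two_sided_ideal (pker X R)"
proof -
 let ?G = "genideal (free_algebra X) R"
 have "frestrict X 0 : ?G" using gi.zero_closed by(simp add: frestrict_def fs.fhom_simps free_algebra_simps)
 moreover have "a + b : ?G" if "a : ?G" "b : ?G" for a b
  using gi.a_closed[OF that] by(simp add: free_algebra_simps)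
 moreover have "r * a : ?G" "a * r : ?G" if "a : ?G" "r : FA X" for a r
  using gi.I_l_closed[OF that] gi.I_r_closed[OF that] by(simp_all add: free_algebra_simps)
 ultimately show ?thesis
  using frestrict_mem[of X] unfolding two_sided_ideal_def pker_def
  by(auto simp: frestrict_def fs.fhom_simps fs.fhom_mult)
qed

lemma pker_relator: "r : R ==> r : pker X R"
 using F.genideal_self[OF relators] relators by(auto simp: pker_def frestrict_id subsetD)

lemma pker_outside: "x \<notin> X ==> fgen x : pker X R"
 using gi.zero_closed by(simp add: pker_def frestrict_def fs.fhom_simps free_algebra_simps)

lemma genideal_subset:
 assumes K: "two_sided_ideal K" "R <= K"
 shows "genideal (free_algebra X) R <= K"
proof -
 note KD = two_sided_idealD[OF K(1)]
 have "ideal (K \<inter> FA X) (free_algebra X)"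
 proof (rule idealI[OF free_algebra_ring])
  show "subgroup (K \<inter> FA X) (add_monoid (free_algebra X))"
   by(rule F.add.subgroupI)
    (use KD in \<open>auto simp: free_algebra_simps free_algebra_minus simp flip: a_inv_def\<close>)
 qed (use KD in \<open>auto simp: free_algebra_simps\<close>)
 hence "genideal (free_algebra X) R <= K \<inter> FA X"
  using K(2) relators by(intro F.genideal_minimal) auto
 thus ?thesis by blast
qed

text \<open>As an ideal of the whole type, the kernel of \<open>pmap\<close> is generated by the
  relators and the letters outside \<open>X\<close>. This is how an action is shown to factor
  through a presented algebra.\<close>

lemma pker_minimal:
 assumes K: "two_sided_ideal K" "R <= K" and out: "!!x. x \<notin> X ==> fgen x : K"
 shows "pker X R <= K"
proof
 fix p assume "p : pker X R"
 hence p: "frestrict X p : genideal (free_algebra X) R" by(simp add: pker_def)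
 note KD = two_sided_idealD[OF K(1)]
 have "frestrict X p : K" using genideal_subset[OF K] p by blast
 moreover have "p - frestrict X p : K"
 proof (induction p rule: falg_induct)
  case (monomial c w)
  have "fword w - frestrict X (fword w) : K"
  proof (induction w)
   case (Cons x w)
   let ?y = "if x : X then fgen x else 0"
   have "fgen x - ?y : K" using out KD by simp
   hence "(fgen x - ?y) * fword w + ?y * (fword w - frestrict X (fword w)) : K"
    using Cons KD by blast
   thus ?case by(simp add: frestrict_def fs.fhom_simps fs.fhom_mult algebra_simps)
  qed (simp add: frestrict_def fs.fhom_simps KD)
  hence "fconst c * (fword w - frestrict X (fword w)) : K" using KD by blast
  thus ?case by(simp add: frestrict_def fs.fhom_simps fs.fhom_mult algebra_simps)
 next
  case (add p q)
  hence "(p - frestrict X p) + (q - frestrict X q) : K" using KD by blast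
  thus ?case by(simp add: frestrict_def fs.fhom_simps algebra_simps)
 qed
 ultimately show "p : K" using KD(2) by fastforce
qed

lemma pclass_hom: "pclass X R : ring_hom (free_algebra X) (presented X R)"
 unfolding presented_def pclass_def by(rule gi.rcos_ring_hom)

lemma pmap_hom:
 shows "pmap X R p : carrier (presented X R)"
  and "pmap X R (p + q) = pmap X R p \<oplus>\<^bsub>presented X R\<^esub> pmap X R q"
  and "pmap X R (p * q) = pmap X R p \<otimes>\<^bsub>presented X R\<^esub> pmap X R q"
  and "pmap X R 1 = \<one>\<^bsub>presented X R\<^esub>"
proof -
 note h = ring_hom_closed[OF pclass_hom] ring_hom_add[OF pclass_hom] ring_hom_mult[OF pclass_hom]
  ring_hom_one[OF pclass_hom]
 show "pmap X R p : carrier (presented X R)" by(simp add: pmap_def h frestrict_mem)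
 show "pmap X R (p + q) = pmap X R p \<oplus>\<^bsub>presented X R\<^esub> pmap X R q"
  "pmap X R (p * q) = pmap X R p \<otimes>\<^bsub>presented X R\<^esub> pmap X R q"
  "pmap X R 1 = \<one>\<^bsub>presented X R\<^esub>"
  using h(2,3)[OF frestrict_mem frestrict_mem, of p q] h(4)
  by(simp_all add: pmap_def free_algebra_simps)
   (simp_all add: frestrict_def fs.fhom_simps fs.fhom_mult)
qed

lemma pmap_eq_iff: "pmap X R p = pmap X R q \<longleftrightarrow> p - q : pker X R"
proof -
 have "pmap X R p = pmap X R q \<longleftrightarrow>
   frestrict X p \<ominus>\<^bsub>free_algebra X\<^esub> frestrict X q : genideal (free_algebra X) R"
  unfolding pmap_def pclass_def
  by(rule F.quotient_eq_iff_same_a_r_cos[symmetric]) (auto simp: gi.is_ideal frestrict_mem)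
 also have "frestrict X p \<ominus>\<^bsub>free_algebra X\<^esub> frestrict X q = frestrict X (p - q)"
  unfolding a_minus_def free_algebra_minus[OF frestrict_mem]
  by(simp add: free_algebra_simps frestrict_def fs.fhom_simps)
 finally show ?thesis by(simp add: pker_def)
qed

lemma pmap_surj: "a : carrier (presented X R) ==> EX p:FA X. a = pmap X R p"
 unfolding presented_def FactRing_def pmap_def pclass_def
 by(auto simp: A_RCOSETS_def' frestrict_id)

lemma pmap_zero: "pmap X R 0 = \<zero>\<^bsub>presented X R\<^esub>"
proof -
 interpret P: ring "presented X R" by(rule presented_ring)
 have "pmap X R 0 \<oplus>\<^bsub>presented X R\<^esub> pmap X R 0 = pmap X R 0"
  using pmap_hom(2)[of 0 0] by simp
 thus ?thesis using pmap_hom(1)[of 0] P.r_zero P.add.l_cancel_one by auto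
qed

lemma pmap_uminus: "pmap X R (- p) = \<ominus>\<^bsub>presented X R\<^esub> pmap X R p"
proof -
 interpret P: ring "presented X R" by(rule presented_ring)
 have "pmap X R (- p) \<oplus>\<^bsub>presented X R\<^esub> pmap X R p = \<zero>\<^bsub>presented X R\<^esub>"
  using pmap_hom(2)[of "- p" p] by(simp add: pmap_zero)
 thus ?thesis using P.minus_equality pmap_hom(1) by metis
qed

lemma pmap_sum:
 assumes "finite A"
 shows "pmap X R (sum f A) = finsum (presented X R) (%x. pmap X R (f x)) A"
proof -
 interpret P: ring "presented X R" by(rule presented_ring)
 show ?thesis
  using assms by(induction A) (simp_all add: pmap_zero pmap_hom P.finsum_insert Pi_iff)
qed

end

section \<open>A Poincare-Birkhoff-Witt theorem relative to \<open>h\<close>\<close>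

text \<open>The module induced from the character \<open>\<theta>\<close> of \<open>h\<close> has the sorted words in the letters
 \<open>X\<close> as a basis. An arbitrary word is brought to this form by \<open>straighten\<close>, where an element
 \<open>y\<close> of \<open>h\<close> in front of a word \<open>v\<close> is evaluated at \<open>\<theta>\<close> plus the weight of \<open>v\<close>.\<close>

locale pbw_basis =
 fixes h X H :: "'g::fin_dim_complex_lie_algebra set" and rk :: "'g => nat"
  and wt :: "'g => 'g => complex" and \<theta> :: "'g => complex"
 assumes indep: "clin.independent (X \<union> H)" and disj: "X \<inter> H = {}"
  and spanning: "clin.span (X \<union> H) = UNIV" and spanH: "clin.span H = h"
  and rk_inj: "inj_on rk X" and abelian: "!!x y. x : h ==> y : h ==> lie x y = 0"
  and wt: "!!x. x : X ==> weight_vector h (wt x) x" and wt_dual: "!!x. x : X ==> wt x : dual_space h"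
  and \<theta>_dual: "\<theta> : dual_space h"
begin

lemma finite_XH: "finite X" "finite H"
 using cfin.finiteI_independent[OF indep] by auto

definition cf :: "'g => 'g => complex" where
 "cf g z = clin.representation (X \<union> H) g z"

definition hpart :: "'g => 'g" where
 "hpart g = (\<Sum>b\<in>H. cf g b *\<^sub>C b)"

lemma cf_linear: "cf (a + b) z = cf a z + cf b z" "cf (r *\<^sub>C a) z = r * cf a z"
 by(simp_all add: cf_def clin.representation_add[OF indep] clin.representation_scale[OF indep] spanning)

lemma hpart_linear: "hpart (a + b) = hpart a + hpart b" "hpart (r *\<^sub>C a) = r *\<^sub>C hpart a"
 by(simp_all add: hpart_def cf_linear clin.scale_left_distrib sum.distrib clin.scale_sum_right)

lemma h_subspace: "clin.subspace h"
 using spanH clin.subspace_span by blast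

lemma hpart_mem: "hpart g : h"
 unfolding hpart_def spanH[symmetric] by(intro clin.span_sum clin.span_scale clin.span_base)

lemma decompose: "g = (\<Sum>z\<in>X. cf g z *\<^sub>C z) + hpart g"
proof -
 have "(\<Sum>z\<in>X \<union> H. cf g z *\<^sub>C z) = g"
  unfolding cf_def by(rule clin.sum_representation_eq[OF indep]) (simp_all add: spanning finite_XH)
 thus ?thesis unfolding hpart_def using finite_XH disj by(simp add: sum.union_disjoint)
qed

lemma cf_X: "x : X ==> cf x z = (if z = x then 1 else 0)" and hpart_X: "x : X ==> hpart x = 0"
proof -
 show *: "cf x z = (if z = x then 1 else 0)" if "x : X" for x z
  using that by(simp add: cf_def clin.representation_basis[OF indep])
 show "x : X ==> hpart x = 0"
  unfolding hpart_def using disj by(intro sum.neutral) (auto simp: *)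
qed

lemma cf_h: "y : h ==> z : X ==> cf y z = 0" and hpart_h: "y : h ==> hpart y = y"
proof -
 show *: "cf y z = 0" if "y : h" "z : X" for y z
  unfolding cf_def using that disj by(intro representation_zero_outside[OF indep, of _ H]) (auto simp: spanH)
 show "y : h ==> hpart y = y" using decompose[of y] by(simp add: *)
qed

lemma homogeneous:
 assumes "weight_vector h \<nu> g" "\<nu> : dual_space h"
 shows cf_weight: "z : X ==> cf g z ~= 0 ==> wt z = \<nu>" and hpart_weight: "hpart g ~= 0 ==> \<nu> = 0"
proof -
 define wt' where "wt' z = (if z : X then wt z else 0)" for z
 have w: "weight_vector h (wt' z) z" if "z : X \<union> H" for z
  using that wt abelian clin.span_base[of z H] spanH by(auto simp: wt'_def weight_vector_def)
 have d: "wt' z : dual_space h" for z by(auto simp: wt'_def wt_dual dual_space_zero)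
 have *: "wt' z = \<nu>" if "z : X \<union> H" "cf g z ~= 0" for z
  using that w d assms finite_XH spanning unfolding cf_def
  by(intro representation_weight[OF _ indep]) auto
 show "z : X ==> cf g z ~= 0 ==> wt z = \<nu>" using *[of z] by(simp add: wt'_def)
 assume "hpart g ~= 0"
 then obtain b where "b : H" "cf g b ~= 0"
  unfolding hpart_def by(metis (no_types, lifting) clin.scale_eq_0_iff sum.neutral)
 thus "\<nu> = 0" using *[of b] disj by(auto simp: wt'_def)
qed

definition wtw :: "'g list => 'g => complex" where
 "wtw w = sum_list (map wt w)"

lemma wtw_simps [simp]: "wtw [] = 0" "wtw (x # w) = wt x + wtw w" "wtw (u @ v) = wtw u + wtw v"
 by(simp_all add: wtw_def)

lemma wtw_dual: "set w <= X ==> wtw w : dual_space h"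
 by(induction w) (auto simp: dual_space_zero intro!: dual_space_add wt_dual)

text \<open>\<open>slot \<nu> g \<phi>\<close> expands \<open>g\<close> in the basis: a letter \<open>z\<close> contributes \<open>\<phi> [z]\<close>, the part in
 \<open>h\<close> is evaluated at \<open>\<nu>\<close>.\<close>

definition slot :: "('g => complex) => 'g => ('g list => 'g falg) => 'g falg" where
 "slot \<nu> g \<phi> = (\<Sum>z\<in>X. fconst (cf g z) * \<phi> [z]) + fconst (\<nu> (hpart g)) * \<phi> []"

lemma slot_add: "\<nu> : dual_space h ==> slot \<nu> (a + b) \<phi> = slot \<nu> a \<phi> + slot \<nu> b \<phi>"
 by(simp add: slot_def cf_linear hpart_linear hpart_mem dual_space_def fconst_add distrib_right
   sum.distrib algebra_simps)

lemma slot_scale: "\<nu> : dual_space h ==> slot \<nu> (r *\<^sub>C a) \<phi> = fconst r * slot \<nu> a \<phi>"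
 by(simp add: slot_def cf_linear hpart_linear hpart_mem dual_space_def fconst_mult distrib_left
   sum_distrib_left mult.assoc)

lemma slot_zero: "\<nu> : dual_space h ==> slot \<nu> 0 \<phi> = 0"
 using slot_scale[of \<nu> 0 0 \<phi>] by simp

lemma slot_minus: "\<nu> : dual_space h ==> slot \<nu> (- a) \<phi> = - slot \<nu> a \<phi>"
 using slot_scale[of \<nu> "- 1" a \<phi>] by(simp add: fconst_minus)

lemma slot_diff: "\<nu> : dual_space h ==> slot \<nu> (a - b) \<phi> = slot \<nu> a \<phi> - slot \<nu> b \<phi>"
 using slot_add[of \<nu> a "- b"] by(simp add: slot_minus)

lemma slot_sum: "\<nu> : dual_space h ==> slot \<nu> (sum f A) \<phi> = (\<Sum>a\<in>A. slot \<nu> (f a) \<phi>)"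
 by(induction A rule: infinite_finite_induct) (simp_all add: slot_zero slot_add)

lemma dual_space_at_0: "\<nu> : dual_space h ==> \<nu> 0 = 0"
 using clin.subspace_0[OF h_subspace] unfolding dual_space_def
 by(metis (mono_tags, lifting) clin.scale_zero_left mem_Collect_eq mult_zero_left)

lemma slot_X: "x : X ==> \<nu> : dual_space h ==> slot \<nu> x \<phi> = \<phi> [x]"
proof -
 assume x: "x : X" and \<nu>: "\<nu> : dual_space h"
 have "(\<Sum>z\<in>X. fconst (cf x z) * \<phi> [z]) = (\<Sum>z\<in>X. if z = x then \<phi> [x] else 0)"
  using x by(intro sum.cong) (auto simp: cf_X)
 thus ?thesis using x finite_XH by(simp add: slot_def hpart_X dual_space_at_0[OF \<nu>])
qed

lemma slot_h: "y : h ==> slot \<nu> y \<phi> = fconst (\<nu> y) * \<phi> []"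
 by(simp add: slot_def cf_h hpart_h)

lemma slot_fun:
 shows slot_fun_add: "slot \<nu> g (%t. \<phi> t + \<psi> t) = slot \<nu> g \<phi> + slot \<nu> g \<psi>"
  and slot_fun_scale: "slot \<nu> g (%t. fconst r * \<phi> t) = fconst r * slot \<nu> g \<phi>"
  and slot_fun_sum: "slot \<nu> g (%t. \<Sum>a\<in>A. \<zeta> a t) = (\<Sum>a\<in>A. slot \<nu> g (\<zeta> a))"
proof -
 show *: "slot \<nu> g (%t. \<phi> t + \<psi> t) = slot \<nu> g \<phi> + slot \<nu> g \<psi>" for \<phi> \<psi>
  by(simp add: slot_def sum.distrib algebra_simps)
 have comm: "fconst a * (fconst r * p) = fconst r * (fconst a * p)" for a and p :: "'g falg"
  by(simp only: mult.assoc[symmetric] fconst_mult[symmetric] mult.commute)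
 show "slot \<nu> g (%t. fconst r * \<phi> t) = fconst r * slot \<nu> g \<phi>"
  by(simp add: slot_def sum_distrib_left distrib_left comm)
 have "slot \<nu> g (%t. 0) = 0" by(simp add: slot_def)
 thus "slot \<nu> g (%t. \<Sum>a\<in>A. \<zeta> a t) = (\<Sum>a\<in>A. slot \<nu> g (\<zeta> a))"
  by(induction A rule: infinite_finite_induct) (simp_all add: *)
qed

lemma slot_swap: "slot \<nu> g (%t. slot \<nu>' g' (%t'. \<phi> t t')) = slot \<nu>' g' (%t'. slot \<nu> g (%t. \<phi> t t'))"
proof -
 have "slot \<nu> g (%t. slot \<nu>' g' (%t'. \<phi> t t'))
   = (\<Sum>z\<in>X. fconst (cf g' z) * slot \<nu> g (%t. \<phi> t [z])) + fconst (\<nu>' (hpart g')) * slot \<nu> g (%t. \<phi> t [])"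
  by(simp add: slot_def[of \<nu>' g'] slot_fun_add slot_fun_sum slot_fun_scale)
 thus ?thesis by(simp add: slot_def[of \<nu>' g'])
qed

text \<open>The point at which an element of \<open>h\<close> is evaluated depends on the weight of
  the word behind it. For homogeneous g only replacements t of the weight of g contribute, so
  exchanging g for t does not move the evaluation points further left.\<close>

lemma slot_cong:
 assumes "weight_vector h \<mu> g" "\<mu> : dual_space h" "\<nu> : dual_space h"
  "!!t. set t <= X ==> length t <= 1 ==> wtw t = \<mu> ==> \<phi> t = \<psi> t"
 shows "slot \<nu> g \<phi> = slot \<nu> g \<psi>"
proof -
 have "fconst (cf g z) * \<phi> [z] = fconst (cf g z) * \<psi> [z]" if "z : X" for z
  using assms(4)[of "[z]"] cf_weight[OF assms(1,2) that] that by(cases "cf g z = 0") auto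
 moreover have "fconst (\<nu> (hpart g)) * \<phi> [] = fconst (\<nu> (hpart g)) * \<psi> []"
 proof (cases "hpart g = 0")
  case True
  thus ?thesis using dual_space_at_0[OF assms(3)] by simp
 next
  case False
  thus ?thesis using assms(4)[of "[]"] hpart_weight[OF assms(1,2)] by simp
 qed
 ultimately show ?thesis unfolding slot_def by(metis (no_types, lifting) sum.cong)
qed

lemma weight_bracket: "x : X ==> y : X ==> weight_vector h (wt x + wt y) (lie x y)"
 and weight_bracket_dual: "x : X ==> y : X ==> wt x + wt y : dual_space h"
 by(auto intro: weight_vector_lie wt dual_space_add wt_dual)

lemma shifted_dual: "set w <= X ==> \<theta> + wtw w : dual_space h"
 by(intro dual_space_add \<theta>_dual wtw_dual)

abbreviation sorted_word :: "'g list => bool" where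
 "sorted_word \<equiv> sorted_wrt (%a b. rk a <= rk b)"

primrec inversions :: "'g list => nat" where
 "inversions [] = 0"
| "inversions (a # w) = length (filter (%b. rk b < rk a) w) + inversions w"

lemma inversions_swap: "rk y < rk x ==> inversions (u @ y # x # v) < inversions (u @ x # y # v)"
 by(induction u) auto

lemma exists_descent:
 assumes "\<not> sorted_word w"
 shows "EX u x y v. w = u @ x # y # v & rk y < rk x & sorted_word (u @ [x])"
 using assms
proof (induction w rule: rev_induct)
 case (snoc a w)
 show ?case
 proof (cases "sorted_word w")
  case True
  with snoc.prems obtain b where b: "b : set w" "rk a < rk b" by(auto simp: sorted_wrt_append)
  then obtain w' c where w: "w = w' @ [c]" by(metis empty_iff list.set(1) rev_exhaust)
  have "rk b <= rk c" using b(1) True by(auto simp: w sorted_wrt_append)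
  thus ?thesis using b(2) True w by(intro exI[of _ w'] exI[of _ c] exI[of _ a] exI[of _ "[]"]) simp
 next
  case False
  then obtain u x y v where "w = u @ x # y # v" "rk y < rk x" "sorted_word (u @ [x])"
   using snoc.IH by blast
  thus ?thesis by(intro exI[of _ u] exI[of _ x] exI[of _ y] exI[of _ "v @ [a]"]) simp
 qed
qed simp

text \<open>The condition on \<open>u @ [x]\<close> makes this the leftmost descent, which is used
  when it is compared with an arbitrary one.\<close>

definition descent :: "'g list => 'g list \<times> 'g \<times> 'g \<times> 'g list" where
 "descent w = (SOME (u, x, y, v). w = u @ x # y # v & rk y < rk x & sorted_word (u @ [x]))"

lemma descentD:
 assumes "\<not> sorted_word w" "descent w = (u, x, y, v)"
 shows "w = u @ x # y # v" "rk y < rk x" "sorted_word (u @ [x])"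
proof -
 have "case descent w of (u, x, y, v) => w = u @ x # y # v & rk y < rk x & sorted_word (u @ [x])"
  unfolding descent_def
 proof (rule someI_ex)
  obtain u x y v where "w = u @ x # y # v & rk y < rk x & sorted_word (u @ [x])"
   using exists_descent[OF assms(1)] by blast
  thus "EX p. case p of (u, x, y, v) => w = u @ x # y # v & rk y < rk x & sorted_word (u @ [x])"
   by(intro exI[of _ "(u, x, y, v)"]) simp
 qed
 thus "w = u @ x # y # v" "rk y < rk x" "sorted_word (u @ [x])" using assms(2) by auto
qed

lemma descent_measures:
 assumes "\<not> sorted_word w" "(u, p) = descent w" "(x, q) = p" "(y, v) = q"
 shows "(u @ y # x # v, w) : measures [length, inversions]"
  "(u @ [z] @ v, w) : measures [length, inversions]" "(u @ [] @ v, w) : measures [length, inversions]"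
proof -
 note d = descentD[OF assms(1), of u x y v]
 have w: "w = u @ x # y # v" "rk y < rk x" using d assms(2-4) by auto
 show "(u @ y # x # v, w) : measures [length, inversions]"
  "(u @ [z] @ v, w) : measures [length, inversions]" "(u @ [] @ v, w) : measures [length, inversions]"
  using inversions_swap[OF w(2), of u v] by(simp_all add: w(1))
qed

text \<open>Fixing one descent makes the recursion deterministic; that any other descent leads to
  the same result is the content of \<open>straighten_swap_descent\<close>. Each word on the right
  is shorter or has fewer inversions.\<close>

function straighten :: "'g list => 'g falg" where
 "straighten w = (if sorted_word w then fword w else case descent w of (u, x, y, v) =>
   straighten (u @ y # x # v) + ((\<Sum>z\<in>X. fconst (cf (lie x y) z) * straighten (u @ [z] @ v))
    + fconst ((\<theta> + wtw v) (hpart (lie x y))) * straighten (u @ [] @ v)))"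
 by pat_completeness auto
termination
proof (relation "measures [length, inversions]", goal_cases)
 case 1
 show ?case by simp
next
 case 2
 thus ?case by(rule descent_measures(1))
next
 case 3
 thus ?case by(intro descent_measures(2))
next
 case 4
 thus ?case by(rule descent_measures(3))
qed

declare straighten.simps [simp del]

lemma straighten_sorted: "sorted_word w ==> straighten w = fword w"
 by(simp add: straighten.simps)

text \<open>\<open>slotw u g v\<close> is the straightening of \<open>u g v\<close> for an arbitrary vector \<open>g\<close>.\<close>

abbreviation slotw :: "'g list => 'g => 'g list => 'g falg" where
 "slotw u g v \<equiv> slot (\<theta> + wtw v) g (%t. straighten (u @ t @ v))"

lemma straighten_descent:
 "\<not> sorted_word w ==> descent w = (u, x, y, v) ==>
  straighten w = straighten (u @ y # x # v) + slotw u (lie x y) v"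
 by(subst straighten.simps) (simp add: slot_def)

text \<open>The rule g a v = a g v + [g, a] v. For the part of g in \<open>h\<close>, crossing a
  changes the evaluation point by \<open>wt a\<close>, and this change is exactly the bracket with
  a.\<close>

lemma slotw_commute:
 assumes a: "a : X" and v: "set v <= X"
  and swap: "!!z. z : X ==> straighten (u @ z # a # v) = straighten (u @ a # z # v) + slotw u (lie z a) v"
 shows "slotw u g (a # v) = slotw (u @ [a]) g v + slotw u (lie g a) v"
proof -
 note dv = shifted_dual[OF v]
 have "slotw u g (a # v) = (\<Sum>z\<in>X. fconst (cf g z) * straighten (u @ z # a # v))
   + fconst ((\<theta> + wtw v) (hpart g) + wt a (hpart g)) * straighten (u @ a # v)"
  by(simp add: slot_def algebra_simps)
 also have "... = slotw (u @ [a]) g v + ((\<Sum>z\<in>X. fconst (cf g z) * slotw u (lie z a) v)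
   + fconst (wt a (hpart g)) * straighten (u @ a # v))"
  by(simp add: slot_def[of _ g] swap fconst_add distrib_left distrib_right sum.distrib add_ac)
 also have "(\<Sum>z\<in>X. fconst (cf g z) * slotw u (lie z a) v) + fconst (wt a (hpart g)) * straighten (u @ a # v)
   = slotw u (\<Sum>z\<in>X. cf g z *\<^sub>C lie z a) v + slotw u (wt a (hpart g) *\<^sub>C a) v"
  using slot_X[OF a dv, of "%t. straighten (u @ t @ v)"]
  by(simp add: slot_sum[OF dv] slot_scale[OF dv])
 also have "... = slotw u (lie g a) v"
 proof -
  have "lie (hpart g) a = wt a (hpart g) *\<^sub>C a" using wt[OF a] hpart_mem by(simp add: weight_vector_def)
  hence "lie g a = (\<Sum>z\<in>X. cf g z *\<^sub>C lie z a) + wt a (hpart g) *\<^sub>C a"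
   by(subst decompose[of g]) (simp add: lie_simps lie_sum_left)
  thus ?thesis by(simp add: slot_add[OF dv])
 qed
 finally show ?thesis .
qed

text \<open>The diamond lemma: any descent may be resolved first. The given descent is compared with
  the leftmost one; the two coincide, overlap in a letter, or are disjoint.\<close>

lemma straighten_swap_descent:
 assumes "set (u @ x # y # v) <= X" "rk y < rk x"
 shows "straighten (u @ x # y # v) = straighten (u @ y # x # v) + slotw u (lie x y) v"
proof -
 let ?M = "measures [length, inversions]"
 let ?P = "%w. ALL u x y v. w = u @ x # y # v --> set w <= X --> rk y < rk x -->
  straighten (u @ x # y # v) = straighten (u @ y # x # v) + slotw u (lie x y) v"
 have "?P w" for w
 proof (induction w rule: wf_induct[OF wf_measures[of "[length, inversions]"]])
  case (1 w)
  hence IH: "straighten (u @ x # y # v) = straighten (u @ y # x # v) + slotw u (lie x y) v"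
   if "(u @ x # y # v, w) : ?M" "set (u @ x # y # v) <= X" "rk y < rk x" for u x y v
   using that by blast
  \<comment> \<open>On shorter words the rule is available for any two adjacent letters: equal
    letters have bracket 0, and antisymmetry covers the increasing order.\<close>
  have gen: "straighten (u @ x # y # v) = straighten (u @ y # x # v) + slotw u (lie x y) v"
   if l: "length (u @ x # y # v) < length w" and s: "set (u @ x # y # v) <= X" for u x y v
  proof -
   have dv: "\<theta> + wtw v : dual_space h" using s by(intro shifted_dual) simp
   consider "rk y < rk x" | "x = y" | "rk x < rk y"
    using rk_inj s by(metis inj_onD linorder_neqE_nat in_set_conv_decomp list.set_intros(1)
     append_Cons append.assoc subsetD append_Nil)
   thus ?thesis
   proof cases
    case 1
    thus ?thesis using IH[OF _ s] l by simp
   next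
    case 2
    thus ?thesis using slot_zero[OF dv] by(simp add: lie_self)
   next
    case 3
    hence "straighten (u @ y # x # v) = straighten (u @ x # y # v) + slotw u (lie y x) v"
     using IH[of u y x v] l s by auto
    moreover have "slotw u (lie y x) v = - slotw u (lie x y) v"
     unfolding lie_anti[of y x] by(rule slot_minus[OF dv])
    ultimately show ?thesis by simp
   qed
  qed
  show "?P w"
  proof (intro allI impI)
   fix u x y v assume w: "w = u @ x # y # v" and wX: "set w <= X" and xy: "rk y < rk x"
   have ns: "\<not> sorted_word w" using xy by(auto simp: w sorted_wrt_append)
   obtain u0 x0 y0 v0 where d: "descent w = (u0, x0, y0, v0)" by(metis prod_cases4)
   note w0 = descentD[OF ns d]
   have st: "straighten w = straighten (u0 @ y0 # x0 # v0) + slotw u0 (lie x0 y0) v0"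
    by(rule straighten_descent[OF ns d])
   \<comment> \<open>The part up to \<open>x0\<close> is sorted, so it cannot contain the descent
     from x to y.\<close>
   have "length u0 <= length u"
   proof (rule ccontr)
    assume "\<not> ?thesis"
    then obtain m where "u0 @ [x0] = u @ x # y # m"
     using w w0(1) by(auto simp: append_eq_append_conv2 append_eq_Cons_conv Cons_eq_append_conv)
    thus False using w0(3) xy by(metis (no_types, lifting) list.set_intros(1) not_less
       sorted_wrt.simps(2) sorted_wrt_append)
   qed
   then obtain m where m: "u = u0 @ m" "x0 # y0 # v0 = m @ x # y # v"
    using w w0(1) by(metis append_eq_append_conv_if append_take_drop_id)
   show "straighten (u @ x # y # v) = straighten (u @ y # x # v) + slotw u (lie x y) v"
   proof (cases m)
    case Nil
    thus ?thesis using st m w by simp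
   next
    case (Cons a m1)
    show ?thesis
    proof (cases m1)
     case Nil
     \<comment> \<open>Overlap a, x, y: both ways of reaching y x a are followed, and the remaining
       bracket terms cancel by the Jacobi identity.\<close>
     let ?s = straighten
     have eqs: "x0 = a" "y0 = x" "v0 = y # v" "u = u0 @ [a]" using m Cons Nil by auto
     have w': "w = u0 @ a # x # y # v" using w eqs by simp
     have aX: "a : X" "x : X" "y : X" "set u0 <= X" "set v <= X" using wX w' by auto
     have ax: "rk x < rk a" and ay: "rk y < rk a" using w0(2) xy eqs by auto
     have l: "length w = length u0 + length v + 3" using w' by simp
     have dv: "\<theta> + wtw v : dual_space h" using aX by(intro shifted_dual)
     have I1: "inversions (u0 @ x # a # y # v) < inversions w"
      unfolding w' by(rule inversions_swap[OF ax])
     have I2: "inversions (u0 @ x # y # a # v) < inversions w"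
      using inversions_swap[OF ay, of "u0 @ [x]" v] I1 by simp
     have I3: "inversions (u0 @ a # y # x # v) < inversions w"
      using inversions_swap[OF xy, of "u0 @ [a]" v] w' by simp
     have I4: "inversions (u0 @ y # a # x # v) < inversions w"
      using inversions_swap[OF ay, of u0 "x # v"] I3 by simp
     have e1: "?s w = ?s (u0 @ x # a # y # v) + slotw u0 (lie a x) (y # v)" using st eqs by simp
     have e2: "?s (u0 @ x # a # y # v) = ?s (u0 @ x # y # a # v) + slotw (u0 @ [x]) (lie a y) v"
      using IH[of "u0 @ [x]" a y v] I1 l aX ay by simp
     have e3: "?s (u0 @ x # y # a # v) = ?s (u0 @ y # x # a # v) + slotw u0 (lie x y) (a # v)"
      using IH[of u0 x y "a # v"] I2 l aX xy by simp
     have f2: "?s (u0 @ a # y # x # v) = ?s (u0 @ y # a # x # v) + slotw u0 (lie a y) (x # v)"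
      using IH[of u0 a y "x # v"] I3 l aX ay by simp
     have f3: "?s (u0 @ y # a # x # v) = ?s (u0 @ y # x # a # v) + slotw (u0 @ [y]) (lie a x) v"
      using IH[of "u0 @ [y]" a x v] I4 l aX ax by simp
     have c: "slotw u0 g (b # v) = slotw (u0 @ [b]) g v + slotw u0 (lie g b) v" if "b : X" for g b
     proof (rule slotw_commute[OF that aX(5)])
      fix z assume "z : X"
      thus "?s (u0 @ z # b # v) = ?s (u0 @ b # z # v) + slotw u0 (lie z b) v"
       using gen[of u0 z b v] l aX that by simp
     qed
     have "slotw u0 (lie (lie a x) y) v + slotw u0 (lie (lie x y) a) v - slotw u0 (lie (lie a y) x) v = 0"
     proof -
      have "lie (lie a x) y + lie (lie x y) a - lie (lie a y) x = 0"
       using jacobi[of a x y] lie_anti[of "lie a x" y] lie_anti[of "lie x y" a]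
        lie_anti[of "lie a y" x] lie_anti[of y a] by(simp add: lie_minus_right algebra_simps)
      thus ?thesis by(metis slot_add[OF dv] slot_diff[OF dv] slot_zero[OF dv])
     qed
     thus ?thesis
      using e1 e2 e3 f2 f3 c[OF aX(3), of "lie a x"] c[OF aX(1), of "lie x y"] c[OF aX(2), of "lie a y"]
      by(simp add: w' eqs algebra_simps)
    next
     case (Cons b m2)
     \<comment> \<open>Disjoint descents: each bracket insertion is carried out inside the other,
       and \<open>slot_swap\<close> interchanges them. Homogeneity keeps the evaluation point of the
       left insertion fixed while the right one is made.\<close>
     let ?s = straighten
     have eqs: "x0 = a" "y0 = b" "v0 = m2 @ x # y # v" "u = u0 @ a # b # m2"
      using m \<open>m = a # m1\<close> Cons by auto
     have w': "w = u0 @ a # b # m2 @ x # y # v" using w eqs by simp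
     have aX: "a : X" "b : X" "x : X" "y : X" "set u0 <= X" "set m2 <= X" "set v <= X" using wX w' by auto
     have ab: "rk b < rk a" using w0(2) eqs by auto
     define g0 g where "g0 = lie a b" and "g = lie x y"
     have dv: "\<theta> + wtw v : dual_space h" and dv0: "\<theta> + wtw (m2 @ x # y # v) : dual_space h"
      using aX by(intro shifted_dual; simp)+
     note g = weight_bracket[OF aX(3,4), folded g_def] weight_bracket_dual[OF aX(3,4)]
     note g0 = weight_bracket[OF aX(1,2), folded g0_def] weight_bracket_dual[OF aX(1,2)]
     have I1: "inversions (u0 @ b # a # m2 @ x # y # v) < inversions w"
      unfolding w' by(rule inversions_swap[OF ab])
     have I2: "inversions (u0 @ a # b # m2 @ y # x # v) < inversions w"
      using inversions_swap[OF xy, of "u0 @ a # b # m2" v] w' by simp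
     have e1: "?s w = ?s (u0 @ b # a # m2 @ x # y # v) + slotw u0 g0 (m2 @ x # y # v)"
      using st eqs by(simp add: g0_def)
     have e2: "?s (u0 @ b # a # m2 @ x # y # v) = ?s (u0 @ b # a # m2 @ y # x # v) + slotw (u0 @ b # a # m2) g v"
      using IH[of "u0 @ b # a # m2" x y v] I1 w' aX xy by(simp add: g_def)
     have e3: "?s (u0 @ a # b # m2 @ y # x # v) = ?s (u0 @ b # a # m2 @ y # x # v) + slotw u0 g0 (m2 @ y # x # v)"
      using IH[of u0 a b "m2 @ y # x # v"] I2 w' aX ab by(simp add: g0_def)
     have "slotw u0 g0 (m2 @ x # y # v)
       = slot (\<theta> + wtw (m2 @ x # y # v)) g0 (%t. ?s (u0 @ t @ m2 @ y # x # v) + slotw (u0 @ t @ m2) g v)"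
     proof (rule slot_cong[OF g0 dv0])
      fix t assume "set t <= X" "length t <= 1"
      thus "?s (u0 @ t @ m2 @ x # y # v) = ?s (u0 @ t @ m2 @ y # x # v) + slotw (u0 @ t @ m2) g v"
       using gen[of "u0 @ t @ m2" x y v] w' aX by(simp add: g_def)
     qed
     also have "... = slotw u0 g0 (m2 @ y # x # v)
       + slot (\<theta> + wtw (m2 @ x # y # v)) g0 (%t. slotw (u0 @ t @ m2) g v)"
      by(simp add: slot_fun_add add_ac)
     finally have i1: "slotw u0 g0 (m2 @ x # y # v) = slotw u0 g0 (m2 @ y # x # v)
       + slot (\<theta> + wtw (m2 @ x # y # v)) g0 (%t. slotw (u0 @ t @ m2) g v)" .
     have "slotw (u0 @ a # b # m2) g v = slot (\<theta> + wtw v) g (%s. ?s (u0 @ b # a # m2 @ s @ v)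
       + slot (\<theta> + wtw (m2 @ x # y # v)) g0 (%t. ?s (u0 @ t @ m2 @ s @ v)))"
     proof (rule slot_cong[OF g dv])
      fix s assume s: "set s <= X" "length s <= 1" "wtw s = wt x + wt y"
      have "\<theta> + wtw (m2 @ s @ v) = \<theta> + wtw (m2 @ x # y # v)" using s(3) by(simp add: add_ac)
      thus "?s ((u0 @ a # b # m2) @ s @ v) = ?s (u0 @ b # a # m2 @ s @ v)
        + slot (\<theta> + wtw (m2 @ x # y # v)) g0 (%t. ?s (u0 @ t @ m2 @ s @ v))"
       using gen[of u0 a b "m2 @ s @ v"] w' aX s by(simp add: g0_def add.assoc)
     qed
     also have "... = slotw (u0 @ b # a # m2) g v
       + slot (\<theta> + wtw v) g (%s. slot (\<theta> + wtw (m2 @ x # y # v)) g0 (%t. ?s (u0 @ t @ m2 @ s @ v)))"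
      by(simp add: slot_fun_add)
     also have "slot (\<theta> + wtw v) g (%s. slot (\<theta> + wtw (m2 @ x # y # v)) g0 (%t. ?s (u0 @ t @ m2 @ s @ v)))
       = slot (\<theta> + wtw (m2 @ x # y # v)) g0 (%t. slotw (u0 @ t @ m2) g v)"
      by(subst slot_swap) simp
     finally have i2: "slotw (u0 @ a # b # m2) g v = slotw (u0 @ b # a # m2) g v
       + slot (\<theta> + wtw (m2 @ x # y # v)) g0 (%t. slotw (u0 @ t @ m2) g v)" .
     have "?s (u0 @ a # b # m2 @ x # y # v) = ?s (u0 @ a # b # m2 @ y # x # v) + slotw (u0 @ a # b # m2) g v"
      unfolding w'[symmetric] e1 e2 e3 i1 i2 by(simp only: add_ac)
     thus ?thesis by(simp add: eqs g_def)
    qed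
   qed
  qed
 qed
 thus ?thesis using assms by blast
qed

theorem straighten_swap:
 assumes s: "set (u @ x # y # v) <= X"
 shows "straighten (u @ x # y # v) = straighten (u @ y # x # v) + slotw u (lie x y) v"
proof -
 have dv: "\<theta> + wtw v : dual_space h" using s by(intro shifted_dual) simp
 have "x : X" "y : X" using s by auto
 then consider "rk y < rk x" | "x = y" | "rk x < rk y" using rk_inj by(metis inj_onD linorder_neqE_nat)
 thus ?thesis
 proof cases
  case 1
  thus ?thesis by(rule straighten_swap_descent[OF s])
 next
  case 2
  thus ?thesis using slot_zero[OF dv] by(simp add: lie_self)
 next
  case 3
  hence "straighten (u @ y # x # v) = straighten (u @ x # y # v) + slotw u (lie y x) v"
   using s by(intro straighten_swap_descent) auto
  moreover have "slotw u (lie y x) v = - slotw u (lie x y) v"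
   unfolding lie_anti[of y x] by(rule slot_minus[OF dv])
  ultimately show ?thesis by simp
 qed
qed

lemma straighten_induct [consumes 1, case_names sorted descent]:
 assumes "set w <= X" "!!w. set w <= X ==> sorted_word w ==> Q w"
  "!!u x y v. set (u @ x # y # v) <= X ==> rk y < rk x ==> Q (u @ y # x # v) ==>
   (!!t. set t <= X ==> length t <= 1 ==> Q (u @ t @ v)) ==> Q (u @ x # y # v)"
 shows "Q w"
 using assms(1)
proof (induction w rule: wf_induct[OF wf_measures[of "[length, inversions]"]])
 case (1 w)
 show ?case
 proof (cases "sorted_word w")
  case False
  then obtain u x y v where w: "w = u @ x # y # v" "rk y < rk x" using exists_descent by blast
  show ?thesis unfolding w(1)
  proof (rule assms(3))
   show "set (u @ x # y # v) <= X" using 1(2) w by simp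
   show "Q (u @ y # x # v)" using 1 inversions_swap[OF w(2), of u v] w by simp
   show "Q (u @ t @ v)" if "set t <= X" "length t <= 1" for t using 1 w that by simp
  qed (rule w)
 qed (use assms(2) 1 in blast)
qed

lemma slot_keys:
 assumes "s : Poly_Mapping.keys (slot \<nu> g \<phi>)"
 shows "EX t. set t <= X & length t <= 1 & (ALL z:set t. cf g z ~= 0) & (t = [] --> \<nu> (hpart g) ~= 0) &
  s : Poly_Mapping.keys (\<phi> t)"
proof -
 have look: "Poly_Mapping.lookup (fconst c * p) k = c * Poly_Mapping.lookup p k" for c and p :: "'g falg" and k
 proof (induction p rule: falg_induct)
  case (monomial d w)
  have "fconst c * Poly_Mapping.single (Word w) d = Poly_Mapping.single (Word w) (c * d)"
   by(simp add: fconst_def mult_single)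
  thus ?case by(simp add: fconst_fword lookup_single when_def)
 qed (simp add: lookup_add distrib_left)
 have "(\<Sum>z\<in>X. cf g z * Poly_Mapping.lookup (\<phi> [z]) s) + \<nu> (hpart g) * Poly_Mapping.lookup (\<phi> []) s ~= 0"
  using assms by(simp add: in_keys_iff slot_def lookup_add lookup_sum look)
 then consider z where "z : X" "cf g z * Poly_Mapping.lookup (\<phi> [z]) s ~= 0"
  | "\<nu> (hpart g) * Poly_Mapping.lookup (\<phi> []) s ~= 0"
  by(metis (no_types, lifting) add.right_neutral sum.neutral)
 thus ?thesis
 proof cases
  case 1
  thus ?thesis by(intro exI[of _ "[z]"]) (auto simp: in_keys_iff)
 next
  case 2
  thus ?thesis by(intro exI[of _ "[]"]) (auto simp: in_keys_iff)
 qed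
qed

text \<open>Invariants of the rewriting: \<open>Q\<close> has to survive a swap, the replacement of
  a descent by a letter of its bracket, and its deletion through the part of the bracket in
  \<open>h\<close>.\<close>

lemma straighten_keys:
 assumes "set w <= X" "Q w"
  and swap: "!!u x y v. Q (u @ x # y # v) ==> set (u @ x # y # v) <= X ==> rk y < rk x ==> Q (u @ y # x # v)"
  and letter: "!!u x y v z. Q (u @ x # y # v) ==> set (u @ x # y # v) <= X ==> rk y < rk x ==> z : X ==>
   cf (lie x y) z ~= 0 ==> Q (u @ z # v)"
  and scalar: "!!u x y v. Q (u @ x # y # v) ==> set (u @ x # y # v) <= X ==> rk y < rk x ==>
   hpart (lie x y) ~= 0 ==> Q (u @ v)"
  and "s : Poly_Mapping.keys (straighten w)"
 shows "sorted_word (letters s) & set (letters s) <= X & Q (letters s)"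
 using assms(1,2,6)
proof (induction w rule: straighten_induct)
 case (sorted w)
 hence "s : Poly_Mapping.keys (Poly_Mapping.single (Word w) (1::complex))"
  by(simp add: straighten_sorted fword_eq_single)
 hence "letters s = w" by(simp split: if_splits)
 thus ?case using sorted by simp
next
 case (descent u x y v)
 have "s : Poly_Mapping.keys (straighten (u @ y # x # v) + slotw u (lie x y) v)"
  using descent.prems(2) straighten_swap[OF descent.hyps(1)] by simp
 from subsetD[OF keys_add this] consider "s : Poly_Mapping.keys (straighten (u @ y # x # v))"
  | t where "set t <= X" "length t <= 1" "ALL z:set t. cf (lie x y) z ~= 0"
   "t = [] --> (\<theta> + wtw v) (hpart (lie x y)) ~= 0" "s : Poly_Mapping.keys (straighten (u @ t @ v))"
  using slot_keys[of s "\<theta> + wtw v" "lie x y" "%t. straighten (u @ t @ v)"] by blast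
 thus ?case
 proof cases
  case 1
  thus ?thesis using descent.IH(1) swap descent.prems(1) descent.hyps by blast
 next
  case (2 t)
  have "Q (u @ t @ v)"
  proof (cases t)
   case Nil
   have "hpart (lie x y) ~= 0"
    using 2(4) Nil dual_space_at_0[OF shifted_dual, of v] descent.hyps(1) by auto
   thus ?thesis using scalar[OF descent.prems(1) descent.hyps] Nil by simp
  next
   case (Cons z t')
   hence "t = [z]" using 2(2) by simp
   thus ?thesis using letter[OF descent.prems(1) descent.hyps, of z] 2 by simp
  qed
  thus ?thesis using descent.IH(2)[OF 2(1,2)] 2(5) by blast
 qed
qed

lemma straighten_weight:
 assumes "set w <= X" "s : Poly_Mapping.keys (straighten w)"
 shows "sorted_word (letters s) & set (letters s) <= X & wtw (letters s) = wtw w"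
proof (rule straighten_keys[OF assms(1) _ _ _ _ assms(2), where Q = "%s. wtw s = wtw w"])
 fix u x y v z assume *: "wtw (u @ x # y # v) = wtw w" "set (u @ x # y # v) <= X"
 have xy: "x : X" "y : X" using *(2) by auto
 note hom = homogeneous[OF weight_bracket[OF xy] weight_bracket_dual[OF xy]]
 show "wtw (u @ y # x # v) = wtw w" using *(1) by(simp add: add_ac)
 show "z : X ==> cf (lie x y) z ~= 0 ==> wtw (u @ z # v) = wtw w"
  using hom(1)[of z] *(1) by(simp add: add_ac)
 show "hpart (lie x y) ~= 0 ==> wtw (u @ v) = wtw w"
  using hom(2) *(1) by(simp add: add.assoc[symmetric, of "wt x"] del: add.assoc)
qed simp

end

declare plus_fun_apply [simp del]

subsection \<open>Modules over free algebras\<close>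

context central_scalars begin

lemma flact_simps:
 "flact L (p + q) m = flact L p m + flact L q m" "flact L (p - q) m = flact L p m - flact L q m"
 "flact L (fgen x) m = L x m" "flact L 1 m = m" "flact L (fconst c) m = s c * m"
 "flact L 0 m = 0"
 using flin_fconst[of "%w. foldr L w m" 1]
 by(simp_all add: flact_def flin_add flin_diff flin_fgen flin_fconst s_one)

lemma flact_linear:
 assumes "!!x m m'. L x (m + m') = L x m + L x m'" "!!x c m. L x (s c * m) = s c * L x m"
 shows "flact L p (m + m') = flact L p m + flact L p m'" "flact L p (s c * m) = s c * flact L p m"
proof -
 have fold: "foldr L w (m + m') = foldr L w m + foldr L w m'" "foldr L w (s c * m) = s c * foldr L w m" for w
  by(induction w) (simp_all add: assms)
 have comm: "s c * (s d * b) = s d * (s c * b)" for d b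
  by(simp only: mult.assoc[symmetric] s_mult[symmetric] mult.commute)
 show "flact L p (m + m') = flact L p m + flact L p m'"
  by(simp add: flact_def flin_def fold distrib_left sum.distrib)
 show "flact L p (s c * m) = s c * flact L p m"
  by(simp add: flact_def flin_def fold comm sum_distrib_left)
qed

lemma flact_mult:
 assumes "!!x m m'. L x (m + m') = L x m + L x m'" "!!x c m. L x (s c * m) = s c * L x m"
 shows "flact L (p * q) m = flact L p (flact L q m)"
proof (induction p rule: falg_induct)
 case (monomial c u)
 show ?case
 proof (induction q rule: falg_induct)
  case (monomial d v)
  have "fconst c * fword u * (fconst d * fword v) = fconst (c * d) * fword (u @ v)"
   unfolding fconst_fword mult_single plus_word_def by simp
  hence "flact L (fconst c * fword u * (fconst d * fword v)) m = s (c * d) * foldr L u (foldr L v m)"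
   unfolding flact_def by(simp only: flin_term foldr_append comp_apply)
  also have "... = s c * foldr L u (s d * foldr L v m)"
   using flact_linear(2)[where L = L and p = "fword u" and c = d, OF assms]
   by(simp add: flact_def flin_fword s_mult mult.assoc)
  finally show ?case by(simp add: flact_def flin_term)
 qed (simp add: distrib_left flact_simps flact_linear[OF assms])
qed (simp add: distrib_right flact_simps)

end

lemma flact_frename: "fs.flact L (frename f p) m = fs.flact (%x. L (f x)) p m"
proof (induction p rule: falg_induct)
 case (monomial c w)
 have "frename f (fword w) = fword (map f w)" by(induction w) (simp_all add: frename_simps)
 hence "frename f (fconst c * fword w) = fconst c * fword (map f w)" by(simp add: frename_simps)
 thus ?case unfolding fs.flact_def by(simp only: fs.flin_term foldr_map comp_def)
qed (simp add: frename_simps fs.flact_simps)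

lemma lookup_fconst_mult: "Poly_Mapping.lookup (fconst c * p) k = c * Poly_Mapping.lookup p k"
proof (induction p rule: falg_induct)
 case (monomial d w)
 have "fconst c * Poly_Mapping.single (Word w) d = Poly_Mapping.single (Word w) (c * d)"
  by(simp add: fconst_def mult_single)
 thus ?case by(simp add: fconst_fword lookup_single when_def)
qed (simp add: lookup_add distrib_left)

lemma keys_fconst_mult: "Poly_Mapping.keys (fconst c * p) <= Poly_Mapping.keys p"
 by(auto simp: in_keys_iff lookup_fconst_mult)

lemma keys_fword: "Poly_Mapping.keys (fword w) = {Word w}"
 by(simp add: fword_eq_single)

lemma falg_restricted_induct [consumes 1, case_names monomial add]:
 assumes "ALL w:Poly_Mapping.keys p. Q (letters w)" "!!c w. Q w ==> P (fconst c * fword w)"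
  "!!p q. P p ==> P q ==> P (p + q)" "P 0"
 shows "P p"
proof -
 have "P (\<Sum>w\<in>K. fconst (Poly_Mapping.lookup p w) * fword (letters w))" if "K <= Poly_Mapping.keys p" for K
  using that
 proof (induction K rule: infinite_finite_induct)
  case (insert w K)
  thus ?case using assms by simp
 qed (simp_all add: assms(4))
 from this[OF subset_refl] show ?thesis using falg_expand[of p] by simp
qed

section \<open>The induced module over the localized enveloping algebra\<close>

text \<open>In rank, \<open>Xm\<close> is an initial and \<open>Xp\<close> a final segment of the
  letters. \<open>nonvanishing\<close> is genericity at all weights of the module and lets the
  inverses of denominators act.\<close>

locale pbw_module = pbw_basis +
 fixes Xm P Xp :: "'a::fin_dim_complex_lie_algebra set" and D :: "'a falg set"
 assumes X_parts: "X = Xm \<union> P \<union> Xp" "Xm \<inter> P = {}" "Xp \<inter> P = {}"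
  and rk_m: "!!x y. x : Xm ==> y : X ==> rk y < rk x ==> y : Xm"
  and rk_p: "!!x y. x : Xp ==> y : X ==> rk x < rk y ==> y : Xp"
  and closed_m: "!!x y. x : Xm ==> y : Xm ==> lie x y : clin.span Xm"
  and closed_p: "!!x y. x : Xp ==> y : Xp ==> lie x y : clin.span Xp"
  and denominators: "!!d. d : D ==> EX t:h. EX l. d = fgen t + fconst l"
  and nonvanishing: "!!d s. d : D ==> set s <= X ==> cs.fhom (\<theta> + wtw s) d ~= 0"
begin

definition M :: "'a falg set" where
 "M = {m. ALL w:Poly_Mapping.keys m. sorted_word (letters w) & set (letters w) <= X}"

lemma M_induct [consumes 1, case_names monomial add]:
 assumes "m : M" "!!c w. sorted_word w ==> set w <= X ==> Q (fconst c * fword w)"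
  "!!p q. Q p ==> Q q ==> Q (p + q)"
 shows "Q m"
proof (rule falg_restricted_induct[where p = m and Q = "%w. sorted_word w & set w <= X"])
 show "ALL w:Poly_Mapping.keys m. sorted_word (letters w) & set (letters w) <= X"
  using assms(1) by(simp add: M_def)
 show "Q 0" using assms(2)[of "[]" 0] by simp
qed (use assms(2,3) in auto)

lemma M_0: "0 : M" and M_1: "1 : M"
 by(simp_all add: M_def zero_word_def)

lemma M_add: "m : M ==> m' : M ==> m + m' : M"
 using keys_add[of m m'] by(auto simp: M_def)

lemma M_scale: "m : M ==> fconst c * m : M"
 using keys_fconst_mult[of c m] by(auto simp: M_def)

lemma M_straighten: "set w <= X ==> straighten w : M"
 using straighten_weight by(auto simp: M_def)

definition gop :: "'a => 'a falg => 'a falg" where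
 "gop g = fs.flin (%s. slotw [] g s)"

definition dop :: "'a falg => 'a falg => 'a falg" where
 "dop d = fs.flin (%s. fconst (inverse (cs.fhom (\<theta> + wtw s) d)) * fword s)"

text \<open>Letters \<open>Inr d\<close> with d outside \<open>D\<close> have to act by 0, because
  \<open>pker\<close> contains the letters outside the generating set.\<close>

definition opr :: "'a + 'a falg => 'a falg => 'a falg" where
 "opr x = (case x of Inl g => gop g | Inr d => if d : D then dop d else (%m. 0))"

lemma gop_simps:
 shows gop_term: "gop g (fconst c * fword w) = fconst c * slotw [] g w"
  and gop_fword: "gop g (fword w) = slotw [] g w"
  and gop_add: "gop g (m + m') = gop g m + gop g m'"
  and gop_scale: "gop g (fconst c * m) = fconst c * gop g m"
  and gop_zero: "gop g 0 = 0"
 unfolding gop_def fs.flin_term fs.flin_fword fs.flin_add fs.flin_scale fs.flin_zero by(rule refl)+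

lemma dop_simps:
 shows dop_fword: "dop d (fword w) = fconst (inverse (cs.fhom (\<theta> + wtw w) d)) * fword w"
  and dop_add: "dop d (m + m') = dop d m + dop d m'"
  and dop_scale: "dop d (fconst c * m) = fconst c * dop d m"
 unfolding dop_def fs.flin_fword fs.flin_add fs.flin_scale by(rule refl)+

lemma opr_linear: "opr x (m + m') = opr x m + opr x m'" "opr x (fconst c * m) = fconst c * opr x m"
 by(auto simp: opr_def gop_add gop_scale dop_add dop_scale split: sum.split)

lemma flin_slot: "fs.flin f (slot \<nu> g \<phi>) = slot \<nu> g (%t. fs.flin f (\<phi> t))"
 by(simp add: slot_def fs.flin_add fs.flin_sum fs.flin_scale)

lemma slot_cong_all:
 "(!!t. set t <= X ==> length t <= 1 ==> \<phi> t = \<psi> t) ==> slot \<nu> g \<phi> = slot \<nu> g \<psi>"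
 by(simp add: slot_def)

text \<open>Straightening a word before or after g is put in front of it makes no difference. The
  induction follows the rewriting, and the insertions of g and of [x, y] are interchanged by
  \<open>slot_swap\<close>.\<close>

lemma gop_straighten: "set w <= X ==> gop g (straighten w) = slotw [] g w"
proof (induction w rule: straighten_induct)
 case (sorted w)
 thus ?case by(simp only: straighten_sorted gop_fword)
next
 case (descent u x y v)
 let ?w = "u @ x # y # v"
 have xy: "x : X" "y : X" using descent.hyps(1) by auto
 have uv: "set u <= X" "set v <= X" using descent.hyps(1) by auto
 note wb = weight_bracket[OF xy] weight_bracket_dual[OF xy]
 have "gop g (straighten ?w) = gop g (straighten (u @ y # x # v))
   + slot (\<theta> + wtw v) (lie x y) (%t. gop g (straighten (u @ t @ v)))"
  unfolding straighten_swap[OF descent.hyps(1)] by(simp add: gop_add) (simp add: gop_def flin_slot)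
 also have "slot (\<theta> + wtw v) (lie x y) (%t. gop g (straighten (u @ t @ v)))
   = slot (\<theta> + wtw v) (lie x y) (%t. slot (\<theta> + wtw ?w) g (%t'. straighten (t' @ u @ t @ v)))"
 proof (rule slot_cong[OF wb shifted_dual[OF uv(2)]])
  fix t assume t: "set t <= X" "length t <= 1" "wtw t = wt x + wt y"
  have "\<theta> + wtw (u @ t @ v) = \<theta> + wtw ?w" using t(3) by(simp add: add_ac)
  thus "gop g (straighten (u @ t @ v)) = slot (\<theta> + wtw ?w) g (%t'. straighten (t' @ u @ t @ v))"
   using descent.IH(2)[OF t(1,2)] by(simp add: add.assoc)
 qed
 also have "... = slot (\<theta> + wtw ?w) g (%t'. slotw (t' @ u) (lie x y) v)"
  by(subst slot_swap) simp
 also have "gop g (straighten (u @ y # x # v)) = slot (\<theta> + wtw ?w) g (%t'. straighten (t' @ u @ y # x # v))"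
  unfolding descent.IH(1) by(simp add: add_ac)
 also have "... + slot (\<theta> + wtw ?w) g (%t'. slotw (t' @ u) (lie x y) v)
   = slot (\<theta> + wtw ?w) g (%t'. straighten ((t' @ u) @ y # x # v) + slotw (t' @ u) (lie x y) v)"
  by(simp add: slot_fun_add)
 also have "... = slotw [] g ?w"
 proof (rule slot_cong_all)
  fix t assume "set t <= X"
  hence "straighten ((t @ u) @ x # y # v) = straighten ((t @ u) @ y # x # v) + slotw (t @ u) (lie x y) v"
   using descent.hyps(1) by(intro straighten_swap) auto
  thus "straighten ((t @ u) @ y # x # v) + slotw (t @ u) (lie x y) v = straighten ([] @ t @ ?w)"
   by simp
 qed
 finally show ?case .
qed

lemma M_sum: "(!!a. a : A ==> f a : M) ==> sum f A : M"
 by(induction A rule: infinite_finite_induct) (auto simp: M_0 M_add)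

lemma M_slot: "(!!t. set t <= X ==> \<phi> t : M) ==> slot \<nu> g \<phi> : M"
 unfolding slot_def by(intro M_add M_sum M_scale) auto

lemma gop_M: "m : M ==> gop g m : M"
proof (induction m rule: M_induct)
 case (monomial c w)
 have "slotw [] g w : M" using monomial by(intro M_slot M_straighten) auto
 thus ?case by(simp add: gop_term M_scale)
qed (simp add: gop_add M_add)

lemma dop_M: "m : M ==> dop d m : M"
proof (induction m rule: M_induct)
 case (monomial c w)
 hence "fword w : M" by(simp add: M_def keys_fword)
 thus ?case by(simp add: dop_scale dop_fword M_scale)
qed (simp add: dop_add M_add)

lemma opr_M: "m : M ==> opr x m : M"
 by(auto simp: opr_def gop_M dop_M M_0 split: sum.split)

lemma flact_M: assumes "m : M" shows "fs.flact opr p m : M"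
proof (induction p rule: falg_induct)
 case (monomial c w)
 have "foldr opr w m : M" by(induction w) (simp_all add: assms opr_M)
 thus ?case by(simp add: fs.flact_def fs.flin_term M_scale)
qed (simp add: fs.flact_simps M_add)

lemma gop_linear:
 assumes "m : M"
 shows "gop (a + b) m = gop a m + gop b m" "gop (r *\<^sub>C a) m = fconst r * gop a m"
 using assms
proof (induction m rule: M_induct)
 case (monomial c w)
 have comm: "fconst c * (fconst r * p) = fconst r * (fconst c * p)" for p :: "'a falg"
  by(simp only: mult.assoc[symmetric] fconst_mult[symmetric] mult.commute)
 note dw = shifted_dual[OF monomial(2)]
 {
  case 1
  show ?case by(simp add: gop_term slot_add[OF dw] distrib_left)
 next
  case 2
  show ?case by(simp add: gop_term slot_scale[OF dw] comm)
 }
next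
 case (add p q)
 {
  case 1
  show ?case using add by(simp add: gop_add algebra_simps)
 next
  case 2
  show ?case using add by(simp add: gop_add algebra_simps)
 }
qed

lemma gop_h: "y : h ==> gop y (fword w) = fconst ((\<theta> + wtw w) y) * straighten w"
 by(simp only: gop_fword slot_h) simp

text \<open>By bilinearity basis vectors suffice. Two letters are \<open>straighten_swap\<close>;
  for an element of \<open>h\<close> and a letter the bracket is the shift of the evaluation point;
  two elements of \<open>h\<close> act by scalars.\<close>

lemma gop_lie_word:
 assumes w: "sorted_word w" "set w <= X"
 shows "gop a (gop b (fword w)) - gop b (gop a (fword w)) = gop (lie a b) (fword w)"
proof -
 let ?R = "%a b. gop a (gop b (fword w)) - gop b (gop a (fword w)) = gop (lie a b) (fword w)"
 have wM: "fword w : M" using w by(simp add: M_def keys_fword)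
 note dw = shifted_dual[OF w(2)]
 have st: "straighten w = fword w" using w by(simp add: straighten_sorted)
 have X1: "gop x (fword w) = straighten (x # w)" if "x : X" for x
  using slot_X[OF that dw] by(simp add: gop_fword w)
 have X2: "gop x (straighten (y # w)) = straighten (x # y # w)" if "x : X" "y : X" for x y
  using slot_X[OF that(1) shifted_dual[of "y # w"]] gop_straighten[of "y # w"] that w by simp
 have H1: "gop t (fword w) = fconst ((\<theta> + wtw w) t) * fword w" if "t : h" for t
  using gop_h[OF that, of w] st by simp
 have H2: "gop t (straighten (y # w)) = fconst ((\<theta> + wtw (y # w)) t) * straighten (y # w)"
  if "t : h" "y : X" for t y
  using gop_straighten[of "y # w" t] that w by(simp add: slot_h)
 have scale: "gop a (fconst c * m) = fconst c * gop a m" for a c m by(simp add: gop_scale)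
 have minus: "gop (- a) m = - gop a m" if "m : M" for a m
  using gop_linear(2)[OF that, of "- 1" a] by(simp add: fconst_minus)
 have hX: "?R t x" if t: "t : h" and x: "x : X" for t x
 proof -
  have "lie t x = wt x t *\<^sub>C x" using wt[OF x] t by(simp add: weight_vector_def)
  thus ?thesis
   using gop_linear(2)[OF wM, of "wt x t" x]
   unfolding X1[OF x] H1[OF t] scale H2[OF t x] by(simp add: X1[OF x] plus_fun_apply fconst_add distrib_right)
 qed
 have anti: "?R b a" if "?R a b" for a b
  using that minus[OF wM, of "lie a b"] lie_anti[of b a] by(simp add: algebra_simps)
 have base: "?R a b" if a: "a : X \<union> H" and b: "b : X \<union> H" for a b
 proof -
  have Hh: "t : h" if "t : H" for t using that clin.span_base spanH by blast
  consider "a : X" "b : X" | "a : H" "b : X" | "a : X" "b : H" | "a : H" "b : H" using a b by blast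
  thus ?thesis
  proof cases
   case 1
   have "straighten (a # b # w) = straighten (b # a # w) + slotw [] (lie a b) w"
    using straighten_swap[of "[]" a b w] 1 w by simp
   thus ?thesis using 1 by(simp only: X1 X2) (simp add: gop_fword)
  next
   case 2
   thus ?thesis using hX Hh by blast
  next
   case 3
   thus ?thesis using anti[OF hX] Hh by blast
  next
   case 4
   have comm: "fconst c * (fconst r * p) = fconst r * (fconst c * p)" for c r and p :: "'a falg"
    by(simp only: mult.assoc[symmetric] fconst_mult[symmetric] mult.commute)
   have "gop (lie a b) (fword w) = 0"
    using abelian[OF Hh Hh] 4 slot_zero[OF dw] by(simp add: gop_fword w)
   thus ?thesis using 4 Hh comm by(simp add: H1 scale)
  qed
 qed
 have add: "gop a (m + m') = gop a m + gop a m'" for a m m' by(simp add: gop_add)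
 have gl: "gop (r *\<^sub>C a + a') m = fconst r * gop a m + gop a' m" if "m : M" for r a a' m
  using gop_linear[OF that] by simp
 have lin1: "?R (r *\<^sub>C a + a') b" if "?R a b" "?R a' b" for r a a' b
 proof -
  have "gop (lie (r *\<^sub>C a + a') b) (fword w) = fconst r * gop (lie a b) (fword w) + gop (lie a' b) (fword w)"
   unfolding lie_add_left lie_cscale_left by(rule gl[OF wM])
  thus ?thesis
   unfolding gl[OF gop_M[OF wM]] gl[OF wM] add scale that[symmetric]
   by(simp add: right_diff_distrib)
 qed
 have R1: "?R a b" if "b : X \<union> H" for a b
 proof -
  have "a : clin.span (X \<union> H)" using spanning by simp
  thus ?thesis
  proof (induction rule: clin.span_induct_alt)
   case base
   have z: "gop 0 m = 0" if "m : M" for m using gop_linear(2)[OF that, of 0 0] by simp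
   have "gop b 0 = 0" by(rule gop_zero)
   thus ?case using z[OF wM] z[OF gop_M[OF wM]] by simp
  next
   case (step c x y)
   thus ?case using lin1 base[OF step(1) that] by blast
  qed
 qed
 have "b : clin.span (X \<union> H)" using spanning by simp
 hence "?R b a"
 proof (induction rule: clin.span_induct_alt)
  case base
  have z: "gop 0 m = 0" if "m : M" for m using gop_linear(2)[OF that, of 0 0] by simp
  have "gop a 0 = 0" by(rule gop_zero)
  thus ?case using z[OF wM] z[OF gop_M[OF wM]] by simp
 next
  case (step c x y)
  thus ?case using lin1 anti[OF R1[OF step(1)]] by blast
 qed
 thus ?thesis by(rule anti)
qed

lemma gop_lie:
 assumes "m : M" shows "gop a (gop b m) - gop b (gop a m) = gop (lie a b) m"
 using assms
proof (induction m rule: M_induct)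
 case (monomial c w)
 have "gop a (fconst c * m) = fconst c * gop a m" for a c m by(simp add: gop_scale)
 thus ?case
  using gop_lie_word[OF monomial, of a b] by(simp flip: right_diff_distrib)
next
 case (add p q)
 have "gop a (m + m') = gop a m + gop a m'" for a m m' by(simp add: gop_add)
 thus ?case using add by(simp add: algebra_simps)
qed

lemma chi_denominator: "cs.fhom \<nu> (fgen t + fconst l) = \<nu> t + l"
 by(simp add: cs.fhom_simps)

lemma flact_denominator:
 assumes "d : D" "sorted_word w" "set w <= X"
 shows "fs.flact opr (frename Inl d) (fword w) = fconst (cs.fhom (\<theta> + wtw w) d) * fword w"
proof -
 obtain t l where t: "t : h" and d: "d = fgen t + fconst l" using denominators[OF assms(1)] by blast
 have "fs.flact opr (frename Inl d) (fword w) = gop t (fword w) + fconst l * fword w"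
  unfolding flact_frename by(simp add: d fs.flact_simps opr_def)
 also have "gop t (fword w) = fconst ((\<theta> + wtw w) t) * fword w"
  using gop_h[OF t, of w] assms by(simp add: straighten_sorted)
 finally show ?thesis by(simp add: d chi_denominator fconst_add distrib_right)
qed

lemma loc_relators: "loc_rels (env_rels UNIV) D <= FA (loc_gens UNIV D)"
proof -
 have ren: "frename Inl p : FA (loc_gens UNIV D)" for p :: "'a falg"
 proof (induction p rule: falg_induct)
  case (monomial c w)
  have "frename Inl (fword w) : FA (loc_gens UNIV D)"
   by(induction w) (auto simp: frename_simps loc_gens_def)
  thus ?case by(simp add: frename_simps)
 qed (simp add: frename_simps)
 have "fgen (Inr d) : FA (loc_gens UNIV D)" if "d : D" for d :: "'a falg"
  using that by(intro free_algebra_fgen) (simp add: loc_gens_def)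
 thus ?thesis using ren by(auto simp: loc_rels_def)
qed

sublocale A: presentation "loc_gens UNIV D" "loc_rels (env_rels UNIV) D"
 by unfold_locales (rule loc_relators)

lemmas flact_opr_mult = fs.flact_mult[of opr, OF opr_linear]
lemmas flact_opr_linear = fs.flact_linear[of opr, OF opr_linear]

text \<open>The annihilator of \<open>M\<close> is a two-sided ideal that contains the relators and
  the foreign letters, so \<open>pker_minimal\<close> applies.\<close>

lemma pker_acts_zero:
 assumes "p : pker (loc_gens UNIV D) (loc_rels (env_rels UNIV) D)" "m : M"
 shows "fs.flact opr p m = 0"
proof -
 let ?K = "{p. ALL m:M. fs.flact opr p m = 0}"
 have z: "fs.flact opr p 0 = 0" for p using flact_opr_linear(2)[of p 0 0] by simp
 have "two_sided_ideal ?K"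
  unfolding two_sided_ideal_def using flact_M by(auto simp: fs.flact_simps flact_opr_mult z)
 moreover have "fgen x : ?K" if "x \<notin> loc_gens UNIV D" for x
  using that by(auto simp: loc_gens_def fs.flact_simps opr_def split: sum.split)
 moreover have "loc_rels (env_rels UNIV) D <= ?K"
 proof
  fix r assume "r : loc_rels (env_rels UNIV) D"
  then consider r' where "r = frename Inl r'" "r' : env_rels UNIV"
   | d where "d : D" "r = frename Inl d * fgen (Inr d) - 1 \<or> r = fgen (Inr d) * frename Inl d - 1"
   unfolding loc_rels_def by blast
  thus "r : ?K"
  proof cases
   case 1
   have inl: "opr (Inl x) = gop x" for x by(simp add: opr_def)
   have gl: "gop x (u + v) = gop x u + gop x v" "gop x (fconst c * u) = fconst c * gop x u" for x u v c
    by(simp_all add: gop_add gop_scale)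
   have "fs.flact gop r' m = 0" if m: "m : M" for m
    using 1(2) gop_linear[OF m] gop_lie[OF m] unfolding env_rels_def
    by(auto simp: fs.flact_simps fs.flact_mult[of gop, OF gl])
   thus ?thesis by(simp add: 1(1) flact_frename inl)
  next
   case 2
   have "fs.flact opr r m = 0" if "m : M" for m
    using that
   proof (induction m rule: M_induct)
    case (monomial c w)
    let ?x = "cs.fhom (\<theta> + wtw w) d"
    have x: "?x ~= 0" using nonvanishing 2(1) monomial by blast
    have "fconst ?x * (fconst (inverse ?x) * fword w) = fword w"
     "fconst (inverse ?x) * (fconst ?x * fword w) = fword w"
     using x by(simp_all add: mult.assoc[symmetric] fconst_mult[symmetric])
    hence "fs.flact opr r (fword w) = 0"
     using 2 by(auto simp: fs.flact_simps flact_opr_mult flact_denominator monomial opr_def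
       dop_fword dop_scale flact_opr_linear)
    thus ?case by(simp add: flact_opr_linear)
   qed (simp add: flact_opr_linear)
   thus ?thesis by simp
  qed
 qed
 ultimately have "pker (loc_gens UNIV D) (loc_rels (env_rels UNIV) D) <= ?K"
  by(intro A.pker_minimal)
 thus ?thesis using assms by blast
qed

text \<open>The coordinates of \<open>p\<close> applied to the generator of the module, at the sorted words in the
 letters \<open>P\<close>. They vanish on \<open>A n\<^sub>+ + n\<^sub>- A\<close>.\<close>

definition coord :: "('a + 'a falg) falg => 'a list => complex" where
 "coord p w = Poly_Mapping.lookup (fs.flact opr p 1) (Word w)"

lemma coord_add: "coord (p + q) w = coord p w + coord q w"
 by(simp add: coord_def fs.flact_simps lookup_add)

lemma coord_pker: "p : pker (loc_gens UNIV D) (loc_rels (env_rels UNIV) D) ==> coord p w = 0"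
 using pker_acts_zero[OF _ M_1] by(simp add: coord_def)

lemma span_cf:
 assumes "g : clin.span Y" "Y <= X"
 shows "z \<notin> Y ==> cf g z = 0" "hpart g = 0"
proof -
 have *: "cf g z = 0" if "z \<notin> Y" for z
  unfolding cf_def using assms that by(intro representation_zero_outside[OF indep, of _ Y]) auto
 thus "z \<notin> Y ==> cf g z = 0" .
 show "hpart g = 0" unfolding hpart_def using * assms(2) disj by(intro sum.neutral) auto
qed

text \<open>\<open>Xp\<close> is a final segment and its brackets stay in its span, so a rewriting
  at the end of a word leaves a letter of \<open>Xp\<close> there.\<close>

lemma straighten_keys_last:
 assumes "set w <= X" "w ~= []" "last w : Xp" "s : Poly_Mapping.keys (straighten w)"
 shows "letters s ~= [] & last (letters s) : Xp"
proof -
 have "sorted_word (letters s) & set (letters s) <= X & (letters s ~= [] & last (letters s) : Xp)"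
 proof (rule straighten_keys[OF assms(1) _ _ _ _ assms(4), where Q = "%w. w ~= [] & last w : Xp"])
  fix u x y v z assume *: "u @ x # y # v ~= [] & last (u @ x # y # v) : Xp"
   "set (u @ x # y # v) <= X" "rk y < rk x"
  have xX: "x : X" using *(2) by auto
  have end_: "x : Xp & y : Xp" if "v = []" using that * rk_p[of y x] xX by simp
  hence sp: "lie x y : clin.span Xp" if "v = []" using that closed_p by blast
  have XpX: "Xp <= X" using X_parts by blast
  show "u @ y # x # v ~= [] & last (u @ y # x # v) : Xp" using * end_ by(cases "v = []") auto
  show "u @ z # v ~= [] & last (u @ z # v) : Xp" if "z : X" "cf (lie x y) z ~= 0"
   using * that span_cf(1)[OF sp XpX, of z] by(cases "v = []") auto
  show "u @ v ~= [] & last (u @ v) : Xp" if "hpart (lie x y) ~= 0"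
   using * that span_cf(2)[OF sp XpX] by(cases "v = []") auto
 qed (use assms in auto)
 thus ?thesis by blast
qed

text \<open>Mirror image of \<open>straighten_keys_last\<close>, with the initial segment
  \<open>Xm\<close>.\<close>

lemma straighten_keys_hd:
 assumes "set w <= X" "w ~= []" "hd w : Xm" "s : Poly_Mapping.keys (straighten w)"
 shows "letters s ~= [] & hd (letters s) : Xm"
proof -
 have "sorted_word (letters s) & set (letters s) <= X & (letters s ~= [] & hd (letters s) : Xm)"
 proof (rule straighten_keys[OF assms(1) _ _ _ _ assms(4), where Q = "%w. w ~= [] & hd w : Xm"])
  fix u x y v z assume *: "u @ x # y # v ~= [] & hd (u @ x # y # v) : Xm"
   "set (u @ x # y # v) <= X" "rk y < rk x"
  have yX: "y : X" using *(2) by auto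
  have start: "x : Xm & y : Xm" if "u = []" using that * rk_m[of x y] yX by simp
  hence sp: "lie x y : clin.span Xm" if "u = []" using that closed_m by blast
  have XmX: "Xm <= X" using X_parts by blast
  show "u @ y # x # v ~= [] & hd (u @ y # x # v) : Xm" using * start by(cases "u = []") auto
  show "u @ z # v ~= [] & hd (u @ z # v) : Xm" if "z : X" "cf (lie x y) z ~= 0"
   using * that span_cf(1)[OF sp XmX, of z] by(cases "u = []") auto
  show "u @ v ~= [] & hd (u @ v) : Xm" if "hpart (lie x y) ~= 0"
   using * that span_cf(2)[OF sp XmX] by(cases "u = []") auto
 qed (use assms in auto)
 thus ?thesis by blast
qed

lemma dop_keys: "Poly_Mapping.keys (dop d m) <= Poly_Mapping.keys m"
proof -
 have look: "Poly_Mapping.lookup (dop d m) s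
   = inverse (cs.fhom (\<theta> + wtw (letters s)) d) * Poly_Mapping.lookup m s" for s
 proof (induction m rule: falg_induct)
  case (monomial c w)
  show ?case
   unfolding dop_scale dop_fword lookup_fconst_mult
   by(cases "s = Word w") (auto simp: fword_eq_single lookup_single when_def)
 qed (simp add: dop_add lookup_add distrib_left)
 thus ?thesis by(auto simp: in_keys_iff)
qed

text \<open>e sends the generator into the span of the words ending in \<open>Xp\<close>. This span
  is a submodule, and no word in the letters \<open>P\<close> ends there.\<close>

lemma coord_right_ideal:
 assumes e: "e : clin.span Xp" and w: "set w <= P"
 shows "coord (p * fgen (Inl e)) w = 0"
proof -
 define L where "L = {m:M. ALL s:Poly_Mapping.keys m. letters s ~= [] & last (letters s) : Xp}"
 have L_add: "m + m' : L" if "m : L" "m' : L" for m m'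
  using that keys_add[of m m'] M_add by(auto simp: L_def)
 have L_scale: "fconst c * m : L" if "m : L" for m c
  using that keys_fconst_mult[of c m] M_scale by(auto simp: L_def)
 have L_slot: "slotw [] g s : L" if s: "set s <= X" "s ~= []" "last s : Xp" for g s
 proof -
  have "letters k ~= [] & last (letters k) : Xp" if k: "k : Poly_Mapping.keys (slotw [] g s)" for k
  proof -
   obtain t where t: "set t <= X" "k : Poly_Mapping.keys (straighten (t @ s))"
    using slot_keys[OF k] by auto
   thus ?thesis using s by(intro straighten_keys_last[of "t @ s"]) auto
  qed
  moreover have "slotw [] g s : M" using s by(intro M_slot M_straighten) auto
  ultimately show ?thesis by(simp add: L_def)
 qed
 have L_gop: "gop g m : L" if "m : L" for g m
 proof -
  have "ALL s:Poly_Mapping.keys m. set (letters s) <= X & letters s ~= [] & last (letters s) : Xp"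
   using that by(auto simp: L_def M_def)
  thus ?thesis
  proof (induction m rule: falg_restricted_induct[where Q = "%s. set s <= X & s ~= [] & last s : Xp"])
   case (monomial c s)
   thus ?case using L_slot L_scale by(simp add: gop_term)
  next
   case (add p q)
   thus ?case using L_add by(simp add: gop_add)
  qed (simp add: gop_zero L_def M_0)
 qed
 have L_dop: "dop d m : L" if "m : L" for d m
  using that dop_keys[of d m] dop_M by(auto simp: L_def)
 have L_opr: "opr x m : L" if "m : L" for x m
 proof (cases x)
  case (Inl g)
  thus ?thesis using L_gop[OF that] by(simp add: opr_def)
 next
  case (Inr d)
  have "0 : L" by(simp add: L_def M_0)
  thus ?thesis using L_dop[OF that] Inr by(simp add: opr_def)
 qed
 have L_flact: "fs.flact opr p m : L" if "m : L" for p m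
 proof (induction p rule: falg_induct)
  case (monomial c w)
  have "foldr opr w m : L" by(induction w) (simp_all add: that L_opr)
  thus ?case by(simp add: fs.flact_def fs.flin_term L_scale)
 qed (simp add: fs.flact_simps L_add)
 have eL: "gop e 1 : L"
 proof -
  have XpX: "Xp <= X" using X_parts by blast
  have eq: "gop e 1 = slotw [] e []" using gop_fword[of e "[]"] by simp
  have "letters k ~= [] & last (letters k) : Xp" if k: "k : Poly_Mapping.keys (gop e 1)" for k
  proof -
   obtain t where t: "set t <= X" "length t <= 1" "ALL z:set t. cf e z ~= 0"
     "t = [] --> (\<theta> + wtw []) (hpart e) ~= 0" "k : Poly_Mapping.keys (straighten ([] @ t @ []))"
    using slot_keys[OF k[unfolded eq]] by blast
   have "t ~= []" using t(4) span_cf(2)[OF e XpX] dual_space_at_0[OF \<theta>_dual] by auto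
   then obtain z where z: "t = [z]" using t(2) by(cases t) auto
   hence "z : Xp" using t(3) span_cf(1)[OF e XpX] by auto
   thus ?thesis using straighten_keys_last[of t k] t z by simp
  qed
  thus ?thesis using gop_M[OF M_1, of e] by(simp add: L_def)
 qed
 have "fs.flact opr (p * fgen (Inl e)) 1 : L"
  using L_flact[OF eL, of p] by(simp add: flact_opr_mult fs.flact_simps opr_def)
 moreover have "Word w \<notin> Poly_Mapping.keys m" if m: "m : L" for m
 proof
  assume "Word w : Poly_Mapping.keys m"
  hence "w ~= []" "last w : Xp" using m by(auto simp: L_def)
  thus False using w X_parts(3) last_in_set[of w] by blast
 qed
 ultimately show ?thesis by(simp add: coord_def in_keys_iff)
qed

text \<open>f is applied last and puts letters of \<open>Xm\<close> in front; straightening keeps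
  the first letter in \<open>Xm\<close>.\<close>

lemma coord_left_ideal:
 assumes f: "f : clin.span Xm" and w: "set w <= P"
 shows "coord (fgen (Inl f) * p) w = 0"
proof -
 let ?L = "{m. ALL s:Poly_Mapping.keys m. letters s ~= [] & hd (letters s) : Xm}"
 have "gop f m : ?L" if "m : M" for m
  using that
 proof (induction m rule: M_induct)
  case (monomial c s)
  have XmX: "Xm <= X" using X_parts by blast
  have "letters k ~= [] & hd (letters k) : Xm" if k: "k : Poly_Mapping.keys (slotw [] f s)" for k
  proof -
   obtain t where t: "set t <= X" "length t <= 1" "ALL z:set t. cf f z ~= 0"
     "t = [] --> (\<theta> + wtw s) (hpart f) ~= 0" "k : Poly_Mapping.keys (straighten ([] @ t @ s))"
    using slot_keys[OF k] by blast
   have "t ~= []" using t(4) span_cf(2)[OF f XmX] dual_space_at_0[OF shifted_dual[OF monomial(2)]] by auto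
   then obtain z where z: "t = [z]" using t(2) by(cases t) auto
   hence "z : Xm" using t(3) span_cf(1)[OF f XmX] by auto
   thus ?thesis using straighten_keys_hd[of "t @ s" k] t z monomial by simp
  qed
  thus ?case using keys_fconst_mult[of c "slotw [] f s"] by(auto simp: gop_term)
 next
  case (add p q)
  thus ?case using keys_add[of "gop f p" "gop f q"] by(auto simp: gop_add)
 qed
 hence "gop f (fs.flact opr p 1) : ?L" using flact_M[OF M_1] by blast
 hence "Word w \<notin> Poly_Mapping.keys (gop f (fs.flact opr p 1))"
  using w X_parts(2) hd_in_set[of w] by fastforce
 thus ?thesis by(simp add: coord_def flact_opr_mult fs.flact_simps opr_def in_keys_iff)
qed

definition evl :: "('a + 'a falg) falg => complex" where
 "evl = cs.fhom (case_sum \<theta> (%d. inverse (cs.fhom \<theta> d)))"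

lemma coord_scalar:
 assumes "u : FA (Inl ` h \<union> Inr ` D)"
 shows "coord (p * u) w = evl u * coord p w"
proof -
 have "fs.flact opr u 1 = fconst (evl u)"
  using assms
 proof (induction u rule: free_algebra_induct)
  case (gen x)
  have "gop y 1 = fconst (\<theta> y)" if "y : h" for y
   using gop_h[OF that, of "[]"] by(simp add: straighten_sorted)
  moreover have "dop d 1 = fconst (inverse (cs.fhom \<theta> d))" for d
   using dop_fword[of d "[]"] by simp
  ultimately show ?case using gen by(auto simp: fs.flact_simps opr_def evl_def cs.fhom_simps)
 next
  case (mult p q)
  have "fs.flact opr p (fconst c) = fconst c * fs.flact opr p 1" for c
   using flact_opr_linear(2)[of p c 1] by simp
  hence "fs.flact opr (p * q) 1 = fconst (evl q) * fconst (evl p)"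
   using mult by(simp add: flact_opr_mult)
  thus ?case by(simp add: evl_def cs.fhom_mult fconst_mult[symmetric] mult.commute)
 qed (simp_all add: fs.flact_simps evl_def cs.fhom_simps fconst_add)
 hence "fs.flact opr (p * u) 1 = fconst (evl u) * fs.flact opr p 1"
  using flact_opr_linear(2)[of p "evl u" 1] by(simp add: flact_opr_mult)
 thus ?thesis by(simp add: coord_def lookup_fconst_mult)
qed

lemma coord_word:
 assumes "sorted_word w" "set w <= X"
 shows "coord (fword (map Inl w)) w' = (if w' = w then 1 else 0)"
proof -
 have "foldr opr (map Inl w) 1 = fword w"
  using assms
 proof (induction w)
  case (Cons x w)
  have "gop x (fword w) = straighten (x # w)"
   using slot_X[of x "\<theta> + wtw w"] shifted_dual[of w] Cons.prems by(simp add: gop_fword)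
  thus ?case using Cons by(simp add: opr_def straighten_sorted)
 qed simp
 hence "fs.flact opr (fword (map Inl w)) 1 = fword w" unfolding fs.flact_def fs.flin_fword .
 thus ?thesis by(simp add: coord_def fword_eq_single lookup_single when_def)
qed

end

declare plus_fun_apply [simp]

section \<open>Congruences and additive closures\<close>

locale ideal_congruence =
 fixes K :: "'r::ring_1 set"
 assumes K_ideal: "two_sided_ideal K"
begin

definition eqv :: "'r => 'r => bool" (infix \<open>=~\<close> 50) where
 "a =~ b \<longleftrightarrow> a - b : K"

lemmas K_simps = two_sided_idealD[OF K_ideal]

lemma eqv_refl [simp]: "a =~ a"
 by(simp add: eqv_def K_simps)

lemma eqv_sym: "a =~ b ==> b =~ a"
 unfolding eqv_def using K_simps(5)[of "a - b"] by simp

lemma eqv_trans [trans]: "a =~ b ==> b =~ c ==> a =~ c"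
 unfolding eqv_def using K_simps(2)[of "a - b" "b - c"] by simp

lemma eqv_eq [trans]: "a =~ b ==> b = c ==> a =~ c" "a = b ==> b =~ c ==> a =~ c"
 by simp_all

lemma eqv_add: "a =~ b ==> c =~ d ==> a + c =~ b + d"
 unfolding eqv_def using K_simps(2)[of "a - b" "c - d"] by(simp add: algebra_simps)

lemma eqv_diff: "a =~ b ==> c =~ d ==> a - c =~ b - d"
 unfolding eqv_def using K_simps(6)[of "a - b" "c - d"] by(simp add: algebra_simps)

lemma eqv_mult: assumes "a =~ b" "c =~ d" shows "a * c =~ b * d"
proof -
 have "(a - b) * c + b * (c - d) : K"
  using assms K_simps(2,3,4) by(auto simp: eqv_def)
 thus ?thesis by(simp add: eqv_def algebra_simps)
qed

lemma eqv_mult_l: "a =~ b ==> r * a =~ r * b" and eqv_mult_r: "a =~ b ==> a * r =~ b * r"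
 by(simp_all add: eqv_mult)

lemma eqv_mult_lr: "a =~ b ==> r * a * s =~ r * b * s"
 by(simp add: eqv_mult)

lemma eqv_sum: "(!!i. i : A ==> f i =~ g i) ==> sum f A =~ sum g A"
 by(induction A rule: infinite_finite_induct) (simp_all add: eqv_add)

lemma eqv_zero: "a =~ 0 \<longleftrightarrow> a : K"
 by(simp add: eqv_def)

lemma eqv_mem: "a =~ b ==> b : K ==> a : K"
 using eqv_trans[of a b 0] by(simp add: eqv_zero)

text \<open>e x = e x d' e' = e d x e' = x e'.\<close>

lemma inverse_shift:
 assumes "e * d =~ 1" "d' * e' =~ 1" "d * x =~ x * d'" shows "e * x =~ x * e'"
proof -
 have "e * x = e * x * 1" by simp
 also have "... =~ e * x * (d' * e')" by(rule eqv_mult_l[OF eqv_sym[OF assms(2)]])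
 also have "... = e * (x * d') * e'" by(simp add: mult.assoc)
 also have "... =~ e * (d * x) * e'" by(rule eqv_mult_lr[OF eqv_sym[OF assms(3)]])
 also have "... = e * d * (x * e')" by(simp add: mult.assoc)
 also have "... =~ 1 * (x * e')" by(rule eqv_mult_r[OF assms(1)])
 finally show ?thesis by simp
qed

end

inductive_set addcl :: "'r::ab_group_add set => 'r set" for G where
 zero: "0 : addcl G"
| add: "x : G ==> y : addcl G ==> x + y : addcl G"

lemma addcl_base: "x : G ==> x : addcl G"
 using addcl.add[OF _ addcl.zero] by fastforce

lemma addcl_plus: "x : addcl G ==> y : addcl G ==> x + y : addcl G"
 by(induction x rule: addcl.induct) (auto simp: add.assoc intro: addcl.add)

lemma addcl_image: "x : addcl G ==> (!!x y. f (x + y) = f x + f y) ==> f 0 = 0 ==> (!!g. g : G ==> f g : addcl G') ==>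
  f x : addcl G'"
 by(induction x rule: addcl.induct) (auto intro: addcl.zero addcl_plus)

lemma addcl_sum: "(!!i. i : A ==> f i : addcl G) ==> sum f A : addcl G"
 by(induction A rule: infinite_finite_induct) (auto intro: addcl.zero addcl_plus)

text \<open>Sums are enough, since in each use the scalars are part of \<open>G\<close>. The set
  \<open>J\<close> may be a one-sided ideal or the sum A n_+ + n_- A.\<close>

definition span_mod :: "'r::ab_group_add set => 'r set => 'r set" where
 "span_mod J G = {x. EX y:addcl G. x - y : J}"

lemma span_mod_induct:
 assumes "x : span_mod J G" and base: "!!g. g : G ==> V g" and add: "!!x y. V x ==> V y ==> V (x + y)" and zero: "V 0"
  and mod: "!!x y. x - y : J ==> V y ==> V x"
 shows "V x"
proof -
 obtain y where y: "y : addcl G" "x - y : J" using assms(1) unfolding span_mod_def by blast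
 from y(1) have "V y" by(induction y rule: addcl.induct) (simp_all add: base add zero)
 thus ?thesis by(rule mod[OF y(2)])
qed

locale additive_set =
 fixes J :: "'r::ab_group_add set"
 assumes J_zero: "0 : J" and J_add: "a : J ==> b : J ==> a + b : J"
begin

abbreviation "sp \<equiv> span_mod J"

lemma sp_mod: "x - y : J ==> y : sp G ==> x : sp G"
 unfolding span_mod_def using J_add[of "x - y"] by fastforce

lemma sp_base: "g : G ==> g : sp G"
 using J_zero by(auto simp: span_mod_def intro!: bexI[of _ g] addcl_base)

lemma sp_zero: "0 : sp G"
 using J_zero by(auto simp: span_mod_def intro!: bexI[of _ 0] addcl.zero)

lemma sp_add:
 assumes "x : sp G" "y : sp G" shows "x + y : sp G"
proof -
 obtain a b where ab: "a : addcl G" "b : addcl G" "x - a : J" "y - b : J" using assms unfolding span_mod_def by blast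
 hence "x + y - (a + b) : J" using J_add[OF ab(3,4)] by(simp add: algebra_simps)
 thus ?thesis unfolding span_mod_def using addcl_plus[OF ab(1,2)] by blast
qed

lemma sp_sum: "(!!i. i : S ==> f i : sp G) ==> sum f S : sp G"
 by(induction S rule: infinite_finite_induct) (auto intro: sp_add sp_zero)

end

sublocale ideal_congruence \<subseteq> additive_set K
 by unfold_locales (auto intro: K_simps)

lemma (in ideal_congruence) sp_eqv: "x =~ y ==> y : sp G ==> x : sp G"
 unfolding eqv_def by(rule sp_mod)

context ideal_congruence begin

text \<open>Terms with the same index are merged, so that every index carries a single
  coefficient.\<close>

lemma addcl_collect:
 assumes "x : addcl {T m a | m a. m : W & a : C}"
  "!!a b. a : C ==> b : C ==> a + b : C" "!!m a b. m : W ==> a : C ==> b : C ==> T m (a + b) =~ T m a + T m b"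
 shows "EX S c. finite S & S <= W & (ALL m:S. c m : C) & x =~ (\<Sum>m\<in>S. T m (c m))"
 using assms(1)
proof (induction x rule: addcl.induct)
 case zero
 show ?case by(intro exI[of _ "{}"]) simp
next
 case (add x y)
 then obtain m a S c where x: "x = T m a" "m : W" "a : C"
  and S: "finite S" "S <= W" "ALL m:S. c m : C" "y =~ (\<Sum>m\<in>S. T m (c m))" by blast
 show ?case
 proof (cases "m : S")
  case True
  let ?c = "c(m := a + c m)"
  have "(\<Sum>i\<in>S. T i (?c i)) = T m (a + c m) + (\<Sum>i\<in>S - {m}. T i (c i))"
   using S(1) True by(simp add: sum.remove)
  also have "... =~ T m a + T m (c m) + (\<Sum>i\<in>S - {m}. T i (c i))"
   using x S(3) True assms(3) by(intro eqv_add) auto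
  also have "... = x + (\<Sum>i\<in>S. T i (c i))" using S(1) True x by(simp add: sum.remove)
  also have "... =~ x + y" using S(4) by(intro eqv_add eqv_sym[OF S(4)]) simp
  finally have "x + y =~ (\<Sum>i\<in>S. T i (?c i))" by(rule eqv_sym)
  thus ?thesis using S x True assms(2) by(intro exI[of _ S] exI[of _ ?c]) auto
 next
  case False
  let ?c = "c(m := a)"
  have "(\<Sum>i\<in>insert m S. T i (?c i)) = x + (\<Sum>i\<in>S. T i (?c i))" using S(1) False x by simp
  also have "(\<Sum>i\<in>S. T i (?c i)) = (\<Sum>i\<in>S. T i (c i))" using False by(intro sum.cong) auto
  also have "x + (\<Sum>i\<in>S. T i (c i)) =~ x + y" using S(4) by(intro eqv_add eqv_sym[OF S(4)]) simp
  finally have "x + y =~ (\<Sum>i\<in>insert m S. T i (?c i))" by(rule eqv_sym)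
  thus ?thesis using S x False by(intro exI[of _ "insert m S"] exI[of _ ?c]) auto
 qed
qed

end

context presentation begin

sublocale ideal_congruence "pker X R"
 by unfold_locales (rule pker_ideal)

lemma pker_carrier_subset:
 "two_sided_ideal K ==> R <= K ==> p : pker X R ==> p : FA X ==> p : K"
 using genideal_subset by(auto simp: pker_def frestrict_id)

lemma pmap_eqv: "pmap X R p = pmap X R q \<longleftrightarrow> eqv p q"
 by(simp add: pmap_eq_iff eqv_def)

end

section \<open>The localized algebras\<close>

text \<open>Common calculus of the two localizations: \<open>L\<close> is the whole algebra for A
  and \<open>h\<close> for U(h).\<close>

locale localized = ideal_congruence K
 for K :: "('g::fin_dim_complex_lie_algebra + 'g falg) falg set" +
 fixes L :: "'g set" and D :: "'g falg set"
 assumes L_subspace: "clin.subspace L"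
  and gen_add: "!!x y. x : L ==> y : L ==> fgen (Inl (x + y)) =~ fgen (Inl x) + fgen (Inl y)"
  and gen_scale: "!!c x. x : L ==> fgen (Inl (c *\<^sub>C x)) =~ fconst c * fgen (Inl x)"
  and gen_lie: "!!x y. x : L ==> y : L ==>
   fgen (Inl x) * fgen (Inl y) =~ fgen (Inl y) * fgen (Inl x) + fgen (Inl (lie x y))"
  and inv_r: "!!d. d : D ==> frename Inl d * fgen (Inr d) =~ 1"
  and inv_l: "!!d. d : D ==> fgen (Inr d) * frename Inl d =~ 1"
begin

lemma gen_zero: "fgen (Inl 0) =~ 0"
 using gen_scale[of 0 0] clin.subspace_0[OF L_subspace] by simp

lemma gen_sum: "(!!i. i : A ==> f i : L) ==> fgen (Inl (sum f A)) =~ (\<Sum>i\<in>A. fgen (Inl (f i)))"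
proof (induction A rule: infinite_finite_induct)
 case (insert a A)
 have "fgen (Inl (f a + sum f A)) =~ fgen (Inl (f a)) + fgen (Inl (sum f A))"
  using insert L_subspace by(intro gen_add clin.subspace_sum) auto
 also have "... =~ fgen (Inl (f a)) + (\<Sum>i\<in>A. fgen (Inl (f i)))" using insert by(intro eqv_add) auto
 finally show ?case using insert by simp
qed (simp_all add: gen_zero)

lemma gen_lincomb:
 "(!!i. i : A ==> f i : L) ==> fgen (Inl (\<Sum>i\<in>A. c i *\<^sub>C f i)) =~ (\<Sum>i\<in>A. fconst (c i) * fgen (Inl (f i)))"
proof -
 assume f: "!!i. i : A ==> f i : L"
 hence "fgen (Inl (\<Sum>i\<in>A. c i *\<^sub>C f i)) =~ (\<Sum>i\<in>A. fgen (Inl (c i *\<^sub>C f i)))"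
  using L_subspace by(intro gen_sum clin.subspace_scale)
 also have "... =~ (\<Sum>i\<in>A. fconst (c i) * fgen (Inl (f i)))" using f by(intro eqv_sum gen_scale)
 finally show ?thesis .
qed

lemma gen_span:
 assumes "v : clin.span Y" "Y <= L"
 shows "EX c B. finite B & B <= Y & v = (\<Sum>y\<in>B. c y *\<^sub>C y) & fgen (Inl v) =~ (\<Sum>y\<in>B. fconst (c y) * fgen (Inl y))"
proof -
 obtain B c where B: "finite B" "B <= Y" "v = (\<Sum>y\<in>B. c y *\<^sub>C y)"
  using assms(1) unfolding clin.span_explicit by blast
 hence "fgen (Inl v) =~ (\<Sum>y\<in>B. fconst (c y) * fgen (Inl y))"
  using gen_lincomb[of B "%y. y" c] assms(2) by auto
 thus ?thesis using B by blast
qed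

lemma inverse_past:
 "d : D ==> d' : D ==> frename Inl d * x =~ x * frename Inl d' ==> fgen (Inr d) * x =~ x * fgen (Inr d')"
 by(rule inverse_shift[OF inv_l inv_r])

end

context reductive_pair begin

abbreviation DD :: "'g falg set" where "DD \<equiv> denominators k h"

lemma DD_iff: "d : DD \<longleftrightarrow> (EX \<alpha>:roots k h. EX l. d = fgen (coroot k h \<alpha>) + fconst (of_int l))"
 by(auto simp: denominators_def)

abbreviation "gA \<equiv> loc_gens UNIV DD"
abbreviation "rA \<equiv> loc_rels (env_rels UNIV) DD"
abbreviation "gU \<equiv> loc_gens h DD"
abbreviation "rU \<equiv> loc_rels (env_rels h) DD"
abbreviation "IA \<equiv> pker gA rA"
abbreviation "IU \<equiv> pker gU rU"
abbreviation "CU \<equiv> FA gU"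

lemma frename_mem: "p : FA Y ==> frename f p : FA (f ` Y)"
 by(induction p rule: free_algebra_induct) (auto simp: frename_simps)

lemma free_algebra_mono: "Y <= Y' ==> FA Y <= carrier (free_algebra Y')"
 unfolding subset_iff[of "carrier _"] free_algebra_mem by(meson order_trans)

lemma loc_rels_mem:
 assumes "R <= FA L" "D <= FA L"
 shows "loc_rels R D <= FA (loc_gens L D)"
proof -
 have "frename Inl p : FA (loc_gens L D)" if "p : FA L" for p
  using frename_mem[OF that, of Inl] free_algebra_mono[of "Inl ` L" "loc_gens L D"] by(auto simp: loc_gens_def)
 moreover have "fgen (Inr d) : FA (loc_gens L D)" if "d : D" for d
  using that by(simp add: loc_gens_def)
 ultimately show ?thesis using assms by(auto simp: loc_rels_def)
qed

lemma env_rels_mem: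
 assumes "clin.subspace L" "!!x y. x : L ==> y : L ==> lie x y : L"
 shows "env_rels L <= FA L"
 using assms by(auto simp: env_rels_def clin.subspace_add clin.subspace_scale)

lemma DD_mem: "DD <= FA h"
 using coroot_mem by(auto simp: DD_iff)

sublocale A: presentation gA rA
proof
 have "DD <= FA UNIV" by(auto simp: free_algebra_mem)
 thus "rA <= FA gA"
  by(intro loc_rels_mem env_rels_mem) auto
qed

sublocale U: presentation gU rU
 by unfold_locales (intro loc_rels_mem env_rels_mem DD_mem h_subspace,
  simp add: h_abelian clin.subspace_0[OF h_subspace])

notation A.eqv (infix \<open>=~\<close> 50)
notation U.eqv (infix \<open>=~U\<close> 50)

lemma env_rel_frename:
 "x : L ==> y : L ==> fgen (Inl (x + y)) - fgen (Inl x) - fgen (Inl y) : loc_rels (env_rels L) D"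
 "x : L ==> fgen (Inl (c *\<^sub>C x)) - fconst c * fgen (Inl x) : loc_rels (env_rels L) D"
 "x : L ==> y : L ==> fgen (Inl x) * fgen (Inl y) - fgen (Inl y) * fgen (Inl x) - fgen (Inl (lie x y))
  : loc_rels (env_rels L) D"
proof -
 have *: "frename Inl r : loc_rels (env_rels L) D" if "r : env_rels L" for r
  using that by(auto simp: loc_rels_def)
 show "x : L ==> y : L ==> fgen (Inl (x + y)) - fgen (Inl x) - fgen (Inl y) : loc_rels (env_rels L) D"
  using *[of "fgen (x + y) - fgen x - fgen y"] unfolding frename_simps env_rels_def by blast
 show "x : L ==> fgen (Inl (c *\<^sub>C x)) - fconst c * fgen (Inl x) : loc_rels (env_rels L) D"
  using *[of "fgen (c *\<^sub>C x) - fconst c * fgen x"] unfolding frename_simps env_rels_def by blast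
 show "x : L ==> y : L ==> fgen (Inl x) * fgen (Inl y) - fgen (Inl y) * fgen (Inl x) - fgen (Inl (lie x y))
  : loc_rels (env_rels L) D"
  using *[of "fgen x * fgen y - fgen y * fgen x - fgen (lie x y)"]
  unfolding frename_simps env_rels_def by blast
qed

lemma localized_pker:
 assumes "presentation (loc_gens L DD) (loc_rels (env_rels L) DD)" "clin.subspace L"
 shows "localized (pker (loc_gens L DD) (loc_rels (env_rels L) DD)) L DD"
proof -
 interpret P: presentation "loc_gens L DD" "loc_rels (env_rels L) DD" by(rule assms(1))
 note rel = env_rel_frename[of _ L _ DD, THEN P.pker_relator]
  env_rel_frename(2)[of _ L _ DD, THEN P.pker_relator]
 show ?thesis
 proof (unfold_locales, unfold P.eqv_def)
  show "clin.subspace L" by(rule assms)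
  show "fgen (Inl (x + y)) - (fgen (Inl x) + fgen (Inl y)) : pker (loc_gens L DD) (loc_rels (env_rels L) DD)"
   if "x : L" "y : L" for x y using P.pker_relator[OF env_rel_frename(1)[OF that]] by(simp add: algebra_simps)
  show "fgen (Inl (c *\<^sub>C x)) - fconst c * fgen (Inl x) : pker (loc_gens L DD) (loc_rels (env_rels L) DD)"
   if "x : L" for c x using P.pker_relator[OF env_rel_frename(2)[OF that]] .
  show "fgen (Inl x) * fgen (Inl y) - (fgen (Inl y) * fgen (Inl x) + fgen (Inl (lie x y)))
    : pker (loc_gens L DD) (loc_rels (env_rels L) DD)"
   if "x : L" "y : L" for x y using P.pker_relator[OF env_rel_frename(3)[OF that]] by(simp add: algebra_simps)
  show "frename Inl d * fgen (Inr d) - 1 : pker (loc_gens L DD) (loc_rels (env_rels L) DD)"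
   "fgen (Inr d) * frename Inl d - 1 : pker (loc_gens L DD) (loc_rels (env_rels L) DD)" if "d : DD" for d
  proof -
   have "frename Inl d * fgen (Inr d) - 1 : loc_rels (env_rels L) DD"
    "fgen (Inr d) * frename Inl d - 1 : loc_rels (env_rels L) DD"
    using that unfolding loc_rels_def by blast+
   thus "frename Inl d * fgen (Inr d) - 1 : pker (loc_gens L DD) (loc_rels (env_rels L) DD)"
    "fgen (Inr d) * frename Inl d - 1 : pker (loc_gens L DD) (loc_rels (env_rels L) DD)"
    by(simp_all add: P.pker_relator)
  qed
 qed
qed

sublocale A: localized IA UNIV DD
 by(rule localized_pker[OF A.presentation_axioms]) simp

sublocale U: localized IU h DD
 by(rule localized_pker[OF U.presentation_axioms h_subspace])

lemma rU_rA: "rU <= rA"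
proof -
 have "env_rels h <= env_rels UNIV" unfolding env_rels_def by(intro Un_mono) blast+
 thus ?thesis unfolding loc_rels_def by(intro Un_mono image_mono) auto
qed

lemma IU_IA: "p : IU ==> p : CU ==> p : IA"
 by(rule U.pker_carrier_subset[OF A.pker_ideal]) (use A.pker_relator rU_rA in auto)

lemma frename_DD: "d : DD ==> EX \<alpha>:roots k h. EX l. d = fgen (coroot k h \<alpha>) + fconst (of_int l) &
  frename Inl d = fgen (Inl (coroot k h \<alpha>)) + fconst (of_int l)"
 by(fastforce simp: DD_iff frename_simps)

subsection \<open>Commuting elements of \<open>U(h)\<close> with weight vectors\<close>

lemma gU_cases: "x : gU \<longleftrightarrow> (EX y:h. x = Inl y) \<or> (EX d:DD. x = Inr d)"
 by(auto simp: loc_gens_def)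

lemma integral_shift:
 assumes "\<alpha> : roots k h" "weight_vector h \<nu> x" "x ~= 0" shows "\<nu> (coroot k h \<alpha>) : \<int>"
 using coroot_integral[OF assms(1), of x] coroot_mem[OF assms(1)] assms(2,3) by(simp add: weight_vector_def)

type_synonym 'a lfalg = "('a + 'a falg) falg"

abbreviation \<iota> :: "'g => 'g lfalg" where "\<iota> x \<equiv> fgen (Inl x)"
abbreviation "\<iota>s xs \<equiv> prod_list (map \<iota> xs)"

text \<open>Induction over the generators of the localized U(h). Integrality of \<open>c\<close> on
  coroots keeps a shifted denominator inside the set of denominators. \<open>V\<close> is abstract
  because the same induction moves coefficients past a weight vector in both directions and, later,
  past a letter of the presented algebra.\<close>

lemma shift_relation:
 fixes V :: "'g lfalg => 'g lfalg => bool"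
 assumes const: "!!a. V (fconst a) (fconst a)" and vec: "!!y. y : h ==> V (\<iota> y) (\<iota> y + fconst (c y))"
  and inv: "!!d d'. d : DD ==> d' : DD ==> V (frename Inl d) (frename Inl d') ==> V (fgen (Inr d)) (fgen (Inr d'))"
  and add: "!!u u' v v'. {u, u', v, v'} <= CU ==> V u u' ==> V v v' ==> V (u + v) (u' + v')"
  and mult: "!!u u' v v'. {u, u', v, v'} <= CU ==> V u u' ==> V v v' ==> V (u * v) (u' * v')"
  and int: "!!\<alpha>. \<alpha> : roots k h ==> c (coroot k h \<alpha>) : \<int>"
  and u: "u : CU"
 shows "EX u':CU. V u u'"
proof -
 have h: "\<iota> y : CU" if "y : h" for y using that by(auto simp: gU_cases)
 have "u : CU & (EX u':CU. V u u')"
  using u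
 proof (induction u rule: free_algebra_induct)
  case (gen z)
  then consider y where "y : h" "z = Inl y" | d where "d : DD" "z = Inr d" by(auto simp: gU_cases)
  thus ?case
  proof cases
   case 1
   hence "\<iota> y + fconst (c y) : CU" using h by blast
   thus ?thesis using vec 1 h by blast
  next
   case 2
   obtain \<alpha> l where d: "\<alpha> : roots k h" "d = fgen (coroot k h \<alpha>) + fconst (of_int l)" using 2(1) by(auto simp: DD_iff)
   let ?t = "coroot k h \<alpha>"
   obtain n where n: "c ?t = of_int n" using int[OF d(1)] by(auto elim: Ints_cases)
   let ?d = "fgen ?t + fconst (of_int (l + n)) :: 'g falg"
   have dm: "?d : DD" using d(1) unfolding DD_iff by blast
   have "V (\<iota> ?t + fconst (of_int l)) (\<iota> ?t + fconst (c ?t) + fconst (of_int l))"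
    using h[OF coroot_mem[OF d(1)]] by(intro add vec const coroot_mem d) auto
   hence "V (frename Inl d) (frename Inl ?d)" by(simp add: d(2) n frename_simps fconst_add add_ac)
   hence "V (fgen (Inr d)) (fgen (Inr ?d))" by(rule inv[OF 2(1) dm])
   moreover have "fgen (Inr d) : CU" "fgen (Inr ?d) : CU" using 2(1) dm by(auto simp: gU_cases)
   ultimately show ?thesis using 2(2) by blast
  qed
 next
  case (add p q)
  then obtain p' q' where "p' : CU" "V p p'" "q' : CU" "V q q'" by blast
  moreover from this have "V (p + q) (p' + q')" using add by(intro assms(4)) auto
  ultimately show ?case using add by(intro conjI bexI[of _ "p' + q'"]) auto
 next
  case (mult p q)
  then obtain p' q' where "p' : CU" "V p p'" "q' : CU" "V q q'" by blast
  moreover from this have "V (p * q) (p' * q')" using mult by(intro assms(5)) auto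
  ultimately show ?case using mult by(intro conjI bexI[of _ "p' * q'"]) auto
 qed (use const in auto)
 thus ?thesis by blast
qed

lemma scalar_past:
 assumes u: "u : CU" and x: "weight_vector h \<nu> x" "\<nu> : dual_space h"
 shows "EX u':CU. u * \<iota> x =~ \<iota> x * u'" "EX u':CU. \<iota> x * u =~ u' * \<iota> x"
proof -
 \<comment> \<open>For x = 0 the weight is arbitrary and its values on coroots may fail to be
   integral; the shift 0 is used then.\<close>
 define c where "c y = (if x = 0 then 0 else \<nu> y)" for y
 have int: "c (coroot k h \<alpha>) : \<int>" if "\<alpha> : roots k h" for \<alpha>
  using integral_shift[OF that x(1)] by(cases "x = 0") (auto simp: c_def)
 have vec: "\<iota> y * \<iota> x =~ \<iota> x * (\<iota> y + fconst (c y))" if "y : h" for y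
 proof -
  have "lie y x = c y *\<^sub>C x" using x(1) that by(simp add: weight_vector_def c_def)
  hence "\<iota> y * \<iota> x =~ \<iota> x * \<iota> y + \<iota> (c y *\<^sub>C x)" using A.gen_lie[of y x] by simp
  also have "... =~ \<iota> x * \<iota> y + fconst (c y) * \<iota> x" by(intro A.eqv_add A.gen_scale A.eqv_refl) simp
  finally show ?thesis by(simp add: distrib_left fconst_central[of "c y" "\<iota> x"])
 qed
 have mult: "(u * v) * \<iota> x =~ \<iota> x * (u' * v')" if "u * \<iota> x =~ \<iota> x * u'" "v * \<iota> x =~ \<iota> x * v'" for u v u' v'
 proof -
  have "u * (v * \<iota> x) =~ u * (\<iota> x * v')" by(rule A.eqv_mult_l[OF that(2)])
  moreover have "(u * \<iota> x) * v' =~ (\<iota> x * u') * v'" by(rule A.eqv_mult_r[OF that(1)])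
  ultimately show ?thesis using A.eqv_trans by(simp add: mult.assoc)
 qed
 show "EX u':CU. u * \<iota> x =~ \<iota> x * u'"
  by(rule shift_relation[where c = c and V = "%u u'. u * \<iota> x =~ \<iota> x * u'"])
   (auto simp: u int vec[unfolded distrib_left] mult distrib_left distrib_right fconst_central[of _ "\<iota> x"] intro: A.eqv_add A.inverse_past)
 have "EX u':CU. u' * \<iota> x =~ \<iota> x * u"
 proof (rule shift_relation[where c = "%y. - c y" and V = "%u u'. u' * \<iota> x =~ \<iota> x * u"])
  fix y assume "y : h"
  from A.eqv_diff[OF vec[OF this] A.eqv_refl, of "fconst (c y) * \<iota> x"]
  show "(\<iota> y + fconst (- c y)) * \<iota> x =~ \<iota> x * \<iota> y"
   by(simp add: distrib_left left_diff_distrib fconst_minus fconst_central[of "c y" "\<iota> x"])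
 qed (auto simp: u int mult distrib_left distrib_right fconst_central[of _ "\<iota> x"] intro: A.eqv_add A.inverse_past)
 thus "EX u':CU. \<iota> x * u =~ u' * \<iota> x" using A.eqv_sym by blast
qed

subsection \<open>Separation of \<open>U(h)\<close> by its characters\<close>

lemma U_comm:
 assumes "p : CU" "q : CU" shows "p * q =~U q * p"
proof -
 have step: "p * q =~U q * p" if "q : CU" and gen: "!!y. y : h ==> p * fgen (Inl y) =~U fgen (Inl y) * p" for p q
  using that(1)
 proof (induction q rule: free_algebra_induct)
  case (const c)
  thus ?case by(simp only: fconst_central[of c p] U.eqv_refl)
 next
  case (gen z)
  then consider y where "y : h" "z = Inl y" | d where "d : DD" "z = Inr d" by(auto simp: gU_cases)
  thus ?case
  proof cases
   case 1
   thus ?thesis using that(2) by blast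
  next
   case 2
   obtain \<alpha> l where d: "\<alpha> : roots k h"
     "frename Inl d = (fgen (Inl (coroot k h \<alpha>)) + fconst (of_int l) :: 'g lfalg)"
    using frename_DD[OF 2(1)] by blast
   have "frename Inl d * p =~U p * frename Inl d"
    unfolding d(2) distrib_left distrib_right fconst_central[of "of_int l" p]
    by(intro U.eqv_add U.eqv_sym[OF that(2)] coroot_mem d) simp
   thus ?thesis using U.inverse_past[OF 2(1) 2(1)] 2(2) U.eqv_sym by blast
  qed
 next
  case (add a b)
  thus ?case by(simp add: distrib_left distrib_right U.eqv_add)
 next
  case (mult a b)
  have "p * (a * b) = p * a * b" by(simp add: mult.assoc)
  also have "... =~U a * p * b" by(rule U.eqv_mult_r[OF mult(1)])
  also have "... = a * (p * b)" by(simp add: mult.assoc)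
  also have "... =~U a * (b * p)" by(rule U.eqv_mult_l[OF mult(2)])
  finally show ?case by(simp add: mult.assoc)
 qed
 have "fgen (Inl x) * fgen (Inl y) =~U fgen (Inl y) * fgen (Inl x)" if "x : h" "y : h" for x y
 proof -
  have "fgen (Inl x) * fgen (Inl y) =~U fgen (Inl y) * fgen (Inl x) + fgen (Inl (lie x y))"
   using that by(rule U.gen_lie)
  also have "... =~U fgen (Inl y) * fgen (Inl x) + 0"
   using h_abelian[OF that] U.gen_zero by(intro U.eqv_add) auto
  finally show ?thesis by simp
 qed
 hence "fgen (Inl x) * r =~U r * fgen (Inl x)" if "x : h" "r : CU" for x r
  using step[OF that(2)] that(1) by blast
 hence "q * p =~U p * q" using step[OF assms(1)] U.eqv_sym assms(2) by blast
 thus ?thesis by(rule U.eqv_sym)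
qed

end

lemma (in central_scalars) fhom_frename_gen: "fhom g (frename f p) = fhom (%x. g (f x)) p"
 by(rule falg_hom_ext[where F = "%p. fhom g (frename f p)"]) (simp_all add: frename_simps fhom_simps fhom_mult)

context reductive_pair begin

definition generic :: "('g => complex) => bool" where
 "generic \<theta> \<longleftrightarrow> \<theta> : dual_space h & (ALL \<alpha>:roots k h. ALL l::int. \<theta> (coroot k h \<alpha>) + of_int l ~= 0)"

definition ev :: "('g => complex) => 'g lfalg => complex" where
 "ev \<theta> = cs.fhom (case_sum \<theta> (%d. inverse (cs.fhom \<theta> d)))"

lemma ev_simps: "ev \<theta> (p + q) = ev \<theta> p + ev \<theta> q" "ev \<theta> (p * q) = ev \<theta> p * ev \<theta> q"
 "ev \<theta> (fgen (Inl x)) = \<theta> x" "ev \<theta> (fconst c) = c" "ev \<theta> 1 = 1" "ev \<theta> 0 = 0" "ev \<theta> (p - q) = ev \<theta> p - ev \<theta> q"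
 by(simp_all add: ev_def cs.fhom_simps cs.fhom_mult)

lemma ev_sum: "ev \<theta> (sum f A) = (\<Sum>i\<in>A. ev \<theta> (f i))"
 by(induction A rule: infinite_finite_induct) (simp_all add: ev_simps)

lemma dual_at_0: "\<nu> : dual_space h ==> \<nu> 0 = 0"
 using clin.subspace_0[OF h_subspace] unfolding dual_space_def
 by(metis (mono_tags, lifting) clin.scale_zero_left mem_Collect_eq mult_zero_left)

lemma ev_IU: assumes "generic \<theta>" "p : IU" "p : CU" shows "ev \<theta> p = 0"
proof -
 let ?K = "{p. ev \<theta> p = 0}"
 have \<theta>: "\<theta> : dual_space h" using assms(1) by(simp add: generic_def)
 have "two_sided_ideal ?K" by(simp add: two_sided_ideal_def ev_simps)
 moreover have "rU <= ?K"
 proof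
  fix r assume "r : rU"
  then consider r' where "r = frename Inl r'" "r' : env_rels h"
   | d where "d : DD" "r = frename Inl d * fgen (Inr d) - 1 \<or> r = fgen (Inr d) * frename Inl d - 1"
   unfolding loc_rels_def by blast
  thus "r : ?K"
  proof cases
   case 1
   have "cs.fhom \<theta> r' = 0"
    using 1(2) \<theta> h_abelian dual_at_0[OF \<theta>] unfolding env_rels_def dual_space_def
    by(auto simp: cs.fhom_simps cs.fhom_mult)
   thus ?thesis by(simp add: 1(1) ev_def cs.fhom_frename_gen)
  next
   case 2
   obtain \<alpha> l where "\<alpha> : roots k h" "d = fgen (coroot k h \<alpha>) + fconst (of_int l)" using 2(1) by(auto simp: DD_iff)
   hence "cs.fhom \<theta> d ~= 0" using assms(1) by(simp add: cs.fhom_simps generic_def)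
   thus ?thesis using 2(2) by(auto simp: ev_def cs.fhom_frename_gen cs.fhom_simps cs.fhom_mult)
  qed
 qed
 ultimately show ?thesis using U.pker_carrier_subset[of ?K p] assms by blast
qed

definition den :: "'g falg list => 'g lfalg" where
 "den ds = prod_list (map (frename Inl) ds)"

lemma CU_h: "FA (Inl ` h) <= CU"
 by(rule free_algebra_mono) (auto simp: gU_cases)

lemma den_mem: "set ds <= DD ==> den ds : FA (Inl ` h)"
proof (induction ds)
 case (Cons d ds)
 hence "(frename Inl d :: 'g lfalg) : FA (Inl ` h)"
  using frename_mem DD_mem by auto
 thus ?case using Cons by(simp add: den_def free_algebra_closed)
qed (simp add: den_def)

text \<open>Addition and multiplication of fractions, legitimate because the localized U(h) is
  commutative.\<close>

lemma U_fraction: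
 assumes "u : CU"
 shows "EX ds q. set ds <= DD & q : FA (Inl ` h) & u * den ds =~U q"
 using assms
proof (induction u rule: free_algebra_induct)
 case (const c)
 show ?case by(intro exI[of _ "[]"] exI[of _ "fconst c"]) (simp add: den_def)
next
 case (gen x)
 then consider y where "y : h" "x = Inl y" | d where "d : DD" "x = Inr d" by(auto simp: gU_cases)
 thus ?case
 proof cases
  case 1
  thus ?thesis by(intro exI[of _ "[]"] exI[of _ "fgen x"]) (simp add: den_def)
 next
  case 2
  thus ?thesis using U.inv_l by(intro exI[of _ "[d]"] exI[of _ 1]) (simp add: den_def)
 qed
next
 case (add u v)
 then obtain ds q es r where *: "set ds <= DD" "q : FA (Inl ` h)" "u * den ds =~U q"
  "set es <= DD" "r : FA (Inl ` h)" "v * den es =~U r" by blast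
 have mem: "den ds : CU" "den es : CU" using den_mem * CU_h by auto
 have "(u + v) * den (ds @ es) = u * den ds * den es + v * (den ds * den es)"
  by(simp add: den_def distrib_right mult.assoc)
 also have "... =~U q * den es + v * (den es * den ds)"
  using mem by(intro U.eqv_add U.eqv_mult_r * U.eqv_mult_l U_comm)
 also have "q * den es + v * (den es * den ds) = q * den es + v * den es * den ds" by(simp add: mult.assoc)
 also have "... =~U q * den es + r * den ds" by(intro U.eqv_add U.eqv_mult_r *) simp
 finally have "(u + v) * den (ds @ es) =~U q * den es + r * den ds" .
 moreover have "q * den es + r * den ds : FA (Inl ` h)" using * den_mem by auto
 ultimately show ?case using *(1,4) by(intro exI[of _ "ds @ es"]) auto
next
 case (mult u v)
 then obtain ds q es r where *: "set ds <= DD" "q : FA (Inl ` h)" "u * den ds =~U q"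
  "set es <= DD" "r : FA (Inl ` h)" "v * den es =~U r" by blast
 have mem: "den es : CU" "r : CU" "q : CU" "den ds : CU" using den_mem * CU_h by auto
 have "u * v * den (es @ ds) = u * (v * den es) * den ds" by(simp add: den_def mult.assoc)
 also have "... =~U u * r * den ds" by(intro U.eqv_mult_lr *)
 also have "... = u * (r * den ds)" by(simp add: mult.assoc)
 also have "... =~U u * (den ds * r)" using mem by(intro U.eqv_mult_l U_comm)
 also have "... = u * den ds * r" by(simp add: mult.assoc)
 also have "... =~U q * r" by(intro U.eqv_mult_r *)
 finally have "u * v * den (es @ ds) =~U q * r" .
 moreover have "q * r : FA (Inl ` h)" using * by auto
 ultimately show ?case using *(1,4) by(intro exI[of _ "es @ ds"]) auto
qed

lemma den_cancel: "set ds <= DD ==> u * den ds : IU ==> u : IU"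
proof (induction ds arbitrary: u)
 case (Cons d ds)
 hence "(u * frename Inl d) * den ds : IU" by(simp add: den_def mult.assoc)
 hence "u * frename Inl d : IU" using Cons by simp
 hence "u * frename Inl d * fgen (Inr d) : IU" by(rule U.K_simps)
 moreover have "u * 1 =~U u * (frename Inl d * fgen (Inr d))"
  using Cons.prems by(intro U.eqv_mult_l U.eqv_sym[OF U.inv_r]) simp
 ultimately show ?case using U.eqv_mem by(simp add: mult.assoc)
qed (simp add: den_def)

definition vary :: "('g => complex) => ('g => complex) => complex => 'g => complex" where
 "vary \<theta> \<beta> s = (%v. \<theta> v + s * \<beta> v)"

lemma vary_dual: "\<theta> : dual_space h ==> \<beta> : dual_space h ==> vary \<theta> \<beta> s : dual_space h"
 by(auto simp: dual_space_def vary_def algebra_simps)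

text \<open>Each condition excludes at most one s, and none if \<beta> vanishes on the coroot, by
  the assumption on \<theta>. So countably many points are removed from the complex plane.\<close>

lemma vary_nonvanishing:
 assumes "!!\<alpha> l. \<alpha> : R ==> \<beta> (coroot k h \<alpha>) = 0 ==> \<theta> (coroot k h \<alpha>) + of_int l ~= 0" "R <= roots k h"
 shows "infinite {s. ALL \<alpha>:R. ALL l::int. vary \<theta> \<beta> s (coroot k h \<alpha>) + of_int l ~= 0}"
proof -
 let ?bad = "\<Union>\<alpha>\<in>R. \<Union>l::int. {s. vary \<theta> \<beta> s (coroot k h \<alpha>) + of_int l = 0}"
 have "{s. vary \<theta> \<beta> s (coroot k h \<alpha>) + of_int l = 0} <= {- (\<theta> (coroot k h \<alpha>) + of_int l) / \<beta> (coroot k h \<alpha>)}"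
  if "\<alpha> : R" for \<alpha> and l :: int
  using assms(1)[OF that, of l]
  by(cases "\<beta> (coroot k h \<alpha>) = 0") (auto simp: vary_def field_simps add_eq_0_iff)
 hence "countable ?bad"
  by(intro countable_UN countable_finite[OF finite_subset[OF assms(2) roots_finite]] countableI_type)
   (meson countable_finite finite.intros finite_subset)
 hence "infinite (UNIV - ?bad)"
  using uncountable_minus_countable[OF uncountable_UNIV_complex] countable_finite by blast
 thus ?thesis by(rule infinite_super[rotated]) auto
qed

definition coordinate :: "'g set => 'g => 'g => complex" where
 "coordinate H b v = (if v : h then clin.representation H v b else 0)"

lemma coordinate_dual: "clin.independent H ==> clin.span H = h ==> coordinate H b : dual_space h"
 using h_subspace unfolding dual_space_def
 by(auto simp: coordinate_def clin.subspace_add clin.subspace_scale clin.representation_add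
   clin.representation_scale)

text \<open>Suitable multiples of the basis coordinates are added one at a time, each time securing
  the conditions for the coroots that have a nonzero coordinate so far. Every coroot has one, as
  \<alpha> takes the value 2 on it.\<close>

lemma generic_exists:
 assumes H: "clin.independent H" "clin.span H = h"
 shows "EX \<theta>. generic \<theta>"
proof -
 have fin: "finite H" using H(1) by(rule cfin.finiteI_independent)
 have "EX \<theta>:dual_space h. ALL \<alpha>:roots k h. (EX b:S. coordinate H b (coroot k h \<alpha>) ~= 0) -->
   (ALL l::int. \<theta> (coroot k h \<alpha>) + of_int l ~= 0)" if "finite S" for S
  using that
 proof (induction S)
  case empty
  show ?case using dual_space_zero by blast
 next
  case (insert b S)
  then obtain \<theta> where \<theta>: "\<theta> : dual_space h" "ALL \<alpha>:roots k h. (EX b:S. coordinate H b (coroot k h \<alpha>) ~= 0) -->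
   (ALL l::int. \<theta> (coroot k h \<alpha>) + of_int l ~= 0)" by blast
  let ?R = "{\<alpha>:roots k h. EX b:insert b S. coordinate H b (coroot k h \<alpha>) ~= 0}"
  have "infinite {s. ALL \<alpha>:?R. ALL l::int. vary \<theta> (coordinate H b) s (coroot k h \<alpha>) + of_int l ~= 0}"
   by(rule vary_nonvanishing) (use \<theta>(2) in auto)
  then obtain s where "ALL \<alpha>:?R. ALL l::int. vary \<theta> (coordinate H b) s (coroot k h \<alpha>) + of_int l ~= 0"
   using not_finite_existsD by blast
  thus ?case using vary_dual[OF \<theta>(1) coordinate_dual[OF H]] by blast
 qed
 then obtain \<theta> where \<theta>: "\<theta> : dual_space h" "ALL \<alpha>:roots k h. (EX b:H. coordinate H b (coroot k h \<alpha>) ~= 0) -->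
   (ALL l::int. \<theta> (coroot k h \<alpha>) + of_int l ~= 0)" using fin by blast
 have "EX b:H. coordinate H b (coroot k h \<alpha>) ~= 0" if \<alpha>: "\<alpha> : roots k h" for \<alpha>
 proof (rule ccontr)
  assume "\<not> ?thesis"
  hence "(\<Sum>x\<in>H. clin.representation H (coroot k h \<alpha>) x *\<^sub>C x) = 0"
   using coroot_mem[OF \<alpha>] by(intro sum.neutral) (simp add: coordinate_def)
  hence "coroot k h \<alpha> = 0"
   using clin.sum_representation_eq[OF H(1) _ fin subset_refl, of "coroot k h \<alpha>"] coroot_mem[OF \<alpha>] H(2) by simp
  thus False using coroot_pair[OF \<alpha>] dual_at_0[of \<alpha>] \<alpha> by(auto simp: roots_iff)
 qed
 thus ?thesis using \<theta> unfolding generic_def by blast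
qed

text \<open>Induction on the number of coordinates: as a polynomial in the last coordinate, \<open>q\<close> vanishes at
 all but countably many points, so that its coefficients vanish at all generic points.\<close>

lemma polynomial_separation:
 assumes q: "q : FA (Inl ` h)" and zero: "!!\<theta>. generic \<theta> ==> ev \<theta> q = 0"
 shows "q : IU"
proof -
 obtain H where H0: "H <= h" "clin.independent H" "h <= clin.span H"
  by(rule clin.maximal_independent_subset)
 have spH: "clin.span H = h" using H0(1,3) h_subspace by(rule clin.span_subspace)
 have fin: "finite H" using H0(2) by(rule cfin.finiteI_independent)
 let ?F = "%S. FA (Inl ` S) :: 'g lfalg set"
 have FU: "?F S <= CU" if "S <= H" for S
  using free_algebra_mono[of "Inl ` S" "Inl ` h"] that H0(1) CU_h by blast
 have main: "q : IU" if "finite S" "S <= H" "q : ?F S" "ALL \<theta>. generic \<theta> --> ev \<theta> q = 0" for S q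
  using that
 proof (induction S arbitrary: q)
  case empty
  have "EX c. q = fconst c" using empty(2)
   by(induction q rule: free_algebra_induct) (auto simp flip: fconst_add fconst_mult)
  then obtain c where c: "q = fconst c" by blast
  obtain \<theta> where "generic \<theta>" using generic_exists[OF H0(2) spH] by blast
  thus ?case using empty(3) U.K_simps(1) by(auto simp: c ev_simps)
 next
  case (insert b S)
  have bS: "?F S <= CU" "\<iota> b : CU" using FU insert.prems H0(1) by(auto simp: gU_cases)
  define T where "T = {a * \<iota> b ^ m | m a. m : (UNIV :: nat set) & a : ?F S}"
  have TI: "a * \<iota> b ^ m : T" if "a : ?F S" for a m using that unfolding T_def by blast
  have pw: "\<iota> b ^ m : CU" for m using bS(2) by(induction m) auto
  have base: "EX w:addcl T. a * \<iota> b ^ m * z =~U w" if a: "a : ?F S" and z: "z : addcl T" for a m z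
   using z
  proof (induction z rule: addcl.induct)
   case zero
   show ?case by(intro bexI[of _ 0]) (auto intro: addcl.zero)
  next
   case (add x y)
   then obtain a' m' w where x: "x = a' * \<iota> b ^ m'" "a' : ?F S" and w: "w : addcl T" "a * \<iota> b ^ m * y =~U w"
    unfolding T_def by blast
   have "a * \<iota> b ^ m * x = a * (\<iota> b ^ m * a') * \<iota> b ^ m'" by(simp add: x mult.assoc)
   also have "... =~U a * (a' * \<iota> b ^ m) * \<iota> b ^ m'" using x(2) bS(1) by(intro U.eqv_mult_lr U_comm pw) auto
   also have "... = a * a' * \<iota> b ^ (m + m')" by(simp add: mult.assoc power_add)
   finally have "a * \<iota> b ^ m * (x + y) =~U a * a' * \<iota> b ^ (m + m') + w"
    using w(2) unfolding distrib_left by(intro U.eqv_add)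
   moreover have "a * a' * \<iota> b ^ (m + m') + w : addcl T"
    using w(1) a x(2) by(intro addcl.add TI) auto
   ultimately show ?case by blast
  qed
  have "EX y:addcl T. q =~U y"
   using insert.prems(2)
  proof (induction q rule: free_algebra_induct)
   case (const c)
   have "fconst c : addcl T" using addcl_base[OF TI[of "fconst c" 0]] by auto
   thus ?case using U.eqv_refl by blast
  next
   case (gen x)
   then consider "x = Inl b" | "fgen x : ?F S" by auto
   hence "fgen x : addcl T"
    using addcl_base[OF TI[of 1 1]] addcl_base[OF TI[of "fgen x" 0]] by cases auto
   thus ?case using U.eqv_refl by blast
  next
   case (add x y)
   thus ?case using addcl_plus U.eqv_add by blast
  next
   case (mult x y)
   then obtain x' y' where xy: "x' : addcl T" "y' : addcl T" "x =~U x'" "y =~U y'" by blast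
   have "EX w:addcl T. x' * y' =~U w"
    using xy(1)
   proof (induction x' rule: addcl.induct)
    case zero
    show ?case by(intro bexI[of _ 0]) (auto intro: addcl.zero)
   next
    case (add t x')
    then obtain a m w v where "t = a * \<iota> b ^ m" "a : ?F S" "w : addcl T" "x' * y' =~U w"
     "v : addcl T" "t * y' =~U v" using base[OF _ xy(2)] unfolding T_def by blast
    thus ?case unfolding distrib_right by(intro bexI[of _ "v + w"] U.eqv_add addcl_plus)
   qed
   thus ?case using U.eqv_trans[OF U.eqv_mult[OF xy(3,4)]] by blast
  qed
  then obtain y where y: "y : addcl T" "q =~U y" by blast
  obtain M c where M: "finite M" "ALL m:M. c m : ?F S" "y =~U (\<Sum>m\<in>M. c m * \<iota> b ^ m)"
   using U.addcl_collect[OF y(1)[unfolded T_def]] by(auto simp: distrib_right)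
  have qM: "q =~U (\<Sum>m\<in>M. c m * \<iota> b ^ m)" using y(2) M(3) by(rule U.eqv_trans)
  have "c m : IU" if m: "m : M" for m
  proof (rule insert.IH)
   show "S <= H" "c m : ?F S" using insert.prems(1) M(2) m by auto
   show "ALL \<theta>. generic \<theta> --> ev \<theta> (c m) = 0"
   proof (intro allI impI)
    fix \<theta> assume \<theta>: "generic \<theta>"
    let ?v = "vary \<theta> (coordinate H b)"
    let ?I = "{s. ALL \<alpha>:roots k h. ALL l::int. ?v s (coroot k h \<alpha>) + of_int l ~= 0}"
    define F where "F = (\<Sum>m\<in>M. monom (ev \<theta> (c m)) m)"
    have "poly F (\<theta> b + s) = 0" if s: "s : ?I" for s
    proof -
     have g: "generic (?v s)" using s vary_dual[OF _ coordinate_dual[OF H0(2) spH]] \<theta> by(auto simp: generic_def)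
     have cS: "ev (?v s) a = ev \<theta> a" if "a : ?F S" for a using that
     proof (induction a rule: free_algebra_induct)
      case (gen x)
      then obtain e where "e : S" "x = Inl e" by blast
      moreover from this have "e : H" "e ~= b" using insert.hyps insert.prems(1) by auto
      ultimately show ?case using clin.representation_basis[OF H0(2), of e]
       by(auto simp: ev_simps vary_def coordinate_def)
     qed (simp_all add: ev_simps)
     have cb: "ev (?v s) (\<iota> b ^ m) = (\<theta> b + s) ^ m" for m
      using insert.prems(1) H0(1) clin.representation_basis[OF H0(2), of b]
      by(induction m) (auto simp: ev_simps vary_def coordinate_def)
     have "q - (\<Sum>m\<in>M. c m * \<iota> b ^ m) : CU"
      using FU[of "insert b S"] insert.prems M(2) bS(1) pw by(intro free_algebra_closed free_algebra_sum) auto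
     hence "ev (?v s) (q - (\<Sum>m\<in>M. c m * \<iota> b ^ m)) = 0" using qM by(intro ev_IU[OF g]) (simp_all add: U.eqv_def)
     thus ?thesis using insert.prems(3) g M(2) cS cb by(simp add: F_def poly_sum poly_monom ev_simps ev_sum)
    qed
    hence "(%s. \<theta> b + s) ` ?I <= {t. poly F t = 0}" by blast
    moreover have "infinite ((%s. \<theta> b + s) ` ?I)"
     using vary_nonvanishing[of "roots k h" "coordinate H b" \<theta>] \<theta> by(simp add: generic_def finite_image_iff inj_on_def)
    ultimately have "F = 0" using poly_roots_finite finite_subset by blast
    hence "coeff F m = 0" by simp
    thus "ev \<theta> (c m) = 0" using M(1) m by(simp add: F_def coeff_sum if_distrib cong: if_cong)
   qed
  qed
  hence "(\<Sum>m\<in>M. c m * \<iota> b ^ m) =~U (\<Sum>m\<in>M. 0 * \<iota> b ^ m)"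
   by(intro U.eqv_sum U.eqv_mult_r) (simp add: U.eqv_zero)
  thus ?case using U.eqv_mem[OF qM] by(simp add: U.eqv_zero)
 qed
 have "EX q':?F H. q =~U q'"
  using q
 proof (induction q rule: free_algebra_induct)
  case (gen x)
  then obtain v where v: "v : h" "x = Inl v" by blast
  then obtain c B where B: "B <= H" "fgen (Inl v) =~U (\<Sum>y\<in>B. fconst (c y) * fgen (Inl y))"
   using U.gen_span[of v H] spH H0(1) by blast
  have "(\<Sum>y\<in>B. fconst (c y) * fgen (Inl y)) : ?F H" using B(1) by(intro free_algebra_sum) auto
  thus ?case using B(2) v(2) by blast
 next
  case (add p q)
  thus ?case using U.eqv_add free_algebra_closed(5) by blast
 next
  case (mult p q)
  thus ?case using U.eqv_mult free_algebra_closed(7) by blast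
 qed (use U.eqv_refl in blast)
 then obtain q' where q': "q' : ?F H" "q =~U q'" by blast
 have "q - q' : CU" using q q'(1) CU_h FU[of H] by auto
 hence "ev \<theta> q' = 0" if "generic \<theta>" for \<theta>
  using ev_IU[OF that, of "q - q'"] q'(2) zero[OF that] by(simp add: U.eqv_def ev_simps)
 hence "q' : IU" using main[OF fin subset_refl q'(1)] by blast
 with q'(2) show ?thesis by(rule U.eqv_mem)
qed

text \<open>Multiplying by a common denominator reduces the claim to polynomials; the denominator is
  invertible and cancels afterwards.\<close>

theorem U_separation:
 assumes u: "u : CU" and zero: "!!\<theta>. generic \<theta> ==> ev \<theta> u = 0"
 shows "u : IU"
proof -
 obtain ds q where *: "set ds <= DD" "q : FA (Inl ` h)" "u * den ds =~U q"
  using U_fraction[OF u] by blast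
 have mem: "u * den ds - q : CU"
  by(intro free_algebra_closed u subsetD[OF CU_h den_mem[OF *(1)]] subsetD[OF CU_h *(2)])
 have "ev \<theta> q = 0" if \<theta>: "generic \<theta>" for \<theta>
  using ev_IU[OF \<theta> _ mem] *(3) zero[OF \<theta>] by(simp add: U.eqv_def ev_simps)
 hence "q : IU" by(rule polynomial_separation[OF *(2)])
 hence "u * den ds : IU" using *(3) U.eqv_mem by blast
 thus ?thesis by(rule den_cancel[OF *(1)])
qed

end

section \<open>Powers of the nilpotent subalgebras\<close>

context reductive_pair begin

text \<open>The statements about the right ideals \<open>n\<^sub>-\<^sup>j A\<close> and the left ideals \<open>A n\<^sub>+\<^sup>j\<close> are
 mirror images of each other; the flag \<open>s\<close> selects the side.\<close>

definition mul :: "bool => 'g lfalg => 'g lfalg => 'g lfalg" where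
 "mul s a b = (if s then a * b else b * a)"

abbreviation "muls s \<equiv> foldr (%f. mul s (\<iota> f))"

definition nil_part :: "bool => 'g set" where
 "nil_part s = (if s then nm else np)"

definition nil_power :: "bool => nat => 'g lfalg set" where
 "nil_power s j = A.sp {muls s fs a | fs a. set fs <= nil_part s & length fs = j}"

lemma mul_simps:
 "mul s (mul s a b) c = mul s a (mul s b c)" "mul s 1 a = a" "mul s a 1 = a" "mul s 0 a = 0" "mul s a 0 = 0"
 "mul s (a + b) c = mul s a c + mul s b c" "mul s a (b + c) = mul s a b + mul s a c"
 "mul s (- a) c = - mul s a c" "mul s a (- c) = - mul s a c" "mul s (fconst z) a = fconst z * a"
 by(simp_all add: mul_def mult.assoc distrib_left distrib_right fconst_central)

lemma mul_eqv: "a =~ b ==> c =~ d ==> mul s a c =~ mul s b d"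
 by(simp add: mul_def A.eqv_mult)

lemma mul_foldr: "mul s (muls s fs b) a = muls s fs (mul s b a)"
 by(induction fs) (simp_all add: mul_simps)

lemma nil_part_subspace: "clin.subspace (nil_part s)"
 by(simp add: nil_part_def nm_subspace np_subspace)

lemma nil_power_eqv: "x =~ y ==> y : nil_power s j ==> x : nil_power s j"
 unfolding nil_power_def by(rule A.sp_eqv)

lemma nil_power_base: "set fs <= nil_part s ==> muls s fs a : nil_power s (length fs)"
 unfolding nil_power_def by(rule A.sp_base) blast

lemma nil_power_zero: "0 : nil_power s j"
 unfolding nil_power_def by(rule A.sp_zero)

lemma nil_power_add: "x : nil_power s j ==> y : nil_power s j ==> x + y : nil_power s j"
 unfolding nil_power_def by(rule A.sp_add)

lemma nil_power_sum: "(!!i. i : S ==> f i : nil_power s j) ==> sum f S : nil_power s j"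
 unfolding nil_power_def by(rule A.sp_sum)

lemma nil_power_induct [consumes 1, case_names base add zero eqv]:
 assumes "x : nil_power s j"
  and "!!fs a. set fs <= nil_part s ==> length fs = j ==> P (muls s fs a)"
  and "!!x y. P x ==> P y ==> P (x + y)" "P 0" "!!x y. x =~ y ==> P y ==> P x"
 shows "P x"
 using assms(1)[unfolded nil_power_def] by(rule span_mod_induct) (use assms(2-) in \<open>auto simp: A.eqv_def\<close>)

lemma nil_power_mul_r: "x : nil_power s j ==> mul s x b : nil_power s j"
proof (induction x rule: nil_power_induct)
 case (base fs a)
 thus ?case using nil_power_base[of fs s "mul s a b"] unfolding mul_foldr by blast
next
 case (eqv x y)
 thus ?case using nil_power_eqv mul_eqv A.eqv_refl by blast
qed (simp_all add: mul_simps nil_power_add nil_power_zero)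

lemma nil_power_mul_l:
 assumes "x : nil_power s i" "!!fs a. set fs <= nil_part s ==> length fs = i ==>
  mul s b (muls s fs a) : nil_power s j"
 shows "mul s b x : nil_power s j"
 using assms(1)
proof (induction x rule: nil_power_induct)
 case (eqv x y)
 thus ?case using nil_power_eqv mul_eqv A.eqv_refl by blast
qed (simp_all add: mul_simps nil_power_add nil_power_zero assms)

lemma nil_power_Suc: "f : nil_part s ==> x : nil_power s j ==> mul s (\<iota> f) x : nil_power s (Suc j)"
 by(erule nil_power_mul_l) (use nil_power_base[of "f # fs" s for fs] in auto)

lemma nil_power_mono: "x : nil_power s j ==> i <= j ==> x : nil_power s i"
proof (induction x rule: nil_power_induct)
 case (base fs a)
 hence "set (take i fs) <= nil_part s" using set_take_subset[of i fs] by blast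
 from nil_power_base[OF this, of "muls s (drop i fs) a"]
 moreover have "length (take i fs) = i" using base by simp
 moreover have "muls s (take i fs) (muls s (drop i fs) a)
   = muls s fs a"
  by(metis append_take_drop_id foldr_append comp_apply)
 ultimately show ?case by metis
qed (auto intro: nil_power_add nil_power_zero nil_power_eqv)

lemma nil_power_0: "x : nil_power s 0"
 using nil_power_base[of "[]" s x] by simp

definition side_bracket :: "bool => 'g => 'g => 'g" where
 "side_bracket s v f = (if s then lie v f else lie f v)"

lemma side_bracket: "mul s (\<iota> v) (\<iota> f) =~ mul s (\<iota> f) (\<iota> v) + \<iota> (side_bracket s v f)"
 using A.gen_lie by(simp add: mul_def side_bracket_def)

lemma side_bracket_nilpotent:
 "EX M. ALL fs v. set fs <= nil_part s --> M <= length fs --> foldl (side_bracket s) v fs = 0"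
proof -
 have "foldl (side_bracket s) v fs = 0" if "foldr lie (rev fs) v = 0" for fs v
 proof (cases s)
  case True
  have *: "foldl lie v fs = foldr lie (rev fs) v \<or> foldl lie v fs = - foldr lie (rev fs) v" for fs v
  proof (induction fs rule: rev_induct)
   case (snoc x fs)
   thus ?case using lie_anti[of "foldr lie (rev fs) v" x]
    by(auto simp: clinear_minus[OF clinear_lie_left])
  qed simp
  show ?thesis using *[of v fs] True that by(auto simp: side_bracket_def[abs_def])
 next
  case False
  thus ?thesis using that by(simp add: side_bracket_def[abs_def] foldr_conv_foldl)
 qed
 moreover obtain M where "ALL xs v. set xs <= nil_part s --> M <= length xs --> foldr lie xs v = 0"
  using nm_nilpotent np_nilpotent unfolding nil_part_def by(cases s) auto
 ultimately show ?thesis by(metis length_rev set_rev)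
qed

text \<open>Passing a factor f, the vector v either survives, with f now in front of it, or is
  replaced by a bracket. After t brackets it has become 0, so at least j factors are collected in
  front.\<close>

lemma generator_past_powers:
 assumes "!!gs. set gs <= nil_part s ==> t <= length gs ==> foldl (side_bracket s) v gs = 0"
  "set fs <= nil_part s" "j + t <= length fs"
 shows "mul s (\<iota> v) (muls s fs a) : nil_power s j"
 using assms
proof (induction fs arbitrary: v j t)
 case Nil
 thus ?case by(simp add: nil_power_0)
next
 case (Cons f fs)
 let ?r = "muls s fs a"
 show ?case
 proof (cases "t = 0 \<or> j = 0")
  case True
  then consider "v = 0" | "j = 0" using Cons.prems(1)[of "[]"] by auto
  thus ?thesis
  proof cases
   case 1
   have "mul s (\<iota> v) (muls s (f # fs) a) =~ mul s 0 (muls s (f # fs) a)"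
    unfolding 1 by(intro mul_eqv A.gen_zero A.eqv_refl)
   thus ?thesis by(rule nil_power_eqv) (simp add: mul_simps nil_power_zero)
  qed (simp add: nil_power_0)
 next
  case False
  then obtain t' j' where tj: "t = Suc t'" "j = Suc j'" by(metis not0_implies_Suc)
  have f: "f : nil_part s" "set fs <= nil_part s" using Cons.prems by auto
  have "mul s (\<iota> v) ?r : nil_power s j'"
   using Cons.prems f by(intro Cons.IH[where t = t]) (auto simp: tj)
  hence "mul s (\<iota> f) (mul s (\<iota> v) ?r) : nil_power s j"
   unfolding tj by(rule nil_power_Suc[OF f(1)])
  moreover have "mul s (\<iota> (side_bracket s v f)) ?r : nil_power s j"
   using Cons.prems(1)[of "f # gs" for gs] Cons.prems f by(intro Cons.IH[where t = t']) (auto simp: tj)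
  moreover have "mul s (\<iota> v) (mul s (\<iota> f) ?r)
    =~ mul s (\<iota> f) (mul s (\<iota> v) ?r) + mul s (\<iota> (side_bracket s v f)) ?r"
   using mul_eqv[OF side_bracket[of s v f] A.eqv_refl, where s = s, of ?r] by(simp add: mul_simps)
  ultimately show ?thesis using nil_power_add nil_power_eqv by simp
 qed
qed

lemma scalar_past_mul:
 assumes "u : CU" "weight_vector h \<nu> x" "\<nu> : dual_space h"
 shows "EX u':CU. mul s u (\<iota> x) =~ mul s (\<iota> x) u'"
 using scalar_past[OF assms] by(simp add: mul_def)

lemma nil_part_weight_basis:
 obtains X wt where "finite X" "clin.independent X" "X <= nil_part s" "clin.span X = nil_part s"
  "ALL x:X. wt x : dual_space h" "ALL x:X. weight_vector h (wt x) x"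
proof (rule weight_basis)
 show "clin.subspace (nil_part s)" by(rule nil_part_subspace)
 show "nil_part s <= k" by(simp add: nil_part_def nm_subset_k np_subset_k)
 show "lie x w : nil_part s" if "x : h" "w : nil_part s" for x w
  using that h_nm h_np by(auto simp: nil_part_def split: if_splits)
qed

text \<open>The factors are expanded in weight vectors, past which coefficients can be
  moved.\<close>

lemma scalar_nil_power:
 assumes "u : CU" "x : nil_power s j" shows "mul s u x : nil_power s j"
proof (rule nil_power_mul_l[OF assms(2)])
 fix fs a assume fs: "set fs <= nil_part s" "length fs = j"
 have "mul s u (muls s fs a) : nil_power s (length fs)"
  using assms(1) fs(1)
 proof (induction fs arbitrary: u)
  case (Cons f fs)
  let ?r = "muls s fs a"
  obtain X wt where X: "X <= nil_part s" "clin.span X = nil_part s"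
   "ALL x:X. wt x : dual_space h" "ALL x:X. weight_vector h (wt x) x"
   by(rule nil_part_weight_basis)
  obtain c B where B: "B <= X" "\<iota> f =~ (\<Sum>y\<in>B. fconst (c y) * \<iota> y)"
  proof -
   have "f : clin.span X" using Cons.prems(2) X(2) by simp
   thus ?thesis using A.gen_span[of f X] that by blast
  qed
  have summand: "mul s u (mul s (fconst (c y) * \<iota> y) ?r) : nil_power s (Suc (length fs))" if y: "y : B" for y
  proof -
   have yX: "y : X" using B(1) y by blast
   have "mul s u (fconst (c y)) : CU" using Cons.prems by(auto simp: mul_def)
   from scalar_past_mul[OF this X(4)[rule_format, OF yX] X(3)[rule_format, OF yX], of s]
   obtain u' where u': "u' : CU" "mul s (mul s u (fconst (c y))) (\<iota> y) =~ mul s (\<iota> y) u'" by blast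
   have "mul s u (mul s (fconst (c y) * \<iota> y) ?r) = mul s (mul s (mul s u (fconst (c y))) (\<iota> y)) ?r"
    by(simp add: mul_simps)
   also have "... =~ mul s (mul s (\<iota> y) u') ?r" by(intro mul_eqv u' A.eqv_refl)
   finally have "mul s u (mul s (fconst (c y) * \<iota> y) ?r) =~ mul s (\<iota> y) (mul s u' ?r)" by(simp add: mul_simps)
   moreover have "mul s (\<iota> y) (mul s u' ?r) : nil_power s (Suc (length fs))"
    using Cons u'(1) y B(1) X(1) by(intro nil_power_Suc Cons.IH) auto
   ultimately show ?thesis by(rule nil_power_eqv)
  qed
  have "mul s u (mul s (\<iota> f) ?r) =~ mul s u (mul s (\<Sum>y\<in>B. fconst (c y) * \<iota> y) ?r)"
   by(intro mul_eqv B A.eqv_refl)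
  also have "... = (\<Sum>y\<in>B. mul s u (mul s (fconst (c y) * \<iota> y) ?r))"
   by(simp add: mul_def sum_distrib_left sum_distrib_right)
  finally have "mul s u (mul s (\<iota> f) ?r) : nil_power s (Suc (length fs))"
   by(rule nil_power_eqv) (rule nil_power_sum[OF summand])
  thus ?case by simp
 qed (simp add: nil_power_0)
 thus "mul s u (muls s fs a) : nil_power s j" using fs by simp
qed

text \<open>Continuity of multiplication by a on the side on which the powers are not ideals: for
  large M, a n_-^M A lies in n_-^j A and A n_+^M a lies in A n_+^j. It holds for generators and
  composes along words.\<close>

theorem nil_power_absorb: "EX M. ALL x:nil_power s M. mul s a x : nil_power s j"
proof (induction a arbitrary: j rule: falg_induct)
 case (monomial c w)
 have *: "EX M. ALL x:nil_power s M. mul s (mul s a b) x : nil_power s j"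
  if "!!j. EX M. ALL x:nil_power s M. mul s a x : nil_power s j"
   "!!j. EX M. ALL x:nil_power s M. mul s b x : nil_power s j" for a b j
  using that unfolding mul_simps by metis
 have scalar: "EX M. ALL x:nil_power s M. mul s u x : nil_power s j" if "u : CU" for u j
  using scalar_nil_power[OF that] by blast
 have gen: "EX M. ALL x:nil_power s M. mul s (fgen g) x : nil_power s j" for g j
 proof (cases "g : gA")
  case False
  hence "fgen g =~ 0" using A.pker_outside by(simp add: A.eqv_zero)
  hence "mul s (fgen g) x =~ mul s 0 x" for x by(intro mul_eqv A.eqv_refl)
  thus ?thesis using nil_power_eqv nil_power_zero unfolding mul_simps by blast
 next
  case True
  then consider v where "g = Inl v" | d where "d : DD" "g = Inr d" by(auto simp: loc_gens_def)
  thus ?thesis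
  proof cases
   case 1
   obtain t where "ALL fs v. set fs <= nil_part s --> t <= length fs --> foldl (side_bracket s) v fs = 0"
    using side_bracket_nilpotent by blast
   hence "mul s (fgen g) x : nil_power s j" if "x : nil_power s (j + t)" for x
    unfolding 1 by(intro nil_power_mul_l[OF that] generator_past_powers[where t = t]) auto
   thus ?thesis by blast
  next
   case 2
   thus ?thesis by(intro scalar) (auto simp: gU_cases)
  qed
 qed
 have word: "EX M. ALL x:nil_power s M. mul s (fword w) x : nil_power s j" for j
 proof (induction w arbitrary: j)
  case Nil
  thus ?case using scalar[of 1] by simp
 next
  case (Cons g w)
  have "fword (g # w) = (if s then mul s (fgen g) (fword w) else mul s (fword w) (fgen g))"
   by(simp add: mul_def)
  thus ?case using *[OF gen Cons] *[OF Cons gen] by(cases s) simp_all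
 qed
 have "fconst c * fword w = mul s (fconst c) (fword w)" by(simp add: mul_simps)
 thus ?case using *[OF scalar word] by simp
next
 case (add p q)
 obtain M M' where "ALL x:nil_power s M. mul s p x : nil_power s j" "ALL x:nil_power s M'. mul s q x : nil_power s j"
  using add by metis
 hence "ALL x:nil_power s (max M M'). mul s (p + q) x : nil_power s j"
  unfolding mul_simps by(meson nil_power_add nil_power_mono max.cobounded1 max.cobounded2)
 thus ?case by blast
qed

section \<open>The sum of the two ideals and its congruence\<close>

definition DI :: "'g lfalg set" where
 "DI = {x + y | x y. x : nil_power False 1 & y : nil_power True 1}"

lemma DI_nil_power: "x : nil_power s 1 ==> x : DI"
proof -
 assume "x : nil_power s 1"
 hence "(if s then 0 else x) : nil_power False 1" "(if s then x else 0) : nil_power True 1"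
  using nil_power_zero by(cases s; simp)+
 moreover have "x = (if s then 0 else x) + (if s then x else 0)" by simp
 ultimately show ?thesis unfolding DI_def by blast
qed

lemma DI_induct [consumes 1, case_names base add]:
 assumes "x : DI" "!!s x. x : nil_power s 1 ==> P x" "!!x y. P x ==> P y ==> P (x + y)"
 shows "P x"
 using assms unfolding DI_def by blast

lemma DI_add: "x : DI ==> y : DI ==> x + y : DI"
proof -
 assume "x : DI" "y : DI"
 then obtain a b c d where "x = a + b" "y = c + d" "a : nil_power False 1" "c : nil_power False 1"
  "b : nil_power True 1" "d : nil_power True 1" unfolding DI_def by blast
 hence "x + y = (a + c) + (b + d)" "a + c : nil_power False 1" "b + d : nil_power True 1"
  by(simp_all add: nil_power_add algebra_simps)
 thus "x + y : DI" unfolding DI_def by blast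
qed

lemma DI_zero: "0 : DI"
 using DI_nil_power nil_power_zero by blast

lemma DI_sum: "(!!i. i : S ==> f i : DI) ==> sum f S : DI"
 by(induction S rule: infinite_finite_induct) (auto intro: DI_add DI_zero)

lemma DI_scalar:
 assumes "x : DI" "u : CU" shows "u * x : DI" "x * u : DI"
proof -
 have "mul s u x : DI" for s
  using assms(1)
 proof (induction x rule: DI_induct)
  case (base s' x)
  show ?case
  proof (cases "s = s'")
   case True
   thus ?thesis using scalar_nil_power[OF assms(2) base] DI_nil_power by blast
  next
   case False
   hence "mul s u x = mul s' x u" by(auto simp: mul_def)
   thus ?thesis using nil_power_mul_r[OF base, of u] DI_nil_power by metis
  qed
 qed (simp add: mul_simps DI_add)
 from this[of True] this[of False] show "u * x : DI" "x * u : DI" by(simp_all add: mul_def)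
qed

lemma DI_minus: "x : DI ==> - x : DI"
 using DI_scalar(1)[of x "- 1"] by auto

text \<open>Equality in the reduction algebra, for representatives in the free algebra. For ordinary
  products it is compatible with factors from the localized U(h), not with arbitrary ones.\<close>

definition deqv :: "'g lfalg => 'g lfalg => bool" (infix \<open>=~D\<close> 50) where
 "x =~D y \<longleftrightarrow> x - y : DI"

lemma deqv_refl [simp]: "x =~D x"
 by(simp add: deqv_def DI_zero)

lemma deqv_sym: "x =~D y ==> y =~D x"
 unfolding deqv_def using DI_minus[of "x - y"] by simp

lemma deqv_trans [trans]: "x =~D y ==> y =~D z ==> x =~D z"
 unfolding deqv_def using DI_add[of "x - y" "y - z"] by simp

lemma deqv_eq [trans]: "x =~D y ==> y = z ==> x =~D z" "x = y ==> y =~D z ==> x =~D z"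
 by simp_all

lemma deqv_add: "x =~D y ==> z =~D w ==> x + z =~D y + w"
 unfolding deqv_def using DI_add[of "x - y" "z - w"] by(simp add: algebra_simps)

lemma deqv_sum: "(!!i. i : S ==> f i =~D g i) ==> sum f S =~D sum g S"
 by(induction S rule: infinite_finite_induct) (simp_all add: deqv_add)

lemma deqv_eqv: "x =~ y ==> x =~D y"
proof -
 assume "x =~ y"
 hence "x - y =~ 0" using A.eqv_zero A.eqv_def by simp
 thus ?thesis using nil_power_eqv[OF _ nil_power_zero, of _ True 1] DI_nil_power unfolding deqv_def by blast
qed

lemma deqv_nil_power: "x : nil_power s 1 ==> x =~D 0"
 using DI_nil_power by(simp add: deqv_def)

lemma deqv_scalar: "x =~D y ==> u : CU ==> u * x =~D u * y" "x =~D y ==> u : CU ==> x * u =~D y * u"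
 unfolding deqv_def using DI_scalar[of "x - y" u] by(simp_all add: algebra_simps)

end

section \<open>The multiplication of the reduction algebra\<close>

context presentation begin

lemma generate_pmap:
 assumes "!!g. g : G ==> - g : G"
 shows "generate (add_monoid (presented X R)) (pmap X R ` G) = pmap X R ` addcl G"
proof -
 interpret P: ring "presented X R" by(rule presented_ring)
 have 1: "a : pmap X R ` addcl G" if "a : generate (add_monoid (presented X R)) (pmap X R ` G)" for a
  using that
 proof (induction a rule: generate.induct)
  case one
  thus ?case using addcl.zero pmap_zero by(metis image_eqI monoid.simps(2))
 next
  case (incl a)
  thus ?case using addcl_base by blast
 next
  case (inv a)
  then obtain g where g: "g : G" "a = pmap X R g" by blast
  hence "inv\<^bsub>add_monoid (presented X R)\<^esub> a = pmap X R (- g)"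
   by(simp add: pmap_uminus a_inv_def)
  thus ?case using g assms addcl_base by blast
 next
  case (eng a b)
  then obtain x y where "x : addcl G" "y : addcl G" "a = pmap X R x" "b = pmap X R y" by blast
  thus ?case using addcl_plus[of x G y] pmap_hom(2)[of x y] by(metis image_eqI monoid.simps(1))
 qed
 have 2: "pmap X R y : generate (add_monoid (presented X R)) (pmap X R ` G)" if "y : addcl G" for y
  using that
 proof (induction y rule: addcl.induct)
  case zero
  show ?case using generate.one[of "add_monoid (presented X R)"] by(simp add: pmap_zero)
 next
  case (add x y)
  have "pmap X R x \<otimes>\<^bsub>add_monoid (presented X R)\<^esub> pmap X R y
    : generate (add_monoid (presented X R)) (pmap X R ` G)"
   by(rule generate.eng[OF generate.incl[OF imageI[OF add(1)]] add(3)])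
  thus ?case by(simp add: pmap_hom)
 qed
 show ?thesis using 1 2 by blast
qed

lemma generate_pmap_iff:
 assumes "!!g. g : G ==> - g : G"
 shows "pmap X R x : generate (add_monoid (presented X R)) (pmap X R ` G) \<longleftrightarrow> (EX y:addcl G. eqv x y)"
 using generate_pmap[of G] assms by(auto simp: image_iff pmap_eqv)

end

context reductive_pair begin

abbreviation qA :: "'g lfalg => 'g loc_elem" where "qA \<equiv> pmap gA rA"
abbreviation "PA \<equiv> presented gA rA"

lemma A_bar_eq: "A_bar k h = PA"
 by(simp add: loc_env_def)

lemma loc_class_A: "p : FA gA ==> loc_class k h UNIV p = qA p"
 by(simp add: loc_class_def pmap_def frestrict_id)

lemma A_of_eq: "A_of k h x = qA (\<iota> x)"
 unfolding A_of_def by(rule loc_class_A) (simp add: loc_gens_def)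

lemma CU_A: "p : CU ==> p : FA gA"
 using free_algebra_mono[of gU gA] by(auto simp: loc_gens_def)

text \<open>The members of a class differ by elements of the relation ideal of U(h), which is
  contained in that of A, so the union in \<open>A_of_Uh\<close> has a single value.\<close>

lemma A_of_Uh_eq:
 assumes "x : CU" shows "A_of_Uh k h (pmap gU rU x) = qA x"
proof -
 have u: "pmap gU rU x = (%i. i + x) ` genideal (free_algebra gU) rU"
  using assms by(auto simp: pmap_def pclass_def frestrict_id a_r_coset_def' free_algebra_simps)
 have "loc_class k h UNIV a = qA x" if "a : pmap gU rU x" for a
 proof -
  obtain i where i: "i : genideal (free_algebra gU) rU" "a = i + x" using \<open>a : pmap gU rU x\<close> u by blast
  have ic: "i : CU" using i(1) U.gi.a_subset by blast
  hence "i : IA" using i(1) by(intro IU_IA) (simp_all add: pker_def frestrict_id)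
  hence "qA a = qA x" by(simp add: A.pmap_eq_iff i(2))
  moreover have "a : FA gA" using ic assms i(2) CU_A by auto
  ultimately show ?thesis by(simp add: loc_class_A)
 qed
 moreover have "pmap gU rU x ~= {}" unfolding u using U.gi.zero_closed by blast
 ultimately show ?thesis unfolding A_of_Uh_def by auto
qed

lemma mprod_qA: "mprod (PA) (map (%x. qA (\<iota> x)) fs) = qA (\<iota>s fs)"
 by(induction fs) (simp_all add: mprod_def A.pmap_hom)

lemma list_image: "set xs <= f ` S \<longleftrightarrow> (EX ys. xs = map f ys & set ys <= S)"
proof
 assume "set xs <= f ` S"
 hence "xs : lists (f ` S)" by auto
 thus "EX ys. xs = map f ys & set ys <= S" unfolding lists_image by auto
qed (auto simp: image_subset_iff subset_iff)

lemma foldr_mul: "muls s fs a =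
  (if s then \<iota>s fs * a else a * \<iota>s (rev fs))"
 by(cases s; induction fs) (simp_all add: mul_def mult.assoc)

lemma pow_generators:
 "{mprod (PA) xs \<otimes>\<^bsub>PA\<^esub> a | a xs. a : carrier (PA) &
   set xs <= A_of k h ` nm & length xs = j} = qA ` {muls True fs a | fs a. set fs <= nm & length fs = j}"
 (is "?L True = ?R True")
 "{a \<otimes>\<^bsub>PA\<^esub> mprod (PA) xs | a xs. a : carrier (PA) &
   set xs <= A_of k h ` np & length xs = j} = qA ` {muls False fs a | fs a. set fs <= np & length fs = j}"
proof -
 have carrier: "a : carrier (PA) \<longleftrightarrow> (EX r. a = qA r)" for a
  using A.pmap_surj A.pmap_hom(1) by blast
 have eq: "mprod (PA) (map (A_of k h) fs) \<otimes>\<^bsub>PA\<^esub> qA r = qA (\<iota>s fs * r)"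
  "qA r \<otimes>\<^bsub>PA\<^esub> mprod (PA) (map (A_of k h) fs) = qA (r * \<iota>s fs)" for fs r
  by(simp_all add: A_of_eq[abs_def] mprod_qA A.pmap_hom)
 show "?L True = ?R True"
  unfolding carrier list_image by(auto simp: eq foldr_mul image_iff) (metis eq(1) length_map)+
 show "{a \<otimes>\<^bsub>PA\<^esub> mprod (PA) xs | a xs. a : carrier (PA) &
   set xs <= A_of k h ` np & length xs = j} = qA ` {muls False fs a | fs a. set fs <= np & length fs = j}"
  unfolding carrier list_image
  by(auto simp: eq foldr_mul image_iff simp del: rev_map) (metis eq(2) length_map length_rev rev_rev_ident set_rev)+
qed

lemma pow_mem:
 "qA x : right_pow (A_bar k h) (A_of k h ` nm) j \<longleftrightarrow> x : nil_power True j"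
 "qA x : left_pow (A_bar k h) (A_of k h ` np) j \<longleftrightarrow> x : nil_power False j"
proof -
 have "- muls s fs a = muls s fs (- a)" for s fs a
  by(induction fs) (simp_all flip: mul_simps(9))
 hence "- g : {muls s fs a | fs a. set fs <= S & length fs = j}"
  if "g : {muls s fs a | fs a. set fs <= S & length fs = j}" for g s S using that by blast
 note * = A.generate_pmap_iff[OF this]
 show "qA x : right_pow (A_bar k h) (A_of k h ` nm) j \<longleftrightarrow> x : nil_power True j"
  "qA x : left_pow (A_bar k h) (A_of k h ` np) j \<longleftrightarrow> x : nil_power False j"
  unfolding right_pow_def left_pow_def A_bar_eq pow_generators nil_power_def span_mod_def nil_part_def
  using * by(simp_all add: A.eqv_def)
qed

lemma pow_carrier:
 "right_pow (A_bar k h) (A_of k h ` nm) j <= carrier (A_bar k h)"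
 "left_pow (A_bar k h) (A_of k h ` np) j <= carrier (A_bar k h)"
proof -
 interpret AR: ring "A_bar k h" unfolding A_bar_eq by(rule A.presented_ring)
 have "mprod (A_bar k h) xs : carrier (A_bar k h)" if xs: "set xs <= A_of k h ` S" for xs S
 proof -
  obtain ys where "xs = map (A_of k h) ys" using xs unfolding list_image by blast
  thus ?thesis by(simp add: A_of_eq[abs_def] A_bar_eq mprod_qA A.pmap_hom)
 qed
 hence "{mprod (A_bar k h) xs \<otimes>\<^bsub>A_bar k h\<^esub> a | a xs. a : carrier (A_bar k h) &
    set xs <= A_of k h ` nm & length xs = j} <= carrier (A_bar k h)"
  "{a \<otimes>\<^bsub>A_bar k h\<^esub> mprod (A_bar k h) xs | a xs. a : carrier (A_bar k h) &
    set xs <= A_of k h ` np & length xs = j} <= carrier (A_bar k h)" by fastforce+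
 thus "right_pow (A_bar k h) (A_of k h ` nm) j <= carrier (A_bar k h)"
  "left_pow (A_bar k h) (A_of k h ` np) j <= carrier (A_bar k h)"
  unfolding right_pow_def left_pow_def using AR.add.generate_incl by simp_all
qed

lemma double_ideal_mem: "qA x : double_ideal k nm h np \<longleftrightarrow> x : DI"
proof
 assume "qA x : double_ideal k nm h np"
 then obtain a b where ab: "a : left_pow (A_bar k h) (A_of k h ` np) 1"
  "b : right_pow (A_bar k h) (A_of k h ` nm) 1" "qA x = a \<oplus>\<^bsub>A_bar k h\<^esub> b"
  unfolding double_ideal_def set_add_def' by blast
 hence "a : carrier (PA)" "b : carrier (PA)"
  using pow_carrier[of 1] by(auto simp: A_bar_eq)
 then obtain y z where yz: "a = qA y" "b = qA z" using A.pmap_surj by metis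
 hence "y : nil_power False 1" "z : nil_power True 1" using ab pow_mem by auto
 moreover have "x =~ y + z" using ab(3) yz by(simp add: A_bar_eq A.pmap_eqv flip: A.pmap_hom)
 hence "x - z =~ y + z - z" by(intro A.eqv_diff) auto
 hence "x - z =~ y" by simp
 ultimately have "x - z : nil_power False 1" "z : nil_power True 1" using nil_power_eqv by auto
 hence "(x - z) + z : DI" unfolding DI_def by blast
 thus "x : DI" by simp
next
 assume "x : DI"
 then obtain y z where x: "x = y + z" "y : nil_power False 1" "z : nil_power True 1" unfolding DI_def by blast
 have "qA x = qA y \<oplus>\<^bsub>A_bar k h\<^esub> qA z" by(simp add: x(1) A_bar_eq A.pmap_hom)
 thus "qA x : double_ideal k nm h np"
  unfolding double_ideal_def set_add_def' using x(2,3) pow_mem by blast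
qed

end

locale extremal_pair = reductive_pair k nm h np
 for k nm h np :: "'g::fin_dim_complex_lie_algebra set" +
 fixes P :: "('g => complex) => 'g loc_elem"
 assumes projector: "extremal_projector k nm h np P"
begin

abbreviation "Q \<equiv> Q_plus h np"

lemma Q_zero: "0 : Q"
 unfolding Q_plus_def by(intro CollectI exI[of _ "%_. 0"]) (simp flip: zero_fun_def)

definition proj_gens :: "('g => complex) => 'g lfalg set" where
 "proj_gens \<kappa> = {u * (\<iota>s fs * \<iota>s es) | u fs es. u : CU &
   (EX \<gamma>s \<gamma>s'. set \<gamma>s <= weights h np & set \<gamma>s' <= weights h np &
     list_all2 (%\<gamma> f. f : weight_space h k (- \<gamma>)) \<gamma>s fs &
     list_all2 (%\<gamma> e. e : weight_space h k \<gamma>) \<gamma>s' es &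
     sum_list \<gamma>s = \<kappa> & sum_list \<gamma>s' = \<kappa>)}"

lemma proj_terms_eq: "proj_terms k h np \<kappa> = qA ` addcl (proj_gens \<kappa>)"
proof -
 have "qA ` proj_gens \<kappa> = {A_of_Uh k h \<xi> \<otimes>\<^bsub>A_bar k h\<^esub>
    (mprod (A_bar k h) (map (A_of k h) fs) \<otimes>\<^bsub>A_bar k h\<^esub>
     mprod (A_bar k h) (map (A_of k h) es)) | \<xi> fs es.
   \<xi> : carrier (Uh_bar k h) &
   (EX \<gamma>s \<gamma>s'. set \<gamma>s <= weights h np & set \<gamma>s' <= weights h np &
     list_all2 (%\<gamma> f. f : weight_space h k (- \<gamma>)) \<gamma>s fs &
     list_all2 (%\<gamma> e. e : weight_space h k \<gamma>) \<gamma>s' es &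
     sum_list \<gamma>s = \<kappa> & sum_list \<gamma>s' = \<kappa>)}" (is "_ = ?R")
 proof (intro equalityI subsetI)
  fix y assume "y : qA ` proj_gens \<kappa>"
  then obtain u fs es \<gamma>s \<gamma>s' where *: "u : CU" "set \<gamma>s <= weights h np & set \<gamma>s' <= weights h np &
     list_all2 (%\<gamma> f. f : weight_space h k (- \<gamma>)) \<gamma>s fs &
     list_all2 (%\<gamma> e. e : weight_space h k \<gamma>) \<gamma>s' es &
     sum_list \<gamma>s = \<kappa> & sum_list \<gamma>s' = \<kappa>"
   "y = qA (u * (\<iota>s fs * \<iota>s es))" unfolding proj_gens_def by blast
  have "y = A_of_Uh k h (pmap gU rU u) \<otimes>\<^bsub>A_bar k h\<^esub>
    (mprod (A_bar k h) (map (A_of k h) fs) \<otimes>\<^bsub>A_bar k h\<^esub> mprod (A_bar k h) (map (A_of k h) es))"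
   by(simp add: * A_of_Uh_eq A_bar_eq A_of_eq[abs_def] mprod_qA A.pmap_hom)
  moreover have "pmap gU rU u : carrier (Uh_bar k h)" by(simp add: loc_env_def U.pmap_hom)
  ultimately show "y : ?R" using *(2) by blast
 next
  fix y assume "y : ?R"
  then obtain \<xi> fs es \<gamma>s \<gamma>s' where *: "\<xi> : carrier (Uh_bar k h)" "set \<gamma>s <= weights h np & set \<gamma>s' <= weights h np &
     list_all2 (%\<gamma> f. f : weight_space h k (- \<gamma>)) \<gamma>s fs &
     list_all2 (%\<gamma> e. e : weight_space h k \<gamma>) \<gamma>s' es &
     sum_list \<gamma>s = \<kappa> & sum_list \<gamma>s' = \<kappa>" "y = A_of_Uh k h \<xi> \<otimes>\<^bsub>A_bar k h\<^esub>
    (mprod (A_bar k h) (map (A_of k h) fs) \<otimes>\<^bsub>A_bar k h\<^esub> mprod (A_bar k h) (map (A_of k h) es))" by blast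
  obtain u where u: "u : CU" "\<xi> = pmap gU rU u" using *(1) U.pmap_surj unfolding loc_env_def by blast
  have "y = qA (u * (\<iota>s fs * \<iota>s es))"
   by(simp add: * u A_of_Uh_eq A_bar_eq A_of_eq[abs_def] mprod_qA A.pmap_hom)
  thus "y : qA ` proj_gens \<kappa>" using u(1) *(2) unfolding proj_gens_def by blast
 qed
 moreover have "- g : proj_gens \<kappa>" if g: "g : proj_gens \<kappa>" for g
 proof -
  obtain u fs es where *: "g = u * (\<iota>s fs * \<iota>s es)" "u : CU"
   "EX \<gamma>s \<gamma>s'. set \<gamma>s <= weights h np & set \<gamma>s' <= weights h np &
     list_all2 (%\<gamma> f. f : weight_space h k (- \<gamma>)) \<gamma>s fs &
     list_all2 (%\<gamma> e. e : weight_space h k \<gamma>) \<gamma>s' es &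
     sum_list \<gamma>s = \<kappa> & sum_list \<gamma>s' = \<kappa>" using g unfolding proj_gens_def by blast
  have "- g = (- u) * (\<iota>s fs * \<iota>s es)" "- u : CU" using * by auto
  thus ?thesis using *(3) unfolding proj_gens_def by blast
 qed
 ultimately show ?thesis using A.generate_pmap[of "proj_gens \<kappa>"] unfolding proj_terms_def A_bar_eq by simp
qed

definition Pr :: "('g => complex) => 'g lfalg" where
 "Pr \<kappa> = (SOME x. x : addcl (proj_gens \<kappa>) & qA x = P \<kappa>)"

lemma Pr: assumes "\<kappa> : Q" shows "Pr \<kappa> : addcl (proj_gens \<kappa>)" "qA (Pr \<kappa>) = P \<kappa>"
proof -
 have "P \<kappa> : proj_terms k h np \<kappa>" using projector assms by(simp add: extremal_projector_def Let_def)
 hence "EX x. x : addcl (proj_gens \<kappa>) & qA x = P \<kappa>" unfolding proj_terms_eq by blast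
 from someI_ex[OF this] show "Pr \<kappa> : addcl (proj_gens \<kappa>)" "qA (Pr \<kappa>) = P \<kappa>"
  by(simp_all add: Pr_def)
qed

lemma Pr_zero: "Pr 0 =~ 1"
 using projector Pr(2)[OF Q_zero] by(simp add: extremal_projector_def Let_def A_bar_eq A.pmap_eqv flip: A.pmap_hom)

definition psr :: "('g => complex) set => 'g lfalg" where "psr T = sum Pr T"

text \<open>n_+ P = 0 for \<open>s\<close> false and P n_- = 0 for \<open>s\<close> true, read as
  convergence of partial sums. The flag is negated because the factor stands on the side opposite to
  that of the ideal.\<close>

lemma psr_absorb:
 assumes "f : nil_part s"
 shows "\<forall>\<^sub>F T in finite_subsets_at_top Q. mul (\<not> s) (\<iota> f) (psr T) : nil_power s N"
proof -
 interpret AR: ring "PA" by(rule A.presented_ring)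
 have fin: "\<forall>\<^sub>F T in finite_subsets_at_top Q. qA (psr T) = finsum (PA) P T"
 proof (rule eventually_finite_subsets_at_top_weakI)
  fix T assume T: "finite T" "T <= Q"
  have "P \<kappa> : carrier (PA)" if "\<kappa> : T" for \<kappa>
   using T(2) that Pr(2)[of \<kappa>] A.pmap_hom(1) by(metis subsetD)
  thus "qA (psr T) = finsum (PA) P T"
   unfolding psr_def A.pmap_sum[OF T(1)] using T(2) Pr(2) by(intro AR.finsum_cong') auto
 qed
 show ?thesis
 proof (cases s)
  case True
  hence "\<forall>\<^sub>F T in finite_subsets_at_top Q. finsum (PA) P T \<otimes>\<^bsub>PA\<^esub> A_of k h f
    : right_pow (A_bar k h) (A_of k h ` nm) N"
   using projector assms unfolding extremal_projector_def Let_def A_bar_eq by(simp add: nil_part_def)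
  with fin show ?thesis
  proof eventually_elim
   case (elim T)
   hence "qA (psr T * \<iota> f) : right_pow (A_bar k h) (A_of k h ` nm) N" by(simp add: A.pmap_hom A_of_eq)
   thus ?case using True pow_mem(1) by(simp add: mul_def)
  qed
 next
  case False
  hence "\<forall>\<^sub>F T in finite_subsets_at_top Q. A_of k h f \<otimes>\<^bsub>PA\<^esub> finsum (PA) P T
    : left_pow (A_bar k h) (A_of k h ` np) N"
   using projector assms unfolding extremal_projector_def Let_def A_bar_eq by(simp add: nil_part_def)
  with fin show ?thesis
  proof eventually_elim
   case (elim T)
   hence "qA (\<iota> f * psr T) : left_pow (A_bar k h) (A_of k h ` np) N" by(simp add: A.pmap_hom A_of_eq)
   thus ?case using False pow_mem(2) by(simp add: mul_def)
  qed
 qed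
qed

text \<open>The \<kappa> at which a term of the projector can have fewer than M lowering or raising
  factors; there are finitely many.\<close>

definition short_sums :: "nat => ('g => complex) set" where
 "short_sums M = sum_list ` {\<gamma>s. set \<gamma>s <= weights h np & length \<gamma>s < M}"

lemma short_sums_finite: "finite (short_sums M)"
proof -
 have "finite (weights h np)"
  using np_subspace np_subset_k h_np by(rule weights_finite)
 hence "finite {\<gamma>s. set \<gamma>s <= weights h np & length \<gamma>s <= M}" by(rule finite_lists_length_le)
 thus ?thesis unfolding short_sums_def by(rule finite_imageI[OF finite_subset[rotated]]) auto
qed

lemma short_sums_1: "short_sums 1 = {0}"
proof -
 have "{\<gamma>s. set \<gamma>s <= weights h np & length \<gamma>s < 1} = {[]}" by auto
 thus ?thesis by(simp add: short_sums_def)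
qed

lemma Pr_nil_power:
 assumes "\<kappa> : Q" "\<kappa> \<notin> short_sums M" shows "Pr \<kappa> : nil_power s M"
proof -
 have gens: "g : nil_power s M" if g: "g : proj_gens \<kappa>" for g
 proof -
  obtain u fs es \<gamma>s \<gamma>s' where *: "g = u * (\<iota>s fs * \<iota>s es)" "u : CU"
   "set \<gamma>s <= weights h np" "set \<gamma>s' <= weights h np"
     "list_all2 (%\<gamma> f. f : weight_space h k (- \<gamma>)) \<gamma>s fs"
     "list_all2 (%\<gamma> e. e : weight_space h k \<gamma>) \<gamma>s' es"
     "sum_list \<gamma>s = \<kappa>" "sum_list \<gamma>s' = \<kappa>" using g unfolding proj_gens_def by blast
  have len: "M <= length fs" "M <= length es"
  proof -
   have "M <= length \<gamma>s" if "set \<gamma>s <= weights h np" "sum_list \<gamma>s = \<kappa>" for \<gamma>s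
    using that assms(2) unfolding short_sums_def by(auto simp: not_less[symmetric])
   from this[OF *(3,7)] this[OF *(4,8)] show "M <= length fs" "M <= length es"
    using list_all2_lengthD[OF *(5)] list_all2_lengthD[OF *(6)] by simp_all
  qed
  have fs: "set fs <= nm"
  proof
   fix f assume "f : set fs"
   then obtain \<gamma> where "\<gamma> : set \<gamma>s" "f : weight_space h k (- \<gamma>)"
    using *(5) by(metis in_set_conv_nth list_all2_conv_all_nth)
   thus "f : nm" using negative_root_space *(3) by(auto simp: weight_space_iff)
  qed
  have es: "set es <= np"
  proof
   fix e assume "e : set es"
   then obtain \<gamma> where "\<gamma> : set \<gamma>s'" "e : weight_space h k \<gamma>"
    using *(6) by(metis in_set_conv_nth list_all2_conv_all_nth)
   thus "e : np" using positive_root_space *(4) by(auto simp: weight_space_iff)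
  qed
  show ?thesis
  proof (cases s)
   case True
   have "mul True u (muls True fs (\<iota>s es)) : nil_power True (length fs)"
    using fs by(intro scalar_nil_power *(2) nil_power_base) (simp add: nil_part_def)
   thus ?thesis using True nil_power_mono len(1) by(simp add: foldr_mul mul_def *(1))
  next
   case False
   have "muls False (rev es) (u * \<iota>s fs) : nil_power False (length (rev es))"
    using es by(intro nil_power_base) (simp add: nil_part_def)
   thus ?thesis using False nil_power_mono len(2) by(simp add: foldr_mul mul_def *(1) mult.assoc)
  qed
 qed
 show ?thesis using Pr(1)[OF assms(1)]
 proof (induction rule: addcl.induct)
  case zero
  show ?case by(rule nil_power_zero)
 next
  case (add x y)
  thus ?case using nil_power_add[OF gens[OF add(1)] add(3)] by simp
 qed
qed

lemma Pr_nonzero: "\<kappa> : Q ==> \<kappa> ~= 0 ==> Pr \<kappa> : nil_power s 1"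
 by(rule Pr_nil_power) (simp_all only: short_sums_1, simp)

lemma Pr_absorb: "EX T. finite T & T <= Q & (ALL \<kappa>:Q - T. mul s a (Pr \<kappa>) : nil_power s 1)"
proof -
 obtain M where "ALL x:nil_power s M. mul s a x : nil_power s 1" using nil_power_absorb by blast
 hence "ALL \<kappa>:Q - short_sums M \<inter> Q. mul s a (Pr \<kappa>) : nil_power s 1" using Pr_nil_power by blast
 thus ?thesis using short_sums_finite[of M] by(intro exI[of _ "short_sums M \<inter> Q"]) auto
qed

section \<open>The product a P b on representatives\<close>

definition dia :: "'g lfalg => 'g lfalg => 'g lfalg" (infixl \<open><>\<close> 70) where
 "a <> b = (\<Sum>\<kappa>\<in>{\<kappa>:Q. a * Pr \<kappa> * b \<notin> DI}. a * Pr \<kappa> * b)"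

lemma exceptional_finite: "finite {\<kappa>:Q. a * Pr \<kappa> * b \<notin> DI}"
proof -
 obtain T where T: "finite T" "ALL \<kappa>:Q - T. mul True a (Pr \<kappa>) : nil_power True 1"
  using Pr_absorb[of True a] by blast
 have "a * Pr \<kappa> * b : DI" if "\<kappa> : Q - T" for \<kappa>
  using nil_power_mul_r[of "a * Pr \<kappa>" True 1 b] T(2) that DI_nil_power by(auto simp: mul_def)
 hence "{\<kappa>:Q. a * Pr \<kappa> * b \<notin> DI} <= T" by blast
 thus ?thesis using T(1) finite_subset by blast
qed

lemma dia_eq:
 assumes "finite T" "T <= Q" "!!\<kappa>. \<kappa> : Q - T ==> a * Pr \<kappa> * b : DI"
 shows "a <> b =~D a * psr T * b"
proof -
 let ?E = "{\<kappa>:Q. a * Pr \<kappa> * b \<notin> DI}"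
 have "?E <= T" using assms(3) by blast
 hence "(\<Sum>\<kappa>\<in>T. a * Pr \<kappa> * b) = a <> b + (\<Sum>\<kappa>\<in>T - ?E. a * Pr \<kappa> * b)"
  unfolding dia_def using assms(1) by(metis (no_types, lifting) add.commute sum.subset_diff)
 moreover have "(\<Sum>\<kappa>\<in>T - ?E. a * Pr \<kappa> * b) : DI" using assms(2) by(intro DI_sum) auto
 moreover have "(\<Sum>\<kappa>\<in>T. a * Pr \<kappa> * b) = a * psr T * b" by(simp add: psr_def sum_distrib_left sum_distrib_right)
 ultimately show ?thesis by(simp add: deqv_def DI_minus)
qed

lemma dia_eventually: "\<forall>\<^sub>F T in finite_subsets_at_top Q. a <> b =~D a * psr T * b"
 unfolding eventually_finite_subsets_at_top
 by(rule exI[of _ "{\<kappa>:Q. a * Pr \<kappa> * b \<notin> DI}"]) (use exceptional_finite in \<open>auto intro!: dia_eq\<close>)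

lemma dia_cong:
 assumes "\<forall>\<^sub>F T in finite_subsets_at_top Q. a * psr T * b =~D a' * psr T * b'"
 shows "a <> b =~D a' <> b'"
proof -
 have "\<forall>\<^sub>F T in finite_subsets_at_top Q. a <> b =~D a' <> b'"
  using dia_eventually[of a b] dia_eventually[of a' b'] assms
  by eventually_elim (meson deqv_trans deqv_sym)
 thus ?thesis by simp
qed

lemma dia_eqv: "a =~ a' ==> b =~ b' ==> a <> b =~D a' <> b'"
 by(intro dia_cong always_eventually allI deqv_eqv A.eqv_mult A.eqv_refl)

lemma dia_add: "(a + a') <> b =~D a <> b + a' <> b" "a <> (b + b') =~D a <> b + a <> b'"
proof -
 have "\<forall>\<^sub>F T in finite_subsets_at_top Q. (a + a') <> b =~D a <> b + a' <> b"
  using dia_eventually[of a b] dia_eventually[of a' b] dia_eventually[of "a + a'" b]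
 proof eventually_elim
  case (elim T)
  have "(a + a') <> b =~D a * psr T * b + a' * psr T * b" using elim(3) by(simp add: distrib_right)
  also have "... =~D a <> b + a' <> b" by(rule deqv_sym[OF deqv_add[OF elim(1,2)]])
  finally show ?case .
 qed
 thus "(a + a') <> b =~D a <> b + a' <> b" by simp
 have "\<forall>\<^sub>F T in finite_subsets_at_top Q. a <> (b + b') =~D a <> b + a <> b'"
  using dia_eventually[of a b] dia_eventually[of a b'] dia_eventually[of a "b + b'"]
 proof eventually_elim
  case (elim T)
  have "a <> (b + b') =~D a * psr T * b + a * psr T * b'" using elim(3) by(simp add: distrib_left)
  also have "... =~D a <> b + a <> b'" by(rule deqv_sym[OF deqv_add[OF elim(1,2)]])
  finally show ?case .
 qed
 thus "a <> (b + b') =~D a <> b + a <> b'" by simp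
qed

definition side_dia :: "bool => 'g lfalg => 'g lfalg => 'g lfalg" where
 "side_dia s a b = (if s then a <> b else b <> a)"

text \<open>Independence of representatives. A left factor x in n_- A keeps the whole product in n_-
  A. For x = c e with e in n_+, the partial sums of e P lie in high powers A n_+^M, and b absorbs
  the excess. Right factors are symmetric.\<close>

lemma side_dia_nil_power:
 assumes "x : nil_power s' 1" shows "side_dia s x b : DI"
proof -
 have ev: "\<forall>\<^sub>F T in finite_subsets_at_top Q. side_dia s x b =~D mul s (mul s x (psr T)) b" for x
  using dia_eventually[of x b] dia_eventually[of b x] by(auto simp: side_dia_def mul_def mult.assoc)
 have add: "side_dia s (x + y) b =~D side_dia s x b + side_dia s y b" for x y
  using dia_add by(simp add: side_dia_def)
 show ?thesis
 proof (cases "s = s'")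
  case True
  have "\<forall>\<^sub>F T in finite_subsets_at_top Q. side_dia s x b : DI"
   using ev[of x]
  proof eventually_elim
   case (elim T)
   moreover have "mul s (mul s x (psr T)) b : nil_power s 1" using assms True by(intro nil_power_mul_r) simp
   hence "mul s (mul s x (psr T)) b =~D 0" by(rule deqv_nil_power)
   ultimately have "side_dia s x b =~D 0" by(rule deqv_trans)
   thus ?case by(simp add: deqv_def)
  qed
  thus ?thesis by simp
 next
  case False
  hence s: "s = (\<not> s')" by simp
  have flip: "mul s x y = mul s' y x" for x y by(auto simp: mul_def s)
  show ?thesis using assms
  proof (induction x rule: nil_power_induct)
   case (base fs c)
   then obtain f where f: "fs = [f]" "f : nil_part s'" by(cases fs) auto
   obtain M where M: "ALL x:nil_power s' M. mul s' b x : nil_power s' 1" using nil_power_absorb by blast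
   have "\<forall>\<^sub>F T in finite_subsets_at_top Q. side_dia s (muls s' fs c) b : DI"
    using ev[of "muls s' fs c"] psr_absorb[OF f(2), of M]
   proof eventually_elim
    case (elim T)
    have "mul s (mul s (muls s' fs c) (psr T)) b
      = mul s' (mul s' b (mul (\<not> s') (\<iota> f) (psr T))) c"
     by(simp add: f s mul_def mult.assoc)
    moreover have "... : nil_power s' 1" by(rule nil_power_mul_r[OF M[rule_format, OF elim(2)]])
    ultimately have "mul s (mul s (muls s' fs c) (psr T)) b =~D 0"
     using deqv_nil_power by metis
    hence "side_dia s (muls s' fs c) b =~D 0" using elim(1) deqv_trans by blast
    thus ?case by(simp add: deqv_def)
   qed
   thus ?case by simp
  next
   case (add x y)
   hence "side_dia s x b + side_dia s y b =~D 0" using DI_add by(simp add: deqv_def)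
   hence "side_dia s (x + y) b =~D 0" using \<open>!!x y. side_dia s (x + y) b =~D side_dia s x b + side_dia s y b\<close> deqv_trans by blast
   thus ?case by(simp add: deqv_def)
  next
   case zero
   show ?case by(simp add: side_dia_def dia_def DI_zero)
  next
   case (eqv x y)
   hence "side_dia s x b =~D side_dia s y b" by(simp add: side_dia_def dia_eqv)
   moreover have "side_dia s y b =~D 0" using eqv by(simp add: deqv_def)
   ultimately have "side_dia s x b =~D 0" by(rule deqv_trans)
   thus ?case by(simp add: deqv_def)
  qed
 qed
qed

lemma dia_DI: assumes "x : DI" shows "x <> b : DI" "b <> x : DI"
proof -
 have "side_dia s x b : DI" for s
  using assms
 proof (induction x rule: DI_induct)
  case (base s' x)
  thus ?case by(rule side_dia_nil_power)
 next
  case (add x y)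
  have "side_dia s (x + y) b =~D side_dia s x b + side_dia s y b" using dia_add by(simp add: side_dia_def)
  moreover have "side_dia s x b + side_dia s y b =~D 0" using add DI_add by(simp add: deqv_def)
  ultimately have "side_dia s (x + y) b =~D 0" by(rule deqv_trans)
  thus ?case by(simp add: deqv_def)
 qed
 from this[of True] this[of False] show "x <> b : DI" "b <> x : DI" by(simp_all add: side_dia_def)
qed

lemma dia_deqv: assumes "a =~D a'" "b =~D b'" shows "a <> b =~D a' <> b'"
proof -
 have "a <> b = (a' + (a - a')) <> b" by simp
 also have "... =~D a' <> b + (a - a') <> b" by(rule dia_add)
 also have "... =~D a' <> b + 0" using assms(1) dia_DI by(intro deqv_add) (simp_all add: deqv_def)
 also have "a' <> b + 0 = a' <> (b' + (b - b'))" by simp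
 also have "... =~D a' <> b' + a' <> (b - b')" by(rule dia_add)
 also have "... =~D a' <> b' + 0" using assms(2) dia_DI by(intro deqv_add) (simp_all add: deqv_def)
 finally show ?thesis by simp
qed

text \<open>For indices outside a finite set T, a P_kappa x lies in n_- A whatever x is; outside T',
  x P_kappa c lies in A n_+. Both bracketings therefore reduce to one ordinary product with the
  partial sums over T and T'.\<close>

lemma dia_assoc: "(a <> b) <> c =~D a <> (b <> c)"
proof -
 obtain T where T: "finite T" "T <= Q" "ALL \<kappa>:Q - T. mul True a (Pr \<kappa>) : nil_power True 1"
  using Pr_absorb[of True a] by blast
 obtain T' where T': "finite T'" "T' <= Q" "ALL \<kappa>:Q - T'. mul False c (Pr \<kappa>) : nil_power False 1"
  using Pr_absorb[of False c] by blast
 have l: "a * Pr \<kappa> * x : DI" if "\<kappa> : Q - T" for \<kappa> x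
  using T(3) that nil_power_mul_r[of "a * Pr \<kappa>" True 1 x] DI_nil_power by(auto simp: mul_def)
 have r: "x * Pr \<kappa> * c : DI" if "\<kappa> : Q - T'" for \<kappa> x
  using T'(3) that nil_power_mul_r[of "Pr \<kappa> * c" False 1 x] DI_nil_power by(auto simp: mul_def mult.assoc)
 have "(a <> b) <> c =~D (a * psr T * b) <> c"
  by(intro dia_deqv dia_eq T l deqv_refl)
 also have "... =~D a * psr T * b * psr T' * c" by(intro dia_eq T' r)
 also have "... = a * psr T * (b * psr T' * c)" by(simp add: mult.assoc)
 also have "... =~D a <> (b * psr T' * c)" by(intro deqv_sym[OF dia_eq] T l)
 also have "... =~D a <> (b <> c)" by(intro dia_deqv deqv_sym[OF dia_eq] T' r deqv_refl)
 finally show ?thesis .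
qed

text \<open>The components of the projector at nonzero \<kappa> lie in n_- A and in A n_+, which
  scalars preserve, so only the constant term 1 is left.\<close>

lemma dia_scalar: assumes "u : CU" shows "u <> b =~D u * b" "b <> u =~D b * u"
proof -
 have *: "x * psr {0} * y =~D x * y" for x y
  using A.eqv_mult_lr[OF Pr_zero, of x y] by(intro deqv_eqv) (simp add: psr_def)
 have "u * Pr \<kappa> * b : DI" if "\<kappa> : Q - {0}" for \<kappa>
  using nil_power_mul_r[OF scalar_nil_power[OF assms Pr_nonzero[of \<kappa> True]], of b] that DI_nil_power
  by(auto simp: mul_def)
 hence "u <> b =~D u * psr {0} * b" using Q_zero by(intro dia_eq) auto
 thus "u <> b =~D u * b" using * deqv_trans by blast
 have "b * Pr \<kappa> * u : DI" if "\<kappa> : Q - {0}" for \<kappa>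
  using nil_power_mul_r[OF scalar_nil_power[OF assms Pr_nonzero[of \<kappa> False]], of b] that DI_nil_power
  by(auto simp: mul_def mult.assoc)
 hence "b <> u =~D b * psr {0} * u" using Q_zero by(intro dia_eq) auto
 thus "b <> u =~D b * u" using * deqv_trans by blast
qed

lemma proj_mult_eq: "proj_mult k nm h np P (qA a) (qA b) = qA (a <> b)"
proof -
 interpret AR: ring "PA" by(rule A.presented_ring)
 have *: "qA a \<otimes>\<^bsub>PA\<^esub> P \<kappa> \<otimes>\<^bsub>PA\<^esub> qA b = qA (a * Pr \<kappa> * b)" if "\<kappa> : Q" for \<kappa>
  using Pr(2)[OF that] by(simp add: A.pmap_hom)
 have E: "{\<kappa> : Q. qA a \<otimes>\<^bsub>PA\<^esub> P \<kappa> \<otimes>\<^bsub>PA\<^esub> qA b \<notin> double_ideal k nm h np}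
   = {\<kappa>:Q. a * Pr \<kappa> * b \<notin> DI}" using * by(auto simp: double_ideal_mem)
 show ?thesis
  unfolding proj_mult_def Let_def A_bar_eq E dia_def A.pmap_sum[OF exceptional_finite]
  using * by(intro AR.finsum_cong') (auto simp: A.pmap_hom(1))
qed

end

declare plus_fun_apply [simp del] zero_fun_apply [simp del] minus_apply [simp del] One_nat_def [simp del]

section \<open>Spans of words in the generators\<close>

locale reduction_data = extremal_pair k nm h np P
 for k nm h np :: "'g::fin_dim_complex_lie_algebra set" and P :: "('g => complex) => 'g loc_elem" +
 fixes \<pp> :: "'g set" and N :: "'i::linorder set" and p :: "'i => 'g" and \<mu> :: "'i => 'g => complex"
 assumes p_stable: "ad_stable k \<pp>" and p_complement: "complementary k \<pp> UNIV"
  and N_finite: "finite N" and p_inj: "inj_on p N" and p_independent: "clin.independent (p ` N)"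
  and p_span: "clin.span (p ` N) = \<pp>"
  and \<mu>_dual: "!!K. K : N ==> \<mu> K : dual_space h"
  and \<mu>_weight: "!!K x. K : N ==> x : h ==> lie x (p K) = \<mu> K x *\<^sub>C p K"
  and compatible: "!!K L. K : N ==> L : N ==> weight_less h np (\<mu> K) (\<mu> L) ==> \<mu> K ~= \<mu> L ==> K < L"
begin

lemma p_weight: "K : N ==> weight_vector h (\<mu> K) (p K)"
 using \<mu>_weight by(simp add: weight_vector_def)

definition WV :: "'g set" where "WV = {x. EX \<nu>:dual_space h. weight_vector h \<nu> x}"

lemma word_scalar:
 assumes "set xs <= WV" "u : CU"
 shows "EX u':CU. u * \<iota>s xs =~ \<iota>s xs * u'"
 using assms
proof (induction xs arbitrary: u)
 case (Cons x xs)
 then obtain \<nu> where "\<nu> : dual_space h" "weight_vector h \<nu> x" by(auto simp: WV_def)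
 then obtain v where v: "v : CU" "u * \<iota> x =~ \<iota> x * v" using scalar_past(1)[OF Cons.prems(2)] by blast
 obtain w where w: "w : CU" "v * \<iota>s xs =~ \<iota>s xs * w"
  using Cons.IH[OF _ v(1)] Cons.prems(1) by auto
 have "u * \<iota>s (x # xs) = u * \<iota> x * \<iota>s xs" by(simp add: mult.assoc)
 also have "... =~ \<iota> x * v * \<iota>s xs" by(rule A.eqv_mult_r[OF v(2)])
 also have "... = \<iota> x * (v * \<iota>s xs)" by(simp add: mult.assoc)
 also have "... =~ \<iota> x * (\<iota>s xs * w)" by(rule A.eqv_mult_l[OF w(2)])
 finally show ?case using w(1) by(auto simp: mult.assoc)
qed (auto intro: A.eqv_refl)

text \<open>Right span over the localized U(h), modulo \<open>J\<close>. The left ideal A n_+ is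
  taken for \<open>J\<close> where multiplication from the left is still to follow, because
  \<open>DI\<close> does not survive it.\<close>

definition rspan :: "'g lfalg set => 'g lfalg set => 'g lfalg set" where
 "rspan J G = span_mod J {g * u | g u. g : G & u : CU}"

definition right_submodule :: "'g lfalg set => bool" where
 "right_submodule J \<longleftrightarrow> (ALL x:J. ALL y:J. x + y : J) & (ALL x:J. ALL u:CU. x * u : J) & IA <= J"

abbreviation "AN \<equiv> nil_power False 1"

lemma IA_nil_power: "x : IA ==> x : nil_power s j"
 using nil_power_eqv[OF _ nil_power_zero] by(simp add: A.eqv_zero)

lemma DI_submodule: "right_submodule DI"
 unfolding right_submodule_def using DI_add DI_scalar DI_nil_power[OF IA_nil_power] by blast

lemma AN_submodule: "right_submodule AN"
 unfolding right_submodule_def using nil_power_add scalar_nil_power[of _ _ False 1] IA_nil_power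
 by(auto simp: mul_def)

lemma right_additive: "right_submodule J ==> additive_set J"
 unfolding right_submodule_def using A.K_simps(1) by unfold_locales auto

lemma rspan_base: "right_submodule J ==> g : G ==> u : CU ==> g * u : rspan J G"
 unfolding rspan_def by(erule additive_set.sp_base[OF right_additive]) blast

lemma rspan_gen: "right_submodule J ==> g : G ==> g : rspan J G"
 using rspan_base[of J g G 1] by simp

lemma rspan_zero: "right_submodule J ==> 0 : rspan J G"
 unfolding rspan_def by(erule additive_set.sp_zero[OF right_additive])

lemma rspan_add: "right_submodule J ==> x : rspan J G ==> y : rspan J G ==> x + y : rspan J G"
 unfolding rspan_def by(erule additive_set.sp_add[OF right_additive])

lemma rspan_sum: "right_submodule J ==> (!!i. i : S ==> f i : rspan J G) ==> sum f S : rspan J G"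
 unfolding rspan_def by(erule additive_set.sp_sum[OF right_additive])

lemma rspan_mod: "right_submodule J ==> x - y : J ==> y : rspan J G ==> x : rspan J G"
 unfolding rspan_def by(erule additive_set.sp_mod[OF right_additive])

lemma rspan_eqv: "right_submodule J ==> x =~ y ==> y : rspan J G ==> x : rspan J G"
 using rspan_mod[of J x y G] by(auto simp: right_submodule_def A.eqv_def)

lemma rspan_deqv: "x =~D y ==> y : rspan DI G ==> x : rspan DI G"
 using rspan_mod[OF DI_submodule] by(simp add: deqv_def)

lemma rspan_induct [consumes 1, case_names base add zero mod]:
 assumes "x : rspan J G" "!!g u. g : G ==> u : CU ==> V (g * u)" "!!x y. V x ==> V y ==> V (x + y)" "V 0"
  "!!x y. x - y : J ==> V y ==> V x"
 shows "V x"
 using assms(1)[unfolded rspan_def] by(rule span_mod_induct) (use assms(2-) in auto)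

lemma rspan_scalar_r: assumes J: "right_submodule J" and "x : rspan J G" "v : CU" shows "x * v : rspan J G"
 using assms(2)
proof (induction x rule: rspan_induct)
 case (base g u)
 hence "g * (u * v) : rspan J G" using assms(3) by(intro rspan_base J) auto
 thus ?case by(simp add: mult.assoc)
next
 case (mod x y)
 hence "x * v - y * v : J" using J assms(3) unfolding right_submodule_def by(metis left_diff_distrib)
 thus ?case using rspan_mod[OF J] mod by blast
qed (auto simp: distrib_right intro: rspan_add rspan_zero J)

lemma rspan_mono: assumes J: "right_submodule J" and "x : rspan J G" "!!g. g : G ==> g : rspan J G'" shows "x : rspan J G'"
 using assms(2)
proof (induction x rule: rspan_induct)
 case (base g u)
 thus ?case by(intro rspan_scalar_r J assms)
qed (auto intro: rspan_add rspan_zero rspan_mod J)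

lemma rspan_minus: "right_submodule J ==> x : rspan J G ==> - x : rspan J G"
 using rspan_scalar_r[of J x G "- 1"] by auto

lemma rspan_AN_DI: "x : rspan AN G ==> x : rspan DI G"
 unfolding rspan_def span_mod_def using DI_nil_power by blast

lemma rspan_coefficients:
 assumes "x : rspan DI (g ` W)" "finite W"
 shows "EX c. (ALL w. c w : CU) & x =~D (\<Sum>w\<in>W. g w * c w)"
 using assms(1)
proof (induction x rule: rspan_induct)
 case (base y u)
 then obtain w where w: "w : W" "y = g w" by blast
 have "(\<Sum>v\<in>W. g v * (if v = w then u else 0)) = (\<Sum>v\<in>W. if v = w then g w * u else 0)" by(intro sum.cong) auto
 thus ?case using base w assms(2) by(intro exI[of _ "%v. if v = w then u else 0"]) auto
next
 case (add x y)
 then obtain c d where "ALL w. c w : CU" "ALL w. d w : CU" "x =~D (\<Sum>w\<in>W. g w * c w)" "y =~D (\<Sum>w\<in>W. g w * d w)" by blast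
 hence "ALL w. c w + d w : CU" "x + y =~D (\<Sum>w\<in>W. g w * (c w + d w))"
  by(auto simp: distrib_left sum.distrib deqv_add)
 thus ?case by(intro exI[of _ "%w. c w + d w"]) blast
next
 case zero
 show ?case by(intro exI[of _ "%_. 0"]) auto
next
 case (mod x y)
 thus ?case using deqv_trans[of x y] by(auto simp: deqv_def[of x y])
qed

definition pw :: "'i list => 'g lfalg" where
 "pw w = \<iota>s (map p w)"

lemma pw_simps [simp]: "pw [] = 1" "pw (K # w) = \<iota> (p K) * pw w"
 by(simp_all add: pw_def)

lemma pw_WV: "set w <= N ==> set (map p w) <= WV"
 using p_weight \<mu>_dual by(auto simp: WV_def)

lemma p_expand:
 assumes "v : \<pp>"
 shows "EX c. \<iota> v =~ (\<Sum>K\<in>N. fconst (c K) * \<iota> (p K)) &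
  (ALL \<nu>:dual_space h. weight_vector h \<nu> v --> (ALL K:N. c K ~= 0 --> \<mu> K = \<nu>))"
proof -
 define c where "c K = clin.representation (p ` N) v (p K)" for K
 have v: "v : clin.span (p ` N)" using assms p_span by simp
 have "(\<Sum>x\<in>p ` N. clin.representation (p ` N) v x *\<^sub>C x) = v"
  using p_independent v finite_imageI[OF N_finite] subset_refl by(rule clin.sum_representation_eq)
 hence "v = (\<Sum>K\<in>N. c K *\<^sub>C p K)" by(simp add: sum.reindex[OF p_inj] c_def)
 hence *: "\<iota> v =~ (\<Sum>K\<in>N. fconst (c K) * \<iota> (p K))" using A.gen_lincomb[of N p c] by simp
 have "\<mu> K = \<nu>" if "\<nu> : dual_space h" "weight_vector h \<nu> v" "K : N" "c K ~= 0" for \<nu> K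
 proof -
  have inv: "inv_into N p (p L) = L" if "L : N" for L by(rule inv_into_f_f[OF p_inj that])
  have "\<mu> (inv_into N p (p K)) = \<nu>"
   using that v N_finite p_independent p_weight \<mu>_dual inv
   by(intro representation_weight[where X = "p ` N" and wt = "%x. \<mu> (inv_into N p x)" and v = v])
    (auto simp: c_def)
  thus ?thesis using inv that by simp
 qed
 thus ?thesis using * by blast
qed

abbreviation "wsum w \<equiv> sum_list (map \<mu> w)"

definition wset :: "nat => ('g => complex) => 'i list set" where
 "wset n \<nu> = {w. set w <= N & length w = n & wsum w = \<nu>}"

lemma lie_p: assumes "e : k" "v : \<pp>" shows "lie e v : \<pp>" "lie v e : \<pp>"
proof -
 show "lie e v : \<pp>" using p_stable assms by(simp add: ad_stable_def)
 hence "- lie e v : \<pp>" using clin.subspace_neg clin.subspace_span p_span by metis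
 thus "lie v e : \<pp>" by(simp flip: lie_anti)
qed

lemma p_in: "K : N ==> p K : \<pp>"
 using clin.span_base[of "p K" "p ` N"] p_span by simp

text \<open>ad e acts on the word as a derivation and preserves \<open>\<pp>\<close>, so it replaces
  one letter at a time; the length is kept and the weight grows by \<gamma>.\<close>

lemma adjoint_word:
 assumes e: "e : k" "weight_vector h \<gamma> e" "\<gamma> : dual_space h" and w: "set w <= N"
 shows "EX y:addcl {pw w' * u | w' u. w' : wset (length w) (\<gamma> + wsum w) & u : CU}. \<iota> e * pw w =~ pw w * \<iota> e + y"
 using w
proof (induction w)
 case Nil
 show ?case by(rule bexI[OF _ addcl.zero]) simp
next
 case (Cons K w)
 let ?G = "%w. {pw w' * u | w' u. w' : wset (length w) (\<gamma> + wsum w) & u : CU}"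
 obtain y where y: "y : addcl (?G w)" "\<iota> e * pw w =~ pw w * \<iota> e + y" using Cons by auto
 have K: "K : N" "set w <= N" using Cons.prems by auto
 obtain c where c: "\<iota> (lie e (p K)) =~ (\<Sum>L\<in>N. fconst (c L) * \<iota> (p L))"
  "ALL \<nu>:dual_space h. weight_vector h \<nu> (lie e (p K)) --> (ALL L:N. c L ~= 0 --> \<mu> L = \<nu>)"
  using p_expand[OF lie_p(1)[OF e(1) p_in[OF K(1)]]] by blast
 have wt: "\<mu> L = \<gamma> + \<mu> K" if "L : N" "c L ~= 0" for L
 proof -
  have "\<gamma> + \<mu> K : dual_space h" using dual_space_add e(3) \<mu>_dual K(1) by blast
  moreover have "weight_vector h (\<gamma> + \<mu> K) (lie e (p K))"
   using weight_vector_lie[OF e(2) p_weight[OF K(1)]] by(simp add: plus_fun_def)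
  ultimately show ?thesis using c(2) that by blast
 qed
 have 1: "(\<Sum>L\<in>N. fconst (c L) * \<iota> (p L)) * pw w : addcl (?G (K # w))"
  unfolding sum_distrib_right
 proof (rule addcl_sum)
  fix L assume L: "L : N"
  show "fconst (c L) * \<iota> (p L) * pw w : addcl (?G (K # w))"
  proof (cases "c L = 0")
   case False
   hence "L # w : wset (length (K # w)) (\<gamma> + wsum (K # w))" using L K wt by(simp add: wset_def add.assoc)
   moreover have "fconst (c L) * \<iota> (p L) * pw w = pw (L # w) * fconst (c L)"
    by(simp only: fconst_central[symmetric]) (simp add: mult.assoc)
   moreover have "fconst (c L) : CU" by simp
   ultimately show ?thesis by(intro addcl_base) blast
  qed (simp add: addcl.zero)
 qed
 have 2: "\<iota> (p K) * y : addcl (?G (K # w))"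
  using y(1)
 proof (rule addcl_image)
  fix g assume "g : ?G w"
  then obtain w' u where g: "g = pw w' * u" "w' : wset (length w) (\<gamma> + wsum w)" "u : CU" by blast
  hence "K # w' : wset (length (K # w)) (\<gamma> + wsum (K # w))" using K by(simp add: wset_def add.left_commute)
  moreover have "\<iota> (p K) * g = pw (K # w') * u" by(simp add: g mult.assoc)
  ultimately show "\<iota> (p K) * g : addcl (?G (K # w))" using g(3) by(intro addcl_base) blast
 qed (simp_all add: distrib_left)
 have "\<iota> e * pw (K # w) = \<iota> e * \<iota> (p K) * pw w" by(simp add: mult.assoc)
 also have "... =~ (\<iota> (p K) * \<iota> e + \<iota> (lie e (p K))) * pw w" by(intro A.eqv_mult_r A.gen_lie) simp_all
 also have "... = \<iota> (p K) * (\<iota> e * pw w) + \<iota> (lie e (p K)) * pw w" by(simp add: distrib_right mult.assoc)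
 also have "... =~ \<iota> (p K) * (pw w * \<iota> e + y) + (\<Sum>L\<in>N. fconst (c L) * \<iota> (p L)) * pw w"
  by(intro A.eqv_add A.eqv_mult_l y A.eqv_mult_r c)
 also have "... = pw (K # w) * \<iota> e + (\<iota> (p K) * y + (\<Sum>L\<in>N. fconst (c L) * \<iota> (p L)) * pw w)"
  by(simp add: distrib_left mult.assoc)
 finally show ?case using addcl_plus[OF 2 1] by blast
qed

lemma raise_span:
 assumes "x : rspan AN (pw ` wset n \<nu>)" "e : np" "weight_vector h \<gamma> e" "\<gamma> : dual_space h"
 shows "\<iota> e * x : rspan AN (pw ` wset n (\<gamma> + \<nu>))"
 using assms(1)
proof (induction x rule: rspan_induct)
 case (base g u)
 then obtain w where w: "g = pw w" "w : wset n \<nu>" by blast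
 then obtain y where y: "y : addcl {pw w' * u | w' u. w' : wset n (\<gamma> + \<nu>) & u : CU}" "\<iota> e * pw w =~ pw w * \<iota> e + y"
  using adjoint_word[of e \<gamma> w] assms np_subset_k by(auto simp: wset_def)
 have "\<iota> e : AN" using nil_power_base[of "[e]" False 1] assms(2) by(simp add: mul_def nil_part_def One_nat_def)
 hence "pw w * \<iota> e : AN" using nil_power_mul_r[of "\<iota> e" False 1 "pw w"] by(simp add: mul_def)
 moreover have "y : rspan AN (pw ` wset n (\<gamma> + \<nu>))"
 proof -
  have "{pw w' * u | w' u. w' : wset n (\<gamma> + \<nu>) & u : CU} = {g * u | g u. g : pw ` wset n (\<gamma> + \<nu>) & u : CU}" by blast
  thus ?thesis using y(1) nil_power_zero unfolding rspan_def span_mod_def by force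
 qed
 ultimately have "pw w * \<iota> e + y : rspan AN (pw ` wset n (\<gamma> + \<nu>))"
  by(intro rspan_mod[OF AN_submodule, of "pw w * \<iota> e + y" y]) simp_all
 hence "\<iota> e * pw w : rspan AN (pw ` wset n (\<gamma> + \<nu>))" by(rule rspan_eqv[OF AN_submodule y(2)])
 from rspan_scalar_r[OF AN_submodule this base(2)] show ?case by(simp only: w(1) mult.assoc)
next
 case (mod x y)
 hence "\<iota> e * x - \<iota> e * y : AN"
  using nil_power_mul_r[of "x - y" False 1 "\<iota> e"] by(simp add: mul_def right_diff_distrib)
 thus ?case by(rule rspan_mod[OF AN_submodule]) (rule mod)
qed (auto simp: distrib_left intro: rspan_add rspan_zero AN_submodule)

text \<open>v f = f v + [v, f]: whenever v passes a factor, that factor comes to the front and the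
  term falls into n_- A. Only the iterated bracket is left.\<close>

lemma lower_letter:
 assumes "set fs <= nm" shows "EX z:nil_power True 1. \<iota> v * \<iota>s fs =~ \<iota> (foldl lie v fs) + z"
 using assms
proof (induction fs arbitrary: v)
 case Nil
 show ?case by(rule bexI[OF _ nil_power_zero]) simp
next
 case (Cons f fs)
 obtain z where z: "z : nil_power True 1" "\<iota> (lie v f) * \<iota>s fs =~ \<iota> (foldl lie (lie v f) fs) + z"
  using Cons by auto
 have f: "\<iota> f * (\<iota> v * \<iota>s fs) : nil_power True 1"
  using nil_power_base[of "[f]" True "\<iota> v * \<iota>s fs"] Cons.prems by(simp add: mul_def nil_part_def One_nat_def)
 have "\<iota> v * \<iota>s (f # fs) = \<iota> v * \<iota> f * \<iota>s fs" by(simp add: mult.assoc)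
 also have "... =~ (\<iota> f * \<iota> v + \<iota> (lie v f)) * \<iota>s fs" by(intro A.eqv_mult_r A.gen_lie) simp_all
 also have "... = \<iota> f * (\<iota> v * \<iota>s fs) + \<iota> (lie v f) * \<iota>s fs"
  by(simp add: distrib_right mult.assoc)
 also have "... =~ \<iota> f * (\<iota> v * \<iota>s fs) + (\<iota> (foldl lie (lie v f) fs) + z)"
  by(intro A.eqv_add z A.eqv_refl)
 finally have "\<iota> v * \<iota>s (f # fs)
   =~ \<iota> (foldl lie v (f # fs)) + (\<iota> f * (\<iota> v * \<iota>s fs) + z)" by(simp add: add_ac)
 thus ?case by(rule bexI[OF _ nil_power_add[OF f z(1)]])
qed

text \<open>The words occurring in \<open>p\<^sub>K P\<^sub>\<kappa> p\<^sub>w\<close>: the first letter is lowered by the weight \<open>\<kappa>\<close>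
 and the remaining ones are raised by it.\<close>

definition shifted :: "('g => complex) => 'i => 'i list => 'i list set" where
 "shifted \<kappa> K w = {K' # w' | K' w'. K' : N & \<mu> K = \<mu> K' + \<kappa> & w' : wset (length w) (\<kappa> + wsum w)}"

lemma raise_word:
 assumes "set \<gamma>s <= weights h np" "list_all2 (%\<gamma> e. e : weight_space h k \<gamma>) \<gamma>s es" "set w <= N"
 shows "\<iota>s es * pw w : rspan AN (pw ` wset (length w) (sum_list \<gamma>s + wsum w))"
 using assms(2,1)
proof (induction rule: list_all2_induct)
 case Nil
 thus ?case using assms(3) by(intro rspan_gen AN_submodule) (auto simp: wset_def)
next
 case (Cons \<gamma> \<gamma>s e es)
 have "e : np" "weight_vector h \<gamma> e" "\<gamma> : dual_space h"
  using Cons positive_root_dual positive_root_space by(auto simp: weight_space_iff)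
 thus ?case using raise_span[OF Cons(3)] Cons.prems by(simp add: mult.assoc add.assoc)
qed

lemma lower_weight:
 assumes "set \<gamma>s <= weights h np" "list_all2 (%\<gamma> f. f : weight_space h k (- \<gamma>)) \<gamma>s fs"
  "v : \<pp>" "weight_vector h \<nu> v" "\<nu> : dual_space h"
 shows "foldl lie v fs : \<pp> & weight_vector h (\<nu> - sum_list \<gamma>s) (foldl lie v fs) & \<nu> - sum_list \<gamma>s : dual_space h & set fs <= nm"
 using assms(2,1,3-)
proof (induction arbitrary: v \<nu> rule: list_all2_induct)
 case (Cons \<gamma> \<gamma>s f fs)
 have f: "f : k" "weight_vector h (- \<gamma>) f" "\<gamma> : weights h np"
  using Cons.prems Cons.hyps by(simp_all add: weight_space_iff)
 note f = f(1,2) dual_space_minus[OF positive_root_dual[OF f(3)]] negative_root_space[OF f(3,1,2)]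
 have "weight_vector h (%x. \<nu> x + (- \<gamma>) x) (lie v f)"
  using weight_vector_lie[OF Cons.prems(3) f(2)] by(simp add: plus_fun_def)
 hence "weight_vector h (\<nu> - \<gamma>) (lie v f)" by(simp add: fun_diff_def)
 moreover have "\<nu> - \<gamma> : dual_space h" using dual_space_add[OF Cons.prems(4) f(3)] by simp
 moreover have "lie v f : \<pp>" by(rule lie_p(2)[OF f(1) Cons.prems(2)])
 ultimately have "foldl lie (lie v f) fs : \<pp> & weight_vector h (\<nu> - \<gamma> - sum_list \<gamma>s) (foldl lie (lie v f) fs) &
   \<nu> - \<gamma> - sum_list \<gamma>s : dual_space h & set fs <= nm"
  using Cons.prems by(intro Cons.IH) auto
 thus ?case using f(4) by(simp add: diff_diff_add)
qed simp

text \<open>The raising factors act first, on the word to their right and modulo the left ideal A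
  n_+. The lowering factors then act on \<open>p K\<close>, modulo n_- A. Coefficients are taken out
  to the left and finally carried past the whole word to the right.\<close>

lemma projector_term:
 assumes K: "K : N" and w: "set w <= N" and \<kappa>: "\<kappa> : Q"
 shows "\<iota> (p K) * Pr \<kappa> * pw w : rspan DI (pw ` shifted \<kappa> K w)"
proof -
 have gens: "\<iota> (p K) * g * pw w : rspan DI (pw ` shifted \<kappa> K w)" if g: "g : proj_gens \<kappa>" for g
 proof -
  obtain u fs es \<gamma>s \<gamma>s' where *: "g = u * (\<iota>s fs * \<iota>s es)" "u : CU"
   "set \<gamma>s <= weights h np" "set \<gamma>s' <= weights h np"
     "list_all2 (%\<gamma> f. f : weight_space h k (- \<gamma>)) \<gamma>s fs"
     "list_all2 (%\<gamma> e. e : weight_space h k \<gamma>) \<gamma>s' es"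
     "sum_list \<gamma>s = \<kappa>" "sum_list \<gamma>s' = \<kappa>" using g unfolding proj_gens_def by blast
  obtain u' where u': "u' : CU" "\<iota> (p K) * u =~ u' * \<iota> (p K)"
   using scalar_past(2)[OF *(2) p_weight[OF K] \<mu>_dual[OF K]] by blast
  have lw: "foldl lie (p K) fs : \<pp>" "weight_vector h (\<mu> K - \<kappa>) (foldl lie (p K) fs)"
   "\<mu> K - \<kappa> : dual_space h" "set fs <= nm"
   using lower_weight[OF *(3,5) p_in[OF K] p_weight[OF K] \<mu>_dual[OF K]] *(7) by auto
  obtain z where z: "z : nil_power True 1" "\<iota> (p K) * \<iota>s fs =~ \<iota> (foldl lie (p K) fs) + z"
   using lower_letter[OF lw(4)] by blast
  obtain c where c: "\<iota> (foldl lie (p K) fs) =~ (\<Sum>L\<in>N. fconst (c L) * \<iota> (p L))"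
   "ALL \<nu>:dual_space h. weight_vector h \<nu> (foldl lie (p K) fs) --> (ALL L:N. c L ~= 0 --> \<mu> L = \<nu>)"
   using p_expand[OF lw(1)] by blast
  have step: "\<iota> (p K) * (u * \<iota>s fs) * r =~D (\<Sum>L\<in>N. u' * fconst (c L) * \<iota> (p L) * r)" for r
  proof -
   have "\<iota> (p K) * (u * \<iota>s fs) * r = \<iota> (p K) * u * (\<iota>s fs * r)" by(simp add: mult.assoc)
   also have "... =~ u' * \<iota> (p K) * (\<iota>s fs * r)" by(rule A.eqv_mult_r[OF u'(2)])
   also have "... = u' * ((\<iota> (p K) * \<iota>s fs) * r)" by(simp add: mult.assoc)
   also have "... =~ u' * (((\<Sum>L\<in>N. fconst (c L) * \<iota> (p L)) + z) * r)"
    by(intro A.eqv_mult_l A.eqv_mult_r A.eqv_trans[OF z(2)] A.eqv_add c A.eqv_refl)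
   also have "... = (\<Sum>L\<in>N. u' * fconst (c L) * \<iota> (p L) * r) + u' * (z * r)"
    by(simp add: distrib_left distrib_right sum_distrib_left sum_distrib_right mult.assoc)
   finally have 1: "\<iota> (p K) * (u * \<iota>s fs) * r
     =~D (\<Sum>L\<in>N. u' * fconst (c L) * \<iota> (p L) * r) + u' * (z * r)" by(rule deqv_eqv)
   have "z * r : DI" using nil_power_mul_r[OF z(1), of r] DI_nil_power by(metis mul_def)
   hence "u' * (z * r) =~D 0" using DI_scalar(1)[OF _ u'(1)] by(simp add: deqv_def)
   hence "(\<Sum>L\<in>N. u' * fconst (c L) * \<iota> (p L) * r) + u' * (z * r) =~D (\<Sum>L\<in>N. u' * fconst (c L) * \<iota> (p L) * r) + 0"
    by(rule deqv_add[OF deqv_refl])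
   from deqv_trans[OF 1 this] show ?thesis by simp
  qed
  have "\<iota> (p K) * (u * \<iota>s fs) * x : rspan DI (pw ` shifted \<kappa> K w)"
   if "x : rspan AN (pw ` wset (length w) (\<kappa> + wsum w))" for x
   using that
  proof (induction x rule: rspan_induct)
   case (base y v)
   then obtain w' where w': "y = pw w'" "w' : wset (length w) (\<kappa> + wsum w)" by blast
   have "u' * fconst (c L) * \<iota> (p L) * y : rspan DI (pw ` shifted \<kappa> K w)" if L: "L : N" for L
   proof (cases "c L = 0")
    case False
    have "\<mu> L = \<mu> K - \<kappa>" using c(2) lw(3,2) L False by blast
    hence mem: "L # w' : shifted \<kappa> K w" using w'(2) L by(auto simp: shifted_def)
    have 1: "set (map p (L # w')) <= WV" using w'(2) L by(intro pw_WV) (auto simp: wset_def)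
    have 2: "u' * fconst (c L) : CU" using u'(1) by auto
    obtain v' where v': "v' : CU" "u' * fconst (c L) * pw (L # w') =~ pw (L # w') * v'"
     using word_scalar[OF 1 2] unfolding pw_def by blast
    have "u' * fconst (c L) * pw (L # w') : rspan DI (pw ` shifted \<kappa> K w)"
     using mem v'(1) by(intro rspan_eqv[OF DI_submodule v'(2)] rspan_base DI_submodule imageI)
    thus ?thesis by(simp add: w'(1) mult.assoc)
   qed (simp add: rspan_zero[OF DI_submodule])
   hence "(\<Sum>L\<in>N. u' * fconst (c L) * \<iota> (p L) * y) : rspan DI (pw ` shifted \<kappa> K w)"
    by(rule rspan_sum[OF DI_submodule])
   with step[of y] have "\<iota> (p K) * (u * \<iota>s fs) * y : rspan DI (pw ` shifted \<kappa> K w)"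
    by(rule rspan_deqv)
   from rspan_scalar_r[OF DI_submodule this base(2)] show ?case by(simp only: mult.assoc)
  next
   case (mod x y)
   have "mul False (x - y) (\<iota> (p K) * (u * \<iota>s fs)) : DI"
    by(rule DI_nil_power[OF nil_power_mul_r[OF mod(1)]])
   hence "\<iota> (p K) * (u * \<iota>s fs) * x =~D \<iota> (p K) * (u * \<iota>s fs) * y"
    by(simp add: mul_def deqv_def right_diff_distrib)
   thus ?case using mod(2) by(rule rspan_deqv)
  qed (auto simp: distrib_left intro: rspan_add rspan_zero DI_submodule)
  from this[OF raise_word[OF *(4,6) w, unfolded *(8)]] show ?thesis by(simp add: *(1) mult.assoc)
 qed
 show ?thesis using Pr(1)[OF \<kappa>]
 proof (induction rule: addcl.induct)
  case zero
  show ?case by(simp add: rspan_zero[OF DI_submodule])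
 next
  case (add x y)
  thus ?case using rspan_add[OF DI_submodule gens[OF add(1)] add(3)] by(simp add: distrib_left distrib_right)
 qed
qed

lemma dia_leading:
 assumes K: "K : N" and w: "set w <= N"
 shows "\<iota> (p K) <> pw w - pw (K # w) : rspan DI (pw ` (\<Union>\<kappa>\<in>Q - {0}. shifted \<kappa> K w))"
proof -
 let ?R = "rspan DI (pw ` (\<Union>\<kappa>\<in>Q - {0}. shifted \<kappa> K w))"
 let ?E = "{\<kappa>:Q. \<iota> (p K) * Pr \<kappa> * pw w \<notin> DI}"
 \<comment> \<open>The index 0 is added by hand: it carries the leading term, yet \<open>dia\<close>
   omits it if that term happens to lie in \<open>DI\<close>.\<close>
 let ?T = "insert 0 ?E"
 have "\<iota> (p K) * Pr \<kappa> * pw w : ?R" if "\<kappa> : ?T - {0}" for \<kappa>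
 proof -
  have \<kappa>: "\<kappa> : Q - {0}" using that by auto
  hence "\<iota> (p K) * Pr \<kappa> * pw w : rspan DI (pw ` shifted \<kappa> K w)" using projector_term[OF K w] by blast
  thus ?thesis by(rule rspan_mono[OF DI_submodule]) (intro rspan_gen[OF DI_submodule], use \<kappa> in blast)
 qed
 hence R: "(\<Sum>\<kappa>\<in>?T - {0}. \<iota> (p K) * Pr \<kappa> * pw w) : ?R" by(rule rspan_sum[OF DI_submodule])
 have fin: "finite ?T" using exceptional_finite by blast
 have "\<iota> (p K) <> pw w =~D \<iota> (p K) * psr ?T * pw w" using fin Q_zero by(intro dia_eq) auto
 also have "... = \<iota> (p K) * Pr 0 * pw w + (\<Sum>\<kappa>\<in>?T - {0}. \<iota> (p K) * Pr \<kappa> * pw w)"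
  using sum.remove[OF fin, of 0 "%\<kappa>. \<iota> (p K) * Pr \<kappa> * pw w"] by(simp add: psr_def sum_distrib_left sum_distrib_right)
 also have "... =~D pw (K # w) + (\<Sum>\<kappa>\<in>?T - {0}. \<iota> (p K) * Pr \<kappa> * pw w)"
  using A.eqv_mult_lr[OF Pr_zero] by(intro deqv_add deqv_eqv deqv_refl) simp
 finally have "\<iota> (p K) <> pw w - pw (K # w) =~D (\<Sum>\<kappa>\<in>?T - {0}. \<iota> (p K) * Pr \<kappa> * pw w)"
  by(simp add: deqv_def algebra_simps)
 thus ?thesis using R by(rule rspan_deqv)
qed

text \<open>A nonzero \<kappa> in Q_+ makes the weights comparable and distinct, so compatibility of
  the order applies: downwards for the first letter, upwards for a single second one.\<close>

lemma shifted_order: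
 assumes "v : shifted \<kappa> K w" "K : N" "set w <= N" "\<kappa> : Q - {0}"
 obtains K' w' where "v = K' # w'" "K' : N" "set w' <= N" "length w' = length w" "K' < K"
  "!!J. w = [J] ==> EX J'. w' = [J'] & J < J'"
proof -
 obtain K' w' where *: "v = K' # w'" "K' : N" "\<mu> K = \<mu> K' + \<kappa>" "set w' <= N" "length w' = length w"
  "wsum w' = \<kappa> + wsum w" using assms(1) by(auto simp: shifted_def wset_def)
 have less: "weight_less h np a (a + \<kappa>)" "weight_less h np a (\<kappa> + a)" for a using assms(4) by(simp_all add: weight_less_def)
 have ne: "a ~= a + \<kappa>" "a ~= \<kappa> + a" for a using assms(4) by simp_all
 have "K' < K" using compatible[OF *(2) assms(2)] less(1)[of "\<mu> K'"] ne(1)[of "\<mu> K'"] *(3) by metis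
 moreover have "EX J'. w' = [J'] & J < J'" if J: "w = [J]" for J
 proof -
  obtain J' where J': "w' = [J']" using *(5) J by(auto simp: length_Suc_conv)
  have "\<mu> J' = \<kappa> + \<mu> J" using *(6) J J' by simp
  hence "J < J'" using compatible[of J J'] less(2)[of "\<mu> J"] ne(2)[of "\<mu> J"] *(4) assms(3) J J' by simp
  thus ?thesis using J' by blast
 qed
 ultimately show thesis using that * by blast
qed

definition dw :: "'i list => 'g lfalg" where
 "dw w = foldr (%K r. \<iota> (p K) <> r) w 1"

lemma dw_simps: "dw [] = 1" "dw (K # w) = \<iota> (p K) <> dw w"
 by(simp_all add: dw_def)

lemma one_CU: "(1 :: 'g lfalg) : CU"
 by simp

lemma dia_zero: "a <> 0 =~D 0"
 using dia_DI(2)[OF DI_zero] by(simp add: deqv_def)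

lemma dia_scalar_assoc: assumes "u : CU"
 shows "a <> (b * u) =~D (a <> b) * u" "(u * a) <> b =~D u * (a <> b)"
proof -
 have "a <> (b * u) =~D a <> (b <> u)" by(intro dia_deqv deqv_refl deqv_sym[OF dia_scalar(2)] assms)
 also have "... =~D (a <> b) <> u" by(rule deqv_sym[OF dia_assoc])
 also have "... =~D (a <> b) * u" by(rule dia_scalar(2)[OF assms])
 finally show "a <> (b * u) =~D (a <> b) * u" .
 have "(u * a) <> b =~D (u <> a) <> b" by(intro dia_deqv deqv_refl deqv_sym[OF dia_scalar(1)] assms)
 also have "... =~D u <> (a <> b)" by(rule dia_assoc)
 also have "... =~D u * (a <> b)" by(rule dia_scalar(1)[OF assms])
 finally show "(u * a) <> b =~D u * (a <> b)" .
qed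

lemma dia_rspan:
 assumes "x : rspan DI (dw ` W)" shows "\<iota> (p K) <> x : rspan DI (dw ` (%w. K # w) ` W)"
 using assms
proof (induction x rule: rspan_induct)
 case (base g u)
 then obtain w where w: "w : W" "g = dw w" by blast
 have "\<iota> (p K) <> (g * u) =~D dw (K # w) * u" using dia_scalar_assoc(1)[OF base(2)] by(simp add: w dw_simps)
 moreover have "dw (K # w) * u : rspan DI (dw ` (%w. K # w) ` W)" using w base(2) by(intro rspan_base DI_submodule) auto
 ultimately show ?case by(rule rspan_deqv)
next
 case (add x y)
 thus ?case using rspan_deqv[OF dia_add(2)] rspan_add[OF DI_submodule] by blast
next
 case zero
 show ?case using dia_zero rspan_zero[OF DI_submodule] by(rule rspan_deqv)
next
 case (mod x y)
 hence "\<iota> (p K) <> x =~D \<iota> (p K) <> y" by(intro dia_deqv) (simp_all add: deqv_def)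
 thus ?case using mod(2) by(rule rspan_deqv)
qed

text \<open>Induction on the length, then on the number of letters below the first letter: by
  \<open>dia_leading\<close> the corrections begin with a smaller letter.\<close>

lemma pw_in_dw_span:
 assumes "set w <= N"
 shows "pw w : rspan DI (dw ` {w'. set w' <= N & length w' = length w})"
 using assms
proof (induction "length w" arbitrary: w)
 case 0
 thus ?case by(intro rspan_gen[OF DI_submodule]) (auto simp: dw_simps image_iff intro!: exI[of _ "[]"])
next
 case (Suc n)
 have main: "ALL w. set w <= N --> length w = n --> pw (K # w) : rspan DI (dw ` {w'. set w' <= N & length w' = Suc n})"
  if "K : N" for K
  using that
 proof (induction "card {L:N. L < K}" arbitrary: K rule: less_induct)
  case less
  show ?case
  proof (intro allI impI)
   fix w assume w: "set w <= N" "length w = n"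
   let ?R = "rspan DI (dw ` {w'. set w' <= N & length w' = Suc n})"
   have "\<iota> (p K) <> pw w : rspan DI (dw ` (%w. K # w) ` {w'. set w' <= N & length w' = length w})"
    using Suc.hyps(1)[of w] w by(intro dia_rspan) auto
   hence 1: "\<iota> (p K) <> pw w : ?R"
    by(rule rspan_mono[OF DI_submodule]) (use w less.prems in \<open>auto intro!: rspan_gen[OF DI_submodule]\<close>)
   have sub: "pw v : ?R" if v: "v : shifted \<kappa> K w" "\<kappa> : Q - {0}" for v \<kappa>
   proof -
    obtain K' w' where *: "v = K' # w'" "K' : N" "set w' <= N" "length w' = length w" "K' < K"
     by(rule shifted_order[OF v(1) less.prems w(1) v(2)])
    have "{L:N. L < K'} \<subset> {L:N. L < K}" using *(2,5) by auto
    hence "card {L:N. L < K'} < card {L:N. L < K}" using N_finite by(intro psubset_card_mono) auto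
    thus ?thesis using less.hyps[of K'] * w(2) by auto
   qed
   have "\<iota> (p K) <> pw w - pw (K # w) : ?R"
    using dia_leading[OF less.prems w(1)] by(rule rspan_mono[OF DI_submodule]) (auto intro: sub)
   hence "\<iota> (p K) <> pw w + - (\<iota> (p K) <> pw w - pw (K # w)) : ?R"
    by(intro rspan_add rspan_minus DI_submodule 1)
   thus "pw (K # w) : ?R" by simp
  qed
 qed
 obtain K v where w: "w = K # v" "length v = n" using Suc.hyps(2) by(metis length_Suc_conv)
 have "K : N" "set v <= N" using Suc.prems w(1) by auto
 from main[OF this(1), rule_format, OF this(2) w(2)] show ?case by(simp add: w)
qed

end

declare plus_fun_apply [simp] zero_fun_apply [simp] minus_apply [simp] One_nat_def [simp]

section \<open>A basis of the reduction algebra\<close>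

declare plus_fun_apply [simp del] One_nat_def [simp del]

lemma independent_Un:
 assumes "clin.independent A" "clin.independent B" "!!x. x : clin.span A ==> x : clin.span B ==> x = 0"
 shows "clin.independent (A \<union> B)" "A \<inter> B = {}"
proof -
 have fin: "finite A" "finite B" using assms cfin.finiteI_independent by blast+
 have "a \<notin> B" if "a : A" for a
  using assms(3)[of a] that clin.span_base clin.dependent_zero assms(1) by blast
 thus disj: "A \<inter> B = {}" by blast
 show "clin.independent (A \<union> B)"
 proof (rule clin.independent_if_scalars_zero)
  fix f x assume "(\<Sum>x\<in>A \<union> B. f x *\<^sub>C x) = 0" and x: "x : A \<union> B"
  hence s: "(\<Sum>x\<in>A. f x *\<^sub>C x) + (\<Sum>x\<in>B. f x *\<^sub>C x) = 0" by(simp add: sum.union_disjoint fin disj)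
  have m: "(\<Sum>x\<in>C. g x *\<^sub>C x) : clin.span C" for C g by(intro clin.span_sum clin.span_scale clin.span_base)
  have "(\<Sum>x\<in>A. f x *\<^sub>C x) = - (\<Sum>x\<in>B. f x *\<^sub>C x)" using s by(simp add: eq_neg_iff_add_eq_0)
  hence "(\<Sum>x\<in>A. f x *\<^sub>C x) = 0" by(intro assms(3) m) (simp add: m clin.span_neg)
  thus "f x = 0"
   using x s clin.independentD[OF assms(1) fin(1) subset_refl] clin.independentD[OF assms(2) fin(2) subset_refl] by auto
 qed (simp add: fin)
qed

text \<open>A left inverse of a square matrix is a right inverse. By dimension: the rows of
  \<open>F\<close> span all delta functions on \<open>W\<close>, and a relation with a nonzero
  coefficient at \<open>w0\<close> would achieve this with one row fewer.\<close>

lemma left_inverse_injective: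
 fixes F :: "'b => 'b => complex"
 assumes W: "finite W" and inv: "!!v x. v : W ==> x : W ==> (\<Sum>w\<in>W. D v w * F w x) = (if x = v then 1 else 0)"
  and zero: "!!x. x : W ==> (\<Sum>w\<in>W. c w * F w x) = 0" and w0: "w0 : W"
 shows "c w0 = 0"
proof (rule ccontr)
 assume c0: "c w0 ~= 0"
 interpret fn: vector_space "%(r::complex) f x. r * (f x :: complex)"
  by unfold_locales (auto simp: fun_eq_iff algebra_simps plus_fun_apply)
 have sum_app: "(\<Sum>w\<in>S. f w) x = (\<Sum>w\<in>S. f w x)" for S :: "'b set" and f :: "'b => 'b => complex" and x
  by(induction S rule: infinite_finite_induct) (simp_all add: plus_fun_apply)
 \<comment> \<open>Cut off outside \<open>W\<close>, so that identities on \<open>W\<close> become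
   identities of functions.\<close>
 define G where "G w x = (if x : W then F w x else 0)" for w x
 define \<delta> :: "'b => 'b => complex" where "\<delta> v x = (if x = v then 1 else 0)" for v x
 let ?S = "fn.span (G ` (W - {w0}))"
 have combo: "(\<Sum>w\<in>W - {w0}. (%x. a w * G w x)) : ?S" for a
  by(intro fn.span_sum fn.span_scale fn.span_base) auto
 have "G w0 = (\<Sum>w\<in>W - {w0}. (%x. (- c w / c w0) * G w x))"
 proof
  fix x
  have "c w0 * G w0 x + (\<Sum>w\<in>W - {w0}. c w * G w x) = (\<Sum>w\<in>W. c w * G w x)" using W w0 by(simp add: sum.remove)
  also have "... = 0" using zero by(cases "x : W") (simp_all add: G_def)
  finally have "G w0 x = (\<Sum>w\<in>W - {w0}. - c w * G w x) / c w0"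
   using c0 by(simp add: field_simps sum_negf add_eq_0_iff)
  thus "G w0 x = (\<Sum>w\<in>W - {w0}. (%x. (- c w / c w0) * G w x)) x"
   by(simp add: sum_app sum_divide_distrib)
 qed
 hence G0: "G w0 : ?S" using combo[of "%w. - c w / c w0"] by(simp only:)
 have GS: "G w : ?S" if "w : W" for w using G0 that by(cases "w = w0") (auto intro: fn.span_base)
 have "\<delta> v : ?S" if v: "v : W" for v
 proof -
  have "\<delta> v x = (\<Sum>w\<in>W. D v w * G w x)" for x
   using inv[OF v, of x] v by(cases "x : W") (auto simp: \<delta>_def G_def)
  hence "\<delta> v = (\<Sum>w\<in>W. (%x. D v w * G w x))" by(simp add: fun_eq_iff sum_app)
  thus ?thesis using GS by(simp add: fn.span_sum fn.span_scale)
 qed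
 hence sub: "\<delta> ` W <= ?S" by blast
 have inj: "inj_on \<delta> W" by(rule inj_onI) (metis \<delta>_def zero_neq_one)
 have "fn.independent (\<delta> ` W)"
 proof (rule fn.independent_if_scalars_zero)
  fix f y assume s: "(\<Sum>x\<in>\<delta> ` W. (%z. f x * x z)) = 0" and "y : \<delta> ` W"
  then obtain v where v: "v : W" "y = \<delta> v" by blast
  have "(\<Sum>w\<in>W. f (\<delta> w) * \<delta> w v) = 0"
   using fun_cong[OF s, of v] by(simp add: sum.reindex[OF inj] sum_app)
  thus "f y = 0" using W v by(simp add: \<delta>_def if_distrib[of "%t. _ * t"] cong: if_cong)
 qed (use W in simp)
 hence "card (\<delta> ` W) <= card (G ` (W - {w0}))" using fn.independent_span_bound[OF _ _ sub] W by simp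
 also have "... <= card (W - {w0})" using W by(intro card_image_le) simp
 also have "... < card W" using W w0 by(intro psubset_card_mono) auto
 finally show False using card_image[OF inj] by simp
qed

context reduction_data begin

lemma decompose:
 obtains a b d e where "v = a + b + d + e" "a : nm" "b : h" "d : \<pp>" "e : np"
proof -
 have "v : {w + w' | w w'. w : k & w' : \<pp>}" using p_complement by(simp add: complementary_def)
 then obtain x d where "x : k" "d : \<pp>" "v = x + d" by blast
 moreover from this obtain a b e where "a : nm" "b : h" "e : np" "x = a + b + e" by(elim triangular_decompose)
 ultimately show thesis using that[of a b d e] by(simp add: add_ac)
qed

lemma decompose_eqv:
 assumes "v = a + b + d + e" shows "\<iota> v =~ \<iota> a + \<iota> b + \<iota> d + \<iota> e"
proof -
 have "\<iota> v =~ \<iota> (a + b + d) + \<iota> e" unfolding assms by(rule A.gen_add) simp_all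
 also have "... =~ \<iota> (a + b) + \<iota> d + \<iota> e" by(intro A.eqv_add A.gen_add A.eqv_refl) simp_all
 also have "... =~ \<iota> a + \<iota> b + \<iota> d + \<iota> e" by(intro A.eqv_add A.gen_add A.eqv_refl) simp_all
 finally show ?thesis .
qed

text \<open>The words on the right of an ordering relation; \<open>c\<close> is instantiated by J <
  L or J <= L, a bound on the second letter of a quadratic word.\<close>

definition ordered_words :: "('i => bool) => 'i list set" where
 "ordered_words c = {[K, L] | K L. K : N & L : N & K <= L & c L} \<union> (%L. [L]) ` N \<union> {[]}"

lemma ordered_words_finite: "finite (ordered_words c)"
proof -
 have "ordered_words c <= (%(K, L). [K, L]) ` (N \<times> N) \<union> (%L. [L]) ` N \<union> {[]}" by(auto simp: ordered_words_def)
 thus ?thesis using N_finite by(elim finite_subset) simp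
qed

lemma dw_single: "dw [K] =~D \<iota> (p K)"
 using dia_scalar(2)[OF one_CU] by(simp add: dw_simps)

lemma linear_in_span: "\<iota> v : rspan DI (dw ` ordered_words c)"
proof -
 obtain a b d e where v: "v = a + b + d + e" "a : nm" "b : h" "d : \<pp>" "e : np" by(rule decompose)
 have "\<iota> a : DI" "\<iota> e : DI"
  using nil_power_base[of "[a]" True 1] nil_power_base[of "[e]" False 1] v DI_nil_power
  by(auto simp: nil_part_def mul_def One_nat_def)
 hence "\<iota> a + \<iota> b + \<iota> d + \<iota> e =~D 0 + \<iota> b + \<iota> d + 0"
  by(intro deqv_add deqv_refl) (simp_all add: deqv_def)
 from deqv_trans[OF deqv_eqv[OF decompose_eqv[OF v(1)]] this] have *: "\<iota> v =~D \<iota> b + \<iota> d" by simp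
 have "\<iota> b : CU" using v(3) by(auto simp: gU_cases)
 hence "dw [] * \<iota> b : rspan DI (dw ` ordered_words c)"
  by(intro rspan_base DI_submodule) (auto simp: ordered_words_def)
 hence b: "\<iota> b : rspan DI (dw ` ordered_words c)" by(simp add: dw_simps)
 obtain z where z: "\<iota> d =~ (\<Sum>K\<in>N. fconst (z K) * \<iota> (p K))" using p_expand[OF v(4)] by blast
 have "fconst (z K) * \<iota> (p K) : rspan DI (dw ` ordered_words c)" if "K : N" for K
 proof -
  have "dw [K] * fconst (z K) : rspan DI (dw ` ordered_words c)"
   using that by(intro rspan_base DI_submodule) (auto simp: ordered_words_def)
  moreover have "\<iota> (p K) * fconst (z K) =~D dw [K] * fconst (z K)"
   by(intro deqv_scalar deqv_sym[OF dw_single]) simp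
  ultimately have "\<iota> (p K) * fconst (z K) : rspan DI (dw ` ordered_words c)" by(rule rspan_deqv[rotated])
  thus ?thesis unfolding fconst_central[of "z K"] .
 qed
 hence "\<iota> d : rspan DI (dw ` ordered_words c)"
  by(intro rspan_eqv[OF DI_submodule z] rspan_sum DI_submodule)
 thus ?thesis using rspan_deqv[OF *] rspan_add[OF DI_submodule b] by blast
qed

text \<open>The three claims support each other. The induction hypothesis, for second letters above
  J, settles the corrections to p_I <> p_J (third claim) and the reversed product if J < I (second
  claim); these give the first.\<close>

lemma quadratic_in_span:
 assumes "J : N"
 shows "ALL I:N. pw [I, J] : rspan DI (dw ` ordered_words (%L. J <= L)) &
  (J < I --> pw [I, J] : rspan DI (dw ` ordered_words (%L. J < L))) &
  \<iota> (p I) <> pw [J] - pw [I, J] : rspan DI (dw ` ordered_words (%L. J < L))"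
 using assms
proof (induction "card {L:N. J < L}" arbitrary: J rule: less_induct)
 case less
 let ?R = "rspan DI (dw ` ordered_words (%L. J < L))"
 let ?S = "rspan DI (dw ` ordered_words (%L. J <= L))"
 have mono: "rspan DI (dw ` ordered_words c) <= rspan DI (dw ` ordered_words c')" if "!!L. c L ==> c' L" for c c'
 proof -
  have "dw ` ordered_words c <= dw ` ordered_words c'" using that by(auto simp: ordered_words_def)
  hence *: "g : rspan DI (dw ` ordered_words c')" if "g : dw ` ordered_words c" for g
   using that by(intro rspan_gen[OF DI_submodule]) auto
  show ?thesis
  proof
   fix x assume "x : rspan DI (dw ` ordered_words c)"
   thus "x : rspan DI (dw ` ordered_words c')" by(rule rspan_mono[OF DI_submodule _ *])
  qed
 qed
 have IH: "pw [I, J'] : ?R" if J': "J' : N" "J < J'" "I : N" for I J'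
 proof -
  have "{L:N. J' < L} \<subset> {L:N. J < L}" using J' by auto
  hence "card {L:N. J' < L} < card {L:N. J < L}" using N_finite by(intro psubset_card_mono) auto
  hence "pw [I, J'] : rspan DI (dw ` ordered_words (%L. J' <= L))" using less.hyps J' by blast
  moreover have "rspan DI (dw ` ordered_words (%L. J' <= L)) <= ?R" using J'(2) by(intro mono) simp
  ultimately show ?thesis by blast
 qed
 show ?case
 proof
  fix I assume I: "I : N"
  have J: "set [J] <= N" using less.prems by simp
  have "pw v : ?R" if v: "v : shifted \<kappa> I [J]" "\<kappa> : Q - {0}" for v \<kappa>
  proof -
   obtain K' w' where *: "v = K' # w'" "K' : N" "set w' <= N" "EX J'. w' = [J'] & J < J'"
    using shifted_order[OF v(1) I J v(2)] by metis
   then obtain J' where "w' = [J']" "J < J'" by blast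
   thus ?thesis using IH[of J' K'] * by simp
  qed
  hence A: "\<iota> (p I) <> pw [J] - pw [I, J] : ?R"
   by(intro rspan_mono[OF DI_submodule dia_leading[OF I J]]) auto
  \<comment> \<open>p_I p_J = p_J p_I + [p_I, p_J], and p_J p_I has the larger second letter
    I.\<close>
  have big: "pw [I, J] : ?R" if "J < I"
  proof -
   have "pw [I, J] =~ pw [J, I] + \<iota> (lie (p I) (p J))" using A.gen_lie[of "p I" "p J"] by simp
   moreover have "pw [J, I] + \<iota> (lie (p I) (p J)) : ?R"
    by(intro rspan_add DI_submodule linear_in_span IH I that less.prems)
   ultimately show ?thesis by(rule rspan_eqv[OF DI_submodule])
  qed
  have RS: "?R <= ?S" by(rule mono) simp
  have "pw [I, J] : ?S"
  proof (cases "J < I")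
   case True
   thus ?thesis using big RS by blast
  next
   case False
   have "\<iota> (p I) <> pw [J] =~D dw [I, J]"
    using dia_deqv[OF deqv_refl deqv_sym[OF dw_single]] by(simp add: dw_simps)
   moreover have "dw [I, J] : ?S" using False I less.prems
    by(intro rspan_gen DI_submodule) (auto simp: ordered_words_def)
   ultimately have "\<iota> (p I) <> pw [J] : ?S" by(rule rspan_deqv)
   moreover have "\<iota> (p I) <> pw [J] - pw [I, J] : ?S" using A RS by blast
   ultimately have "\<iota> (p I) <> pw [J] + - (\<iota> (p I) <> pw [J] - pw [I, J]) : ?S"
    by(intro rspan_add rspan_minus DI_submodule)
   thus ?thesis by simp
  qed
  thus "pw [I, J] : ?S & (J < I --> pw [I, J] : ?R) & \<iota> (p I) <> pw [J] - pw [I, J] : ?R"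
   using big A by blast
 qed
qed

lemma dw_scalar:
 assumes "set w <= N" "u : CU" shows "EX u':CU. dw w * u =~D u' * dw w"
 using assms
proof (induction w arbitrary: u)
 case (Cons K w)
 then obtain v where v: "v : CU" "dw w * u =~D v * dw w" by auto
 obtain z where z: "z : CU" "\<iota> (p K) * v =~ z * \<iota> (p K)"
  using scalar_past(2)[OF v(1) p_weight \<mu>_dual] Cons.prems by auto
 have "dw (K # w) * u =~D \<iota> (p K) <> (dw w * u)" unfolding dw_simps
  by(rule deqv_sym[OF dia_scalar_assoc(1)]) (rule Cons.prems)
 also have "... =~D \<iota> (p K) <> (v <> dw w)"
  by(intro dia_deqv deqv_refl deqv_trans[OF v(2)] deqv_sym[OF dia_scalar(1)] v)
 also have "... =~D (\<iota> (p K) <> v) <> dw w" by(rule deqv_sym[OF dia_assoc])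
 also have "... =~D (z * \<iota> (p K)) <> dw w"
  by(intro dia_deqv deqv_refl deqv_trans[OF dia_scalar(2)[OF v(1)]] deqv_eqv z)
 also have "... =~D z * dw (K # w)" unfolding dw_simps by(rule dia_scalar_assoc(2)[OF z(1)])
 finally show ?case using z(1) by blast
qed (auto simp: dw_simps intro: deqv_refl)

theorem ordering_relation:
 assumes "I : N" "J : N" "J < I"
 shows "EX c. (ALL w. c w : CU) & dw [I, J] =~D (\<Sum>w\<in>ordered_words (%L. J < L). c w * dw w)"
proof -
 let ?R = "rspan DI (dw ` ordered_words (%L. J < L))"
 have "(\<iota> (p I) <> pw [J] - pw [I, J]) + pw [I, J] : ?R"
  using quadratic_in_span[OF assms(2)] assms by(intro rspan_add DI_submodule) auto
 moreover have "dw [I, J] =~D \<iota> (p I) <> pw [J]"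
  using dia_deqv[OF deqv_refl dw_single] by(simp add: dw_simps)
 ultimately have "dw [I, J] : ?R" using rspan_deqv by simp
 then obtain c where c: "ALL w. c w : CU" "dw [I, J] =~D (\<Sum>w\<in>ordered_words (%L. J < L). dw w * c w)"
  using rspan_coefficients ordered_words_finite by blast
 \<comment> \<open>Spans carry their coefficients on the right, whereas an ordering relation has
   them on the left.\<close>
 have "ALL w:ordered_words (%L. J < L). EX u':CU. dw w * c w =~D u' * dw w"
  using c(1) by(intro ballI dw_scalar) (auto simp: ordered_words_def)
 then obtain c' where c': "ALL w:ordered_words (%L. J < L). c' w : CU & dw w * c w =~D c' w * dw w" by metis
 let ?c = "%w. if w : ordered_words (%L. J < L) then c' w else 0"
 have "dw [I, J] =~D (\<Sum>w\<in>ordered_words (%L. J < L). ?c w * dw w)"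
  by(rule deqv_trans[OF c(2) deqv_sum]) (use c' in simp)
 moreover have "ALL w. ?c w : CU" using c' by auto
 ultimately show ?thesis by(intro exI[of _ ?c] conjI)
qed

subsection \<open>Spanning\<close>

text \<open>n_- words times words in the p_K span, over the localized U(h) and modulo A n_+, a set
  stable under left multiplication; as it contains 1, it will be everything. A letter of n_+ crosses
  the word by \<open>raise_span\<close> and disappears at its right end.\<close>

lemma left_generator_span:
 defines "G \<equiv> {\<iota>s fs * pw w | fs w. set fs <= nm \<inter> WV & set w <= N}"
 assumes "x : rspan AN G" shows "a * x : rspan AN G"
proof -
 let ?R = "rspan AN G"
 have ext: "a * x : ?R" if "x : ?R" "!!g. g : G ==> a * g : ?R" for a x
  using that(1)
 proof (induction x rule: rspan_induct)
  case (base g u)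
  thus ?case using rspan_scalar_r[OF AN_submodule that(2)] by(simp flip: mult.assoc)
 next
  case (mod x y)
  hence "a * x - a * y : AN" using nil_power_mul_r[of "x - y" False 1 a] by(simp add: mul_def right_diff_distrib)
  thus ?case using mod(2) by(rule rspan_mod[OF AN_submodule])
 qed (auto simp: distrib_left intro: rspan_add rspan_zero AN_submodule)
 have scalar: "u * x : ?R" if "u : CU" "x : ?R" for u x
 proof (rule ext[OF that(2)])
  fix g assume "g : G"
  then obtain fs w where g: "g = \<iota>s fs * pw w" "set fs <= WV" "set w <= N" "g : G"
   unfolding G_def by blast
  have "set (fs @ map p w) <= WV" using g(2) pw_WV[OF g(3)] by simp
  from word_scalar[OF this that(1)] obtain u' where "u' : CU" "u * g =~ g * u'"
   by(auto simp: g(1) pw_def)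
  thus "u * g : ?R" using rspan_eqv[OF AN_submodule _ rspan_base[OF AN_submodule g(4)]] by blast
 qed
 have nm: "\<iota> f * x : ?R" if "f : nm" "x : ?R" for f x
 proof -
  obtain X wt where X: "X <= nil_part True" "clin.span X = nil_part True"
   "ALL x:X. wt x : dual_space h" "ALL x:X. weight_vector h (wt x) x" by(rule nil_part_weight_basis)
  have "f : clin.span X" using that(1) X(2) by(simp add: nil_part_def)
  then obtain c B where B: "B <= X" "\<iota> f =~ (\<Sum>y\<in>B. fconst (c y) * \<iota> y)" using A.gen_span[of f X] by blast
  have "fconst (c y) * \<iota> y * x : ?R" if y: "y : B" for y
  proof -
   have "y : X" using y B(1) by blast
   hence yX: "y : nm \<inter> WV" using X(1,3,4) by(auto simp: nil_part_def WV_def)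
   have "\<iota> y * x : ?R"
   proof (rule ext[OF \<open>x : ?R\<close>])
    fix g assume "g : G"
    then obtain fs w where "g = \<iota>s fs * pw w" "set fs <= nm \<inter> WV" "set w <= N" by(auto simp: G_def)
    hence "\<iota> y * g = \<iota>s (y # fs) * pw w" "set (y # fs) <= nm \<inter> WV" "set w <= N"
     using yX by(simp_all add: mult.assoc)
    hence "\<iota> y * g : G" unfolding G_def by blast
    thus "\<iota> y * g : ?R" by(rule rspan_gen[OF AN_submodule])
   qed
   thus ?thesis using scalar[of "fconst (c y)"] by(simp add: mult.assoc)
  qed
  hence "(\<Sum>y\<in>B. fconst (c y) * \<iota> y) * x : ?R"
   unfolding sum_distrib_right by(rule rspan_sum[OF AN_submodule])
  thus ?thesis by(rule rspan_eqv[OF AN_submodule A.eqv_mult_r[OF B(2)]])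
 qed
 have pg: "pw w : ?R" if "set w <= N" for w
  using that by(intro rspan_gen AN_submodule) (auto simp: G_def intro!: exI[of _ "[]"] exI[of _ w])
 have vec: "\<iota> v * (\<iota>s fs * pw w) : ?R" if "set fs <= nm" "set w <= N" for v fs w
  using that
 proof (induction fs arbitrary: v)
  case Nil
  obtain a b d e where v: "v = a + b + d + e" "a : nm" "b : h" "d : \<pp>" "e : np" by(rule decompose)
  have w: "pw w : ?R" using pg[OF Nil.prems(2)] .
  have "\<iota> b : CU" using v(3) by(auto simp: gU_cases)
  hence b: "\<iota> b * pw w : ?R" using w by(rule scalar)
  obtain z where z: "\<iota> d =~ (\<Sum>K\<in>N. fconst (z K) * \<iota> (p K))" using p_expand[OF v(4)] by blast
  have "fconst (z K) * \<iota> (p K) * pw w : ?R" if "K : N" for K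
  proof -
   have "\<iota> (p K) * pw w : ?R" using pg[of "K # w"] that Nil.prems(2) by simp
   thus ?thesis using scalar[of "fconst (z K)"] by(simp add: mult.assoc)
  qed
  hence "(\<Sum>K\<in>N. fconst (z K) * \<iota> (p K)) * pw w : ?R"
   unfolding sum_distrib_right by(rule rspan_sum[OF AN_submodule])
  hence d: "\<iota> d * pw w : ?R" by(rule rspan_eqv[OF AN_submodule A.eqv_mult_r[OF z]])
  have e: "\<iota> e * pw w : ?R"
  proof -
   obtain X wt where X: "X <= nil_part False" "clin.span X = nil_part False"
    "ALL x:X. wt x : dual_space h" "ALL x:X. weight_vector h (wt x) x" by(rule nil_part_weight_basis)
   have "e : clin.span X" using v(5) X(2) by(simp add: nil_part_def)
   then obtain c B where B: "B <= X" "\<iota> e =~ (\<Sum>y\<in>B. fconst (c y) * \<iota> y)" using A.gen_span[of e X] by blast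
   have "fconst (c y) * \<iota> y * pw w : ?R" if y: "y : B" for y
   proof -
    have yX: "y : np" "weight_vector h (wt y) y" "wt y : dual_space h"
     using y B(1) X by(auto simp: nil_part_def)
    have "pw w : rspan AN (pw ` wset (length w) (wsum w))"
     using Nil.prems(2) by(intro rspan_gen AN_submodule) (auto simp: wset_def)
    hence "\<iota> y * pw w : rspan AN (pw ` wset (length w) (wt y + wsum w))" by(rule raise_span[OF _ yX])
    hence "\<iota> y * pw w : ?R"
    proof (rule rspan_mono[OF AN_submodule])
     fix g assume "g : pw ` wset (length w) (wt y + wsum w)"
     thus "g : ?R" using pg by(auto simp: wset_def)
    qed
    thus ?thesis using scalar[of "fconst (c y)"] by(simp add: mult.assoc)
   qed
   hence "(\<Sum>y\<in>B. fconst (c y) * \<iota> y) * pw w : ?R"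
    unfolding sum_distrib_right by(rule rspan_sum[OF AN_submodule])
   thus ?thesis by(rule rspan_eqv[OF AN_submodule A.eqv_mult_r[OF B(2)]])
  qed
  have "\<iota> a * pw w + \<iota> b * pw w + \<iota> d * pw w + \<iota> e * pw w : ?R"
   by(intro rspan_add AN_submodule nm[OF v(2) w] b d e)
  hence "(\<iota> a + \<iota> b + \<iota> d + \<iota> e) * pw w : ?R" by(simp add: distrib_right)
  hence "\<iota> v * pw w : ?R" by(rule rspan_eqv[OF AN_submodule A.eqv_mult_r[OF decompose_eqv[OF v(1)]]])
  thus ?case by simp
 next
  case (Cons f fs)
  let ?r = "\<iota>s fs * pw w"
  have "\<iota> v * (\<iota>s (f # fs) * pw w) = \<iota> v * \<iota> f * ?r" by(simp add: mult.assoc)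
  also have "... =~ (\<iota> f * \<iota> v + \<iota> (lie v f)) * ?r" by(intro A.eqv_mult_r A.gen_lie) simp_all
  also have "... = \<iota> f * (\<iota> v * ?r) + \<iota> (lie v f) * ?r" by(simp add: distrib_right mult.assoc)
  finally have *: "\<iota> v * (\<iota>s (f # fs) * pw w) =~ \<iota> f * (\<iota> v * ?r) + \<iota> (lie v f) * ?r" .
  have f: "f : nm" and IH: "\<iota> v' * ?r : ?R" for v' using Cons by auto
  show ?case by(rule rspan_eqv[OF AN_submodule *]) (intro rspan_add AN_submodule nm[OF f] IH)
 qed
 have gen: "fgen g * x : ?R" if "x : ?R" for g x
 proof (cases "g : gA")
  case False
  hence "fgen g * x =~ 0 * x" using A.pker_outside by(intro A.eqv_mult_r) (simp add: A.eqv_zero)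
  thus ?thesis by(rule rspan_eqv[OF AN_submodule]) (simp add: rspan_zero[OF AN_submodule])
 next
  case True
  then consider v where "g = Inl v" | "fgen g : CU" by(auto simp: loc_gens_def)
  thus ?thesis
  proof cases
   case (1 v)
   thus ?thesis using vec by(intro ext[OF that]) (auto simp: G_def)
  next
   case 2
   thus ?thesis using scalar that by blast
  qed
 qed
 show ?thesis
 proof (induction a rule: falg_induct)
  case (monomial c w)
  have "fword w * x : ?R" using gen assms(2) by(induction w) (simp_all add: mult.assoc)
  thus ?case using scalar[of "fconst c"] by(simp add: mult.assoc)
 qed (simp add: distrib_right rspan_add[OF AN_submodule])
qed

theorem dw_spanning: "a : rspan DI (dw ` {w. set w <= N})"
proof -
 let ?G = "{\<iota>s fs * pw w | fs w. set fs <= nm \<inter> WV & set w <= N}"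
 have "1 : ?G" by(intro CollectI exI[of _ "[]"]) simp
 hence "a * 1 : rspan AN ?G" by(intro left_generator_span rspan_gen[OF AN_submodule])
 hence "a : rspan DI ?G" using rspan_AN_DI by simp
 thus ?thesis
 proof (rule rspan_mono[OF DI_submodule])
  fix g assume "g : ?G"
  then obtain fs w where g: "g = \<iota>s fs * pw w" "set fs <= nm \<inter> WV" "set w <= N" by blast
  show "g : rspan DI (dw ` {w. set w <= N})"
  proof (cases fs)
   case Nil
   have "pw w : rspan DI (dw ` {w. set w <= N})"
    by(rule rspan_mono[OF DI_submodule pw_in_dw_span[OF g(3)]]) (auto intro!: rspan_gen[OF DI_submodule])
   thus ?thesis by(simp add: g(1) Nil)
  next
   case (Cons f fs')
   have "g : nil_power True 1"
    using nil_power_base[of "[f]" True "\<iota>s fs' * pw w"] g Cons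
    by(simp add: nil_part_def mul_def One_nat_def mult.assoc)
   hence "g =~D 0" by(rule deqv_nil_power)
   thus ?thesis by(rule rspan_deqv) (rule rspan_zero[OF DI_submodule])
  qed
 qed
qed

end

declare plus_fun_apply [simp] One_nat_def [simp]

declare plus_fun_apply [simp del] One_nat_def [simp del]

section \<open>Independence of the sorted monomials\<close>

context reduction_data begin

lemma adapted_basis:
 obtains Xm Xp H rk where "clin.span Xm = nm" "clin.span Xp = np" "clin.span H = h" "Xm <= WV" "Xp <= WV"
  "clin.independent (Xm \<union> p ` N \<union> Xp \<union> H)" "(Xm \<union> p ` N \<union> Xp) \<inter> H = {}" "Xm \<inter> p ` N = {}" "Xp \<inter> p ` N = {}"
  "inj_on rk (Xm \<union> p ` N \<union> Xp)" "!!x y. x : Xm ==> y : Xm \<union> p ` N \<union> Xp ==> rk y < rk x ==> y : Xm"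
  "!!x y. x : Xp ==> y : Xm \<union> p ` N \<union> Xp ==> rk x < rk y ==> y : Xp"
  "!!K L. K : N ==> L : N ==> K <= L ==> rk (p K) <= (rk (p L) :: nat)"
proof -
 obtain Xm wm where Xm: "finite Xm" "clin.independent Xm" "Xm <= nil_part True" "clin.span Xm = nil_part True"
  "ALL x:Xm. wm x : dual_space h" "ALL x:Xm. weight_vector h (wm x) x" by(rule nil_part_weight_basis)
 obtain Xp wp where Xp: "finite Xp" "clin.independent Xp" "Xp <= nil_part False" "clin.span Xp = nil_part False"
  "ALL x:Xp. wp x : dual_space h" "ALL x:Xp. weight_vector h (wp x) x" by(rule nil_part_weight_basis)
 obtain H where H: "H <= h" "clin.independent H" "h <= clin.span H" by(rule clin.maximal_independent_subset)
 have sp: "clin.span Xm = nm" "clin.span Xp = np" "clin.span H = h"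
  using Xm(4) Xp(4) clin.span_subspace[OF H(1,3) h_subspace] by(simp_all add: nil_part_def)
 have i1: "clin.independent (Xm \<union> H)" "Xm \<inter> H = {}"
  using independent_Un[OF Xm(2) H(2)] h_nm_disjoint unfolding sp by blast+
 have s1: "EX a:nm. EX b:h. x = a + b" if "x : clin.span (Xm \<union> H)" for x
  using that unfolding clin.span_Un sp by blast
 have z2: "x = 0" if x: "x : clin.span (Xm \<union> H)" "x : clin.span Xp" for x
 proof -
  obtain a b where "a : nm" "b : h" "x = a + b" using s1[OF x(1)] by blast
  moreover have "0 : nm" "0 : h" "0 : np" using clin.subspace_0 nm_subspace h_subspace np_subspace by blast+
  ultimately show ?thesis using triangular_unique[of a b 0 0 0 x] x(2) sp(2) by auto
 qed
 have i2: "clin.independent (Xm \<union> H \<union> Xp)" "(Xm \<union> H) \<inter> Xp = {}"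
  using independent_Un[OF i1(1) Xp(2) z2] by blast+
 have sub: "Xm \<union> H \<union> Xp <= k"
  using Xm(3) Xp(3) H(1) nm_subset_k np_subset_k h_subset_k by(auto simp: nil_part_def)
 have z3: "x = 0" if "x : clin.span (Xm \<union> H \<union> Xp)" "x : clin.span (p ` N)" for x
 proof -
  have "x : k" using clin.span_minimal[OF sub k_subspace] that(1) by blast
  hence "x : k \<inter> \<pp>" using that(2) p_span by simp
  thus ?thesis using p_complement unfolding complementary_def by blast
 qed
 have i3: "clin.independent (Xm \<union> H \<union> Xp \<union> p ` N)" "(Xm \<union> H \<union> Xp) \<inter> p ` N = {}"
  using independent_Un[OF i2(1) p_independent z3] by blast+
 obtain fm m where fm: "fm ` Xm = {i. i < (m :: nat)}" "inj_on fm Xm" using finite_imp_inj_to_nat_seg[OF Xm(1)] by blast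
 obtain fp m' where fp: "fp ` Xp = {i. i < (m' :: nat)}" "inj_on fp Xp" using finite_imp_inj_to_nat_seg[OF Xp(1)] by blast
 define pos where "pos K = card {L:N. L < K}" for K
 have pos: "pos K < card N" if "K : N" for K
  unfolding pos_def using that N_finite by(intro psubset_card_mono) auto
 have pos_less: "pos K < pos L" if "K : N" "K < L" for K L
  unfolding pos_def using that N_finite by(intro psubset_card_mono) auto
 \<comment> \<open>Three consecutive blocks: \<open>Xm\<close>, then the p_K in their given order,
   then \<open>Xp\<close>.\<close>
 define rk where "rk x = (if x : Xm then fm x else if x : p ` N then m + pos (inv_into N p x) else m + card N + fp x)" for x
 have rm: "rk x = fm x & rk x < m" if "x : Xm" for x using that fm(1) by(auto simp: rk_def)
 have rp: "rk (p K) = m + pos K & m <= rk (p K) & rk (p K) < m + card N" if "K : N" for K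
 proof -
  have "p K \<notin> Xm" using i3(2) that by blast
  thus ?thesis using that pos[OF that] inv_into_f_f[OF p_inj that] by(simp add: rk_def)
 qed
 have rx: "rk x = m + card N + fp x" if "x : Xp" for x
  using that i2(2) i3(2) by(auto simp: rk_def)
 show thesis
 proof (rule that[OF sp])
  show "Xm <= WV" "Xp <= WV" using Xm(5,6) Xp(5,6) by(auto simp: WV_def)
  show "clin.independent (Xm \<union> p ` N \<union> Xp \<union> H)" using i3(1) by(simp add: Un_ac)
  show "(Xm \<union> p ` N \<union> Xp) \<inter> H = {}" "Xm \<inter> p ` N = {}" "Xp \<inter> p ` N = {}" using i1 i2 i3 by blast+
  show "inj_on rk (Xm \<union> p ` N \<union> Xp)"
  proof (rule inj_onI)
   fix x y assume xy: "x : Xm \<union> p ` N \<union> Xp" "y : Xm \<union> p ` N \<union> Xp" "rk x = rk y"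
   consider "x : Xm" "y : Xm" | "x : Xp" "y : Xp" | K L where "K : N" "L : N" "x = p K" "y = p L"
    using xy rm[of x] rm[of y] rp rx[of x] rx[of y] by fastforce
   thus "x = y"
   proof cases
    case 1
    thus ?thesis using xy(3) rm fm(2) by(simp add: inj_on_eq_iff)
   next
    case 2
    thus ?thesis using xy(3) rx fp(2) by(simp add: inj_on_eq_iff)
   next
    case (3 K L)
    hence "pos K = pos L" using xy(3) rp by simp
    hence "K = L" using pos_less 3 by(metis linorder_neqE nat_less_le)
    thus ?thesis using 3 by simp
   qed
  qed
  show "y : Xm" if "x : Xm" "y : Xm \<union> p ` N \<union> Xp" "rk y < rk x" for x y
   using that rm[of x] rp rx[of y] by fastforce
  show "y : Xp" if "x : Xp" "y : Xm \<union> p ` N \<union> Xp" "rk x < rk y" for x y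
   using that rm[of y] rp rx[of x] by fastforce
  show "rk (p K) <= rk (p L)" if "K : N" "L : N" "K <= L" for K L
   using rp[OF that(1)] rp[OF that(2)] pos_less[OF that(1), of L] that(3) by(cases "K < L") auto
 qed
qed

text \<open>At a generic \<theta> let F be the matrix of coordinates of the monomials
  \<open>dw\<close>. The coefficients that express the ordinary sorted products through the
  \<open>dw\<close>, by \<open>reorder\<close>, form a left inverse of F. So the evaluated
  coefficients \<open>c w\<close> vanish, and \<open>U_separation\<close> removes the
  evaluation.\<close>

theorem dw_independent:
 assumes W: "W = {w. set w <= N & sorted w & length w <= n}"
  and reorder: "!!w. w : W ==> pw w : rspan DI (dw ` W)"
  and c: "!!w. c w : CU" and zero: "(\<Sum>w\<in>W. dw w * c w) : DI" and w: "w : W"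
 shows "c w : IU"
proof (rule U_separation[OF c])
 fix \<theta> assume \<theta>: "generic \<theta>"
 have fin: "finite W"
  by(rule finite_subset[OF _ finite_lists_length_le[OF N_finite, of n]]) (auto simp: W)
 obtain Xm Xp H rk where X: "clin.span Xm = nm" "clin.span Xp = np" "clin.span H = h" "Xm <= WV" "Xp <= WV"
  and ind: "clin.independent (Xm \<union> p ` N \<union> Xp \<union> H)" "(Xm \<union> p ` N \<union> Xp) \<inter> H = {}"
   "Xm \<inter> p ` N = {}" "Xp \<inter> p ` N = {}"
  and rk: "inj_on rk (Xm \<union> p ` N \<union> Xp)"
   "!!x y. x : Xm ==> y : Xm \<union> p ` N \<union> Xp ==> rk y < rk x ==> y : Xm"
   "!!x y. x : Xp ==> y : Xm \<union> p ` N \<union> Xp ==> rk x < rk y ==> y : Xp"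
  and mono: "!!K L. K : N ==> L : N ==> K <= L ==> rk (p K) <= (rk (p L) :: nat)"
  by(rule adapted_basis) blast
 let ?X = "Xm \<union> p ` N \<union> Xp"
 define wt where "wt x = (SOME \<nu>. \<nu> : dual_space h & weight_vector h \<nu> x)" for x
 have wt: "wt x : dual_space h & weight_vector h (wt x) x" if "x : ?X" for x
 proof -
  have "p K : WV" if "K : N" for K using p_weight[OF that] \<mu>_dual[OF that] by(auto simp: WV_def)
  hence "x : WV" using that X(4,5) by blast
  hence "EX \<nu>. \<nu> : dual_space h & weight_vector h \<nu> x" by(auto simp: WV_def)
  from someI_ex[OF this] show ?thesis by(simp add: wt_def)
 qed
 have gen: "clin.span (?X \<union> H) = UNIV"
 proof -
  have "v : clin.span (?X \<union> H)" for v
  proof -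
   obtain a b d e where v: "v = a + b + d + e" "a : nm" "b : h" "d : \<pp>" "e : np" by(rule decompose)
   have m: "clin.span S <= clin.span (?X \<union> H)" if "S <= ?X \<union> H" for S using that by(rule clin.span_mono)
   have "a : clin.span (?X \<union> H)" using m[of Xm] v(2) X(1) by blast
   moreover have "b : clin.span (?X \<union> H)" using m[of H] v(3) X(3) by blast
   moreover have "d : clin.span (?X \<union> H)" using m[of "p ` N"] v(4) p_span by blast
   moreover have "e : clin.span (?X \<union> H)" using m[of Xp] v(5) X(2) by blast
   ultimately show ?thesis unfolding v(1) by(intro clin.span_add)
  qed
  thus ?thesis by blast
 qed
 have \<theta>d: "\<theta> : dual_space h" using \<theta> by(simp add: generic_def)
 interpret B: pbw_basis h ?X H rk wt \<theta>
  by unfold_locales (use ind gen X rk(1) h_abelian wt \<theta>d in auto)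
 have nz: "x ~= 0" if "x : ?X" for x using ind(1) that clin.dependent_zero[of "?X \<union> H"] by auto
 \<comment> \<open>Integral values on coroots merely change the integer in \<theta> (h_alpha) + l,
   so genericity passes to all weights of the module.\<close>
 have int: "EX i::int. B.wtw s (coroot k h \<alpha>) = of_int i" if \<alpha>: "\<alpha> : roots k h" and "set s <= ?X" for \<alpha> s
  using that(2)
 proof (induction s)
  case Nil
  thus ?case by(intro exI[of _ 0]) simp
 next
  case (Cons x s)
  then obtain i :: int where i: "B.wtw s (coroot k h \<alpha>) = of_int i" by auto
  have x: "x : ?X" using Cons.prems by simp
  obtain j :: int where "wt x (coroot k h \<alpha>) = of_int j"
   using integral_shift[OF \<alpha> conjunct2[OF wt[OF x]] nz[OF x]] by(auto elim: Ints_cases)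
  thus ?case using i by(intro exI[of _ "j + i"]) (simp add: plus_fun_apply)
 qed
 interpret M: pbw_module h ?X H rk wt \<theta> Xm "p ` N" Xp DD
 proof unfold_locales
  show "lie x y : clin.span Xm" if "x : Xm" "y : Xm" for x y
   using nm_lie that clin.span_base X(1) by metis
  show "lie x y : clin.span Xp" if "x : Xp" "y : Xp" for x y
   using np_lie that clin.span_base X(2) by metis
  show "EX t:h. EX l. d = fgen t + fconst l" if "d : DD" for d using that coroot_mem by(auto simp: DD_iff)
  show "cs.fhom (\<theta> + B.wtw s) d ~= 0" if ds: "d : DD" "set s <= ?X" for d s
  proof -
   obtain \<alpha> l where d: "\<alpha> : roots k h" "d = fgen (coroot k h \<alpha>) + fconst (of_int l)" using ds(1) by(auto simp: DD_iff)
   obtain i :: int where i: "B.wtw s (coroot k h \<alpha>) = of_int i" using int[OF d(1) ds(2)] by blast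
   have "\<theta> (coroot k h \<alpha>) + of_int (i + l) ~= 0" using \<theta> d(1) unfolding generic_def by blast
   thus ?thesis by(simp add: d(2) cs.fhom_simps plus_fun_apply i add.assoc)
  qed
 qed (rule refl ind rk; assumption?)+
 have coord0: "M.coord 0 v = 0" for v using M.coord_add[of 0 0 v] by simp
 have coord_diff: "M.coord x v = M.coord (x - y) v + M.coord y v" for x y v using M.coord_add[of "x - y" y v] by simp
 have coord_sum: "M.coord (sum f S) v = (\<Sum>i\<in>S. M.coord (f i) v)" for f :: "'i list => _" and S v
  by(induction S rule: infinite_finite_induct) (simp_all add: coord0 M.coord_add)
 have coord_DI: "M.coord x (map p v) = 0" if x: "x : DI" and v: "set v <= N" for x v
  using x
 proof (induction x rule: DI_induct)
  case (base s x)
  thus ?case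
  proof (induction x rule: nil_power_induct)
   case (base fs a)
   then obtain f where f: "fs = [f]" "f : nil_part s" by(cases fs) (auto simp: One_nat_def)
   have "set (map p v) <= p ` N" using v by auto
   thus ?case using M.coord_left_ideal[of f] M.coord_right_ideal[of f] f X(1,2)
    by(cases s) (simp_all add: mul_def nil_part_def)
  next
   case (eqv x y)
   thus ?case using coord_diff[of x _ y] M.coord_pker[of "x - y"] by(simp add: A.eqv_def)
  qed (simp_all add: coord0 M.coord_add)
 qed (simp add: M.coord_add)
 have scalar: "M.coord (x * u) v = ev \<theta> u * M.coord x v" if "u : CU" for x u v
  using M.coord_scalar[of u x v] that by(simp add: loc_gens_def M.evl_def ev_def)
 have "EX d. (ALL w. d w : CU) & pw v =~D (\<Sum>w\<in>W. dw w * d w)" if "v : W" for v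
  using reorder[OF that] fin by(rule rspan_coefficients)
 hence "ALL v:W. EX d. (ALL w. d w : CU) & pw v =~D (\<Sum>w\<in>W. dw w * d w)" by blast
 from bchoice[OF this] obtain d where d: "!!v. v : W ==> (ALL w. d v w : CU) & pw v =~D (\<Sum>w\<in>W. dw w * d v w)"
  by auto
 show "ev \<theta> (c w) = 0"
 proof (rule left_inverse_injective[OF fin _ _ w, where F = "%w v. M.coord (dw w) (map p v)"])
  fix v assume v: "v : W"
  have "(\<Sum>w\<in>W. ev \<theta> (c w) * M.coord (dw w) (map p v)) = M.coord (\<Sum>w\<in>W. dw w * c w) (map p v)"
   unfolding coord_sum using scalar[OF c] by simp
  also have "... = 0" using coord_DI[OF zero] v by(simp add: W)
  finally show "(\<Sum>w\<in>W. ev \<theta> (c w) * M.coord (dw w) (map p v)) = 0" .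
 next
  fix v x assume vx: "v : W" "x : W"
  have "set x <= N" "set v <= N" "sorted v" using vx by(simp_all add: W)
  hence "sorted_wrt (%a b. rk a <= rk b) (map p v)" unfolding sorted_wrt_map
   by(intro sorted_wrt_mono_rel[of v "(<=)" "%K L. rk (p K) <= rk (p L)"]) (auto intro!: mono)
  hence "M.coord (pw v) (map p x) = (if map p x = map p v then 1 else 0)"
  proof -
   have "set (map p v) <= ?X" using \<open>set v <= N\<close> by auto
   from M.coord_word[OF \<open>sorted_wrt _ (map p v)\<close> this] show ?thesis by(simp add: pw_def comp_def)
  qed
  also have "map p x = map p v \<longleftrightarrow> x = v"
   using inj_on_map_eq_map[OF inj_on_subset[OF p_inj], of x v] \<open>set x <= N\<close> \<open>set v <= N\<close> by auto
  finally have 1: "M.coord (pw v) (map p x) = (if x = v then 1 else 0)" .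
  have "(\<Sum>w\<in>W. ev \<theta> (d v w) * M.coord (dw w) (map p x)) = M.coord (\<Sum>w\<in>W. dw w * d v w) (map p x)"
   unfolding coord_sum using scalar d[OF vx(1)] by simp
  also have "... = M.coord (pw v) (map p x)"
   using coord_diff[of "pw v" "map p x" "\<Sum>w\<in>W. dw w * d v w"] coord_DI[of "pw v - (\<Sum>w\<in>W. dw w * d v w)" x]
    d[OF vx(1)] \<open>set x <= N\<close> by(simp add: deqv_def)
  finally show "(\<Sum>w\<in>W. ev \<theta> (d v w) * M.coord (dw w) (map p x)) = (if x = v then 1 else 0)" using 1 by simp
 qed
qed

end

declare plus_fun_apply [simp] One_nat_def [simp]

section \<open>The presentation\<close>

lemma descent_exists: "\<not> sorted w ==> EX a I J b. w = a @ I # J # b & J < (I :: 'i::linorder)"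
proof (induction w)
 case (Cons x w)
 show ?case
 proof (cases "sorted w")
  case True
  then obtain y v where w: "w = y # v" using Cons.prems by(cases w) auto
  hence "y < x" using Cons.prems True by auto
  thus ?thesis using w by(intro exI[of _ "[]"]) auto
 next
  case False
  then obtain a I J b where "w = a @ I # J # b" "J < I" using Cons.IH by blast
  thus ?thesis by(intro exI[of _ "x # a"]) auto
 qed
qed simp

text \<open>\<open>cc\<close> gathers B, C and D as functions of the word on the right. The relators
  sum over all K <= L, so the sharper information L > J is carried by
  \<open>cc_zero\<close>.\<close>

locale presentation_data = reduction_data k nm h np P \<pp> N p \<mu>
 for k nm h np :: "'g::fin_dim_complex_lie_algebra set" and P and \<pp> :: "'g set"
  and N :: "'i::linorder set" and p :: "'i => 'g" and \<mu> +
 fixes cc :: "'i => 'i => 'i list => 'g lfalg"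
 assumes cc_mem: "cc I J w : CU"
  and cc_relation: "I : N ==> J : N ==> J < I ==>
   dw [I, J] =~D (\<Sum>w\<in>ordered_words (%L. J < L). cc I J w * dw w)"
  and cc_zero: "w \<notin> ordered_words (%L. J < L) ==> cc I J w = 0"
begin

abbreviation "qU \<equiv> pmap gU rU"
abbreviation "gE \<equiv> Inl ` carrier (Uh_bar k h) \<union> Inr ` N"
abbreviation "rE \<equiv> coeff_rels k h \<union> weight_rels k h N \<mu> \<union>
 ordering_rels N (%I J K L. qU (cc I J [K, L])) (%I J L. qU (cc I J [L])) (%I J. qU (cc I J []))"

definition eU :: "'g lfalg => ('g, 'i) red_falg" where "eU x = fgen (Inl (qU x))"

lemma Uh_eq: "Uh_bar k h = presented gU rU"
 by(simp add: loc_env_def)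

lemma qU_mem: "qU x : carrier (Uh_bar k h)"
 by(simp add: Uh_eq U.pmap_hom)

lemma qU_surj: "u : carrier (Uh_bar k h) ==> EX x:CU. u = qU x"
 unfolding Uh_eq by(rule U.pmap_surj)

lemma loc_class_U: "x : CU ==> loc_class k h h x = qU x"
 by(simp add: loc_class_def pmap_def frestrict_id)

lemma h_CU: "x : h ==> \<iota> x : CU"
 by(auto simp: gU_cases)

lemma gE_mem [simp]: "eU x : FA gE" "K : N ==> fgen (Inr K) : FA gE"
 using qU_mem by(auto simp: eU_def)

lemma ordering_rels_eq:
 "ordering_rels N (%I J K L. qU (cc I J [K, L])) (%I J L. qU (cc I J [L])) (%I J. qU (cc I J []))
  = {fgen (Inr I) * fgen (Inr J)
    - ((\<Sum>(K, L)\<in>{(K, L). K : N & L : N & K <= L}. eU (cc I J [K, L]) * fgen (Inr K) * fgen (Inr L))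
      + (\<Sum>L\<in>N. eU (cc I J [L]) * fgen (Inr L)) + eU (cc I J [])) | I J. I : N & J : N & J < I}"
 by(simp add: ordering_rels_def eU_def)

lemma weight_rels_eq:
 "weight_rels k h N \<mu> = {eU (\<iota> x) * fgen (Inr K) - fgen (Inr K) * eU (\<iota> x) - fconst (\<mu> K x) * fgen (Inr K) |
  x K. x : h & K : N}"
 using loc_class_U[OF h_CU] unfolding weight_rels_def eU_def by(intro Collect_cong ex_cong1) auto

lemma coeff_rels_mem:
 "r : coeff_rels k h \<longleftrightarrow> (EX x:CU. EX y:CU. r = eU (x + y) - eU x - eU y) \<or> (EX x:CU. EX y:CU. r = eU (x * y) - eU x * eU y)
  \<or> (EX c. r = eU (fconst c) - fconst c)"
proof -
 have *: "(EX u v. r = F u v & u : carrier (Uh_bar k h) & v : carrier (Uh_bar k h)) \<longleftrightarrow> (EX x:CU. EX y:CU. r = F (qU x) (qU y))" for F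
  using qU_surj qU_mem by blast
 show ?thesis
  unfolding coeff_rels_def Let_def Un_iff mem_Collect_eq * eU_def
  by(simp add: Uh_eq U.pmap_hom loc_class_U)
qed

sublocale E: presentation gE rE
proof
 have "coeff_rels k h <= FA gE" by(auto simp: coeff_rels_mem)
 moreover have "weight_rels k h N \<mu> <= FA gE"
  unfolding weight_rels_eq by(auto intro!: free_algebra_closed)
 moreover have "fgen (Inr I) * fgen (Inr J)
    - ((\<Sum>(K, L)\<in>{(K, L). K : N & L : N & K <= L}. eU (cc I J [K, L]) * fgen (Inr K) * fgen (Inr L))
      + (\<Sum>L\<in>N. eU (cc I J [L]) * fgen (Inr L)) + eU (cc I J [])) : FA gE"
  if "I : N" "J : N" for I J
  using that by(intro free_algebra_closed free_algebra_sum gE_mem) (auto intro!: free_algebra_closed)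
 ultimately show "rE <= FA gE" unfolding ordering_rels_eq by blast
qed

notation E.eqv (infix \<open>=~E\<close> 50)

lemma E_relator: "x - y : rE ==> x =~E y"
 unfolding E.eqv_def by(rule E.pker_relator)

lemma eU_hom:
 assumes "x : CU" "y : CU"
 shows "eU (x + y) =~E eU x + eU y" "eU (x * y) =~E eU x * eU y"
 using assms by(intro E_relator UnI1; auto simp: coeff_rels_mem diff_diff_add)+

lemma eU_const: "eU (fconst c) =~E fconst c"
 by(intro E_relator UnI1) (auto simp: coeff_rels_mem)

lemma eU_IU: assumes "x : IU" shows "eU x =~E 0"
proof -
 have "qU x = qU (fconst 0)" using assms by(simp add: U.pmap_eq_iff)
 thus ?thesis using eU_const[of 0] by(simp add: eU_def)
qed

definition ew :: "'i list => ('g, 'i) red_falg" where "ew w = fword (map Inr w)"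

lemma ew_simps [simp]: "ew [] = 1" "ew (K # w) = fgen (Inr K) * ew w" "ew (v @ w) = ew v * ew w"
 by(simp_all add: ew_def)

text \<open>The weight relators treat only elements of \<open>h\<close>. The other coefficients
  follow by \<open>shift_relation\<close>; the inverses are covered because \<open>eU\<close>
  respects products equal to 1.\<close>

lemma letter_shift:
 assumes K: "K : N" and x: "x : CU"
 shows "EX y:CU. eU x * fgen (Inr K) =~E fgen (Inr K) * eU y"
proof (rule shift_relation[where c = "\<mu> K", OF _ _ _ _ _ _ x])
 let ?K = "fgen (Inr K) :: ('g, 'i) red_falg"
 let ?V = "%x y. eU x * ?K =~E ?K * eU y"
 show const: "?V (fconst a) (fconst a)" for a
  by(rule E.eqv_trans[OF E.eqv_mult_r[OF eU_const]
     E.eqv_eq(2)[OF fconst_central E.eqv_mult_l[OF E.eqv_sym[OF eU_const]]]])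
 show add: "?V (u + v) (u' + v')" if "{u, u', v, v'} <= CU" "?V u u'" "?V v v'" for u u' v v'
 proof -
  have "eU (u + v) * ?K =~E (eU u + eU v) * ?K" using that(1) by(intro E.eqv_mult_r eU_hom) auto
  also have "... =~E ?K * eU u' + ?K * eU v'" unfolding distrib_right by(intro E.eqv_add that)
  also have "... =~E ?K * eU (u' + v')" unfolding distrib_left[symmetric]
   using that(1) by(intro E.eqv_mult_l E.eqv_sym[OF eU_hom(1)]) auto
  finally show ?thesis .
 qed
 show "?V (u * v) (u' * v')" if "{u, u', v, v'} <= CU" "?V u u'" "?V v v'" for u u' v v'
 proof -
  have "eU (u * v) * ?K =~E eU u * eU v * ?K" using that(1) by(intro E.eqv_mult_r eU_hom) auto
  also have "... =~E eU u * (?K * eU v')" unfolding mult.assoc by(intro E.eqv_mult_l that)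
  also have "... =~E ?K * eU u' * eU v'" unfolding mult.assoc[symmetric] by(intro E.eqv_mult_r that)
  also have "... =~E ?K * eU (u' * v')" unfolding mult.assoc
   using that(1) by(intro E.eqv_mult_l E.eqv_sym[OF eU_hom(2)]) auto
  finally show ?thesis .
 qed
 show "?V (\<iota> y) (\<iota> y + fconst (\<mu> K y))" if y: "y : h" for y
 proof -
  have "eU (\<iota> y) * ?K - (?K * eU (\<iota> y) + fconst (\<mu> K y) * ?K) : rE"
   using y K unfolding weight_rels_eq diff_diff_add by blast
  hence "eU (\<iota> y) * ?K =~E ?K * eU (\<iota> y) + ?K * fconst (\<mu> K y)"
   unfolding fconst_central[of "\<mu> K y" ?K] by(rule E_relator)
  also have "... =~E ?K * (eU (\<iota> y) + eU (fconst (\<mu> K y)))" unfolding distrib_left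
   by(intro E.eqv_add E.eqv_mult_l E.eqv_sym[OF eU_const] E.eqv_refl)
  also have "... =~E ?K * eU (\<iota> y + fconst (\<mu> K y))" by(intro E.eqv_mult_l E.eqv_sym[OF eU_hom(1)] h_CU y) simp
  finally show ?thesis .
 qed
 have one: "eU x * eU y =~E 1" if "x : CU" "y : CU" "x * y =~U 1" for x y
 proof -
  have "qU (x * y) = qU (fconst 1)" using that(3) by(simp add: U.pmap_eqv)
  hence "eU (x * y) =~E 1" using eU_const[of 1] by(simp add: eU_def)
  thus ?thesis by(rule E.eqv_trans[OF E.eqv_sym[OF eU_hom(2)[OF that(1,2)]]])
 qed
 have mem: "fgen (Inr d) : CU" "frename Inl d : CU" if "d : DD" for d
  using that DD_mem frename_mem[of d h Inl] CU_h by(auto simp: gU_cases)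
 show "?V (fgen (Inr d)) (fgen (Inr d'))" if "d : DD" "d' : DD" "?V (frename Inl d) (frename Inl d')" for d d'
  by(rule E.inverse_shift[OF one one that(3)]) (intro mem that U.inv_l U.inv_r)+
 have "p K ~= 0" using p_independent K clin.dependent_zero[of "p ` N"] by(metis imageI)
 thus "\<mu> K (coroot k h \<alpha>) : \<int>" if "\<alpha> : roots k h" for \<alpha>
  using integral_shift[OF that p_weight[OF K]] by blast
qed

lemma word_shift:
 assumes "set w <= N" "x : CU" shows "EX y:CU. eU x * ew w =~E ew w * eU y"
 using assms
proof (induction w arbitrary: x)
 case (Cons K w)
 obtain y where y: "y : CU" "eU x * fgen (Inr K) =~E fgen (Inr K) * eU y"
  using letter_shift[of K x] Cons.prems by auto
 obtain z where z: "z : CU" "eU y * ew w =~E ew w * eU z" using Cons.IH[OF _ y(1)] Cons.prems by auto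
 have "eU x * ew (K # w) = eU x * fgen (Inr K) * ew w" by(simp add: mult.assoc)
 also have "... =~E fgen (Inr K) * eU y * ew w" by(rule E.eqv_mult_r[OF y(2)])
 also have "... = fgen (Inr K) * (eU y * ew w)" by(rule mult.assoc)
 also have "... =~E fgen (Inr K) * (ew w * eU z)" by(rule E.eqv_mult_l[OF z(2)])
 finally show ?case using z(1) by(auto simp: mult.assoc)
qed (auto intro: E.eqv_refl)

definition espan :: "'i list set => ('g, 'i) red_falg set" where
 "espan W = E.sp {ew w * eU u | w u. w : W & u : CU}"

lemma espan_base: "w : W ==> u : CU ==> ew w * eU u : espan W"
 unfolding espan_def by(rule E.sp_base) blast

lemmas espan_eqv = E.sp_eqv[where G = "{ew w * eU u | w u. w : W & u : CU}" for W, folded espan_def]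
lemmas espan_zero = E.sp_zero[where G = "{ew w * eU u | w u. w : W & u : CU}" for W, folded espan_def]
lemmas espan_add = E.sp_add[where G = "{ew w * eU u | w u. w : W & u : CU}" for W, folded espan_def]
lemmas espan_sum = E.sp_sum[where G = "{ew w * eU u | w u. w : W & u : CU}" for W, folded espan_def]

lemma espan_induct [consumes 1, case_names base add zero eqv]:
 assumes "x : espan W" "!!w u. w : W ==> u : CU ==> V (ew w * eU u)" "!!x y. V x ==> V y ==> V (x + y)" "V 0"
  "!!x y. x =~E y ==> V y ==> V x"
 shows "V x"
 using assms(1)[unfolded espan_def] by(rule span_mod_induct) (use assms(2-) in \<open>auto simp: E.eqv_def\<close>)

lemma espan_scalar_r: assumes "x : espan W" "u : CU" shows "x * eU u : espan W"
 using assms(1)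
proof (induction x rule: espan_induct)
 case (base w y)
 thus ?case using assms(2) unfolding mult.assoc
  by(intro espan_eqv[OF E.eqv_mult_l[OF E.eqv_sym[OF eU_hom(2)]]] espan_base) auto
next
 case (eqv x y)
 show ?case by(rule espan_eqv[OF E.eqv_mult_r[OF eqv(1)] eqv(2)])
qed (auto simp: distrib_right espan_add espan_zero)

lemma espan_mult:
 assumes "x : espan W" and base: "!!w u. w : W ==> u : CU ==> a * (ew w * eU u) * b : espan W'"
 shows "a * x * b : espan W'"
 using assms(1)
proof (induction x rule: espan_induct)
 case (eqv x y)
 show ?case by(rule espan_eqv[OF E.eqv_mult_lr[OF eqv(1)] eqv(2)])
qed (auto simp: distrib_left distrib_right espan_add espan_zero base)

lemma espan_mono: "x : espan W ==> W <= W' ==> x : espan W'"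
 using espan_mult[of x W 1 1 W'] by(auto intro!: espan_base)

lemma scalar_word_span: "set w <= N ==> u : CU ==> w : W ==> eU u * ew w : espan W"
proof -
 assume *: "set w <= N" "u : CU" "w : W"
 obtain v where v: "v : CU" "eU u * ew w =~E ew w * eU v" using word_shift[OF *(1,2)] by blast
 from v(2) espan_base[OF *(3) v(1)] show "eU u * ew w : espan W" by(rule espan_eqv)
qed

text \<open>The span is stable under left multiplication by every generator; coefficients are
  carried to the right end by \<open>word_shift\<close>.\<close>

theorem espan_all:
 assumes "x : FA gE" shows "x : espan {w. set w <= N}"
proof -
 let ?R = "espan {w. set w <= N}"
 have one: "eU 1 =~E 1" using eU_const[of 1] by simp
 have scalar: "eU v * y : ?R" if v: "v : CU" and y: "y : ?R" for v y
 proof -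
  have "eU v * y * 1 : ?R"
  proof (rule espan_mult[OF y])
   fix w u assume w: "w : {w. set w <= N}" and u: "u : CU"
   have "eU v * ew w * eU u : ?R" by(rule espan_scalar_r[OF scalar_word_span[OF _ v w] u]) (use w in simp)
   thus "eU v * (ew w * eU u) * 1 : ?R" by(simp add: mult.assoc)
  qed
  thus ?thesis by simp
 qed
 have letter: "fgen (Inr K) * y : ?R" if K: "K : N" and y: "y : ?R" for K y
 proof -
  have "fgen (Inr K) * y * 1 : ?R"
  proof (rule espan_mult[OF y])
   fix w u assume w: "w : {w. set w <= N}" and u: "u : CU"
   have "ew (K # w) * eU u : ?R" using w u K by(intro espan_base) auto
   thus "fgen (Inr K) * (ew w * eU u) * 1 : ?R" by(simp add: mult.assoc)
  qed
  thus ?thesis by simp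
 qed
 have "ALL y:?R. x * y : ?R"
  using assms
 proof (induction x rule: free_algebra_induct)
  case (const c)
  show ?case
  proof
   fix y assume "y : ?R"
   hence "eU (fconst c) * y : ?R" by(intro scalar) auto
   thus "fconst c * y : ?R" by(rule espan_eqv[OF E.eqv_mult_r[OF E.eqv_sym[OF eU_const]]])
  qed
 next
  case (gen g)
  then consider u where "u : carrier (Uh_bar k h)" "g = Inl u" | K where "K : N" "g = Inr K" by blast
  thus ?case
  proof cases
   case (1 u)
   then obtain x where "x : CU" "u = qU x" using qU_surj by blast
   thus ?thesis using scalar 1 by(simp add: eU_def)
  next
   case 2
   thus ?thesis using letter by simp
  qed
 qed (auto simp: distrib_right mult.assoc espan_add)
 moreover have "1 : ?R"
  using espan_base[of "[]" "{w. set w <= N}" 1] espan_eqv[OF E.eqv_sym[OF one]] by simp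
 ultimately show ?thesis by fastforce
qed

lemma ordering_span:
 assumes "I : N" "J : N" "J < I"
 shows "fgen (Inr I) * fgen (Inr J) : espan (ordered_words (%L. J < L))"
proof -
 let ?R = "espan (ordered_words (%L. J < L))"
 have word: "eU (cc I J w) * ew w : ?R" if w: "set w <= N" for w
 proof (cases "w : ordered_words (%L. J < L)")
  case True
  thus ?thesis using w cc_mem by(intro scalar_word_span)
 next
  case False
  hence "cc I J w : IU" using cc_zero U.K_simps(1) by simp
  hence "eU (cc I J w) * ew w =~E 0 * ew w" by(intro E.eqv_mult_r eU_IU)
  thus ?thesis using espan_eqv espan_zero by simp
 qed
 have "eU (cc I J [K, L]) * fgen (Inr K) * fgen (Inr L) : ?R" if "K : N" "L : N" for K L
  using word[of "[K, L]"] that by(simp add: mult.assoc)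
 moreover have "eU (cc I J [L]) * fgen (Inr L) : ?R" if "L : N" for L using word[of "[L]"] that by simp
 ultimately have "(\<Sum>(K, L)\<in>{(K, L). K : N & L : N & K <= L}. eU (cc I J [K, L]) * fgen (Inr K) * fgen (Inr L))
   + (\<Sum>L\<in>N. eU (cc I J [L]) * fgen (Inr L)) + eU (cc I J []) : ?R" (is "?S : _")
  using word[of "[]"] by(intro espan_add espan_sum) auto
 moreover have "fgen (Inr I) * fgen (Inr J) - ?S : rE" using assms unfolding ordering_rels_eq by blast
 ultimately show ?thesis by(rule espan_eqv[OF E_relator, rotated])
qed

abbreviation "sorted_words n \<equiv> {w. set w <= N & sorted w & length w <= n}"

text \<open>Rewriting \<open>p\<^sub>I p\<^sub>J\<close>, \<open>I > J\<close>, by the ordering relations either shortens a word or increases the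
 second letter, as \<open>L > J\<close> in all quadratic terms.\<close>

theorem straightening:
 assumes "set w <= N" shows "ew w : espan (sorted_words (length w))"
proof -
 \<comment> \<open>Words are compared by length and then from the right end: replacing I J by K L
   with L > J first changes the letter next to the suffix, and \<open>?r\<close> places larger
   letters lower.\<close>
 let ?r = "{(x, y). x : N & y : N & y < x}"
 have "?r <= measure (%x. card {L:N. x < L})"
  using N_finite by(auto intro!: psubset_card_mono)
 hence wf: "wf (inv_image (lenlex ?r) rev)" by(intro wf_inv_image wf_lenlex wf_subset[OF wf_measure])
 show ?thesis using assms
 proof (induction w rule: wf_induct_rule[OF wf])
  case (1 w)
  show ?case
  proof (cases "sorted w")
   case True
   have "eU 1 =~E 1" using eU_const[of 1] by simp
   hence "ew w =~E ew w * eU 1" using E.eqv_mult_l[OF E.eqv_sym] by fastforce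
   moreover have "ew w * eU 1 : espan (sorted_words (length w))" using True 1 by(intro espan_base) auto
   ultimately show ?thesis by(rule espan_eqv)
  next
   case False
   then obtain a I J b where w: "w = a @ I # J # b" "J < I" using descent_exists by blast
   have IJ: "I : N" "J : N" "set a <= N" "set b <= N" using 1 w by auto
   have "ew a * (fgen (Inr I) * fgen (Inr J)) * ew b : espan (sorted_words (length w))"
   proof (rule espan_mult[OF ordering_span[OF IJ(1,2) w(2)]])
    fix v u assume v: "v : ordered_words (%L. J < L)" and u: "u : CU"
    have vN: "set (a @ v @ b) <= N" "length (a @ v @ b) <= length w"
     using v IJ w by(auto simp: ordered_words_def)
    have "(rev (a @ v @ b), rev w) : lenlex ?r"
    proof (cases "length v = 2")
     case True
     then obtain K L where "v = [K, L]" "L : N" "J < L" using v by(auto simp: ordered_words_def)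
     thus ?thesis using IJ w by(auto simp: lenlex_conv lex_conv intro!: exI[of _ "rev b"])
    next
     case False
     hence "length v < 2" using v by(auto simp: ordered_words_def)
     thus ?thesis using w by(simp add: lenlex_conv)
    qed
    hence sp: "ew (a @ v @ b) : espan (sorted_words (length (a @ v @ b)))" using 1 vN by(intro 1) auto
    have sp: "ew (a @ v @ b) : espan (sorted_words (length w))"
     by(rule espan_mono[OF sp]) (use vN(2) in auto)
    obtain u' where u': "u' : CU" "eU u * ew b =~E ew b * eU u'" using word_shift[OF IJ(4) u] by blast
    have "ew a * (ew v * eU u) * ew b = ew a * ew v * (eU u * ew b)" by(simp add: mult.assoc)
    also have "... =~E ew a * ew v * (ew b * eU u')" by(rule E.eqv_mult_l[OF u'(2)])
    also have "... = ew (a @ v @ b) * eU u'" by(simp add: mult.assoc)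
    finally show "ew a * (ew v * eU u) * ew b : espan (sorted_words (length w))"
     by(rule espan_eqv) (rule espan_scalar_r[OF sp u'(1)])
   qed
   thus ?thesis by(simp add: w(1) mult.assoc)
  qed
 qed
qed

end

section \<open>The map from the presented algebra onto the reduction algebra\<close>

context presentation_data begin

definition \<iota>E :: "'g loc_elem + 'i => 'g lfalg" where
 "\<iota>E g = (case g of Inl u => (SOME x. x : CU & qU x = u) | Inr K => \<iota> (p K))"

definition \<psi> :: "('g loc_elem + 'i) list => 'g lfalg" where
 "\<psi> w = foldr (%g r. \<iota>E g <> r) w 1"

text \<open>A lift of the homomorphism to representatives. Products are nested to the right, so it
  is multiplicative modulo \<open>DI\<close>.\<close>

definition \<Psi> :: "('g, 'i) red_falg => 'g lfalg" where "\<Psi> = fs.flin \<psi>"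

lemma \<psi>_simps: "\<psi> [] = 1" "\<psi> (g # w) = \<iota>E g <> \<psi> w" "\<psi> (map Inr v) = dw v"
proof -
 show "\<psi> (map Inr v) = dw v" by(induction v) (simp_all add: \<psi>_def \<iota>E_def dw_def)
qed (simp_all add: \<psi>_def)

lemma \<iota>E_Inl: "u : carrier (Uh_bar k h) ==> \<iota>E (Inl u) : CU & qU (\<iota>E (Inl u)) = u"
 unfolding \<iota>E_def sum.case using qU_surj[of u] by(intro someI_ex[of "%x. x : CU & qU x = u"]) auto

lemma \<Psi>_simps: "\<Psi> (x + y) = \<Psi> x + \<Psi> y" "\<Psi> (x - y) = \<Psi> x - \<Psi> y" "\<Psi> (fconst c * x) = fconst c * \<Psi> x"
 "\<Psi> (fword w) = \<psi> w" "\<Psi> 0 = 0" "\<Psi> (ew v) = dw v" "\<Psi> (sum f S) = (\<Sum>i\<in>S. \<Psi> (f i))" "\<Psi> 1 = 1"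
 using fs.flin_fword[of \<psi> "[]"]
 by(simp_all add: \<Psi>_def fs.flin_add fs.flin_diff fs.flin_scale fs.flin_fword ew_def \<psi>_simps fs.flin_sum del: map_map)

lemma \<Psi>_fgen: "\<Psi> (fgen g) =~D \<iota>E g"
 using dia_scalar(2)[OF one_CU, of "\<iota>E g"] \<Psi>_simps(4)[of "[g]"] by(simp add: \<psi>_simps)

lemma same_qU: "x : CU ==> y : CU ==> qU x = qU y ==> x =~D y"
 using IU_IA[of "x - y"] by(intro deqv_eqv) (auto simp: U.pmap_eq_iff A.eqv_def)

lemma \<Psi>_eU: assumes "x : CU" shows "\<Psi> (eU x) =~D x"
proof -
 have "\<Psi> (eU x) =~D \<iota>E (Inl (qU x))" unfolding eU_def by(rule \<Psi>_fgen)
 also have "... =~D x" using \<iota>E_Inl[OF qU_mem] assms by(intro same_qU) auto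
 finally show ?thesis .
qed

lemma \<psi>_append: "\<psi> (v @ w) =~D \<psi> v <> \<psi> w"
proof (induction v)
 case Nil
 thus ?case using deqv_sym[OF dia_scalar(1)[OF one_CU, of "\<psi> w"]] by(simp add: \<psi>_simps)
next
 case (Cons g v)
 have "\<iota>E g <> \<psi> (v @ w) =~D \<iota>E g <> (\<psi> v <> \<psi> w)" by(rule dia_deqv[OF deqv_refl Cons])
 also have "... =~D (\<iota>E g <> \<psi> v) <> \<psi> w" by(rule deqv_sym[OF dia_assoc])
 finally show ?case by(simp add: \<psi>_simps)
qed

lemma \<Psi>_mult: "\<Psi> (x * y) =~D \<Psi> x <> \<Psi> y"
proof (induction x rule: falg_induct)
 case (monomial c v)
 show ?case
 proof (induction y rule: falg_induct)
  case (monomial d w)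
  have "fconst c * fword v * (fconst d * fword w) = fconst c * (fconst d * fword (v @ w))"
   using fconst_central[of d "fword v"] by(simp add: mult.assoc) (simp add: mult.assoc[symmetric])
  hence "\<Psi> (fconst c * fword v * (fconst d * fword w)) = fconst c * \<psi> (v @ w) * fconst d"
   using fconst_central[of d "\<psi> (v @ w)"] by(simp only: \<Psi>_simps mult.assoc)
  also have "... =~D fconst c * (\<psi> v <> \<psi> w) * fconst d" by(intro deqv_scalar \<psi>_append) auto
  also have "... =~D ((fconst c * \<psi> v) <> \<psi> w) * fconst d"
   by(intro deqv_scalar deqv_sym[OF dia_scalar_assoc(2)]) auto
  also have "... =~D (fconst c * \<psi> v) <> (\<psi> w * fconst d)" by(intro deqv_sym[OF dia_scalar_assoc(1)]) auto
  finally show ?case by(simp only: \<Psi>_simps fconst_central[of d "\<psi> w"])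
 next
  case (add y z)
  thus ?case unfolding distrib_left \<Psi>_simps
   by(rule deqv_trans[OF deqv_add deqv_sym[OF dia_add(2)]])
 qed
next
 case (add x z)
 thus ?case unfolding distrib_right \<Psi>_simps
  by(rule deqv_trans[OF deqv_add deqv_sym[OF dia_add(1)]])
qed

lemma \<Psi>_word_scalar: assumes "u : CU" shows "\<Psi> (ew w * eU u) =~D dw w * u" "\<Psi> (eU u * ew w) =~D u * dw w"
proof -
 have "\<Psi> (ew w * eU u) =~D dw w <> u"
  by(rule deqv_trans[OF \<Psi>_mult]) (unfold \<Psi>_simps, intro dia_deqv deqv_refl \<Psi>_eU assms)
 thus "\<Psi> (ew w * eU u) =~D dw w * u" using dia_scalar(2)[OF assms] by(rule deqv_trans)
 have "\<Psi> (eU u * ew w) =~D u <> dw w"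
  by(rule deqv_trans[OF \<Psi>_mult]) (unfold \<Psi>_simps, intro dia_deqv deqv_refl \<Psi>_eU assms)
 thus "\<Psi> (eU u * ew w) =~D u * dw w" using dia_scalar(1)[OF assms] by(rule deqv_trans)
qed

definition \<Psi>_kernel :: "('g, 'i) red_falg set" where "\<Psi>_kernel = {x. \<Psi> x : DI}"

lemma \<Psi>_kernel_iff: "x - y : \<Psi>_kernel \<longleftrightarrow> \<Psi> x =~D \<Psi> y"
 by(simp add: \<Psi>_kernel_def \<Psi>_simps deqv_def)

lemma \<Psi>_kernel_ideal: "two_sided_ideal \<Psi>_kernel"
proof -
 have "r * a : \<Psi>_kernel" "a * r : \<Psi>_kernel" if "a : \<Psi>_kernel" for a r
 proof -
  have a: "\<Psi> r <> \<Psi> a =~D 0" "\<Psi> a <> \<Psi> r =~D 0" using dia_DI that by(auto simp: \<Psi>_kernel_def deqv_def)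
  show "r * a : \<Psi>_kernel" "a * r : \<Psi>_kernel"
   using deqv_trans[OF \<Psi>_mult a(1)] deqv_trans[OF \<Psi>_mult a(2)] by(simp_all add: \<Psi>_kernel_def deqv_def)
 qed
 thus ?thesis
  using DI_add DI_zero by(auto simp: two_sided_ideal_def \<Psi>_kernel_def \<Psi>_simps)
qed

lemma relators_in_kernel: "rE <= \<Psi>_kernel"
proof -
 have "r : \<Psi>_kernel" if r: "r : coeff_rels k h" for r
 proof -
  consider x y where "x : CU" "y : CU" "r = eU (x + y) - (eU x + eU y)"
   | x y where "x : CU" "y : CU" "r = eU (x * y) - eU x * eU y" | c where "r = eU (fconst c) - fconst c * 1"
   using r unfolding coeff_rels_mem diff_diff_add by auto
  thus ?thesis
  proof cases
   case (1 x y)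
   have "\<Psi> (eU (x + y)) =~D x + y" using 1 by(intro \<Psi>_eU) auto
   also have "... =~D \<Psi> (eU x + eU y)" unfolding \<Psi>_simps by(intro deqv_sym[OF deqv_add] \<Psi>_eU 1)
   finally show ?thesis unfolding 1 \<Psi>_kernel_iff .
  next
   case (2 x y)
   have "\<Psi> (eU (x * y)) =~D x * y" using 2 by(intro \<Psi>_eU) auto
   also have "... =~D x <> y" by(rule deqv_sym[OF dia_scalar(1)[OF 2(1)]])
   also have "... =~D \<Psi> (eU x) <> \<Psi> (eU y)" by(intro dia_deqv deqv_sym[OF \<Psi>_eU] 2)
   also have "... =~D \<Psi> (eU x * eU y)" by(rule deqv_sym[OF \<Psi>_mult])
   finally show ?thesis unfolding 2 \<Psi>_kernel_iff .
  next
   case (3 c)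
   have "\<Psi> (eU (fconst c)) =~D fconst c" by(intro \<Psi>_eU) auto
   thus ?thesis unfolding 3 \<Psi>_kernel_iff \<Psi>_simps by simp
  qed
 qed
 moreover have "r : \<Psi>_kernel" if r: "r : weight_rels k h N \<mu>" for r
 proof -
  obtain x K where x: "x : h" "K : N"
   "r = eU (\<iota> x) * ew [K] - (ew [K] * eU (\<iota> x) + fconst (\<mu> K x) * ew [K])"
   using r unfolding weight_rels_eq diff_diff_add by auto
  have "\<iota> x * \<iota> (p K) =~ \<iota> (p K) * \<iota> x + \<iota> (\<mu> K x *\<^sub>C p K)" using A.gen_lie[of x "p K"] \<mu>_weight[OF x(2,1)] by simp
  also have "... =~ \<iota> (p K) * \<iota> x + fconst (\<mu> K x) * \<iota> (p K)" by(intro A.eqv_add A.gen_scale A.eqv_refl) simp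
  finally have *: "\<iota> x * \<iota> (p K) =~D \<iota> (p K) * \<iota> x + fconst (\<mu> K x) * \<iota> (p K)" by(rule deqv_eqv)
  have "\<Psi> (eU (\<iota> x) * ew [K]) =~D \<iota> x * dw [K]" by(rule \<Psi>_word_scalar(2)[OF h_CU[OF x(1)]])
  also have "... =~D \<iota> x * \<iota> (p K)" by(intro deqv_scalar dw_single h_CU x)
  also note *
  also have "\<iota> (p K) * \<iota> x + fconst (\<mu> K x) * \<iota> (p K) =~D dw [K] * \<iota> x + fconst (\<mu> K x) * dw [K]"
   by(intro deqv_sym[OF deqv_add] deqv_scalar dw_single h_CU x) simp
  also have "... =~D \<Psi> (ew [K] * eU (\<iota> x) + fconst (\<mu> K x) * ew [K])"
   unfolding \<Psi>_simps by(intro deqv_add deqv_refl deqv_sym[OF \<Psi>_word_scalar(1)] h_CU x)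
  finally show ?thesis unfolding x(3) \<Psi>_kernel_iff .
 qed
 moreover have "fgen (Inr I) * fgen (Inr J)
    - ((\<Sum>(K, L)\<in>{(K, L). K : N & L : N & K <= L}. eU (cc I J [K, L]) * fgen (Inr K) * fgen (Inr L))
      + (\<Sum>L\<in>N. eU (cc I J [L]) * fgen (Inr L)) + eU (cc I J [])) : \<Psi>_kernel" (is "_ - ?S : _")
  if IJ: "I : N" "J : N" "J < I" for I J
 proof -
  let ?T = "{(K, L). K : N & L : N & K <= L}"
  \<comment> \<open>The index set of the relator. Its words with second letter not above J have
    coefficient 0 by \<open>cc_zero\<close>, which reconciles it with
    \<open>ordered_words\<close>.\<close>
  let ?W = "(%(K, L). [K, L]) ` ?T \<union> (%L. [L]) ` N \<union> {[]}"
  have fin: "finite ?T" by(rule finite_subset[of _ "N \<times> N"]) (use N_finite in auto)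
  have "?S = (\<Sum>w\<in>(%(K, L). [K, L]) ` ?T. eU (cc I J w) * ew w) + (\<Sum>w\<in>(%L. [L]) ` N. eU (cc I J w) * ew w)
    + eU (cc I J []) * ew []"
   by(simp add: sum.reindex inj_on_def case_prod_unfold mult.assoc)
  also have "... = (\<Sum>w\<in>?W. eU (cc I J w) * ew w)"
   using fin N_finite by(subst sum.union_disjoint; (subst sum.union_disjoint)?; auto)
  finally have S: "?S = (\<Sum>w\<in>?W. eU (cc I J w) * ew w)" .
  have "\<Psi> (fgen (Inr I) * fgen (Inr J)) = dw [I, J]" using \<Psi>_simps(6)[of "[I, J]"] by simp
  also have "... =~D (\<Sum>w\<in>ordered_words (%L. J < L). cc I J w * dw w)" by(rule cc_relation[OF IJ])
  also have "... = (\<Sum>w\<in>?W. cc I J w * dw w)"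
   using fin N_finite cc_zero[of _ J I] by(intro sum.mono_neutral_left) (auto simp: ordered_words_def)
  also have "... =~D \<Psi> ?S" unfolding S \<Psi>_simps by(intro deqv_sum deqv_sym[OF \<Psi>_word_scalar(2)] cc_mem)
  finally show ?thesis unfolding \<Psi>_kernel_iff .
 qed
 ultimately show ?thesis unfolding ordering_rels_eq by blast
qed

lemma \<Psi>_eqv: assumes "x =~E y" "x : FA gE" "y : FA gE" shows "\<Psi> x =~D \<Psi> y"
proof -
 have "x - y : \<Psi>_kernel"
  using assms by(intro E.pker_carrier_subset[OF \<Psi>_kernel_ideal relators_in_kernel]) (auto simp: E.eqv_def)
 thus ?thesis by(simp add: \<Psi>_kernel_iff)
qed

lemma ew_mem: "set w <= N ==> ew w : FA gE"
 unfolding ew_def by(rule free_algebra_fword) auto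

text \<open>A single choice of coefficients describes both x in the presented algebra and its image
  in the reduction algebra, so that vanishing can be transported back.\<close>

lemma espan_expansion:
 assumes "x : espan W" "x : FA gE" "!!w. w : W ==> set w <= N"
 shows "EX S c. finite S & S <= W & (ALL w:S. c w : CU) & x =~E (\<Sum>w\<in>S. ew w * eU (c w)) &
  \<Psi> x =~D (\<Sum>w\<in>S. dw w * c w)"
proof -
 obtain y where y: "y : addcl {ew w * eU u | w u. w : W & u : CU}" "x =~E y" using assms(1) unfolding espan_def span_mod_def E.eqv_def by blast
 have "EX S c. finite S & S <= W & (ALL m:S. c m : CU) & y =~E (\<Sum>m\<in>S. ew m * eU (c m))"
  by(rule E.addcl_collect[OF y(1)]) (auto simp flip: distrib_left intro!: E.eqv_mult_l eU_hom)
 then obtain S c where S: "finite S" "S <= W" "ALL w:S. c w : CU" "y =~E (\<Sum>w\<in>S. ew w * eU (c w))" by blast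
 have e: "x =~E (\<Sum>w\<in>S. ew w * eU (c w))" using y(2) S(4) by(rule E.eqv_trans)
 have "(\<Sum>w\<in>S. ew w * eU (c w)) : FA gE"
  using S(2) assms(3) by(intro free_algebra_sum free_algebra_closed ew_mem gE_mem) auto
 hence "\<Psi> x =~D (\<Sum>w\<in>S. \<Psi> (ew w * eU (c w)))" using \<Psi>_eqv[OF e assms(2)] by(simp add: \<Psi>_simps)
 also have "... =~D (\<Sum>w\<in>S. dw w * c w)" using S(3) by(intro deqv_sum \<Psi>_word_scalar) auto
 finally show ?thesis using S(1-3) e by blast
qed

lemma sorted_words_finite: "finite (sorted_words n)"
 by(rule finite_subset[OF _ finite_lists_length_le[OF N_finite, of n]]) auto

lemma dw_in_sorted_span:
 assumes "set w <= N" "length w <= n" shows "dw w : rspan DI (dw ` sorted_words n)"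
proof -
 have "v : sorted_words (length w) ==> set v <= N" for v by simp
 from espan_expansion[OF straightening[OF assms(1)] ew_mem[OF assms(1)] this]
 obtain S c where S: "S <= sorted_words (length w)" "ALL w:S. c w : CU" "\<Psi> (ew w) =~D (\<Sum>w\<in>S. dw w * c w)" by blast
 have "(\<Sum>w\<in>S. dw w * c w) : rspan DI (dw ` sorted_words n)"
  using S(1,2) assms(2) by(intro rspan_sum rspan_base DI_submodule imageI) auto
 thus ?thesis using S(3) rspan_deqv by(simp add: \<Psi>_simps)
qed

text \<open>x is rewritten through sorted words. Its image is then a relation between sorted
  monomials, so the coefficients vanish by independence, and x with them.\<close>

theorem kernel_trivial:
 assumes x: "x : FA gE" and 0: "\<Psi> x : DI" shows "x =~E 0"
proof -
 have "x : espan (\<Union>n. sorted_words n)"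
 proof -
  have "x * 1 : espan (\<Union>n. sorted_words n)"
  proof -
   have "1 * x * 1 : espan (\<Union>n. sorted_words n)"
   proof (rule espan_mult[OF espan_all[OF x]])
    fix w u assume "w : {w. set w <= N}" "u : CU"
    hence "ew w * eU u : espan (sorted_words (length w))" by(intro espan_scalar_r straightening) auto
    hence "ew w * eU u : espan (\<Union>n. sorted_words n)" by(rule espan_mono) auto
    thus "1 * (ew w * eU u) * 1 : espan (\<Union>n. sorted_words n)" by simp
   qed
   thus ?thesis by simp
  qed
  thus ?thesis by simp
 qed
 moreover have "v : (\<Union>n. sorted_words n) ==> set v <= N" for v by auto
 ultimately obtain S c where S: "finite S" "S <= (\<Union>n. sorted_words n)" "ALL w:S. c w : CU"
  "x =~E (\<Sum>w\<in>S. ew w * eU (c w))" "\<Psi> x =~D (\<Sum>w\<in>S. dw w * c w)"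
  using espan_expansion[OF _ x, of "\<Union>n. sorted_words n"] by blast
 \<comment> \<open>The sum of the lengths is a convenient bound for each of them; a bound makes the
   index set of sorted words finite.\<close>
 define n where "n = (\<Sum>w\<in>S. length w)"
 have SW: "S <= sorted_words n"
  using S(1,2) member_le_sum[of _ S length] by(auto simp: n_def)
 let ?c = "%w. if w : S then c w else 0"
 have "(\<Sum>w\<in>sorted_words n. dw w * ?c w) = (\<Sum>w\<in>S. dw w * ?c w)"
  using SW sorted_words_finite by(intro sum.mono_neutral_right) auto
 also have "... = (\<Sum>w\<in>S. dw w * c w)" by(intro sum.cong) auto
 also have "... =~D \<Psi> x" by(rule deqv_sym[OF S(5)])
 also have "... =~D 0" using 0 by(simp add: deqv_def)
 finally have z: "(\<Sum>w\<in>sorted_words n. dw w * ?c w) : DI" by(simp add: deqv_def)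
 have "c w : IU" if w: "w : S" for w
 proof -
  have "?c w : IU"
  proof (rule dw_independent[OF refl _ _ z])
   fix v assume v: "v : sorted_words n"
   have "pw v : rspan DI (dw ` {w'. set w' <= N & length w' = length v})" using v by(intro pw_in_dw_span) auto
   thus "pw v : rspan DI (dw ` sorted_words n)"
    by(rule rspan_mono[OF DI_submodule]) (use v dw_in_sorted_span in auto)
  qed (use S(3) SW w in auto)
  thus ?thesis using w by simp
 qed
 hence "ew w * eU (c w) =~E ew w * 0" if "w : S" for w using that by(intro E.eqv_mult_l eU_IU)
 hence "(\<Sum>w\<in>S. ew w * eU (c w)) =~E (\<Sum>w\<in>S. ew w * 0)" by(rule E.eqv_sum)
 thus ?thesis using E.eqv_trans[OF S(4)] by simp
qed

theorem \<Psi>_surj: "EX x:FA gE. \<Psi> x =~D a"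
 using dw_spanning[of a]
proof (induction a rule: rspan_induct)
 case (base g u)
 then obtain w where w: "set w <= N" "g = dw w" by blast
 thus ?case using \<Psi>_word_scalar(1)[OF base(2)] by(intro bexI[of _ "ew w * eU u"]) (auto intro!: free_algebra_closed ew_mem)
next
 case (add a b)
 then obtain x y where "x : FA gE" "y : FA gE" "\<Psi> x =~D a" "\<Psi> y =~D b" by blast
 thus ?case by(intro bexI[of _ "x + y"]) (auto simp: \<Psi>_simps deqv_add)
next
 case zero
 thus ?case by(intro bexI[of _ 0]) (auto simp: \<Psi>_simps)
next
 case (mod a b)
 then obtain x where x: "x : FA gE" "\<Psi> x =~D b" by blast
 have "b =~D a" by(rule deqv_sym) (simp add: deqv_def mod(1))
 with x(2) have "\<Psi> x =~D a" by(rule deqv_trans)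
 thus ?case using x(1) by blast
qed

definition zc :: "'g lfalg => 'g loc_elem set" where "zc x = Z_of_A k nm h np (qA x)"

lemma zc_set: "zc x = {qA y | y. y =~D x}"
proof -
 have "zc x = {i \<oplus>\<^bsub>PA\<^esub> qA x | i. i : double_ideal k nm h np}"
  by(auto simp: zc_def Z_of_A_def a_r_coset_def' A_bar_eq)
 also have "... = {qA y | y. y =~D x}"
 proof (intro equalityI subsetI)
  fix t assume "t : {i \<oplus>\<^bsub>PA\<^esub> qA x | i. i : double_ideal k nm h np}"
  then obtain i where i: "i : double_ideal k nm h np" "t = i \<oplus>\<^bsub>PA\<^esub> qA x" by blast
  have "double_ideal k nm h np <= carrier (PA)"
  proof -
   interpret AR: ring "PA" by(rule A.presented_ring)
   show ?thesis using pow_carrier[of 1] by(auto simp: double_ideal_def set_add_def' A_bar_eq)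
  qed
  then obtain z where z: "i = qA z" using i(1) A.pmap_surj by blast
  hence "z : DI" using i(1) double_ideal_mem by simp
  hence "z + x =~D x" by(simp add: deqv_def)
  moreover have "t = qA (z + x)" by(simp add: i z A.pmap_hom)
  ultimately show "t : {qA y | y. y =~D x}" by blast
 next
  fix t assume "t : {qA y | y. y =~D x}"
  then obtain y where y: "t = qA y" "y =~D x" by blast
  have "t = qA (y - x) \<oplus>\<^bsub>PA\<^esub> qA x" unfolding y(1) by(simp flip: A.pmap_hom)
  moreover have "qA (y - x) : double_ideal k nm h np" using y(2) double_ideal_mem by(simp add: deqv_def)
  ultimately show "t : {i \<oplus>\<^bsub>PA\<^esub> qA x | i. i : double_ideal k nm h np}" by blast
 qed
 finally show ?thesis .
qed

lemma zc_eq: "zc x = zc y \<longleftrightarrow> x =~D y"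
proof
 assume "zc x = zc y"
 hence "qA x : zc y" unfolding zc_set by(metis (mono_tags, lifting) deqv_refl mem_Collect_eq)
 then obtain z where z: "qA x = qA z" "z =~D y" unfolding zc_set by blast
 hence "x =~D z" by(intro deqv_eqv) (simp add: A.pmap_eqv)
 thus "x =~D y" using z(2) by(rule deqv_trans)
next
 assume "x =~D y"
 hence "z =~D x \<longleftrightarrow> z =~D y" for z using deqv_trans deqv_sym by blast
 thus "zc x = zc y" by(simp add: zc_set)
qed

abbreviation "Z \<equiv> reduction_algebra k nm h np P"

lemma Z_simps:
 "carrier Z = range zc" "zc x \<otimes>\<^bsub>Z\<^esub> zc y = zc (x <> y)" "zc x \<oplus>\<^bsub>Z\<^esub> zc y = zc (x + y)" "\<one>\<^bsub>Z\<^esub> = zc 1"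
proof -
 have "carrier (PA) = range qA" using A.pmap_surj A.pmap_hom(1) by auto
 thus "carrier Z = range zc"
  by(auto simp: reduction_algebra_def Let_def A_RCOSETS_def' zc_def Z_of_A_def A_bar_eq)
 show "\<one>\<^bsub>Z\<^esub> = zc 1" by(simp add: reduction_algebra_def Let_def zc_def Z_of_A_def A_bar_eq A.pmap_hom)
 have "zc x \<otimes>\<^bsub>Z\<^esub> zc y = (\<Union>a\<in>zc x. \<Union>b\<in>zc y. Z_of_A k nm h np (proj_mult k nm h np P a b))"
  by(simp add: reduction_algebra_def Let_def Z_of_A_def)
 \<comment> \<open>All pairs of representatives give the same class, so the union that defines the
   product is a single class.\<close>
 moreover have "Z_of_A k nm h np (proj_mult k nm h np P a b) = zc (x <> y)" if ab: "a : zc x" "b : zc y" for a b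
 proof -
  obtain a' b' where "a = qA a'" "a' =~D x" "b = qA b'" "b' =~D y" using ab unfolding zc_set by blast
  hence "Z_of_A k nm h np (proj_mult k nm h np P a b) = zc (a' <> b')" "a' <> b' =~D x <> y"
   by(simp_all add: proj_mult_eq zc_def dia_deqv)
  thus ?thesis by(simp add: zc_eq)
 qed
 moreover have "zc x ~= {}" for x unfolding zc_set using deqv_refl by blast
 ultimately show "zc x \<otimes>\<^bsub>Z\<^esub> zc y = zc (x <> y)" by auto
 have "zc x \<oplus>\<^bsub>Z\<^esub> zc y = {a \<oplus>\<^bsub>PA\<^esub> b | a b. a : zc x & b : zc y}"
  by(auto simp: reduction_algebra_def Let_def set_add_def' A_bar_eq)
 also have "... = zc (x + y)"
 proof (intro equalityI subsetI)
  fix t assume "t : {a \<oplus>\<^bsub>PA\<^esub> b | a b. a : zc x & b : zc y}"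
  then obtain a b where *: "t = qA a \<oplus>\<^bsub>PA\<^esub> qA b" "a =~D x" "b =~D y" unfolding zc_set by blast
  have "t = qA (a + b)" by(simp add: * A.pmap_hom)
  thus "t : zc (x + y)" unfolding zc_set using deqv_add[OF *(2,3)] by blast
 next
  fix t assume "t : zc (x + y)"
  then obtain z where z: "t = qA z" "z =~D x + y" unfolding zc_set by blast
  have "z - y =~D x" using z(2) by(simp add: deqv_def diff_diff_eq add.commute)
  moreover have "t = qA (z - y) \<oplus>\<^bsub>PA\<^esub> qA y" by(simp add: z(1) flip: A.pmap_hom)
  ultimately show "t : {a \<oplus>\<^bsub>PA\<^esub> b | a b. a : zc x & b : zc y}"
   unfolding zc_set using deqv_refl[of y] by blast
 qed
 finally show "zc x \<oplus>\<^bsub>Z\<^esub> zc y = zc (x + y)" .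
qed

text \<open>\<open>\<Psi>\<close> descends to a bijection: its fibres are the classes of the
  presented algebra, by \<open>\<Psi>_eqv\<close> and \<open>kernel_trivial\<close>, and
  \<open>\<Psi>_surj\<close> reaches every class.\<close>

theorem presentation_theorem:
 "presented_by Z gE (case_sum (%u. Z_of_A k nm h np (A_of_Uh k h u)) (%K. Z_of_A k nm h np (A_of k h (p K)))) rE"
proof -
 let ?q = "pmap gE rE" and ?C = "FA gE" and ?R = "presented gE rE"
 define \<phi> where "\<phi> X = zc (\<Psi> (SOME x. x : ?C & ?q x = X))" for X
 have eqv: "\<Psi> x =~D \<Psi> y \<longleftrightarrow> ?q x = ?q y" if "x : ?C" "y : ?C" for x y
 proof -
  have "x - y : ?C" using that by auto
  hence "\<Psi> x =~D \<Psi> y ==> x - y =~E 0" by(intro kernel_trivial) (simp_all add: deqv_def \<Psi>_simps)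
  thus ?thesis using \<Psi>_eqv that by(auto simp: E.pmap_eqv E.eqv_def)
 qed
 have \<phi>: "\<phi> (?q x) = zc (\<Psi> x)" if "x : ?C" for x
 proof -
  have "(SOME y. y : ?C & ?q y = ?q x) : ?C & ?q (SOME y. y : ?C & ?q y = ?q x) = ?q x"
   by(rule someI[of _ x]) (simp add: that)
  thus ?thesis unfolding \<phi>_def zc_eq using eqv that by blast
 qed
 have surj: "EX x:?C. X = ?q x" if "X : carrier ?R" for X using that by(rule E.pmap_surj)
 have closed: "x + y : ?C" "x * y : ?C" if "x : ?C" "y : ?C" for x y using that by auto
 have "\<phi> : ring_hom ?R Z"
 proof (rule ring_hom_memI)
  fix X Y assume "X : carrier ?R" "Y : carrier ?R"
  then obtain x y where xy: "x : ?C" "y : ?C" "X = ?q x" "Y = ?q y" using surj by metis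
  show "\<phi> X : carrier Z" using \<phi>[OF xy(1)] xy(3) Z_simps(1) by simp
  show "\<phi> (X \<otimes>\<^bsub>?R\<^esub> Y) = \<phi> X \<otimes>\<^bsub>Z\<^esub> \<phi> Y"
   using xy \<Psi>_mult closed by(simp add: \<phi> Z_simps zc_eq flip: E.pmap_hom)
  show "\<phi> (X \<oplus>\<^bsub>?R\<^esub> Y) = \<phi> X \<oplus>\<^bsub>Z\<^esub> \<phi> Y"
   using xy closed by(simp add: \<phi> Z_simps \<Psi>_simps flip: E.pmap_hom)
 next
  show "\<phi> \<one>\<^bsub>?R\<^esub> = \<one>\<^bsub>Z\<^esub>" using \<phi>[of 1] by(simp add: Z_simps \<Psi>_simps flip: E.pmap_hom)
 qed
 moreover have "bij_betw \<phi> (carrier ?R) (carrier Z)"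
  unfolding bij_betw_def
 proof
  show "inj_on \<phi> (carrier ?R)"
  proof (rule inj_onI)
   fix X Y assume XY: "X : carrier ?R" "Y : carrier ?R" "\<phi> X = \<phi> Y"
   then obtain x y where "x : ?C" "y : ?C" "X = ?q x" "Y = ?q y" using surj by metis
   thus "X = Y" using XY(3) by(simp add: \<phi> zc_eq eqv)
  qed
  show "\<phi> ` carrier ?R = carrier Z"
  proof (intro equalityI subsetI)
   fix T assume "T : \<phi> ` carrier ?R"
   thus "T : carrier Z" using Z_simps(1) by(auto simp: \<phi>_def)
  next
   fix T assume "T : carrier Z"
   then obtain a where a: "T = zc a" using Z_simps(1) by blast
   obtain x where x: "x : ?C" "\<Psi> x =~D a" using \<Psi>_surj by blast
   hence "T = \<phi> (?q x)" using a by(simp add: \<phi> zc_eq deqv_sym)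
   thus "T : \<phi> ` carrier ?R" using E.pmap_hom(1) by blast
  qed
 qed
 moreover have "\<phi> (pclass gE rE (fgen g))
   = case_sum (%u. Z_of_A k nm h np (A_of_Uh k h u)) (%K. Z_of_A k nm h np (A_of k h (p K))) g" if "g : gE" for g
 proof -
  have "pclass gE rE (fgen g) = ?q (fgen g)" using that by(simp add: pmap_def frestrict_id)
  hence 1: "\<phi> (pclass gE rE (fgen g)) = zc (\<iota>E g)" using \<phi>[of "fgen g"] \<Psi>_fgen that by(simp add: zc_eq)
  show ?thesis
  proof (cases g)
   case (Inl u)
   hence "\<iota>E (Inl u) : CU & qU (\<iota>E (Inl u)) = u" using that by(intro \<iota>E_Inl) auto
   thus ?thesis using 1 A_of_Uh_eq[of "\<iota>E (Inl u)"] Inl by(simp add: zc_def)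
  next
   case (Inr K)
   thus ?thesis using 1 by(simp add: zc_def \<iota>E_def A_of_eq)
  qed
 qed
 ultimately show ?thesis unfolding presented_by_def ring_iso_def by blast
qed

end

theorem mainTheorem1:
  fixes k nm h np \<pp> :: "'g::fin_dim_complex_lie_algebra set"
    and P :: "('g \<Rightarrow> complex) \<Rightarrow> 'g loc_elem"
    and N :: "'i::linorder set"
    and p :: "'i \<Rightarrow> 'g"
    and \<mu> :: "'i \<Rightarrow> 'g \<Rightarrow> complex"
  assumes "reductive_subalgebra k"
    and "ad_semisimple k UNIV"
    and "triangular_decomposition k nm h np"
    and "extremal_projector k nm h np P"
    and "clin.subspace \<pp>" and "ad_stable k \<pp>" and "complementary k \<pp> UNIV"
    and "finite N" and "inj_on p N" and "clin.independent (p ` N)" and "clin.span (p ` N) = \<pp>"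
    and "\<And>K. K \<in> N \<Longrightarrow> \<mu> K \<in> dual_space h"
    and "\<And>K x. K \<in> N \<Longrightarrow> x \<in> h \<Longrightarrow> lie x (p K) = \<mu> K x *\<^sub>C p K"
    and "\<And>K L. K \<in> N \<Longrightarrow> L \<in> N \<Longrightarrow> weight_less h np (\<mu> K) (\<mu> L) \<Longrightarrow> \<mu> K \<noteq> \<mu> L \<Longrightarrow> K < L"
  shows "\<exists>B C D.
    (\<forall>I\<in>N. \<forall>J\<in>N.
       (\<forall>K\<in>N. \<forall>L\<in>N. B I J K L \<in> carrier (Uh_bar k h)) \<and>
       (\<forall>L\<in>N. C I J L \<in> carrier (Uh_bar k h)) \<and>
       D I J \<in> carrier (Uh_bar k h)) \<and>
    presented_by (reduction_algebra k nm h np P)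
      (Inl ` carrier (Uh_bar k h) \<union> Inr ` N)
      (case_sum (\<lambda>u. Z_of_A k nm h np (A_of_Uh k h u))
                (\<lambda>K. Z_of_A k nm h np (A_of k h (p K))))
      (coeff_rels k h \<union> weight_rels k h N \<mu> \<union> ordering_rels N B C D)"
proof -
 interpret reduction_data k nm h np P \<pp> N p \<mu>
  by unfold_locales (rule assms; assumption)+
 have "ALL I J. EX c. (ALL w. c w : CU) & (I : N --> J : N --> J < I -->
   dw [I, J] =~D (\<Sum>w\<in>ordered_words (%L. J < L). c w * dw w)) &
   (ALL w. w \<notin> ordered_words (%L. J < L) --> c w = 0)"
 proof (intro allI)
  fix I J
  show "EX c. (ALL w. c w : CU) & (I : N --> J : N --> J < I -->
   dw [I, J] =~D (\<Sum>w\<in>ordered_words (%L. J < L). c w * dw w)) &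
   (ALL w. w \<notin> ordered_words (%L. J < L) --> c w = 0)"
 proof (cases "I : N & J : N & J < I")
  case True
  then obtain c where c: "ALL w. c w : CU" "dw [I, J] =~D (\<Sum>w\<in>ordered_words (%L. J < L). c w * dw w)"
   using ordering_relation by blast
  \<comment> \<open>\<open>ordering_relation\<close> leaves the coefficients outside its index set
    open; they are set to 0.\<close>
  let ?c = "%w. if w : ordered_words (%L. J < L) then c w else 0"
  have "(\<Sum>w\<in>ordered_words (%L. J < L). ?c w * dw w) = (\<Sum>w\<in>ordered_words (%L. J < L). c w * dw w)"
   by(intro sum.cong) auto
  thus ?thesis using c by(intro exI[of _ ?c]) auto
 next
  case False
  thus ?thesis by(intro exI[of _ "%_. 0"]) auto
 qed
 qed
 then obtain cc where cc: "ALL I J. (ALL w. cc I J w : CU) & (I : N --> J : N --> J < I -->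
   dw [I, J] =~D (\<Sum>w\<in>ordered_words (%L. J < L). cc I J w * dw w)) &
   (ALL w. w \<notin> ordered_words (%L. J < L) --> cc I J w = 0)"
  unfolding choice_iff by blast
 interpret presentation_data k nm h np P \<pp> N p \<mu> cc
  by unfold_locales (use cc in blast)+
 show ?thesis
  by(intro exI[of _ "%I J K L. qU (cc I J [K, L])"] exI[of _ "%I J L. qU (cc I J [L])"]
    exI[of _ "%I J. qU (cc I J [])"] conjI presentation_theorem) (simp add: qU_mem)
qed

end
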